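(* Let $(\sigma_\varepsilon,v_\varepsilon,w_\varepsilon)$, $\varepsilon\in(0,1)$, be the solutions of system (CF) with initial data $(\sigma_{0,\varepsilon},v_{0,\varepsilon},w_{0,\varepsilon})$ satisfying $E(0)\le M<\infty$ and $E_1(0)\le M_1<\infty$ for all $\varepsilon\in(0,1)$, and let $T^{*}$, $T^{**}$ and the limit $(\sigma_p,v_p,w_p)$, a solution of (CPE), be as described in the context. Suppose that $(\sigma_p,v_p,w_p)$ satisfies $$\|\sigma_p\|_{L^\infty(0,T^{**};H^4)}+\|\partial_t\sigma_p\|_{L^\infty(0,T^{**};H^2)}+\|v_p\|_{L^\infty(0,T^{**};H^3)}+\|v_p\|_{L^2(0,T^{**};H^4)}+\|w_p\|_{L^\infty(0,T^{**};H^2)}<C_p<\infty$$ for some constant $C_p\in(0,\infty)$, and that the initial data satisfy, for some constant $K$ independent of $\varepsilon$, $$\bigl\|\sigma_{0,\varepsilon}-\sigma_p|_{t=0},\ v_{0,\varepsilon}-v_p|_{t=0}\bigr\|_{L^2}\le K\varepsilon .$$ Then $$\|\sigma_\varepsilon-\sigma_p,\ v_\varepsilon-v_p\|_{L^\infty(0,T^{**};L^2)}+\|v_\varepsilon-v_p\|_{L^2(0,T^{**};H^1)}\le C_2\,\varepsilon,$$ $$\|w_\varepsilon-w_p\|_{L^\infty(0,T^{**};L^2)}\le C_2\,\varepsilon^{2/3},\qquad \|w_\varepsilon-w_p\|_{L^2(0,T^{**};L^2)}\le C_2\,\varepsilon^{3/4},$$ where $C_2\in(0,\infty)$ is a constant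 depending only on the bounds $M,M_1$ of $E(0),E_1(0)$, on $C_p$ (and on $K$), and independent of $\varepsilon$.
   Context: Domain and notation. $2\mathbb T^3$ is the flat torus with period $2$ in each of the variables $x,y$ (horizontal) and $z$ (vertical). $\nabla_h=(\partial_x,\partial_y)^{\top}$, $\mathrm{div}_h=\nabla_h\cdot$, $\Delta_h=\mathrm{div}_h\nabla_h$. $\|\cdot\|_{X}$ is the norm of $X=L^2,H^k$ over $2\mathbb T^3$, and $\|f,g,\dots\|_X=(\|f\|_X^2+\|g\|_X^2+\cdots)^{1/2}$. The unknowns are the scalar $\sigma$ (logarithm of the density), the horizontal velocity $v\in\mathbb R^2$ and the vertical velocity $w\in\mathbb R$. System (CF), for $\varepsilon\in(0,1)$, in $2\mathbb T^3$: $$\partial_t\sigma_\varepsilon+v_\varepsilon\cdot\nabla_h\sigma_\varepsilon+w_\varepsilon\partial_z\sigma_\varepsilon+\mathrm{div}_hv_\varepsilon+\partial_zw_\varepsilon=0,$$ $$\partial_tv_\varepsilon+v_\varepsilon\cdot\nabla_hv_\varepsilon+w_\varepsilon\partial_zv_\varepsilon+\nabla_h\sigma_\varepsilon=\Delta_hv_\varepsilon+\partial_{zz}v_\varepsilon,$$ $$\varepsilon^2(\partial_tw_\varepsilon+v_\varepsilon\cdot\nabla_hw_\varepsilon+w_\varepsilon\partial_zw_\varepsilon)+\partial_z\sigma_\varepsilon=\varepsilon^2(\Delta_hw_\varepsilon+\partial_{zz}w_\varepsilon),$$ with initial data $(\sigma_\varepsilon,v_\varepsilon,w_\varepsilon)|_{t=0}=(\sigma_{0,\varepsilon},v_{0,\varepsilon},w_{0,\varepsilon})$.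 All data and solutions are periodic and satisfy (SYM): $\sigma_\varepsilon,v_\varepsilon,w_\varepsilon$ are respectively even, even and odd in $z$. "The solution" is the unique strong solution satisfying (SYM). System (CPE), in $2\mathbb T^3$, with the same symmetry for $\sigma_p,v_p,w_p$: $$\partial_t\sigma_p+v_p\cdot\nabla_h\sigma_p+w_p\partial_z\sigma_p+\mathrm{div}_hv_p+\partial_zw_p=0,$$ $$\partial_tv_p+v_p\cdot\nabla_hv_p+w_p\partial_zv_p+\nabla_h\sigma_p=\Delta_hv_p+\partial_{zz}v_p,\qquad \partial_z\sigma_p=0.$$ Functionals (depending on $t$ and $\varepsilon$): $$E=\|v_\varepsilon,\varepsilon w_\varepsilon\|_{H^3}+\|\partial_t\sigma_\varepsilon,\nabla_h\sigma_\varepsilon,\tfrac{\partial_z\sigma_\varepsilon}{\varepsilon}\|_{H^2}+\|\sigma_\varepsilon\|_{H^4}+\|w_\varepsilon,\partial_zw_\varepsilon\|_{H^2},$$ $$D=\|\partial_tv_\varepsilon,\partial_t(\varepsilon w_\varepsilon)\|_{H^2}+\|v_\varepsilon,\varepsilon w_\varepsilon\|_{H^4}+\|\partial_t\sigma_\varepsilon,\nabla_h\sigma_\varepsilon,\tfrac{\partial_z\sigma_\varepsilon}{\varepsilon}\|_{H^3}+\|w_\varepsilon,\partial_zw_\varepsilon\|_{H^3},$$ $$E_1=\|\partial_tv_\varepsilon,\partial_t(\varepsilon w_\varepsilon)\|_{H^1}+\|\partial_t^2\sigma_\varepsilon,\partial_t\nabla_h\sigma_\varepsilon,\tfrac{\partial_z\partial_t\sigma_\varepsilon}{\varepsilon}\|_{L^2}+\|\partial_t\sigma_\varepsilon\|_{H^2}+\|\partial_tw_\varepsilon,\partial_z\partial_tw_\varepsilon\|_{L^2},$$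 $$D_1=\|\partial_t^2v_\varepsilon,\partial_t^2(\varepsilon w_\varepsilon)\|_{L^2}+\|\partial_tv_\varepsilon,\partial_t(\varepsilon w_\varepsilon)\|_{H^2}+\|\partial_t^2\sigma_\varepsilon,\partial_t\nabla_h\sigma_\varepsilon,\tfrac{\partial_z\partial_t\sigma_\varepsilon}{\varepsilon}\|_{H^1}+\|\partial_tw_\varepsilon,\partial_z\partial_tw_\varepsilon\|_{H^1}.$$ Compatibility. In $E(0)$ and $E_1(0)$, the values $(\partial_t\sigma_\varepsilon,\partial_tv_\varepsilon,\partial_tw_\varepsilon,\partial_t^2\sigma_\varepsilon)|_{t=0}=(\sigma_{1,\varepsilon},v_{1,\varepsilon},w_{1,\varepsilon},\sigma_{2,\varepsilon})$ are defined from the initial data by $$\sigma_{1,\varepsilon}+v_{0,\varepsilon}\cdot\nabla_h\sigma_{0,\varepsilon}+w_{0,\varepsilon}\partial_z\sigma_{0,\varepsilon}+\mathrm{div}_hv_{0,\varepsilon}+\partial_zw_{0,\varepsilon}=0,$$ $$v_{1,\varepsilon}+v_{0,\varepsilon}\cdot\nabla_hv_{0,\varepsilon}+w_{0,\varepsilon}\partial_zv_{0,\varepsilon}+\nabla_h\sigma_{0,\varepsilon}=\Delta_hv_{0,\varepsilon}+\partial_{zz}v_{0,\varepsilon},$$ $$w_{1,\varepsilon}+v_{0,\varepsilon}\cdot\nabla_hw_{0,\varepsilon}+w_{0,\varepsilon}\partial_zw_{0,\varepsilon}+\tfrac1{\varepsilon^2}\partial_z\sigma_{0,\varepsilon}=\Delta_hw_{0,\varepsilon}+\partial_{zz}w_{0,\varepsilon},$$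 $$\sigma_{2,\varepsilon}+v_{0,\varepsilon}\cdot\nabla_h\sigma_{1,\varepsilon}+w_{0,\varepsilon}\partial_z\sigma_{1,\varepsilon}+v_{1,\varepsilon}\cdot\nabla_h\sigma_{0,\varepsilon}+w_{1,\varepsilon}\partial_z\sigma_{0,\varepsilon}+\mathrm{div}_hv_{1,\varepsilon}+\partial_zw_{1,\varepsilon}=0.$$ The times $T^*,T^{**}$ and the limit. $0<T^{**}\le T^*<\infty$ are times, fixed in terms of $M,M_1$ and independent of $\varepsilon$, such that for all $\varepsilon\in(0,1)$ the solution of (CF) exists on $[0,T^*]$ and $$\sup_{0\le t\le T^*}E^2(t)+\int_0^{T^*}D^2(t)\,dt<C_0,\qquad \sup_{0\le t\le T^{**}}\bigl(E^2+E_1^2\bigr)(t)+\int_0^{T^{**}}\bigl(D^2+D_1^2\bigr)(t)\,dt<C_1,$$ with constants $C_0,C_1<\infty$ depending only on $M,M_1$. $(\sigma_p,v_p,w_p)$ is a solution of (CPE) on $[0,T^*]$ obtained as the limit of a subsequence of $(\sigma_\varepsilon,v_\varepsilon,w_\varepsilon)$ as $\varepsilon\to0^+$, in the following sense: $\sigma_\varepsilon\to\sigma_p$ weak-$\ast$ in $L^\infty(0,T^*;H^4)$ and strongly in $C([0,T^*];H^3)$; $(\partial_t\sigma_\varepsilon,w_\varepsilon,\partial_zw_\varepsilon)\to(\partial_t\sigma_p,w_p,\partial_zw_p)$ weak-$\ast$ in $L^\infty(0,T^*;H^2)$ and weakly in $L^2(0,T^*;H^3)$; $v_\varepsilon\to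 v_p$ weak-$\ast$ in $L^\infty(0,T^*;H^3)$, strongly in $C([0,T^*];H^2)$ and weakly in $L^2(0,T^*;H^4)$; $\partial_tv_\varepsilon\to\partial_tv_p$ weakly in $L^2(0,T^*;H^2)$. (Existence of such times, constants and limit is the paper's Theorem 1 and may be taken as given.) *)

theory Defs
  imports "HOL-Analysis.Analysis" "HOL-Probability.Essential_Supremum"
begin

section \<open>Smooth periodic test functions\<close>

definition pderiv_dir :: "'a::euclidean_space \<Rightarrow> ('a \<Rightarrow> real) \<Rightarrow> 'a \<Rightarrow> real" where
  "pderiv_dir b f x = frechet_derivative f (at x) b"

definition smooth :: "('a::euclidean_space \<Rightarrow> real) \<Rightarrow> bool" where
  "smooth f \<longleftrightarrow> (\<forall>bs. set bs \<subseteq> Basis \<longrightarrow> (\<forall>x. foldr pderiv_dir bs f differentiable (at x)))"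

definition periodic2 :: "(real^3 \<Rightarrow> 'b) \<Rightarrow> bool" where
  "periodic2 f \<longleftrightarrow> (\<forall>x i. f (x + 2 *\<^sub>R axis i 1) = f x)"


section \<open>Weak derivatives and Sobolev norms on the torus\<close>

text \<open>The torus of period 2 is represented by the cell \<open>[-1,1]\<^sup>3\<close>.  Functions on it are functions
  on \<open>real^3\<close>, of which only the values almost everywhere on the cell matter; the periodicity of
  the test functions makes the weak derivatives below those of the periodic extension.
  Coordinates 1 and 2 are horizontal, coordinate 3 is vertical.\<close>

definition torus :: "(real^3) measure" where
  "torus = lebesgue_on (cbox (-1) 1)"

definition mpderiv :: "(3 \<Rightarrow> nat) \<Rightarrow> (real^3 \<Rightarrow> real) \<Rightarrow> real^3 \<Rightarrow> real" where
  "mpderiv \<alpha> f = (pderiv_dir (axis 1 1) ^^ \<alpha> 1) ((pderiv_dir (axis 2 1) ^^ \<alpha> 2)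
     ((pderiv_dir (axis 3 1) ^^ \<alpha> 3) f))"

definition has_weak_deriv :: "(3 \<Rightarrow> nat) \<Rightarrow> (real^3 \<Rightarrow> real) \<Rightarrow> (real^3 \<Rightarrow> real) \<Rightarrow> bool" where
  "has_weak_deriv \<alpha> f g \<longleftrightarrow> integrable torus f \<and> integrable torus g \<and>
     (\<forall>\<phi>. smooth \<phi> \<and> periodic2 \<phi> \<longrightarrow>
        (\<integral>x. f x * mpderiv \<alpha> \<phi> x \<partial>torus)
        = (-1) ^ (\<Sum>i\<in>UNIV. \<alpha> i) * (\<integral>x. g x * \<phi> x \<partial>torus))"

text \<open>The weak derivative is determined up to null sets; one representative is chosen. It is
  unspecified when no weak derivative exists (and \<open>\<alpha> \<noteq> 0\<close>).\<close>

definition weak_deriv :: "(3 \<Rightarrow> nat) \<Rightarrow> (real^3 \<Rightarrow> real) \<Rightarrow> real^3 \<Rightarrow> real" where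
  "weak_deriv \<alpha> f = (if \<alpha> = (\<lambda>_. 0) then f else (SOME g. has_weak_deriv \<alpha> f g))"

definition wpd :: "3 \<Rightarrow> (real^3 \<Rightarrow> real) \<Rightarrow> real^3 \<Rightarrow> real" where
  "wpd i f = weak_deriv (\<lambda>j. if j = i then 1 else 0) f"

definition wpd2 :: "3 \<Rightarrow> (real^3 \<Rightarrow> real) \<Rightarrow> real^3 \<Rightarrow> real" where
  "wpd2 i f = weak_deriv (\<lambda>j. if j = i then 2 else 0) f"

definition multi_indices :: "nat \<Rightarrow> (3 \<Rightarrow> nat) set" where
  "multi_indices k = {\<alpha>. (\<Sum>i\<in>UNIV. \<alpha> i) \<le> k}"

lemma finite_multi_indices: "finite (multi_indices k)"
proof (rule finite_subset)
  show "multi_indices k \<subseteq> PiE UNIV (\<lambda>_. {..k})"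
  proof
    fix \<alpha> assume "\<alpha> \<in> multi_indices k"
    then have "\<alpha> i \<le> k" for i
      using member_le_sum[of i UNIV \<alpha>] by (simp add: multi_indices_def)
    then show "\<alpha> \<in> PiE UNIV (\<lambda>_. {..k})" by auto
  qed
  show "finite (PiE UNIV (\<lambda>_::3. {..k}))" by (rule finite_PiE) auto
qed

definition ennreal_sqrt :: "ennreal \<Rightarrow> ennreal" where
  "ennreal_sqrt a = (if a = \<infinity> then \<infinity> else ennreal (sqrt (enn2real a)))"

text \<open>Squared \<open>H\<^sup>k\<close> norm, infinite for functions that are not in \<open>H\<^sup>k\<close>.\<close>

definition Hsq :: "nat \<Rightarrow> (real^3 \<Rightarrow> real) \<Rightarrow> ennreal" where
  "Hsq k f = (if \<forall>\<alpha>\<in>multi_indices k. \<exists>g. has_weak_deriv \<alpha> f g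
     then \<Sum>\<alpha>\<in>multi_indices k. \<integral>\<^sup>+x. ennreal ((weak_deriv \<alpha> f x)\<^sup>2) \<partial>torus else \<infinity>)"

definition Hnorm :: "nat \<Rightarrow> (real^3 \<Rightarrow> real) list \<Rightarrow> ennreal" where
  "Hnorm k fs = ennreal_sqrt (\<Sum>f\<leftarrow>fs. Hsq k f)"

abbreviation L2norm :: "(real^3 \<Rightarrow> real) list \<Rightarrow> ennreal" where
  "L2norm \<equiv> Hnorm 0"

lemma Hsq_0:
  "Hsq 0 f = (if integrable torus f then \<integral>\<^sup>+x. ennreal ((f x)\<^sup>2) \<partial>torus else \<infinity>)"
proof -
  have "multi_indices 0 = {\<lambda>_. 0}"
    by (auto simp: multi_indices_def)
  moreover have "(\<exists>g. has_weak_deriv (\<lambda>_. 0) f g) \<longleftrightarrow> integrable torus f"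
    by (auto simp: has_weak_deriv_def mpderiv_def)
  ultimately show ?thesis
    by (simp add: Hsq_def weak_deriv_def)
qed

definition Hinner :: "nat \<Rightarrow> (real^3 \<Rightarrow> real) \<Rightarrow> (real^3 \<Rightarrow> real) \<Rightarrow> real" where
  "Hinner k f g = (\<Sum>\<alpha>\<in>multi_indices k. \<integral>x. weak_deriv \<alpha> f x * weak_deriv \<alpha> g x \<partial>torus)"

definition comps :: "(real^3 \<Rightarrow> real^2) \<Rightarrow> (real^3 \<Rightarrow> real) list" where
  "comps v = [\<lambda>x. v x $ 1, \<lambda>x. v x $ 2]"


section \<open>Functions of time with values in Sobolev spaces\<close>

definition time :: "real \<Rightarrow> real measure" where
  "time T = lebesgue_on {0<..<T}"

text \<open>Measurability of an \<open>L\<^sup>2\<close>-valued function of time.  It is stated through a jointly measurable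
  representative because, e.g., \<open>\<lambda>t. wpd i (f t)\<close> chooses representatives separately for each \<open>t\<close>.\<close>

definition time_measurable :: "real \<Rightarrow> (real \<Rightarrow> real^3 \<Rightarrow> real) \<Rightarrow> bool" where
  "time_measurable T f \<longleftrightarrow> (\<exists>g. (\<lambda>(t, x). g t x) \<in> borel_measurable (time T \<Otimes>\<^sub>M torus) \<and>
     (AE t in time T. AE x in torus. f t x = g t x))"

definition Linf_time :: "real \<Rightarrow> (real \<Rightarrow> ennreal) \<Rightarrow> ennreal" where
  "Linf_time T N = esssup (time T) N"

definition L2_time :: "real \<Rightarrow> (real \<Rightarrow> ennreal) \<Rightarrow> ennreal" where
  "L2_time T N = ennreal_sqrt (\<integral>\<^sup>+t. (N t)\<^sup>2 \<partial>time T)"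

definition in_L1H :: "real \<Rightarrow> nat \<Rightarrow> (real \<Rightarrow> real^3 \<Rightarrow> real) \<Rightarrow> bool" where
  "in_L1H T k f \<longleftrightarrow> time_measurable T f \<and> (\<integral>\<^sup>+t. Hnorm k [f t] \<partial>time T) < \<infinity>"

definition in_L2H :: "real \<Rightarrow> nat \<Rightarrow> (real \<Rightarrow> real^3 \<Rightarrow> real) \<Rightarrow> bool" where
  "in_L2H T k f \<longleftrightarrow> time_measurable T f \<and> L2_time T (\<lambda>t. Hnorm k [f t]) < \<infinity>"

definition in_LinfH :: "real \<Rightarrow> nat \<Rightarrow> (real \<Rightarrow> real^3 \<Rightarrow> real) \<Rightarrow> bool" where
  "in_LinfH T k f \<longleftrightarrow> time_measurable T f \<and> Linf_time T (\<lambda>t. Hnorm k [f t]) < \<infinity>"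

definition in_CH :: "real \<Rightarrow> nat \<Rightarrow> (real \<Rightarrow> real^3 \<Rightarrow> real) \<Rightarrow> bool" where
  "in_CH T k f \<longleftrightarrow> (\<forall>t\<in>{0..T}. Hnorm k [f t] < \<infinity> \<and>
     ((\<lambda>s. Hnorm k [\<lambda>x. f s x - f t x]) \<longlongrightarrow> 0) (at t within {0..T}))"

text \<open>\<open>g\<close> is the distributional time derivative of \<open>f\<close> on \<open>(0,T)\<close> times the torus.\<close>

definition has_time_deriv ::
    "real \<Rightarrow> (real \<Rightarrow> real^3 \<Rightarrow> real) \<Rightarrow> (real \<Rightarrow> real^3 \<Rightarrow> real) \<Rightarrow> bool" where
  "has_time_deriv T f g \<longleftrightarrow>
     time_measurable T f \<and> (\<integral>\<^sup>+t. \<integral>\<^sup>+x. ennreal \<bar>f t x\<bar> \<partial>torus \<partial>time T) < \<infinity> \<and>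
     time_measurable T g \<and> (\<integral>\<^sup>+t. \<integral>\<^sup>+x. ennreal \<bar>g t x\<bar> \<partial>torus \<partial>time T) < \<infinity> \<and>
     (\<forall>\<phi>::real \<times> (real^3) \<Rightarrow> real.
        smooth \<phi> \<and> (\<forall>t. periodic2 (\<lambda>x. \<phi> (t, x))) \<and>
        (\<exists>a b. 0 < a \<and> b < T \<and> (\<forall>t x. t \<notin> {a..b} \<longrightarrow> \<phi> (t, x) = 0)) \<longrightarrow>
        (\<integral>t. (\<integral>x. f t x * pderiv_dir (1, 0) \<phi> (t, x) \<partial>torus) \<partial>time T)
        = - (\<integral>t. (\<integral>x. g t x * \<phi> (t, x) \<partial>torus) \<partial>time T))"

definition has_time_deriv_vec ::
    "real \<Rightarrow> (real \<Rightarrow> real^3 \<Rightarrow> real^2) \<Rightarrow> (real \<Rightarrow> real^3 \<Rightarrow> real^2) \<Rightarrow> bool" where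
  "has_time_deriv_vec T f g \<longleftrightarrow> (\<forall>j. has_time_deriv T (\<lambda>t x. f t x $ j) (\<lambda>t x. g t x $ j))"

text \<open>Weak convergence: \<open>H\<^sup>k\<close> is identified with its dual through its inner product, so that
  \<open>L\<^sup>\<infinity>(0,T;H\<^sup>k)\<close> is the dual of \<open>L\<^sup>1(0,T;H\<^sup>k)\<close> and \<open>L\<^sup>2(0,T;H\<^sup>k)\<close> is its own dual.\<close>

definition weakstar_LinfH ::
    "real \<Rightarrow> nat \<Rightarrow> (nat \<Rightarrow> real \<Rightarrow> real^3 \<Rightarrow> real) \<Rightarrow> (real \<Rightarrow> real^3 \<Rightarrow> real) \<Rightarrow> bool" where
  "weakstar_LinfH T k F f \<longleftrightarrow> (\<forall>n. in_LinfH T k (F n)) \<and> in_LinfH T k f \<and>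
     (\<forall>g. in_L1H T k g \<longrightarrow>
        (\<lambda>n. \<integral>t. Hinner k (F n t) (g t) \<partial>time T) \<longlonglongrightarrow> (\<integral>t. Hinner k (f t) (g t) \<partial>time T))"

definition weak_L2H ::
    "real \<Rightarrow> nat \<Rightarrow> (nat \<Rightarrow> real \<Rightarrow> real^3 \<Rightarrow> real) \<Rightarrow> (real \<Rightarrow> real^3 \<Rightarrow> real) \<Rightarrow> bool" where
  "weak_L2H T k F f \<longleftrightarrow> (\<forall>n. in_L2H T k (F n)) \<and> in_L2H T k f \<and>
     (\<forall>g. in_L2H T k g \<longrightarrow>
        (\<lambda>n. \<integral>t. Hinner k (F n t) (g t) \<partial>time T) \<longlonglongrightarrow> (\<integral>t. Hinner k (f t) (g t) \<partial>time T))"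

definition strong_CH ::
    "real \<Rightarrow> nat \<Rightarrow> (nat \<Rightarrow> real \<Rightarrow> real^3 \<Rightarrow> real) \<Rightarrow> (real \<Rightarrow> real^3 \<Rightarrow> real) \<Rightarrow> bool" where
  "strong_CH T k F f \<longleftrightarrow> (\<forall>n. in_CH T k (F n)) \<and> in_CH T k f \<and>
     (\<lambda>n. SUP t\<in>{0..T}. Hnorm k [\<lambda>x. F n t x - f t x]) \<longlonglongrightarrow> 0"


section \<open>Spatial operators and the symmetry\<close>

definition hidx :: "2 \<Rightarrow> 3" where
  "hidx j = (if j = 1 then 1 else 2)"

text \<open>\<open>v \<cdot> \<nabla>\<^sub>h f + w \<partial>\<^sub>z f\<close>\<close>

definition transport ::
    "(real^3 \<Rightarrow> real^2) \<Rightarrow> (real^3 \<Rightarrow> real) \<Rightarrow> (real^3 \<Rightarrow> real) \<Rightarrow> real^3 \<Rightarrow> real" where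
  "transport v w f x = (\<Sum>j\<in>UNIV. v x $ j * wpd (hidx j) f x) + w x * wpd 3 f x"

definition div_h :: "(real^3 \<Rightarrow> real^2) \<Rightarrow> real^3 \<Rightarrow> real" where
  "div_h v x = (\<Sum>j\<in>UNIV. wpd (hidx j) (\<lambda>y. v y $ j) x)"

text \<open>\<open>\<Delta>\<^sub>h f + \<partial>\<^sub>z\<^sub>z f\<close>\<close>

definition laplacian :: "(real^3 \<Rightarrow> real) \<Rightarrow> real^3 \<Rightarrow> real" where
  "laplacian f x = (\<Sum>i\<in>UNIV. wpd2 i f x)"

definition reflect_z :: "real^3 \<Rightarrow> real^3" where
  "reflect_z x = (\<chi> i. if i = 3 then - (x $ 3) else x $ i)"

definition periodic_sym :: "(real^3 \<Rightarrow> real) \<Rightarrow> (real^3 \<Rightarrow> real^2) \<Rightarrow> (real^3 \<Rightarrow> real) \<Rightarrow> bool" where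
  "periodic_sym s v w \<longleftrightarrow> periodic2 s \<and> periodic2 v \<and> periodic2 w \<and>
     (\<forall>x. s (reflect_z x) = s x \<and> v (reflect_z x) = v x \<and> w (reflect_z x) = - w x)"


section \<open>The two systems\<close>

text \<open>In the predicates below \<open>s\<close>, \<open>v\<close>, \<open>w\<close> stand for \<open>\<sigma>\<close>, \<open>v\<close>, \<open>w\<close>, and \<open>st\<close>, \<open>vt\<close>, \<open>wt\<close> for their
  time derivatives.  A strong solution has enough regularity for every derivative in the system to
  be a function, satisfies the equations almost everywhere, and is continuous in time with values
  in \<open>L\<^sup>2\<close>, which gives a meaning to its initial value.\<close>

definition cf_solution ::
    "real \<Rightarrow> real \<Rightarrow>
     (real \<Rightarrow> real^3 \<Rightarrow> real) \<Rightarrow> (real \<Rightarrow> real^3 \<Rightarrow> real) \<Rightarrow>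
     (real \<Rightarrow> real^3 \<Rightarrow> real^2) \<Rightarrow> (real \<Rightarrow> real^3 \<Rightarrow> real^2) \<Rightarrow>
     (real \<Rightarrow> real^3 \<Rightarrow> real) \<Rightarrow> (real \<Rightarrow> real^3 \<Rightarrow> real) \<Rightarrow>
     (real^3 \<Rightarrow> real) \<Rightarrow> (real^3 \<Rightarrow> real^2) \<Rightarrow> (real^3 \<Rightarrow> real) \<Rightarrow> bool" where
  "cf_solution \<epsilon> T s st v vt w wt s0 v0 w0 \<longleftrightarrow>
     periodic_sym s0 v0 w0 \<and>
     (\<forall>t\<in>{0..T}. periodic_sym (s t) (v t) (w t)) \<and>
     in_CH T 0 s \<and> (\<forall>j. in_CH T 0 (\<lambda>t x. v t x $ j)) \<and> in_CH T 0 w \<and>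
     (AE x in torus. s 0 x = s0 x \<and> v 0 x = v0 x \<and> w 0 x = w0 x) \<and>
     in_L2H T 1 s \<and> (\<forall>j. in_L2H T 2 (\<lambda>t x. v t x $ j)) \<and> in_L2H T 2 w \<and>
     in_L2H T 0 st \<and> (\<forall>j. in_L2H T 0 (\<lambda>t x. vt t x $ j)) \<and> in_L2H T 0 wt \<and>
     has_time_deriv T s st \<and> has_time_deriv_vec T v vt \<and> has_time_deriv T w wt \<and>
     (AE t in time T. AE x in torus.
        st t x + transport (v t) (w t) (s t) x + div_h (v t) x + wpd 3 (w t) x = 0 \<and>
        (\<forall>j. vt t x $ j + transport (v t) (w t) (\<lambda>y. v t y $ j) x + wpd (hidx j) (s t) x
             = laplacian (\<lambda>y. v t y $ j) x) \<and>
        \<epsilon>\<^sup>2 * (wt t x + transport (v t) (w t) (w t) x) + wpd 3 (s t) x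
             = \<epsilon>\<^sup>2 * laplacian (w t) x)"

definition cpe_solution ::
    "real \<Rightarrow>
     (real \<Rightarrow> real^3 \<Rightarrow> real) \<Rightarrow> (real \<Rightarrow> real^3 \<Rightarrow> real) \<Rightarrow>
     (real \<Rightarrow> real^3 \<Rightarrow> real^2) \<Rightarrow> (real \<Rightarrow> real^3 \<Rightarrow> real^2) \<Rightarrow>
     (real \<Rightarrow> real^3 \<Rightarrow> real) \<Rightarrow> bool" where
  "cpe_solution T s st v vt w \<longleftrightarrow>
     (\<forall>t\<in>{0..T}. periodic_sym (s t) (v t) (w t)) \<and>
     in_CH T 0 s \<and> (\<forall>j. in_CH T 0 (\<lambda>t x. v t x $ j)) \<and>
     in_L2H T 1 s \<and> (\<forall>j. in_L2H T 2 (\<lambda>t x. v t x $ j)) \<and> in_L2H T 1 w \<and>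
     in_L2H T 0 st \<and> (\<forall>j. in_L2H T 0 (\<lambda>t x. vt t x $ j)) \<and>
     has_time_deriv T s st \<and> has_time_deriv_vec T v vt \<and>
     (AE t in time T. AE x in torus.
        st t x + transport (v t) (w t) (s t) x + div_h (v t) x + wpd 3 (w t) x = 0 \<and>
        (\<forall>j. vt t x $ j + transport (v t) (w t) (\<lambda>y. v t y $ j) x + wpd (hidx j) (s t) x
             = laplacian (\<lambda>y. v t y $ j) x) \<and>
        wpd 3 (s t) x = 0)"

text \<open>The limit \<open>(sp, vp, wp)\<close> is attained along a sequence \<open>e\<close> of parameters tending to 0.\<close>

definition limit_along ::
    "real \<Rightarrow> (nat \<Rightarrow> real) \<Rightarrow>
     (real \<Rightarrow> real \<Rightarrow> real^3 \<Rightarrow> real) \<Rightarrow> (real \<Rightarrow> real \<Rightarrow> real^3 \<Rightarrow> real) \<Rightarrow>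
     (real \<Rightarrow> real \<Rightarrow> real^3 \<Rightarrow> real^2) \<Rightarrow> (real \<Rightarrow> real \<Rightarrow> real^3 \<Rightarrow> real^2) \<Rightarrow>
     (real \<Rightarrow> real \<Rightarrow> real^3 \<Rightarrow> real) \<Rightarrow>
     (real \<Rightarrow> real^3 \<Rightarrow> real) \<Rightarrow> (real \<Rightarrow> real^3 \<Rightarrow> real) \<Rightarrow>
     (real \<Rightarrow> real^3 \<Rightarrow> real^2) \<Rightarrow> (real \<Rightarrow> real^3 \<Rightarrow> real^2) \<Rightarrow>
     (real \<Rightarrow> real^3 \<Rightarrow> real) \<Rightarrow> bool" where
  "limit_along T e s st v vt w sp spt vp vpt wp \<longleftrightarrow>
     (\<forall>n. e n \<in> {0<..<1}) \<and> e \<longlonglongrightarrow> 0 \<and>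
     weakstar_LinfH T 4 (\<lambda>n. s (e n)) sp \<and>
     strong_CH T 3 (\<lambda>n. s (e n)) sp \<and>
     weakstar_LinfH T 2 (\<lambda>n. st (e n)) spt \<and>
     weakstar_LinfH T 2 (\<lambda>n. w (e n)) wp \<and>
     weakstar_LinfH T 2 (\<lambda>n t. wpd 3 (w (e n) t)) (\<lambda>t. wpd 3 (wp t)) \<and>
     weak_L2H T 3 (\<lambda>n. st (e n)) spt \<and>
     weak_L2H T 3 (\<lambda>n. w (e n)) wp \<and>
     weak_L2H T 3 (\<lambda>n t. wpd 3 (w (e n) t)) (\<lambda>t. wpd 3 (wp t)) \<and>
     (\<forall>j. weakstar_LinfH T 3 (\<lambda>n t x. v (e n) t x $ j) (\<lambda>t x. vp t x $ j) \<and>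
          strong_CH T 2 (\<lambda>n t x. v (e n) t x $ j) (\<lambda>t x. vp t x $ j) \<and>
          weak_L2H T 4 (\<lambda>n t x. v (e n) t x $ j) (\<lambda>t x. vp t x $ j) \<and>
          weak_L2H T 2 (\<lambda>n t x. vt (e n) t x $ j) (\<lambda>t x. vpt t x $ j))"


section \<open>Energy and dissipation functionals\<close>

text \<open>\<open>wpd i f\<close> is meaningful wherever it matters: when \<open>energy_E\<close> is finite, \<open>s\<close> is in \<open>H\<^sup>4\<close> and \<open>w\<close>
  in \<open>H\<^sup>2\<close>; when \<open>energy_E1\<close> is finite, \<open>st\<close> is in \<open>H\<^sup>2\<close> and \<open>\<epsilon> wt\<close> in \<open>H\<^sup>1\<close>.  Otherwise another
  summand makes these functionals infinite.  The dissipations are used only together with them.\<close>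

definition energy_E ::
    "real \<Rightarrow> (real^3 \<Rightarrow> real) \<Rightarrow> (real^3 \<Rightarrow> real) \<Rightarrow> (real^3 \<Rightarrow> real^2) \<Rightarrow> (real^3 \<Rightarrow> real) \<Rightarrow> ennreal" where
  "energy_E \<epsilon> s st v w =
     Hnorm 3 (comps v @ [\<lambda>x. \<epsilon> * w x])
     + Hnorm 2 [st, wpd 1 s, wpd 2 s, \<lambda>x. wpd 3 s x / \<epsilon>]
     + Hnorm 4 [s]
     + Hnorm 2 [w, wpd 3 w]"

definition dissip_D ::
    "real \<Rightarrow> (real^3 \<Rightarrow> real) \<Rightarrow> (real^3 \<Rightarrow> real) \<Rightarrow> (real^3 \<Rightarrow> real^2) \<Rightarrow> (real^3 \<Rightarrow> real^2) \<Rightarrow>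
     (real^3 \<Rightarrow> real) \<Rightarrow> (real^3 \<Rightarrow> real) \<Rightarrow> ennreal" where
  "dissip_D \<epsilon> s st v vt w wt =
     Hnorm 2 (comps vt @ [\<lambda>x. \<epsilon> * wt x])
     + Hnorm 4 (comps v @ [\<lambda>x. \<epsilon> * w x])
     + Hnorm 3 [st, wpd 1 s, wpd 2 s, \<lambda>x. wpd 3 s x / \<epsilon>]
     + Hnorm 3 [w, wpd 3 w]"

text \<open>Here \<open>stt\<close>, \<open>vtt\<close>, \<open>wtt\<close> are second time derivatives, and \<open>\<partial>\<^sub>t\<close> of a spatial derivative of
  \<open>s\<close> or \<open>w\<close> is written as the spatial derivative of \<open>st\<close> or \<open>wt\<close>.\<close>

definition energy_E1 ::
    "real \<Rightarrow> (real^3 \<Rightarrow> real) \<Rightarrow> (real^3 \<Rightarrow> real) \<Rightarrow> (real^3 \<Rightarrow> real^2) \<Rightarrow> (real^3 \<Rightarrow> real) \<Rightarrow> ennreal" where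
  "energy_E1 \<epsilon> st stt vt wt =
     Hnorm 1 (comps vt @ [\<lambda>x. \<epsilon> * wt x])
     + L2norm [stt, wpd 1 st, wpd 2 st, \<lambda>x. wpd 3 st x / \<epsilon>]
     + Hnorm 2 [st]
     + L2norm [wt, wpd 3 wt]"

definition dissip_D1 ::
    "real \<Rightarrow> (real^3 \<Rightarrow> real) \<Rightarrow> (real^3 \<Rightarrow> real) \<Rightarrow> (real^3 \<Rightarrow> real^2) \<Rightarrow> (real^3 \<Rightarrow> real^2) \<Rightarrow>
     (real^3 \<Rightarrow> real) \<Rightarrow> (real^3 \<Rightarrow> real) \<Rightarrow> ennreal" where
  "dissip_D1 \<epsilon> st stt vt vtt wt wtt =
     L2norm (comps vtt @ [\<lambda>x. \<epsilon> * wtt x])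
     + Hnorm 2 (comps vt @ [\<lambda>x. \<epsilon> * wt x])
     + Hnorm 1 [stt, wpd 1 st, wpd 2 st, \<lambda>x. wpd 3 st x / \<epsilon>]
     + Hnorm 1 [wt, wpd 3 wt]"


section \<open>Initial values of the time derivatives\<close>

text \<open>These are obtained by solving the equations (and, for \<open>init_stt\<close>, the time derivative of the
  first equation) at time 0 for the time derivatives.\<close>

definition init_st :: "(real^3 \<Rightarrow> real) \<Rightarrow> (real^3 \<Rightarrow> real^2) \<Rightarrow> (real^3 \<Rightarrow> real) \<Rightarrow> real^3 \<Rightarrow> real" where
  "init_st s0 v0 w0 x = - (transport v0 w0 s0 x + div_h v0 x + wpd 3 w0 x)"

definition init_vt :: "(real^3 \<Rightarrow> real) \<Rightarrow> (real^3 \<Rightarrow> real^2) \<Rightarrow> (real^3 \<Rightarrow> real) \<Rightarrow> real^3 \<Rightarrow> real^2" where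
  "init_vt s0 v0 w0 x = (\<chi> j. laplacian (\<lambda>y. v0 y $ j) x
     - transport v0 w0 (\<lambda>y. v0 y $ j) x - wpd (hidx j) s0 x)"

definition init_wt ::
    "real \<Rightarrow> (real^3 \<Rightarrow> real) \<Rightarrow> (real^3 \<Rightarrow> real^2) \<Rightarrow> (real^3 \<Rightarrow> real) \<Rightarrow> real^3 \<Rightarrow> real" where
  "init_wt \<epsilon> s0 v0 w0 x = laplacian w0 x - transport v0 w0 w0 x - (1 / \<epsilon>\<^sup>2) * wpd 3 s0 x"

definition init_stt ::
    "real \<Rightarrow> (real^3 \<Rightarrow> real) \<Rightarrow> (real^3 \<Rightarrow> real^2) \<Rightarrow> (real^3 \<Rightarrow> real) \<Rightarrow> real^3 \<Rightarrow> real" where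
  "init_stt \<epsilon> s0 v0 w0 x =
     (let s1 = init_st s0 v0 w0; v1 = init_vt s0 v0 w0; w1 = init_wt \<epsilon> s0 v0 w0
      in - (transport v0 w0 s1 x + transport v1 w1 s0 x + div_h v1 x + wpd 3 w1 x))"

definition init_E :: "real \<Rightarrow> (real^3 \<Rightarrow> real) \<Rightarrow> (real^3 \<Rightarrow> real^2) \<Rightarrow> (real^3 \<Rightarrow> real) \<Rightarrow> ennreal" where
  "init_E \<epsilon> s0 v0 w0 = energy_E \<epsilon> s0 (init_st s0 v0 w0) v0 w0"

definition init_E1 :: "real \<Rightarrow> (real^3 \<Rightarrow> real) \<Rightarrow> (real^3 \<Rightarrow> real^2) \<Rightarrow> (real^3 \<Rightarrow> real) \<Rightarrow> ennreal" where
  "init_E1 \<epsilon> s0 v0 w0 =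
     energy_E1 \<epsilon> (init_st s0 v0 w0) (init_stt \<epsilon> s0 v0 w0) (init_vt s0 v0 w0) (init_wt \<epsilon> s0 v0 w0)"

end

theory Submission
  imports Defs
begin

text \<open>Let \<open>S\<close>, \<open>V\<close>, \<open>W\<close> be the differences of the two solutions. Testing the difference of the equations with
  \<open>S\<close> and \<open>V\<close> produces the bad term \<open>\<integral> W F\<close> with \<open>F = \<Sum>\<^sub>j \<partial>\<^sub>z vp\<^sub>j V\<^sub>j\<close>, in which \<open>W\<close> has no dissipation. Since \<open>W\<close> is
  odd in \<open>z\<close>, one may write \<open>F\<close> as the vertical derivative of some \<open>G\<close> and integrate by parts: the continuity
  equations express \<open>\<partial>\<^sub>z W\<close> by horizontal derivatives of \<open>S\<close> and \<open>V\<close>, which are moved to \<open>G\<close>, and by \<open>\<partial>\<^sub>t S\<close>, whose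
  vertical derivative is of order \<open>\<epsilon>\<close> by the bound on \<open>E\<^sub>1\<close>. Moreover \<open>\<partial>\<^sub>z \<sigma>\<^sub>\<epsilon>\<close> is of order \<open>\<epsilon>\<^sup>2\<close> by the vertical momentum
  equation. Gronwall's inequality then yields the rate \<open>\<epsilon>\<close> for \<open>S\<close> and \<open>V\<close>. Finally \<open>W\<close> is recovered from \<open>\<partial>\<^sub>z W\<close>, that
  is from \<open>\<nabla>S\<close> and \<open>\<nabla>V\<close>; interpolating \<open>\<nabla>S\<close> between \<open>L\<^sup>2\<close> and \<open>H\<^sup>4\<close> gives \<open>\<epsilon>\<^bsup>3/4\<^esup>\<close>, while \<open>\<nabla>V\<close> is of order \<open>\<epsilon>\<close> in
  \<open>L\<^sup>2(0,T;L\<^sup>2)\<close> and, by interpolation with \<open>H\<^sup>3\<close>, of order \<open>\<epsilon>\<^bsup>2/3\<^esup>\<close> uniformly in time. Everything is done on the level of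
  Fourier coefficients, where weak derivatives are multiplications.\<close>

section \<open>Square-integrable functions\<close>

text \<open>Three obstacles shape the argument. The limit system has no evolution equation for its
  vertical velocity, so \<open>W\<close> is accessible only through its vertical derivative. For the
  vertical derivative of \<open>St\<close> to be small, \<open>spt\<close> must have no mode with
  \<open>k 3 \<noteq> 0\<close>; this is inherited from \<open>sp\<close> through the evolution and
  cannot be seen at a fixed time. Next, moving horizontal derivatives onto the antiderivative of
  \<open>F\<close> costs second derivatives of \<open>vp\<close> in the sup norm, that is, the
  fourth order norm of \<open>vp\<close>, which is only square-integrable in time. The coefficient
  in Gronwall's inequality is therefore an unbounded, square-integrable function of time. Finally,
  time derivatives are distributional and spatial derivatives are representatives chosen separately
  at each time, so neither the chain rule for squared norms nor measurability in time comes for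
  free. Both are obtained from single Fourier coefficients, which are continuous in time for the
  solutions, and from finite sums of them.\<close>

definition sqi :: "'a measure \<Rightarrow> ('a \<Rightarrow> real) \<Rightarrow> bool" where
  "sqi M f \<longleftrightarrow> f \<in> borel_measurable M \<and> integrable M (\<lambda>x. (f x)\<^sup>2)"

definition nsq :: "'a measure \<Rightarrow> ('a \<Rightarrow> real) \<Rightarrow> real" where
  "nsq M f = (\<integral>x. (f x)\<^sup>2 \<partial>M)"

definition nrm :: "'a measure \<Rightarrow> ('a \<Rightarrow> real) \<Rightarrow> real" where
  "nrm M f = sqrt (nsq M f)"

definition ip :: "'a measure \<Rightarrow> ('a \<Rightarrow> real) \<Rightarrow> ('a \<Rightarrow> real) \<Rightarrow> real" where
  "ip M f g = (\<integral>x. f x * g x \<partial>M)"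

lemma sqi_meas [measurable_dest]: "sqi M f \<Longrightarrow> f \<in> borel_measurable M"
  by (simp add: sqi_def)

lemma sqi_int: "sqi M f \<Longrightarrow> integrable M (\<lambda>x. (f x)\<^sup>2)"
  by (simp add: sqi_def)

lemma nsq_nonneg [simp]: "0 \<le> nsq M f"
  by (simp add: nsq_def)

lemma nrm_nonneg [simp]: "0 \<le> nrm M f"
  by (simp add: nrm_def)

lemma nrm_sq [simp]: "(nrm M f)\<^sup>2 = nsq M f"
  by (simp add: nrm_def)

lemma sqi_mult_integrable:
  assumes "sqi M f" "sqi M g"
  shows "integrable M (\<lambda>x. f x * g x)"
proof (rule Bochner_Integration.integrable_bound)
  show "integrable M (\<lambda>x. (f x)\<^sup>2 + (g x)\<^sup>2)"
    using assms by (auto simp: sqi_def)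
  show "(\<lambda>x. f x * g x) \<in> borel_measurable M"
    using assms by (auto simp: sqi_def)
  have "\<bar>a * b\<bar> \<le> a\<^sup>2 + b\<^sup>2" for a b :: real
    using sum_squares_bound[of "\<bar>a\<bar>" "\<bar>b\<bar>"] mult_nonneg_nonneg[OF abs_ge_zero[of a] abs_ge_zero[of b]]
    unfolding abs_mult power2_abs by linarith
  then show "AE x in M. norm (f x * g x) \<le> norm ((f x)\<^sup>2 + (g x)\<^sup>2)"
    by auto
qed

lemma sqi_add: "sqi M f \<Longrightarrow> sqi M g \<Longrightarrow> sqi M (\<lambda>x. f x + g x)"
  using sqi_mult_integrable[of M f g] by (auto simp: sqi_def power2_sum mult.assoc)

lemma sqi_cmult: "sqi M f \<Longrightarrow> sqi M (\<lambda>x. c * f x)"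
  by (auto simp: sqi_def power_mult_distrib)

lemma sqi_uminus: "sqi M f \<Longrightarrow> sqi M (\<lambda>x. - f x)"
  by (auto simp: sqi_def)

lemma sqi_diff: "sqi M f \<Longrightarrow> sqi M g \<Longrightarrow> sqi M (\<lambda>x. f x - g x)"
  using sqi_add[OF _ sqi_uminus] by fastforce

lemma sqi_zero: "sqi M (\<lambda>x. 0)"
  by (simp add: sqi_def)

lemma sqi_sum: "(\<And>i. i \<in> I \<Longrightarrow> sqi M (f i)) \<Longrightarrow> sqi M (\<lambda>x. \<Sum>i\<in>I. f i x)"
  by (induction I rule: infinite_finite_induct) (auto intro: sqi_add simp: sqi_zero)

lemma nsq_cong_AE:
  assumes "f \<in> borel_measurable M" "g \<in> borel_measurable M" "AE x in M. f x = g x"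
  shows "nsq M f = nsq M g"
  unfolding nsq_def by (rule integral_cong_AE) (use assms in auto)

lemma sqi_bounded_mult:
  assumes "sqi M g" "f \<in> borel_measurable M" "AE x in M. \<bar>f x\<bar> \<le> B" "0 \<le> B"
  shows "sqi M (\<lambda>x. f x * g x)" "nrm M (\<lambda>x. f x * g x) \<le> B * nrm M g"
proof -
  have le: "AE x in M. (f x * g x)\<^sup>2 \<le> B\<^sup>2 * (g x)\<^sup>2"
    using assms(3)
    by eventually_elim (auto simp: power_mult_distrib abs_le_square_iff intro!: mult_right_mono
        power2_le_iff_abs_le[THEN iffD2] assms(4))
  show s: "sqi M (\<lambda>x. f x * g x)"
    unfolding sqi_def
  proof
    show "integrable M (\<lambda>x. (f x * g x)\<^sup>2)"
      by (rule Bochner_Integration.integrable_bound[of _ "\<lambda>x. B\<^sup>2 * (g x)\<^sup>2"])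
        (use assms le in \<open>auto simp: sqi_def\<close>)
  qed (use assms in \<open>auto simp: sqi_def\<close>)
  have "nsq M (\<lambda>x. f x * g x) \<le> (\<integral>x. B\<^sup>2 * (g x)\<^sup>2 \<partial>M)"
    unfolding nsq_def by (rule integral_mono_AE) (use s assms le in \<open>auto simp: sqi_def\<close>)
  also have "\<dots> = (B * nrm M g)\<^sup>2"
    by (simp add: nsq_def power_mult_distrib)
  finally show "nrm M (\<lambda>x. f x * g x) \<le> B * nrm M g"
    using assms(4) by (simp add: nrm_def real_le_lsqrt)
qed

lemma nsq_add:
  assumes "sqi M f" "sqi M g"
  shows "nsq M (\<lambda>x. f x + g x) = nsq M f + 2 * ip M f g + nsq M g"
proof -
  have "nsq M (\<lambda>x. f x + g x) = (\<integral>x. ((f x)\<^sup>2 + 2 * (f x * g x)) + (g x)\<^sup>2 \<partial>M)"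
    unfolding nsq_def by (simp add: power2_sum algebra_simps)
  then show ?thesis
    using assms sqi_mult_integrable[OF assms] by (simp add: nsq_def ip_def sqi_def)
qed

lemma nsq_cmult [simp]: "nsq M (\<lambda>x. c * f x) = c\<^sup>2 * nsq M f"
  by (simp add: nsq_def power_mult_distrib)

lemma nrm_cmult [simp]: "nrm M (\<lambda>x. c * f x) = \<bar>c\<bar> * nrm M f"
  by (simp add: nrm_def real_sqrt_mult)

lemma nrm_uminus [simp]: "nrm M (\<lambda>x. - f x) = nrm M f"
  by (simp add: nrm_def nsq_def)

lemma ip_commute: "ip M f g = ip M g f"
  by (simp add: ip_def mult.commute)

lemma ip_cmult_right [simp]: "ip M f (\<lambda>x. c * g x) = c * ip M f g"
  by (simp add: ip_def mult.left_commute)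

lemma ip_self: "ip M f f = nsq M f"
  by (simp add: ip_def nsq_def power2_eq_square)

lemma ip_add_left:
  "sqi M f \<Longrightarrow> sqi M g \<Longrightarrow> sqi M h \<Longrightarrow> ip M (\<lambda>x. f x + g x) h = ip M f h + ip M g h"
  by (simp add: ip_def distrib_right sqi_mult_integrable)

lemma ip_diff_left:
  "sqi M f \<Longrightarrow> sqi M g \<Longrightarrow> sqi M h \<Longrightarrow> ip M (\<lambda>x. f x - g x) h = ip M f h - ip M g h"
  by (simp add: ip_def left_diff_distrib sqi_mult_integrable)

lemma ip_uminus_left: "ip M (\<lambda>x. - f x) h = - ip M f h"
  by (simp add: ip_def)

lemma ip_sum_left:
  "(\<And>i. i \<in> I \<Longrightarrow> sqi M (f i)) \<Longrightarrow> sqi M h \<Longrightarrow> ip M (\<lambda>x. \<Sum>i\<in>I. f i x) h = (\<Sum>i\<in>I. ip M (f i) h)"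
  by (simp add: ip_def sum_distrib_right sqi_mult_integrable)

lemma ip_sum_right:
  "(\<And>i. i \<in> I \<Longrightarrow> sqi M (f i)) \<Longrightarrow> sqi M h \<Longrightarrow> ip M h (\<lambda>x. \<Sum>i\<in>I. f i x) = (\<Sum>i\<in>I. ip M h (f i))"
  by (simp add: ip_def sum_distrib_left sqi_mult_integrable)

lemma ip_cong_AE:
  assumes "f \<in> borel_measurable M" "g \<in> borel_measurable M" "h \<in> borel_measurable M"
    "AE x in M. f x = g x"
  shows "ip M f h = ip M g h"
  unfolding ip_def by (rule integral_cong_AE) (use assms in auto)

lemma ip_Cauchy_Schwarz:
  assumes "sqi M f" "sqi M g"
  shows "\<bar>ip M f g\<bar> \<le> nrm M f * nrm M g"
proof -
  let ?a = "nsq M f" and ?b = "ip M f g" and ?c = "nsq M g"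
  \<comment> \<open>The classical discriminant argument: the squared norm of \<open>f + l g\<close>
    is a nonnegative quadratic polynomial in \<open>l\<close>.\<close>
  have q: "0 \<le> ?a + 2 * l * ?b + l\<^sup>2 * ?c" for l
    using nsq_add[OF assms(1) sqi_cmult[OF assms(2), of l]] nsq_nonneg[of M "\<lambda>x. f x + l * g x"]
    by simp
  have "?b\<^sup>2 \<le> ?a * ?c"
  proof (cases "?c = 0")
    case True
    have "?b = 0"
    proof (rule ccontr)
      assume b: "?b \<noteq> 0"
      \<comment> \<open>With \<open>?c = 0\<close> the polynomial is affine in \<open>l\<close>, and
        this \<open>l\<close> gives it the negative value \<open>- ?a - 2\<close>.\<close>
      have "0 \<le> ?a + 2 * (- (?a + 1) / ?b) * ?b"
        using q[of "- (?a + 1) / ?b"] True by simp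
      then show False
        using b nsq_nonneg[of M f] by simp
    qed
    then show ?thesis by (simp add: True)
  next
    case False
    then have c: "0 < ?c" using nsq_nonneg[of M g] by linarith
    have "0 \<le> ?a + 2 * (- ?b / ?c) * ?b + (- ?b / ?c)\<^sup>2 * ?c" by (rule q)
    also have "\<dots> = ?a - ?b\<^sup>2 / ?c"
      using c by (simp add: field_simps power2_eq_square)
    finally show ?thesis
      using c by (simp add: field_simps)
  qed
  then have "?b\<^sup>2 \<le> (nrm M f * nrm M g)\<^sup>2"
    by (simp add: power_mult_distrib)
  then show ?thesis
    by (metis abs_le_square_iff abs_of_nonneg mult_nonneg_nonneg nrm_nonneg)
qed

lemma nrm_triangle:
  assumes "sqi M f" "sqi M g"
  shows "nrm M (\<lambda>x. f x + g x) \<le> nrm M f + nrm M g"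
proof -
  have "nsq M (\<lambda>x. f x + g x) \<le> (nrm M f + nrm M g)\<^sup>2"
    using nsq_add[OF assms] ip_Cauchy_Schwarz[OF assms] by (simp add: power2_sum)
  then show ?thesis
    by (simp add: nrm_def real_le_lsqrt)
qed

lemma nrm_triangle_diff:
  assumes "sqi M f" "sqi M g"
  shows "nrm M (\<lambda>x. f x - g x) \<le> nrm M f + nrm M g"
  using nrm_triangle[OF assms(1) sqi_uminus[OF assms(2)]] by simp

lemma nrm_sum_le:
  assumes "\<And>i. i \<in> I \<Longrightarrow> sqi M (f i)"
  shows "nrm M (\<lambda>x. \<Sum>i\<in>I. f i x) \<le> (\<Sum>i\<in>I. nrm M (f i))"
  using assms
proof (induction I rule: infinite_finite_induct)
  case (insert i I)
  then show ?case
    using nrm_triangle[of M "f i" "\<lambda>x. \<Sum>i\<in>I. f i x"] sqi_sum[of I M f] by fastforce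
qed (auto simp: nrm_def nsq_def)

lemma sqi_integrable:
  assumes "finite_measure M" "sqi M f"
  shows "integrable M f"
proof -
  interpret finite_measure M by fact
  have "sqi M (\<lambda>x. 1)" by (simp add: sqi_def)
  from sqi_mult_integrable[OF assms(2) this] show ?thesis by simp
qed

lemma sqi_bounded:
  assumes "finite_measure M" "f \<in> borel_measurable M" "AE x in M. \<bar>f x\<bar> \<le> B"
  shows "sqi M f"
proof -
  interpret finite_measure M by fact
  have one: "sqi M (\<lambda>x. 1)" by (simp add: sqi_def)
  have "AE x in M. \<bar>f x\<bar> \<le> \<bar>B\<bar>" using assms(3) by auto
  from sqi_bounded_mult(1)[OF one assms(2) this] show ?thesis by simp
qed

text \<open>Cauchy-Schwarz applied to \<open>f n - g\<close>. It carries statements about the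
  partial sums \<open>ps N f\<close> over to \<open>f\<close>.\<close>

lemma tendsto_nrm_zero_ip:
  assumes "\<And>n. sqi M (f n)" "sqi M g" "sqi M h" "(\<lambda>n. nsq M (\<lambda>x. f n x - g x)) \<longlonglongrightarrow> 0"
  shows "(\<lambda>n. ip M (f n) h) \<longlonglongrightarrow> ip M g h"
proof -
  have "(\<lambda>n. nrm M (\<lambda>x. f n x - g x)) \<longlonglongrightarrow> 0"
    unfolding nrm_def using tendsto_real_sqrt[OF assms(4)] by simp
  then have lim: "(\<lambda>n. nrm M (\<lambda>x. f n x - g x) * nrm M h) \<longlonglongrightarrow> 0"
    by (rule tendsto_mult_left_zero)
  have "norm (ip M (f n) h - ip M g h) \<le> nrm M (\<lambda>x. f n x - g x) * nrm M h" for n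
    using ip_Cauchy_Schwarz[OF sqi_diff[OF assms(1)[of n] assms(2)] assms(3)] assms
    by (simp add: ip_diff_left)
  then have "(\<lambda>n. ip M (f n) h - ip M g h) \<longlonglongrightarrow> 0"
    by (intro Lim_null_comparison[OF _ lim] always_eventually allI)
  then show ?thesis by (rule LIM_zero_cancel)
qed

section \<open>Fourier coefficients on the torus\<close>

text \<open>The characters of the torus with period 2. \<open>fc\<close> pairs with
  \<open>ek k\<close> itself, not with its conjugate, so that the real test functions
  \<open>Re (c * ek k x)\<close> produce \<open>Re (c * fc f k)\<close> without conjugation.\<close>

definition ek :: "(3 \<Rightarrow> int) \<Rightarrow> real^3 \<Rightarrow> complex" where
  "ek k x = cis (pi * (\<Sum>i\<in>UNIV. of_int (k i) * x $ i))"

definition fc :: "(real^3 \<Rightarrow> real) \<Rightarrow> (3 \<Rightarrow> int) \<Rightarrow> complex" where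
  "fc f k = (\<integral>x. of_real (f x) * ek k x \<partial>torus)"

definition KB :: "nat \<Rightarrow> (3 \<Rightarrow> int) set" where
  "KB N = {k. \<forall>i. \<bar>k i\<bar> \<le> int N}"

text \<open>The Fourier partial sum over a cube of frequencies; 8 is the volume of the cell. The
  conjugate undoes the convention in \<open>fc\<close>, and the real parts keep the sum real term by
  term.\<close>

definition ps :: "nat \<Rightarrow> (real^3 \<Rightarrow> real) \<Rightarrow> real^3 \<Rightarrow> real" where
  "ps N f x = (\<Sum>k\<in>KB N. Re (fc f k * cnj (ek k x))) / 8"

lemma prod_UNIV_3: "(\<Prod>i\<in>(UNIV::3 set). f i) = f 1 * f 2 * (f 3 :: 'a::comm_monoid_mult)"
  unfolding UNIV_3 by (simp add: mult.assoc)

lemma space_torus [simp]: "space torus = cbox (-1) 1"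
  by (simp add: torus_def)

lemma finite_measure_torus: "finite_measure torus"
proof
  show "emeasure torus (space torus) \<noteq> \<infinity>"
    by (simp add: torus_def emeasure_restrict_space emeasure_lborel_cbox_eq)
qed

interpretation torus: finite_measure torus
  by (rule finite_measure_torus)

lemma continuous_torus_measurable:
  fixes f :: "real^3 \<Rightarrow> 'b::real_normed_vector"
  shows "continuous_on UNIV f \<Longrightarrow> f \<in> borel_measurable torus"
  unfolding torus_def
  by (rule continuous_imp_measurable_on_sets_lebesgue) (auto intro: continuous_on_subset)

lemma continuous_ek: "continuous_on UNIV (ek k)"
  unfolding ek_def cis_conv_exp by (intro continuous_intros)

lemma ek_measurable [measurable]: "ek k \<in> borel_measurable torus"
  by (rule continuous_torus_measurable[OF continuous_ek])

lemma norm_ek [simp]: "norm (ek k x) = 1"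
  by (simp add: ek_def)

lemma ek_mult: "ek k x * ek l x = ek (\<lambda>i. k i + l i) x"
  by (simp add: ek_def cis_mult distrib_left distrib_right sum.distrib)

lemma cnj_ek: "cnj (ek k x) = ek (\<lambda>i. - k i) x"
  by (simp add: ek_def cis_cnj sum_negf)

lemma integral_cis:
  fixes m :: int
  shows "(\<integral>y. indicator {-1..1} y *\<^sub>R cis (pi * of_int m * y) \<partial>lborel) = (if m = 0 then 2 else 0)"
proof (cases "m = 0")
  case True
  then show ?thesis
    by (simp add: scaleR_conv_of_real)
next
  case False
  define F where "F y = cis (pi * of_int m * y) / (\<i> * (pi * of_int m))" for y
  have "(F has_vector_derivative cis (pi * of_int m * y)) (at y within {-1..1})" for y
  proof -
    have "((\<lambda>y. cis (pi * of_int m * y)) has_vector_derivative (pi * of_int m) *\<^sub>R (\<i> * cis (pi * of_int m * y))) (at y within {-1..1})"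
      unfolding cis_conv_exp of_real_mult
      by (rule has_vector_derivative_real_field) (auto intro!: derivative_eq_intros simp: scaleR_conv_of_real)
    from has_vector_derivative_divide[OF this, of "\<i> * (pi * of_int m)"] show ?thesis
      using False by (simp add: F_def[abs_def] scaleR_conv_of_real)
  qed
  then have "(\<integral>y. indicator {-1..1} y *\<^sub>R cis (pi * of_int m * y) \<partial>lborel) = F 1 - F (-1)"
    by (intro integral_FTC_atLeastAtMost) (auto intro!: continuous_intros simp: cis_conv_exp)
  \<comment> \<open>The antiderivative takes equal values at both ends because \<open>sin\<close>
    vanishes at integer multiples of pi.\<close>
  also have "cis (pi * of_int m) = cis (- (pi * of_int m))"
    by (simp add: complex_eq_iff sin_times_pi_eq_0)
  then have "F 1 - F (-1) = 0"
    by (simp add: F_def)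
  finally show ?thesis
    using False by simp
qed

lemma Basis_vec3: "(Basis :: (real^3) set) = range (\<lambda>i. axis i 1)"
  by (auto simp: Basis_vec_def)

lemma inj_axis1: "inj (\<lambda>i::3. axis i (1::real))"
  by (auto simp: inj_on_def axis_eq_axis)

text \<open>Orthogonality of the characters. A character times the indicator of the cell is a
  product of functions of single coordinates, so the integral factors into copies of
  \<open>integral_cis\<close>.\<close>

lemma integral_ek: "(\<integral>x. ek k x \<partial>torus) = (if k = (\<lambda>_. 0) then 8 else 0)"
proof -
  define g :: "real^3 \<Rightarrow> real \<Rightarrow> complex" where
    "g b y = indicator {-1..1} y *\<^sub>R cis (pi * (\<Sum>i\<in>UNIV. of_int (k i) * b $ i) * y)" for b y
  have bij: "(\<Prod>b\<in>Basis. h b) = (\<Prod>i\<in>UNIV. h (axis i 1))" for h :: "real^3 \<Rightarrow> complex"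
    unfolding Basis_vec3 by (simp add: prod.reindex[OF inj_axis1])
  have ax: "(\<Sum>i\<in>UNIV. of_int (k i) * (axis j 1 :: real^3) $ i) = real_of_int (k j)" for j
    by (simp add: axis_def if_distrib[of "\<lambda>x. _ * x"] cong: if_cong)
  have ind: "indicator (cbox (-1) 1) x *\<^sub>R ek k x = (\<Prod>b\<in>Basis. g b (x \<bullet> b))" for x :: "real^3"
  proof -
    have "(\<Prod>b\<in>Basis. g b (x \<bullet> b)) = (\<Prod>i\<in>UNIV. indicator {-1..1} (x $ i) *\<^sub>R cis (pi * of_int (k i) * x $ i))"
      unfolding bij by (simp add: g_def ax inner_axis)
    also have "\<dots> = (\<Prod>i\<in>UNIV. of_real (indicator {-1..1} (x $ i))) * (\<Prod>i\<in>UNIV. cis (pi * of_int (k i) * x $ i))"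
      by (simp add: scaleR_conv_of_real prod.distrib)
    also have "(\<Prod>i\<in>UNIV. cis (pi * of_int (k i) * x $ i)) = ek k x"
      by (simp add: ek_def prod_UNIV_3 sum_3 cis_mult algebra_simps)
    also have "(\<Prod>i\<in>UNIV. of_real (indicator {-1..1} (x $ i)) :: complex) = of_real (indicator (cbox (-1) 1) x)"
      by (auto simp: prod_UNIV_3 indicator_def mem_box_cart forall_3)
    finally show ?thesis by (simp add: scaleR_conv_of_real)
  qed
  interpret product_sigma_finite "\<lambda>b::real^3. lborel :: real measure" by standard
  have int: "integrable lborel (g b)" for b
    unfolding g_def by (rule borel_integrable_compact) (auto intro!: continuous_intros simp: cis_conv_exp)
  have meas: "(\<lambda>x. \<Prod>b\<in>Basis. g b (x \<bullet> b)) \<in> borel_measurable borel"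
  proof (rule borel_measurable_prod)
    fix b :: "real^3"
    have "g b \<in> borel_measurable borel"
      using borel_measurable_integrable[OF int[of b]] by simp
    then show "(\<lambda>x. g b (x \<bullet> b)) \<in> borel_measurable borel"
      by (rule measurable_compose[rotated]) simp
  qed
  have "(\<integral>x. ek k x \<partial>torus) = (\<integral>x. indicator (cbox (-1) 1) x *\<^sub>R ek k x \<partial>lebesgue)"
    unfolding torus_def by (rule integral_restrict_space) simp
  also have "\<dots> = (\<integral>x. (\<Prod>b\<in>Basis. g b (x \<bullet> b)) \<partial>lborel)"
    unfolding ind by (rule integral_completion) (use meas in simp)
  also have "\<dots> = (\<integral>f. (\<Prod>b\<in>Basis. g b ((\<Sum>b\<in>Basis. f b *\<^sub>R b) \<bullet> b)) \<partial>(\<Pi>\<^sub>M b\<in>Basis. lborel))"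
    by (subst lborel_eq, rule integral_distr) (use meas in \<open>auto simp: space_PiM\<close>)
  also have "\<dots> = (\<integral>f. (\<Prod>b\<in>Basis. g b (f b)) \<partial>(\<Pi>\<^sub>M b\<in>Basis. lborel))"
    by (intro Bochner_Integration.integral_cong refl prod.cong arg_cong2[where f=g]) (simp add: inner_sum_left_Basis)
  also have "\<dots> = (\<Prod>b\<in>Basis. \<integral>y. g b y \<partial>lborel)"
    by (rule product_integral_prod) (use int in auto)
  also have "\<dots> = (\<Prod>i\<in>UNIV. if k i = 0 then 2 else 0)"
    unfolding bij using integral_cis by (simp add: g_def[abs_def] ax cong: if_cong)
  also have "\<dots> = (if k = (\<lambda>_. 0) then 8 else 0)"
    by (auto simp: prod_UNIV_3 fun_eq_iff forall_3)
  finally show ?thesis .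
qed

lemma finite_KB [simp]: "finite (KB N)"
proof (rule finite_subset)
  show "KB N \<subseteq> PiE UNIV (\<lambda>_. {- int N..int N})"
    by (auto simp: KB_def) (metis abs_le_D2 minus_le_iff, meson abs_le_iff)
qed (auto intro: finite_PiE)

lemma KB_mono: "M \<le> N \<Longrightarrow> KB M \<subseteq> KB N"
  by (simp add: KB_def subset_iff) (meson of_nat_le_iff order_trans)

lemma KB_uminus: "(\<lambda>i. - k i) \<in> KB N \<longleftrightarrow> k \<in> KB N"
  by (simp add: KB_def)

lemma ex_KB: "\<exists>N. k \<in> KB N"
proof
  show "k \<in> KB (\<Sum>i\<in>UNIV. nat \<bar>k i\<bar>)"
    using member_le_sum[of _ UNIV "\<lambda>i. nat \<bar>k i\<bar>"] by (simp add: KB_def nat_le_iff)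
qed

lemma integrable_ek_mult:
  assumes "integrable torus f" shows "integrable torus (\<lambda>x. complex_of_real (f x) * ek k x)"
proof -
  have "f \<in> borel_measurable torus" using assms by auto
  then show ?thesis
    by (intro Bochner_Integration.integrable_bound[OF assms]) (auto simp: norm_mult)
qed

lemma integrable_ek: "integrable torus (ek k)"
  by (rule torus.integrable_const_bound[where B=1]) auto

lemma fc_add: "integrable torus f \<Longrightarrow> integrable torus g \<Longrightarrow> fc (\<lambda>x. f x + g x) k = fc f k + fc g k"
  by (simp add: fc_def distrib_right integrable_ek_mult)

lemma fc_diff: "integrable torus f \<Longrightarrow> integrable torus g \<Longrightarrow> fc (\<lambda>x. f x - g x) k = fc f k - fc g k"
  by (simp add: fc_def left_diff_distrib integrable_ek_mult)

lemma fc_cmult: "fc (\<lambda>x. c * f x) k = of_real c * fc f k"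
  by (simp add: fc_def mult.assoc)

lemma fc_uminus: "fc (\<lambda>x. - f x) k = - fc f k"
  by (simp add: fc_def)

lemma fc_sum:
  "(\<And>i. i \<in> I \<Longrightarrow> integrable torus (f i)) \<Longrightarrow> fc (\<lambda>x. \<Sum>i\<in>I. f i x) k = (\<Sum>i\<in>I. fc (f i) k)"
  by (simp add: fc_def sum_distrib_right integrable_ek_mult)

lemma fc_cong_AE:
  assumes "f \<in> borel_measurable torus" "g \<in> borel_measurable torus" "AE x in torus. f x = g x"
  shows "fc f k = fc g k"
  unfolding fc_def by (rule integral_cong_AE) (use assms in auto)

lemma fc_minus_index: "fc f (\<lambda>i. - k i) = cnj (fc f k)"
proof -
  have "cnj (fc f k) = (\<integral>x. cnj (complex_of_real (f x) * ek k x) \<partial>torus)"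
    unfolding fc_def by (rule Bochner_Integration.integral_cnj[symmetric])
  then show ?thesis by (simp add: cnj_ek fc_def)
qed

text \<open>Letting \<open>c\<close> range over the complex numbers, the real integrals on the right
  determine the complex coefficient; see \<open>complex_eqI_Re\<close>.\<close>

lemma Re_mult_fc:
  assumes "integrable torus f"
  shows "Re (c * fc f k) = (\<integral>x. f x * Re (c * ek k x) \<partial>torus)"
proof -
  have "c * fc f k = (\<integral>x. c * (complex_of_real (f x) * ek k x) \<partial>torus)"
    unfolding fc_def by simp
  also have "Re \<dots> = (\<integral>x. Re (c * (complex_of_real (f x) * ek k x)) \<partial>torus)"
    by (rule integral_Re[symmetric]) (intro integrable_mult_right integrable_ek_mult assms)
  finally show ?thesis by (simp add: algebra_simps)
qed

lemma norm_fc_le: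
  assumes "sqi torus f" shows "norm (fc f k) \<le> sqrt 8 * nrm torus f"
proof -
  have one: "sqi torus (\<lambda>x. 1)" by (simp add: sqi_def)
  have ab: "sqi torus (\<lambda>x. \<bar>f x\<bar>)" using assms by (auto simp: sqi_def)
  have "(\<integral>x. (1::complex) \<partial>torus) = 8"
    using integral_ek[of "\<lambda>_. 0"] by (simp add: ek_def[abs_def])
  then have m8: "measure torus (space torus) = 8"
    by (simp add: scaleR_conv_of_real) (metis of_real_eq_iff of_real_numeral)
  have "norm (fc f k) \<le> (\<integral>x. norm (complex_of_real (f x) * ek k x) \<partial>torus)"
    unfolding fc_def by (rule integral_norm_bound)
  also have "\<dots> = ip torus (\<lambda>x. 1) (\<lambda>x. \<bar>f x\<bar>)"
    by (simp add: ip_def norm_mult)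
  also have "\<dots> \<le> nrm torus (\<lambda>x. 1) * nrm torus (\<lambda>x. \<bar>f x\<bar>)"
    using ip_Cauchy_Schwarz[OF one ab] by linarith
  also have "\<dots> = sqrt 8 * nrm torus f"
    using m8 by (simp add: nrm_def nsq_def)
  finally show ?thesis .
qed

lemma sqi_Re_ek: "sqi torus (\<lambda>x. Re (c * ek k x))"
proof (rule sqi_bounded[OF finite_measure_torus])
  show "AE x in torus. \<bar>Re (c * ek k x)\<bar> \<le> norm c"
    using abs_Re_le_cmod[of "c * ek k _"] by (simp add: norm_mult del: times_complex.sel)
qed auto

lemma sqi_Re_cnj_ek: "sqi torus (\<lambda>x. Re (c * cnj (ek k x)))"
  using sqi_Re_ek by (simp add: cnj_ek)

lemma sqi_ps: "sqi torus (ps N f)"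
proof -
  have "sqi torus (\<lambda>x. (1/8) * (\<Sum>k\<in>KB N. Re (fc f k * cnj (ek k x))))"
    by (intro sqi_cmult sqi_sum sqi_Re_cnj_ek)
  then show ?thesis by (simp add: ps_def[abs_def])
qed

lemma ip_ps:
  assumes "sqi torus g"
  shows "ip torus g (ps N f) = (\<Sum>k\<in>KB N. Re (fc f k * cnj (fc g k))) / 8"
proof -
  have "ip torus g (ps N f) = (1/8) * ip torus g (\<lambda>x. \<Sum>k\<in>KB N. Re (fc f k * cnj (ek k x)))"
    unfolding ps_def[abs_def] ip_cmult_right[symmetric] by simp
  also have "ip torus g (\<lambda>x. \<Sum>k\<in>KB N. Re (fc f k * cnj (ek k x))) = (\<Sum>k\<in>KB N. Re (fc f k * cnj (fc g k)))"
    using Re_mult_fc[OF sqi_integrable[OF finite_measure_torus assms]]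
    by (subst ip_sum_right) (auto simp: sqi_Re_cnj_ek assms ip_def cnj_ek sqi_Re_ek simp flip: fc_minus_index simp del: times_complex.sel intro!: sum.cong)
  finally show ?thesis by simp
qed

text \<open>\<open>Re (c * ek k x)\<close> consists of the frequencies \<open>k\<close> and
  \<open>- k\<close> with halved coefficients, and the volume 8 turns one half into 4. The sum of
  two conditionals also covers \<open>k = 0\<close>, where both apply.\<close>

lemma fc_Re_ek:
  "fc (\<lambda>x. Re (c * ek k x)) l = 4 * ((if l = (\<lambda>i. - k i) then c else 0) + (if l = k then cnj c else 0))"
proof -
  have "fc (\<lambda>x. Re (c * ek k x)) l = (\<integral>x. (c / 2) * ek (\<lambda>i. k i + l i) x + (cnj c / 2) * ek (\<lambda>i. - k i + l i) x \<partial>torus)"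
    unfolding fc_def
  proof (rule Bochner_Integration.integral_cong[OF refl])
    fix x
    have re: "complex_of_real (Re z) = (z + cnj z) / 2" for z by (simp add: complex_eq_iff)
    have "complex_of_real (Re (c * ek k x)) * ek l x = (c / 2) * (ek k x * ek l x) + (cnj c / 2) * (cnj (ek k x) * ek l x)"
      unfolding re by (simp add: field_simps)
    then show "complex_of_real (Re (c * ek k x)) * ek l x = (c / 2) * ek (\<lambda>i. k i + l i) x + (cnj c / 2) * ek (\<lambda>i. - k i + l i) x"
      unfolding cnj_ek ek_mult .
  qed
  also have "\<dots> = (c / 2) * (if (\<lambda>i. k i + l i) = (\<lambda>_. 0) then 8 else 0) + (cnj c / 2) * (if (\<lambda>i. - k i + l i) = (\<lambda>_. 0) then 8 else 0)"
    by (simp add: integrable_ek integral_ek)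
  also have "(\<lambda>i. k i + l i) = (\<lambda>_. 0) \<longleftrightarrow> l = (\<lambda>i. - k i)"
    by (auto simp: fun_eq_iff) (metis add_eq_0_iff)
  also have "(\<lambda>i. - k i + l i) = (\<lambda>_. 0) \<longleftrightarrow> l = k"
    by (auto simp: fun_eq_iff)
  finally show ?thesis by (simp split: if_splits)
qed

lemma fc_ps: "fc (ps N f) l = (if l \<in> KB N then fc f l else 0)"
proof -
  have "fc (ps N f) l = fc (\<lambda>x. \<Sum>k\<in>KB N. (1/8) * Re (cnj (fc f k) * ek k x)) l"
    by (rule arg_cong[where f="\<lambda>h. fc h l"]) (simp add: ps_def fun_eq_iff sum_divide_distrib)
  also have "\<dots> = (\<Sum>k\<in>KB N. (1/8) * (4 * ((if l = (\<lambda>i. - k i) then cnj (fc f k) else 0) + (if l = k then fc f k else 0))))"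
  proof (subst fc_sum)
    show "integrable torus (\<lambda>x. 1 / 8 * Re (cnj (fc f k) * ek k x))" for k
      by (intro sqi_integrable[OF finite_measure_torus] sqi_cmult sqi_Re_ek)
    show "(\<Sum>k\<in>KB N. fc (\<lambda>x. 1 / 8 * Re (cnj (fc f k) * ek k x)) l) =
      (\<Sum>k\<in>KB N. (1/8) * (4 * ((if l = (\<lambda>i. - k i) then cnj (fc f k) else 0) + (if l = k then fc f k else 0))))"
      unfolding fc_cmult fc_Re_ek by (auto intro!: sum.cong)
  qed
  also have "\<dots> = (\<Sum>k\<in>KB N. (if k = (\<lambda>i. - l i) then cnj (fc f k) / 2 else 0)) + (\<Sum>k\<in>KB N. (if l = k then fc f k / 2 else 0))"
    by (subst sum.distrib[symmetric], rule sum.cong) (auto simp: fun_eq_iff)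
  \<comment> \<open>The two halves are equal because the coefficients of a real function are
    hermitian; the cube is symmetric, so either both occur or neither.\<close>
  also have "\<dots> = (if l \<in> KB N then fc f l else 0)"
    by (simp add: KB_uminus sum.delta) (simp add: fc_minus_index)
  finally show ?thesis .
qed

lemma nsq_ps: "nsq torus (ps N f) = (\<Sum>k\<in>KB N. (norm (fc f k))\<^sup>2) / 8"
  unfolding ip_self[symmetric] ip_ps[OF sqi_ps]
  by (auto simp: fc_ps complex_mult_cnj cmod_power2 intro!: sum.cong arg_cong[where f="\<lambda>x. x / 8"])

text \<open>Pythagoras: the inner product of \<open>f\<close> with \<open>ps N f\<close> equals the
  squared norm of \<open>ps N f\<close>. Bessel's inequality is then the nonnegativity of the left
  side.\<close>

lemma nsq_diff_ps:
  assumes "sqi torus f"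
  shows "nsq torus (\<lambda>x. f x - ps N f x) = nsq torus f - (\<Sum>k\<in>KB N. (norm (fc f k))\<^sup>2) / 8"
proof -
  have "nsq torus (\<lambda>x. f x - ps N f x) = nsq torus f + 2 * ip torus f (\<lambda>x. - 1 * ps N f x) + nsq torus (\<lambda>x. - 1 * ps N f x)"
    using nsq_add[OF assms sqi_cmult[OF sqi_ps, of "-1" N f]] by simp
  also have "\<dots> = nsq torus f - 2 * ip torus f (ps N f) + nsq torus (ps N f)"
    unfolding ip_cmult_right nsq_cmult by simp
  also have "ip torus f (ps N f) = (\<Sum>k\<in>KB N. (norm (fc f k))\<^sup>2) / 8"
    unfolding ip_ps[OF assms] by (auto simp: complex_mult_cnj cmod_power2 intro!: sum.cong arg_cong[where f="\<lambda>x. x / 8"])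
  finally show ?thesis by (simp add: nsq_ps)
qed

lemma Bessel: "sqi torus f \<Longrightarrow> (\<Sum>k\<in>KB N. (norm (fc f k))\<^sup>2) \<le> 8 * nsq torus f"
  using nsq_diff_ps[of f N] nsq_nonneg[of torus "\<lambda>x. f x - ps N f x"] by simp

lemma ps_add:
  assumes "sqi torus f" "sqi torus g" shows "ps N (\<lambda>x. f x + g x) x = ps N f x + ps N g x"
  using assms by (simp add: ps_def fc_add sqi_integrable[OF finite_measure_torus] distrib_right sum.distrib add_divide_distrib)

lemma ps_diff:
  assumes "sqi torus f" "sqi torus g" shows "ps N (\<lambda>x. f x - g x) x = ps N f x - ps N g x"
  using assms by (simp add: ps_def fc_diff sqi_integrable[OF finite_measure_torus] left_diff_distrib sum_subtractf diff_divide_distrib)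

lemma ps_Re_ek:
  assumes "k \<in> KB N" shows "ps N (\<lambda>x. Re (c * ek k x)) = (\<lambda>x. Re (c * ek k x))"
proof
  fix x
  have "ps N (\<lambda>x. Re (c * ek k x)) x = (\<Sum>l\<in>KB N. Re (4 * ((if l = (\<lambda>i. - k i) then c else 0) + (if l = k then cnj c else 0)) * cnj (ek l x))) / 8"
    unfolding ps_def fc_Re_ek ..
  also have "\<dots> = (\<Sum>l\<in>KB N. (if l = (\<lambda>i. - k i) then 4 * Re (c * cnj (ek l x)) else 0) + (if l = k then 4 * Re (cnj c * cnj (ek l x)) else 0)) / 8"
    by (intro arg_cong[where f="\<lambda>x. x / 8"] sum.cong refl) (auto simp: algebra_simps)
  also have "\<dots> = Re (c * ek k x)"
    using assms by (simp add: sum.distrib sum.delta KB_uminus cnj_ek del: times_complex.sel)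
      (simp del: times_complex.sel flip: cnj_ek complex_cnj_mult)
  finally show "ps N (\<lambda>x. Re (c * ek k x)) x = Re (c * ek k x)" .
qed

text \<open>Since \<open>ps N\<close> is linear and fixes \<open>q\<close>, the error of
  \<open>f\<close> is also the error of \<open>f - q\<close>, and an error never exceeds the
  function itself in norm.\<close>

lemma best_approx:
  assumes "sqi torus f" "sqi torus q" "ps N q = q"
  shows "nsq torus (\<lambda>x. f x - ps N f x) \<le> nsq torus (\<lambda>x. f x - q x)"
proof -
  have "(\<lambda>x. f x - ps N f x) = (\<lambda>x. (f x - q x) - ps N (\<lambda>x. f x - q x) x)"
    using assms by (simp add: ps_diff fun_eq_iff)
  then show ?thesis
    using nsq_diff_ps[OF sqi_diff[OF assms(1,2)], of N] by (simp add: sum_nonneg)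
qed

section \<open>Density of trigonometric polynomials\<close>

inductive tp :: "(real^3 \<Rightarrow> complex) \<Rightarrow> bool" where
  monom: "tp (\<lambda>x. c * ek k x)"
| add: "tp f \<Longrightarrow> tp g \<Longrightarrow> tp (\<lambda>x. f x + g x)"

lemma tp_mult_monom: "tp f \<Longrightarrow> tp (\<lambda>x. f x * (c * ek k x))"
proof (induction rule: tp.induct)
  case (monom d l)
  have "(\<lambda>x. (d * ek l x) * (c * ek k x)) = (\<lambda>x. (d * c) * ek (\<lambda>i. l i + k i) x)"
    by (simp add: fun_eq_iff flip: ek_mult)
  then show ?case by (simp only: tp.monom)
next
  case (add f g)
  show ?case unfolding distrib_right by (rule tp.add[OF add.IH])
qed

lemma tp_mult: "tp g \<Longrightarrow> tp f \<Longrightarrow> tp (\<lambda>x. f x * g x)"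
proof (induction rule: tp.induct)
  case (monom c k)
  then show ?case by (rule tp_mult_monom)
next
  case (add g h)
  then show ?case unfolding distrib_left by (intro tp.add) auto
qed

lemma tp_const: "tp (\<lambda>x. c)"
  using tp.monom[of c "\<lambda>_. 0"] by (simp add: ek_def)

lemma tp_cmult: "tp f \<Longrightarrow> tp (\<lambda>x. c * f x)"
  by (rule tp_mult[OF _ tp_const])

lemma tp_sum: "finite I \<Longrightarrow> (\<And>i. i \<in> I \<Longrightarrow> tp (f i)) \<Longrightarrow> tp (\<lambda>x. \<Sum>i\<in>I. f i x)"
  by (induction I rule: finite_induct) (auto intro: tp.add tp_const)

text \<open>The bridge to \<open>best_approx\<close>: a trigonometric polynomial is reproduced by
  every partial sum over a sufficiently large cube.\<close>

lemma tp_Re: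
  "tp f \<Longrightarrow> sqi torus (\<lambda>x. Re (f x)) \<and> (\<exists>M. \<forall>N\<ge>M. ps N (\<lambda>x. Re (f x)) = (\<lambda>x. Re (f x)))"
proof (induction rule: tp.induct)
  case (monom c k)
  obtain M where "k \<in> KB M" using ex_KB by blast
  then show ?case
    using KB_mono[of M] ps_Re_ek[of k _ c] sqi_Re_ek[of c k] by blast
next
  case (add f g)
  then obtain M M' where "\<And>N. M \<le> N \<Longrightarrow> ps N (\<lambda>x. Re (f x)) = (\<lambda>x. Re (f x))"
    "\<And>N. M' \<le> N \<Longrightarrow> ps N (\<lambda>x. Re (g x)) = (\<lambda>x. Re (g x))" by blast
  then have *: "\<forall>N\<ge>max M M'. ps N (\<lambda>x. Re (f x) + Re (g x)) = (\<lambda>x. Re (f x) + Re (g x))"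
    using add.IH by (simp add: fun_eq_iff ps_add)
  then show ?case
    using add.IH sqi_add[of torus "\<lambda>x. Re (f x)" "\<lambda>x. Re (g x)"] exI[of "\<lambda>M. \<forall>N\<ge>M. ps N (\<lambda>x. Re (f x) + Re (g x)) = (\<lambda>x. Re (f x) + Re (g x))", OF *] by simp
qed

text \<open>Wraps the cell around unit circles and so realises the torus as a compact subset of
  \<open>complex^3\<close>. Polynomials in the real coordinates of that space pull back to
  trigonometric polynomials, which makes Stone-Weierstrass applicable on the image.\<close>

definition tE :: "real^3 \<Rightarrow> complex^3" where
  "tE x = (\<chi> i. cis (pi * x $ i))"

lemma continuous_tE: "continuous_on S tE"
  unfolding tE_def cis_conv_exp by (intro continuous_intros continuous_on_vec_lambda)

lemma tp_cis: "tp (\<lambda>x. cis (pi * x $ i))"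
proof -
  have "(\<Sum>j\<in>UNIV. of_int (if j = i then 1 else 0) * x $ j) = x $ i" for x :: "real^3"
    by (simp add: if_distrib[of of_int] if_distrib[of "\<lambda>t. t * _"] cong: if_cong)
  then have "(\<lambda>x. cis (pi * x $ i)) = (\<lambda>x. 1 * ek (\<lambda>j. if j = i then 1 else 0) x)"
    by (simp add: ek_def)
  then show ?thesis by (simp only: tp.monom)
qed

lemma tp_cis_uminus: "tp (\<lambda>x. cis (- (pi * x $ i)))"
proof -
  have "(\<Sum>j\<in>UNIV. of_int (if j = i then - 1 else 0) * x $ j) = - (x $ i)" for x :: "real^3"
    by (simp add: if_distrib[of of_int] if_distrib[of "\<lambda>t. t * _"] cong: if_cong)
  then have "(\<lambda>x. cis (- (pi * x $ i))) = (\<lambda>x. 1 * ek (\<lambda>j. if j = i then - 1 else 0) x)"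
    by (simp add: ek_def)
  then show ?thesis by (simp only: tp.monom)
qed

lemma tp_inner_tE: "tp (\<lambda>x. complex_of_real (tE x \<bullet> b))"
proof -
  have "complex_of_real (tE x \<bullet> b) = (\<Sum>i\<in>UNIV. (of_real (Re (b $ i)) / 2) * (cis (pi * x $ i) + cis (- (pi * x $ i)))
      + (of_real (Im (b $ i)) / (2 * \<i>)) * (cis (pi * x $ i) + (-1) * cis (- (pi * x $ i))))" for x
    unfolding inner_vec_def of_real_sum
    by (intro sum.cong refl) (simp add: tE_def complex_eq_iff inner_complex_def Re_divide Im_divide)
  moreover have "tp (\<lambda>x. \<Sum>i\<in>UNIV. (of_real (Re (b $ i)) / 2) * (cis (pi * x $ i) + cis (- (pi * x $ i)))
      + (of_real (Im (b $ i)) / (2 * \<i>)) * (cis (pi * x $ i) + (-1) * cis (- (pi * x $ i))))"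
    by (intro tp_sum tp.add tp_cmult tp_cis tp_cis_uminus) simp
  ultimately show ?thesis by simp
qed

lemma tp_polynomial: "real_polynomial_function p \<Longrightarrow> tp (\<lambda>x. complex_of_real (p (tE x)))"
proof (induction rule: real_polynomial_function.induct)
  case (linear p)
  then interpret bounded_linear p .
  have p: "p z = (\<Sum>b\<in>Basis. p b * (z \<bullet> b))" for z
    by (subst euclidean_representation[of z, symmetric]) (simp add: sum scale mult.commute)
  have "(\<lambda>x. complex_of_real (p (tE x))) = (\<lambda>x. \<Sum>b\<in>Basis. of_real (p b) * of_real (tE x \<bullet> b))"
    by (intro ext, subst p) simp
  then show ?case
    by (simp only:) (intro tp_sum tp_cmult tp_inner_tE finite_Basis)
qed (auto intro: tp_const tp.add tp_mult)

text \<open>\<open>tE\<close> glues opposite faces of the cell, so injectivity can be expected only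
  when one of the points is interior. For this reason the continuous functions approximated below
  vanish on the boundary.\<close>

lemma tE_eqD:
  assumes "tE x = tE y" "x \<in> cbox (-1) 1" "y \<in> cbox (-1) 1" "x \<in> box (-1) 1"
  shows "x = y"
proof (rule ccontr)
  assume "x \<noteq> y"
  then obtain i where i: "x $ i \<noteq> y $ i" by (auto simp: vec_eq_iff)
  have "cis (pi * x $ i) = cis (pi * y $ i)"
    using assms(1) by (simp add: tE_def vec_eq_iff)
  then have "sin (pi * x $ i) = sin (pi * y $ i) \<and> cos (pi * x $ i) = cos (pi * y $ i)"
    by (simp add: complex_eq_iff)
  then obtain n :: int where "pi * x $ i = pi * y $ i + 2 * pi * n"
    unfolding sin_cos_eq_iff by (auto simp: mult.assoc)
  then have "pi * (x $ i) = pi * (y $ i + 2 * n)" by (simp add: algebra_simps)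
  then have n: "x $ i = y $ i + 2 * n" by simp
  have "-1 < x $ i" "x $ i < 1" "-1 \<le> y $ i" "y $ i \<le> 1"
    using assms by (auto simp: mem_box_cart)
  then have "\<bar>2 * real_of_int n\<bar> < 2" using n by linarith
  then have "n = 0" by linarith
  then show False using n i by simp
qed

lemma tp_approx_continuous:
  assumes f: "continuous_on (cbox (-1) 1) f" and z: "\<And>x. x \<in> cbox (-1) 1 - box (-1) 1 \<Longrightarrow> f x = (0::real)" and "0 < e"
  shows "\<exists>q. tp (\<lambda>x. complex_of_real (q x)) \<and> (\<forall>x\<in>cbox (-1) 1. \<bar>f x - q x\<bar> < e)"
proof -
  let ?Q = "cbox (-1) 1 :: (real^3) set"
  \<comment> \<open>\<open>h\<close> is \<open>f\<close> regarded as a function on the image of the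
    cell. Distinct points with the same image lie on the boundary, where \<open>f\<close> is zero,
    so the choice does not matter.\<close>
  define h where "h z = f (SOME x. x \<in> ?Q \<and> tE x = z)" for z
  have h: "h (tE x) = f x" if "x \<in> ?Q" for x
  proof -
    define y where "y = (SOME y. y \<in> ?Q \<and> tE y = tE x)"
    have "y \<in> ?Q \<and> tE y = tE x"
      unfolding y_def by (rule someI[of _ x]) (use that in auto)
    then have "f y = f x"
      using tE_eqD[of x y] tE_eqD[of y x] that z[of x] z[of y] by (metis DiffI)
    then show ?thesis by (simp add: h_def y_def)
  qed
  have K: "compact (tE ` ?Q)"
    by (intro compact_continuous_image continuous_tE compact_cbox)
  have "continuous_on (tE ` ?Q) h"
  proof (subst continuous_on_closed_vimage[OF compact_imp_closed[OF K]], intro allI impI)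
    fix B :: "real set" assume "closed B"
    \<comment> \<open>Preimages of closed sets are closed because they are continuous images of
      compact sets.\<close>
    have "h -` B \<inter> tE ` ?Q = tE ` (f -` B \<inter> ?Q)" using h by auto
    moreover have "compact (f -` B \<inter> ?Q)"
      using continuous_on_closed_vimage[OF closed_cbox, of "-1" 1 f] f \<open>closed B\<close>
      by (metis bounded_Int bounded_cbox compact_eq_bounded_closed)
    ultimately show "closed (h -` B \<inter> tE ` ?Q)"
      by (simp add: compact_imp_closed compact_continuous_image continuous_tE)
  qed
  from Stone_Weierstrass_real_polynomial_function[OF K this \<open>0 < e\<close>]
  obtain p where p: "real_polynomial_function p" "\<And>z. z \<in> tE ` ?Q \<Longrightarrow> \<bar>h z - p z\<bar> < e" by blast
  show ?thesis
    using tp_polynomial[OF p(1)] p(2) h by (intro exI[of _ "\<lambda>x. p (tE x)"]) force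
qed

lemma AE_torusI: "negligible N \<Longrightarrow> (\<And>x. x \<in> cbox (-1) 1 \<Longrightarrow> x \<notin> N \<Longrightarrow> P x) \<Longrightarrow> AE x in torus. P x"
  unfolding torus_def
  by (subst AE_restrict_space_iff) (auto intro!: AE_I'[of N] simp: negligible_iff_null_sets)

lemma AE_torus_cbox: "(\<And>x. x \<in> cbox (-1) 1 \<Longrightarrow> P x) \<Longrightarrow> AE x in torus. P x"
  by (rule AE_torusI[of "{}"]) auto

lemma nsq_tendsto_zero:
  assumes "\<And>n. f n \<in> borel_measurable M" "integrable M b" "\<And>n. AE x in M. (f n x)\<^sup>2 \<le> b x"
    "AE x in M. (\<lambda>n. f n x) \<longlonglongrightarrow> 0"
  shows "(\<lambda>n. nsq M (f n)) \<longlonglongrightarrow> 0"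
proof -
  have "(\<lambda>n. \<integral>x. (f n x)\<^sup>2 \<partial>M) \<longlonglongrightarrow> (\<integral>x. 0 \<partial>M)"
  proof (rule integral_dominated_convergence)
    show "AE x in M. (\<lambda>n. (f n x)\<^sup>2) \<longlonglongrightarrow> 0"
      using assms(4) by eventually_elim (auto intro: tendsto_eq_intros)
    show "AE x in M. norm ((f n x)\<^sup>2) \<le> b x" for n using assms(3) by simp
  qed (use assms in auto)
  then show ?thesis by (simp add: nsq_def)
qed

lemma nsq_triangle2:
  assumes "sqi M f" "sqi M g" "sqi M h"
  shows "nsq M (\<lambda>x. f x - h x) \<le> 2 * nsq M (\<lambda>x. f x - g x) + 2 * nsq M (\<lambda>x. g x - h x)"
proof -
  have "nrm M (\<lambda>x. f x - h x) \<le> nrm M (\<lambda>x. f x - g x) + nrm M (\<lambda>x. g x - h x)"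
    using nrm_triangle[OF sqi_diff[OF assms(1,2)] sqi_diff[OF assms(2,3)]] by simp
  then have "(nrm M (\<lambda>x. f x - h x))\<^sup>2 \<le> (nrm M (\<lambda>x. f x - g x) + nrm M (\<lambda>x. g x - h x))\<^sup>2"
    by (rule power_mono) simp
  also have "\<dots> \<le> 2 * (nrm M (\<lambda>x. f x - g x))\<^sup>2 + 2 * (nrm M (\<lambda>x. g x - h x))\<^sup>2"
    using sum_squares_bound[of "nrm M (\<lambda>x. f x - g x)" "nrm M (\<lambda>x. g x - h x)"] by (simp add: power2_sum)
  finally show ?thesis by simp
qed

text \<open>Approximation by functions that \<open>ps\<close> eventually fixes, rather than by
  trigonometric polynomials: this is the form that \<open>best_approx\<close> consumes.\<close>

definition tapprox :: "(real^3 \<Rightarrow> real) \<Rightarrow> bool" where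
  "tapprox f \<longleftrightarrow> sqi torus f \<and> (\<forall>e>0. \<exists>q M. sqi torus q \<and> (\<forall>N\<ge>M. ps N q = q) \<and> nsq torus (\<lambda>x. f x - q x) < e)"

lemma tapprox_limit:
  assumes "sqi torus f" "\<And>n. tapprox (g n)" "(\<lambda>n. nsq torus (\<lambda>x. f x - g n x)) \<longlonglongrightarrow> 0"
  shows "tapprox f"
  unfolding tapprox_def
proof (intro conjI allI impI)
  fix e :: real assume "0 < e"
  then have "\<forall>\<^sub>F n in sequentially. nsq torus (\<lambda>x. f x - g n x) < e / 4"
    using assms(3) by (intro order_tendstoD(2)[of _ 0]) auto
  then obtain n where n: "nsq torus (\<lambda>x. f x - g n x) < e / 4"
    by (auto simp: eventually_sequentially)
  obtain q M where q: "sqi torus q" "\<forall>N\<ge>M. ps N q = q" "nsq torus (\<lambda>x. g n x - q x) < e / 4"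
    using assms(2)[of n] \<open>0 < e\<close> unfolding tapprox_def by (metis zero_less_divide_iff zero_less_numeral)
  have "nsq torus (\<lambda>x. f x - q x) < e"
    using nsq_triangle2[OF assms(1) _ q(1), of "g n"] assms(2)[of n] n q(3) by (auto simp: tapprox_def)
  then show "\<exists>q M. sqi torus q \<and> (\<forall>N\<ge>M. ps N q = q) \<and> nsq torus (\<lambda>x. f x - q x) < e"
    using q by blast
qed (fact assms(1))

lemma measure_torus: "measure torus (space torus) = 8"
proof -
  have "(\<integral>x. (1::complex) \<partial>torus) = 8"
    using integral_ek[of "\<lambda>_. 0"] by (simp add: ek_def[abs_def])
  then show ?thesis
    by (simp add: scaleR_conv_of_real) (metis of_real_eq_iff of_real_numeral)
qed

lemma tapprox_tp: "tp (\<lambda>x. complex_of_real (q x)) \<Longrightarrow> tapprox q"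
  using tp_Re[of "\<lambda>x. complex_of_real (q x)"] unfolding tapprox_def
  by (auto simp: nsq_def intro!: exI[of _ q])

lemma clamp_le: "0 \<le> B \<Longrightarrow> \<bar>max (-B) (min B y)\<bar> \<le> (B::real)" by linarith

text \<open>Convergence almost everywhere under a uniform bound permits dominated convergence
  against a function that is merely integrable, which convergence in the square norm would not;
  \<open>fc_zero_imp_AE_zero\<close> depends on this.\<close>

lemma trig_approx_bounded:
  assumes f: "f \<in> borel_measurable torus" and B: "\<And>x. \<bar>f x\<bar> \<le> B"
  shows "\<exists>q. (\<forall>n. tp (\<lambda>x. complex_of_real (q n x))) \<and> (\<forall>n. \<forall>x\<in>cbox (-1) 1. \<bar>q n x\<bar> \<le> B + 1)
    \<and> (AE x in torus. (\<lambda>n. q n x) \<longlonglongrightarrow> f x)"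
proof -
  let ?U = "box (-1) 1 :: (real^3) set"
  have B0: "0 \<le> B" using B[of 0] by linarith
  have "f measurable_on cbox (-1) 1"
    using f by (simp add: torus_def measurable_on_iff_borel_measurable)
  then obtain N g where N: "negligible N" and g: "\<And>n. continuous_on UNIV (g n)"
    "\<And>x. x \<notin> N \<Longrightarrow> (\<lambda>n. g n x) \<longlonglongrightarrow> (if x \<in> cbox (-1) 1 then f x else 0)"
    unfolding measurable_on_def by blast
  \<comment> \<open>A cutoff that vanishes on the boundary of the cell and equals 1 at each interior
    point for large \<open>n\<close>. The clamping in \<open>h\<close> preserves the bound
    \<open>B\<close>.\<close>
  define c where "c n x = min 1 (real n * infdist x (- ?U))" for n and x :: "real^3"
  define h where "h n x = c n x * max (-B) (min B (g n x))" for n x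
  have ne: "- ?U \<noteq> {}" proof -
    have "1 \<in> - ?U" by (simp add: mem_box_cart)
    then show ?thesis by blast
  qed
  have cont: "continuous_on UNIV (h n)" for n
    unfolding h_def c_def by (intro continuous_intros g(1))
  have bd: "\<bar>h n x\<bar> \<le> B" for n x
  proof -
    have "\<bar>c n x\<bar> \<le> 1"
      using mult_nonneg_nonneg[OF of_nat_0_le_iff[of n] infdist_nonneg[of x "- ?U"]] unfolding c_def by linarith
    from mult_mono[OF this clamp_le[OF B0, of "g n x"]] show ?thesis by (simp add: h_def abs_mult)
  qed
  \<comment> \<open>The errors are at most 1, which accounts for the bound
    \<open>B + 1\<close>.\<close>
  have "\<forall>n. \<exists>q. tp (\<lambda>x. complex_of_real (q x)) \<and> (\<forall>x\<in>cbox (-1) 1. \<bar>h n x - q x\<bar> < inverse (real (Suc n)))"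
    by (intro allI tp_approx_continuous continuous_on_subset[OF cont]) (auto simp: h_def c_def)
  then obtain q where q: "\<And>n. tp (\<lambda>x. complex_of_real (q n x))"
    "\<And>n x. x \<in> cbox (-1) 1 \<Longrightarrow> \<bar>h n x - q n x\<bar> < inverse (real (Suc n))"
    by metis
  have lim: "(\<lambda>n. q n x) \<longlonglongrightarrow> f x" if "x \<in> ?U" "x \<notin> N" for x
  proof -
    have "infdist x (- ?U) \<noteq> 0"
      using that(1) in_closed_iff_infdist_zero[OF _ ne, of x] by (simp add: open_box closed_Compl)
    then have pos: "0 < infdist x (- ?U)" using infdist_nonneg[of x "- ?U"] by linarith
    then obtain n0 where n0: "1 < real n0 * infdist x (- ?U)" using reals_Archimedean3 by blast
    have "c n x = 1" if "n0 \<le> n" for n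
    proof -
      have "real n0 * infdist x (- ?U) \<le> real n * infdist x (- ?U)"
        using that pos by (intro mult_right_mono) auto
      then show ?thesis using n0 unfolding c_def by linarith
    qed
    then have "\<forall>\<^sub>F n in sequentially. 1 = c n x"
      unfolding eventually_sequentially by (intro exI[of _ n0]) simp
    then have c1: "(\<lambda>n. c n x) \<longlonglongrightarrow> 1"
      by (rule Lim_transform_eventually[OF tendsto_const])
    have "x \<in> cbox (-1) 1" using that(1) box_subset_cbox by blast
    then have "(\<lambda>n. g n x) \<longlonglongrightarrow> f x" using g(2)[OF that(2)] by simp
    then have "(\<lambda>n. h n x) \<longlonglongrightarrow> 1 * max (-B) (min B (f x))"
      unfolding h_def by (intro tendsto_intros c1)
    also have "1 * max (-B) (min B (f x)) = f x" using B[of x] by auto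
    finally have h: "(\<lambda>n. h n x) \<longlonglongrightarrow> f x" .
    have "(\<lambda>n. h n x - q n x) \<longlonglongrightarrow> 0"
    proof (rule Lim_null_comparison[OF _ LIMSEQ_inverse_real_of_nat], rule always_eventually, rule allI)
      show "norm (h n x - q n x) \<le> inverse (real (Suc n))" for n
        using q(2)[OF \<open>x \<in> cbox (-1) 1\<close>, of n] unfolding real_norm_def by (rule less_imp_le)
    qed
    from tendsto_diff[OF h this] show ?thesis by simp
  qed
  have "negligible (N \<union> (cbox (-1) 1 - ?U))"
    using N by (intro negligible_Un) (simp_all add: negligible_frontier_interval)
  then have "AE x in torus. (\<lambda>n. q n x) \<longlonglongrightarrow> f x"
    by (rule AE_torusI) (use lim in auto)
  moreover have "\<bar>q n x\<bar> \<le> B + 1" if "x \<in> cbox (-1) 1" for n x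
  proof -
    have "inverse (real (Suc n)) \<le> 1" by (simp add: field_simps)
    then show ?thesis using q(2)[OF that, of n] bd[of n x] by linarith
  qed
  ultimately show ?thesis using q(1) by blast
qed

lemma tapprox_bounded:
  assumes f: "f \<in> borel_measurable torus" and B: "\<And>x. \<bar>f x\<bar> \<le> B"
  shows "tapprox f"
proof -
  obtain q where q: "\<And>n. tp (\<lambda>x. complex_of_real (q n x))" "\<And>n x. x \<in> cbox (-1) 1 \<Longrightarrow> \<bar>q n x\<bar> \<le> B + 1"
    "AE x in torus. (\<lambda>n. q n x) \<longlonglongrightarrow> f x"
    using trig_approx_bounded[OF assms] by blast
  have sf: "sqi torus f"
    by (rule sqi_bounded[OF finite_measure_torus f]) (use B in auto)
  have tap: "tapprox (q n)" for n by (rule tapprox_tp[OF q(1)])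
  have "(\<lambda>n. nsq torus (\<lambda>x. f x - q n x)) \<longlonglongrightarrow> 0"
  proof (rule nsq_tendsto_zero)
    show "(\<lambda>x. f x - q n x) \<in> borel_measurable torus" for n
      using f tap[of n] by (auto simp: tapprox_def sqi_def)
    show "AE x in torus. (f x - q n x)\<^sup>2 \<le> (2 * B + 1)\<^sup>2" for n
    proof (rule AE_torus_cbox)
      fix x :: "real^3" assume "x \<in> cbox (-1) 1"
      then have "\<bar>f x - q n x\<bar> \<le> \<bar>2 * B + 1\<bar>" using B[of x] q(2)[of x n] by linarith
      then show "(f x - q n x)\<^sup>2 \<le> (2 * B + 1)\<^sup>2" unfolding abs_le_square_iff .
    qed
    show "AE x in torus. (\<lambda>n. f x - q n x) \<longlonglongrightarrow> 0"
      using q(3) by eventually_elim (auto intro: tendsto_eq_intros)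
  qed auto
  from tapprox_limit[OF sf tap this] show ?thesis .
qed

lemma tapprox_sqi:
  assumes f: "sqi torus f"
  shows "tapprox f"
proof -
  define g where "g n x = max (- real n) (min (real n) (f x))" for n x
  have tap: "tapprox (g n)" for n
    by (rule tapprox_bounded[of _ "real n"]) (use f clamp_le in \<open>auto simp: g_def[abs_def] sqi_def\<close>)
  have le: "\<bar>f x - g n x\<bar> \<le> \<bar>f x\<bar>" for n x unfolding g_def by linarith
  have "(\<lambda>n. nsq torus (\<lambda>x. f x - g n x)) \<longlonglongrightarrow> 0"
  proof (rule nsq_tendsto_zero)
    show "(\<lambda>x. f x - g n x) \<in> borel_measurable torus" for n
      using f by (auto simp: g_def sqi_def)
    show "integrable torus (\<lambda>x. (f x)\<^sup>2)" using f by (simp add: sqi_def)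
    show "AE x in torus. (f x - g n x)\<^sup>2 \<le> (f x)\<^sup>2" for n
      using le[of _ n] unfolding abs_le_square_iff by simp
    have "(\<lambda>n. f x - g n x) \<longlonglongrightarrow> 0" for x
    proof (rule tendsto_eventually)
      obtain n0 :: nat where "\<bar>f x\<bar> \<le> real n0" using real_arch_simple by blast
      then have "f x - g n x = 0" if "n0 \<le> n" for n
        using that unfolding g_def by (simp add: min_def max_def) linarith
      then show "\<forall>\<^sub>F n in sequentially. f x - g n x = 0"
        unfolding eventually_sequentially by blast
    qed
    then show "AE x in torus. (\<lambda>n. f x - g n x) \<longlonglongrightarrow> 0" by simp
  qed
  from tapprox_limit[OF f tap this] show ?thesis .
qed

text \<open>Once the cube is so large that \<open>ps N\<close> fixes a good approximation
  \<open>q\<close>, the partial sum of \<open>f\<close> is at least as close to \<open>f\<close> as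
  \<open>q\<close> is.\<close>

theorem ps_tendsto:
  assumes f: "sqi torus f"
  shows "(\<lambda>N. nsq torus (\<lambda>x. f x - ps N f x)) \<longlonglongrightarrow> 0"
proof (rule LIMSEQ_I)
  fix e :: real assume "0 < e"
  then obtain q M where q: "sqi torus q" "\<forall>N\<ge>M. ps N q = q" "nsq torus (\<lambda>x. f x - q x) < e"
    using tapprox_sqi[OF f] by (auto simp: tapprox_def)
  show "\<exists>M. \<forall>N\<ge>M. norm (nsq torus (\<lambda>x. f x - ps N f x) - 0) < e"
  proof (intro exI[of _ M] allI impI)
    fix N assume "M \<le> N"
    then show "norm (nsq torus (\<lambda>x. f x - ps N f x) - 0) < e"
      using best_approx[OF f q(1), of N] q(2,3) by auto
  qed
qed

lemma Parseval_ip: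
  assumes "sqi torus f" "sqi torus g"
  shows "(\<lambda>N. (\<Sum>k\<in>KB N. Re (fc f k * cnj (fc g k))) / 8) \<longlonglongrightarrow> ip torus f g"
proof -
  have "(\<lambda>N. nsq torus (\<lambda>x. ps N f x - f x)) \<longlonglongrightarrow> 0"
    using ps_tendsto[OF assms(1)] by (simp add: nsq_def power2_commute)
  from tendsto_nrm_zero_ip[OF sqi_ps assms(1,2) this] show ?thesis
    by (simp add: ip_commute[of _ "ps _ f"] ip_ps[OF assms(2)])
qed

lemma Parseval: "sqi torus f \<Longrightarrow> (\<lambda>N. (\<Sum>k\<in>KB N. (norm (fc f k))\<^sup>2)) \<longlonglongrightarrow> 8 * nsq torus f"
  using tendsto_mult_left[OF Parseval_ip[of f f], of 8]
  by (simp add: ip_self complex_mult_cnj cmod_power2 cong: sum.cong)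

lemma nsq_le_Parseval:
  assumes "sqi torus f" "\<And>N. (\<Sum>k\<in>KB N. (norm (fc f k))\<^sup>2) \<le> C"
  shows "8 * nsq torus f \<le> C"
  by (rule LIMSEQ_le_const2[OF Parseval[OF assms(1)]]) (use assms(2) in auto)

lemma fc_zero_imp_AE_zero:
  assumes h: "integrable torus h" and z: "\<And>k. fc h k = 0"
  shows "AE x in torus. h x = 0"
proof -
  have tp0: "tp f \<Longrightarrow> (\<integral>x. h x * Re (f x) \<partial>torus) = 0 \<and> integrable torus (\<lambda>x. h x * Re (f x))" for f
  proof (induction rule: tp.induct)
    case (monom c k)
    have "integrable torus (\<lambda>x. Re (c * (complex_of_real (h x) * ek k x)))"
      by (intro integrable_Re integrable_mult_right integrable_ek_mult h)
    then have "integrable torus (\<lambda>x. h x * Re (c * ek k x))"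
      by (simp add: algebra_simps)
    then show ?case using Re_mult_fc[OF h, of c k] z[of k] by simp
  next
    case (add f g)
    then show ?case by (simp add: distrib_left)
  qed
  have "(\<lambda>x. sgn (h x)) \<in> borel_measurable torus" using h by measurable
  moreover have "\<bar>sgn (h x)\<bar> \<le> 1" for x by (simp add: sgn_real_def)
  ultimately obtain q where q: "\<And>n. tp (\<lambda>x. complex_of_real (q n x))" "\<And>n x. x \<in> cbox (-1) 1 \<Longrightarrow> \<bar>q n x\<bar> \<le> 1 + 1"
    "AE x in torus. (\<lambda>n. q n x) \<longlonglongrightarrow> sgn (h x)"
    using trig_approx_bounded[of "\<lambda>x. sgn (h x)" 1] by blast
  have "(\<lambda>n. \<integral>x. h x * q n x \<partial>torus) \<longlonglongrightarrow> (\<integral>x. h x * sgn (h x) \<partial>torus)"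
  proof (rule integral_dominated_convergence)
    show "integrable torus (\<lambda>x. 2 * \<bar>h x\<bar>)" using h by simp
    show "(\<lambda>x. h x * q n x) \<in> borel_measurable torus" for n
      using tp0[OF q(1)[of n]] by auto
    show "AE x in torus. (\<lambda>n. h x * q n x) \<longlonglongrightarrow> h x * sgn (h x)"
      using q(3) by eventually_elim (intro tendsto_intros)
    show "AE x in torus. norm (h x * q n x) \<le> 2 * \<bar>h x\<bar>" for n
    proof (rule AE_torus_cbox)
      fix x :: "real^3" assume "x \<in> cbox (-1) 1"
      from mult_left_mono[OF q(2)[OF this, of n], of "\<bar>h x\<bar>"]
      show "norm (h x * q n x) \<le> 2 * \<bar>h x\<bar>" by (simp add: abs_mult)
    qed
  qed (use h in measurable)
  moreover have "(\<integral>x. h x * q n x \<partial>torus) = 0" for n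
    using tp0[OF q(1)[of n]] by simp
  ultimately have "(\<integral>x. h x * sgn (h x) \<partial>torus) = 0"
    by (simp add: LIMSEQ_const_iff)
  then have "(\<integral>x. \<bar>h x\<bar> \<partial>torus) = 0" by (simp add: abs_sgn)
  then show ?thesis
    using h by (subst (asm) integral_nonneg_eq_0_iff_AE) auto
qed

section \<open>Weak derivatives on the Fourier side\<close>

declare times_complex.sel [simp del]

lemma complex_eqI_Re:
  assumes "\<And>c. Re (c * a) = Re (c * b)" shows "a = b"
  using assms[of 1] assms[of "- \<i>"] by (simp add: complex_eq_iff times_complex.sel)

text \<open>Smoothness is obtained from a class \<open>C\<close> closed under derivatives: here
  characters with an arbitrary complex factor, later their products with time profiles.\<close>

lemma smooth_coinduct:
  assumes "f \<in> C" "\<And>f x. f \<in> C \<Longrightarrow> f differentiable (at x)"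
    "\<And>f b. f \<in> C \<Longrightarrow> b \<in> Basis \<Longrightarrow> pderiv_dir b f \<in> C"
  shows "smooth f"
proof -
  have "set bs \<subseteq> Basis \<Longrightarrow> foldr pderiv_dir bs f \<in> C" for bs
    by (induction bs) (auto intro: assms)
  then show ?thesis by (auto simp: smooth_def intro: assms)
qed

text \<open>The eigenvalue of the derivative in direction \<open>i\<close> on \<open>ek k\<close>.
  It is purely imaginary, which makes differentiation skew-adjoint.\<close>

definition mu :: "(3 \<Rightarrow> int) \<Rightarrow> 3 \<Rightarrow> complex" where
  "mu k i = \<i> * of_real pi * of_int (k i)"

lemma Re_ek_has_derivative:
  "((\<lambda>x. Re (c * ek k x)) has_derivative (\<lambda>h. Re (c * (\<i> * of_real pi * (\<Sum>i\<in>UNIV. of_int (k i) * of_real (h $ i))) * ek k x))) (at x within S)"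
proof -
  define g where "g x = \<i> * of_real pi * (\<Sum>i\<in>UNIV. of_int (k i) * complex_of_real (x $ i))" for x :: "real^3"
  have "linear g"
    by (rule linearI) (simp_all add: g_def algebra_simps sum.distrib sum_distrib_left scaleR_conv_of_real[where 'a=complex])
  then have "(g has_derivative g) (at x within S)"
    by (intro bounded_linear_imp_has_derivative) (simp add: linear_conv_bounded_linear)
  from has_derivative_compose[OF this DERIV_exp[unfolded has_field_derivative_def]]
  have "((\<lambda>x. exp (g x)) has_derivative (\<lambda>h. exp (g x) * g h)) (at x within S)" .
  then have "((\<lambda>x. Re (c * exp (g x))) has_derivative (\<lambda>h. Re (c * (exp (g x) * g h)))) (at x within S)"
    by (intro bounded_linear.has_derivative[OF bounded_linear_Re] has_derivative_mult_right)
  moreover have "exp (g x) = ek k x" for x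
    by (simp add: g_def ek_def cis_conv_exp mult.assoc)
  ultimately show ?thesis by (simp add: g_def ac_simps)
qed

lemma pderiv_Re_ek: "pderiv_dir (axis i 1) (\<lambda>x. Re (c * ek k x)) = (\<lambda>x. Re ((c * mu k i) * ek k x))"
proof
  fix x
  have "(\<Sum>j\<in>UNIV. of_int (k j) * complex_of_real ((axis i 1 :: real^3) $ j)) = of_int (k i)"
    by (simp add: axis_def if_distrib[of of_real] if_distrib[of "\<lambda>t. _ * t"] cong: if_cong)
  then show "pderiv_dir (axis i 1) (\<lambda>x. Re (c * ek k x)) x = Re ((c * mu k i) * ek k x)"
    unfolding pderiv_dir_def frechet_derivative_at[OF Re_ek_has_derivative, symmetric]
    by (simp add: mu_def mult.assoc)
qed

lemma smooth_Re_ek: "smooth (\<lambda>x. Re (c * ek k x))"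
proof (rule smooth_coinduct[where C="range (\<lambda>c x. Re (c * ek k x))"])
  show "f differentiable (at x)" if "f \<in> range (\<lambda>c x. Re (c * ek k x))" for f x
    using that by (auto intro: differentiableI[OF Re_ek_has_derivative])
  show "pderiv_dir b f \<in> range (\<lambda>c x. Re (c * ek k x))"
    if "f \<in> range (\<lambda>c x. Re (c * ek k x))" "b \<in> Basis" for f b
    using that by (auto simp: Basis_vec3 pderiv_Re_ek)
qed auto

lemma periodic2_ek: "ek k (x + 2 *\<^sub>R axis i 1) = ek k x"
proof -
  have "(\<Sum>j\<in>UNIV. of_int (k j) * (x + 2 *\<^sub>R axis i 1) $ j) = (\<Sum>j\<in>UNIV. of_int (k j) * x $ j + (if j = i then 2 * of_int (k i) else 0))"
    by (intro sum.cong refl) (simp add: axis_def distrib_left)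
  also have "\<dots> = (\<Sum>j\<in>UNIV. of_int (k j) * x $ j) + 2 * of_int (k i)"
    by (simp add: sum.distrib)
  finally have "ek k (x + 2 *\<^sub>R axis i 1) = ek k x * cis (2 * pi * of_int (k i))"
    by (simp add: ek_def cis_mult algebra_simps)
  also have "cis (2 * pi * of_int (k i)) = 1"
    by (simp add: complex_eq_iff cos_int_2pin sin_int_2pin)
  finally show ?thesis by simp
qed

lemma pderiv_pow_Re_ek:
  "(pderiv_dir (axis i 1) ^^ n) (\<lambda>x. Re (c * ek k x)) = (\<lambda>x. Re ((c * mu k i ^ n) * ek k x))"
proof (induction n arbitrary: c)
  case (Suc n)
  show ?case
    by (simp only: funpow_Suc_right o_apply pderiv_Re_ek Suc.IH) (simp add: mult.assoc)
qed simp

lemma mpderiv_Re_ek: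
  "mpderiv \<alpha> (\<lambda>x. Re (c * ek k x)) = (\<lambda>x. Re ((c * (\<Prod>i\<in>UNIV. mu k i ^ \<alpha> i)) * ek k x))"
  unfolding mpderiv_def pderiv_pow_Re_ek prod_UNIV_3 by (simp add: ac_simps)

text \<open>The characters are admissible test functions, and differentiating them multiplies by
  \<open>mu\<close>. The sign in the definition of the weak derivative is absorbed into
  \<open>- mu k i\<close>.\<close>

lemma fc_weak_deriv:
  assumes "has_weak_deriv \<alpha> f g"
  shows "fc g k = (\<Prod>i\<in>UNIV. (- mu k i) ^ \<alpha> i) * fc f k"
proof (rule complex_eqI_Re)
  fix c :: complex
  let ?m = "\<Prod>i\<in>UNIV. mu k i ^ \<alpha> i" and ?s = "(-1) ^ (\<Sum>i\<in>UNIV. \<alpha> i) :: real"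
  have int: "integrable torus f" "integrable torus g"
    using assms by (auto simp: has_weak_deriv_def)
  have "smooth (\<lambda>x. Re (c * ek k x))" "periodic2 (\<lambda>x. Re (c * ek k x))"
    using smooth_Re_ek by (auto simp: periodic2_def periodic2_ek)
  moreover have "\<And>\<phi>. smooth \<phi> \<and> periodic2 \<phi> \<Longrightarrow> (\<integral>x. f x * mpderiv \<alpha> \<phi> x \<partial>torus) = ?s * (\<integral>x. g x * \<phi> x \<partial>torus)"
    using assms by (simp add: has_weak_deriv_def)
  ultimately have "(\<integral>x. f x * mpderiv \<alpha> (\<lambda>x. Re (c * ek k x)) x \<partial>torus) = ?s * (\<integral>x. g x * Re (c * ek k x) \<partial>torus)"
    by blast
  then have "(\<integral>x. f x * Re ((c * ?m) * ek k x) \<partial>torus) = ?s * (\<integral>x. g x * Re (c * ek k x) \<partial>torus)"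
    unfolding mpderiv_Re_ek .
  then have "Re ((c * ?m) * fc f k) = ?s * Re (c * fc g k)"
    unfolding Re_mult_fc[OF int(1)] Re_mult_fc[OF int(2)] .
  then have "Re (c * fc g k) = ?s * Re ((c * ?m) * fc f k)"
  proof -
    have "?s * ?s = 1" by (simp flip: power_mult_distrib)
    then show ?thesis using \<open>Re ((c * ?m) * fc f k) = ?s * Re (c * fc g k)\<close> by (simp flip: mult.assoc)
  qed
  also have "\<dots> = Re (c * (of_real ?s * ?m * fc f k))"
  proof -
    have "c * (of_real ?s * ?m * fc f k) = ?s *\<^sub>R ((c * ?m) * fc f k)"
      by (simp add: scaleR_conv_of_real ac_simps)
    then show ?thesis by (simp only: scaleR_complex.sel)
  qed
  also have "of_real ?s * ?m = (\<Prod>i\<in>UNIV. (- mu k i) ^ \<alpha> i)"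
    by (simp add: power_minus[of "mu k _"] prod.distrib power_sum)
  finally show "Re (c * fc g k) = Re (c * ((\<Prod>i\<in>UNIV. (- mu k i) ^ \<alpha> i) * fc f k))" .
qed

text \<open>\<open>g\<close> is the derivative of \<open>f\<close> in direction \<open>i\<close>; the sign comes from the convention
  \<open>ek k x = exp (+ i \<pi> k \<cdot> x)\<close> in \<open>fc\<close>.\<close>

definition fd :: "3 \<Rightarrow> (real^3 \<Rightarrow> real) \<Rightarrow> (real^3 \<Rightarrow> real) \<Rightarrow> bool" where
  "fd i f g \<longleftrightarrow> (\<forall>k. fc g k = - mu k i * fc f k)"

abbreviation "L2 \<equiv> sqi torus"

lemmas L2_integrable = sqi_integrable[OF finite_measure_torus]

lemma fd_diff:
  "fd i f f' \<Longrightarrow> fd i g g' \<Longrightarrow> L2 f \<Longrightarrow> L2 f' \<Longrightarrow> L2 g \<Longrightarrow> L2 g' \<Longrightarrow> fd i (\<lambda>x. f x - g x) (\<lambda>x. f' x - g' x)"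
  by (simp add: fd_def fc_diff L2_integrable algebra_simps)

lemma fd_sum:
  "(\<And>j. j \<in> I \<Longrightarrow> fd i (f j) (g j) \<and> L2 (f j) \<and> L2 (g j)) \<Longrightarrow> fd i (\<lambda>x. \<Sum>j\<in>I. f j x) (\<lambda>x. \<Sum>j\<in>I. g j x)"
  by (auto simp: fd_def fc_sum L2_integrable sum_distrib_left intro!: sum.cong)

lemma Re_mult_imag: "Re (- (\<i> * of_real r) * a * cnj b) = - Re (a * cnj (- (\<i> * of_real r) * b))"
  by (simp add: algebra_simps)

lemma mu_eq: "mu k i = \<i> * of_real (pi * of_int (k i))"
  by (simp add: mu_def)

text \<open>By Parseval's identity this is the skew-adjointness of the imaginary multiplier,
  \<open>Re_mult_imag\<close>, in each single mode.\<close>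

lemma fd_ibp:
  assumes "fd i f f'" "fd i g g'" "L2 f" "L2 f'" "L2 g" "L2 g'"
  shows "ip torus f' g = - ip torus f g'"
proof (rule LIMSEQ_unique)
  show "(\<lambda>N. (\<Sum>k\<in>KB N. Re (fc f' k * cnj (fc g k))) / 8) \<longlonglongrightarrow> ip torus f' g"
    by (intro Parseval_ip assms)
  have "Re (fc f' k * cnj (fc g k)) = - Re (fc f k * cnj (fc g' k))" for k
    using assms(1,2) unfolding fd_def mu_eq by (simp only: Re_mult_imag)
  then show "(\<lambda>N. (\<Sum>k\<in>KB N. Re (fc f' k * cnj (fc g k))) / 8) \<longlonglongrightarrow> - ip torus f g'"
    using tendsto_minus[OF Parseval_ip[OF assms(3,6)]] by (simp only: sum_negf minus_divide_left)
qed

lemma fc_mult_Re_ek: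
  assumes "integrable torus g"
  shows "fc (\<lambda>x. g x * Re (c * ek l x)) k = (c * fc g (\<lambda>i. k i + l i) + cnj c * fc g (\<lambda>i. k i - l i)) / 2"
proof -
  have "fc (\<lambda>x. g x * Re (c * ek l x)) k =
    (\<integral>x. (c / 2) * (of_real (g x) * ek (\<lambda>i. k i + l i) x) + (cnj c / 2) * (of_real (g x) * ek (\<lambda>i. k i - l i) x) \<partial>torus)"
    unfolding fc_def
  proof (rule Bochner_Integration.integral_cong[OF refl])
    fix x
    have re: "complex_of_real (Re z) = (z + cnj z) / 2" for z by (simp add: complex_eq_iff)
    have "complex_of_real (g x * Re (c * ek l x)) * ek k x =
      (c / 2) * (of_real (g x) * (ek k x * ek l x)) + (cnj c / 2) * (of_real (g x) * (ek k x * cnj (ek l x)))"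
      unfolding of_real_mult re by (simp add: field_simps)
    then show "complex_of_real (g x * Re (c * ek l x)) * ek k x =
      (c / 2) * (of_real (g x) * ek (\<lambda>i. k i + l i) x) + (cnj c / 2) * (of_real (g x) * ek (\<lambda>i. k i - l i) x)"
      unfolding cnj_ek ek_mult by simp
  qed
  also have "\<dots> = (c / 2) * fc g (\<lambda>i. k i + l i) + (cnj c / 2) * fc g (\<lambda>i. k i - l i)"
    using integrable_ek_mult[OF assms] by (simp add: fc_def)
  finally show ?thesis by (simp add: field_simps)
qed

lemma L2_mult_Re_ek: "L2 g \<Longrightarrow> L2 (\<lambda>x. g x * Re (c * ek l x))"
  using sqi_bounded_mult(1)[of torus g "\<lambda>x. Re (c * ek l x)" "norm c"] abs_Re_le_cmod[of "c * ek l _"]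
  by (simp add: norm_mult mult.commute[of "g _"])

text \<open>Multiplication by a character shifts frequencies by \<open>l\<close>, and
  \<open>mu\<close> is additive in the frequency. The general product rule reduces to this case by
  duality.\<close>

lemma fd_mult_Re_ek:
  assumes "fd i g g'" "L2 g" "L2 g'"
  shows "fd i (\<lambda>x. g x * Re (c * ek l x)) (\<lambda>x. g' x * Re (c * ek l x) + g x * Re ((c * mu l i) * ek l x))"
  unfolding fd_def
proof
  fix k
  have m: "mu (\<lambda>i. k i + l i) i = mu k i + mu l i" "mu (\<lambda>i. k i - l i) i = mu k i - mu l i" "cnj (mu l i) = - mu l i"
    by (auto simp: mu_def algebra_simps)
  have "fc (\<lambda>x. g' x * Re (c * ek l x) + g x * Re ((c * mu l i) * ek l x)) k =
     fc (\<lambda>x. g' x * Re (c * ek l x)) k + fc (\<lambda>x. g x * Re ((c * mu l i) * ek l x)) k"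
    by (intro fc_add L2_integrable L2_mult_Re_ek assms)
  also have "\<dots> = - mu k i * fc (\<lambda>x. g x * Re (c * ek l x)) k"
    using assms(1) unfolding fd_def fc_mult_Re_ek[OF L2_integrable[OF assms(2)]] fc_mult_Re_ek[OF L2_integrable[OF assms(3)]]
    by (simp add: m) (simp add: field_simps)
  finally show "fc (\<lambda>x. g' x * Re (c * ek l x) + g x * Re ((c * mu l i) * ek l x)) k = - mu k i * fc (\<lambda>x. g x * Re (c * ek l x)) k" .
qed

text \<open>Products of square-integrable functions are only integrable, so the coefficients are
  compared by testing with characters: the test function is attached to \<open>g\<close>, and the
  derivative is moved off \<open>f\<close> by \<open>fd_ibp\<close>.\<close>

lemma fd_mult:
  assumes "fd i f f'" "fd i g g'" "L2 f" "L2 f'" "L2 g" "L2 g'"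
  shows "fd i (\<lambda>x. f x * g x) (\<lambda>x. f' x * g x + f x * g' x)"
  unfolding fd_def
proof (intro allI complex_eqI_Re)
  fix k c
  let ?p = "\<lambda>x. Re (c * ek k x)" and ?q = "\<lambda>x. Re ((c * mu k i) * ek k x)"
  have i1: "integrable torus (\<lambda>x. f' x * g x)" "integrable torus (\<lambda>x. f x * g' x)" "integrable torus (\<lambda>x. f x * g x)"
    using assms by (auto intro: sqi_mult_integrable)
  have s: "L2 (\<lambda>x. g x * ?p x)" "L2 (\<lambda>x. g' x * ?p x)" "L2 (\<lambda>x. g x * ?q x)"
    using assms by (auto intro: L2_mult_Re_ek)
  have i2: "integrable torus (\<lambda>x. f' x * (g x * ?p x))" "integrable torus (\<lambda>x. f x * (g' x * ?p x))" "integrable torus (\<lambda>x. f x * (g x * ?q x))"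
    using assms s by (auto intro: sqi_mult_integrable)
  have "Re (c * fc (\<lambda>x. f' x * g x + f x * g' x) k) = (\<integral>x. (f' x * g x + f x * g' x) * ?p x \<partial>torus)"
    by (rule Re_mult_fc) (use i1 in simp)
  also have "\<dots> = (\<integral>x. f' x * (g x * ?p x) + f x * (g' x * ?p x) \<partial>torus)"
    by (intro Bochner_Integration.integral_cong refl) (simp add: algebra_simps)
  also have "\<dots> = ip torus f' (\<lambda>x. g x * ?p x) + ip torus f (\<lambda>x. g' x * ?p x)"
    unfolding ip_def by (rule Bochner_Integration.integral_add) (use i2 in auto)
  also have "ip torus f' (\<lambda>x. g x * ?p x) = - ip torus f (\<lambda>x. g' x * ?p x + g x * ?q x)"
    using assms s by (intro fd_ibp[of i] fd_mult_Re_ek sqi_add)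
  also have "ip torus f (\<lambda>x. g' x * ?p x + g x * ?q x) = ip torus f (\<lambda>x. g' x * ?p x) + ip torus f (\<lambda>x. g x * ?q x)"
    using i2 unfolding ip_def distrib_left by simp
  also have "- (ip torus f (\<lambda>x. g' x * ?p x) + ip torus f (\<lambda>x. g x * ?q x)) + ip torus f (\<lambda>x. g' x * ?p x) = - (\<integral>x. (f x * g x) * ?q x \<partial>torus)"
    unfolding ip_def by (simp add: mult.assoc)
  also have "\<dots> = - Re ((c * mu k i) * fc (\<lambda>x. f x * g x) k)"
    using Re_mult_fc[OF i1(3)] by simp
  finally show "Re (c * fc (\<lambda>x. f' x * g x + f x * g' x) k) = Re (c * (- mu k i * fc (\<lambda>x. f x * g x) k))"
    by (simp add: mult.assoc)
qed

section \<open>Sobolev bounds on the Fourier side\<close>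

definition JJ :: "(3 \<Rightarrow> int) \<Rightarrow> real" where
  "JJ k = 1 + (\<Sum>i\<in>UNIV. (of_int (k i))\<^sup>2)"

text \<open>A uniform bound on finite sums takes the place of a series. Unlike \<open>Hsq\<close> it
  involves no chosen weak derivatives, only coefficients. \<open>X\<close> bounds the norm, not its
  square, up to the normalisation of \<open>fc\<close>.\<close>

definition sob :: "nat \<Rightarrow> real \<Rightarrow> (real^3 \<Rightarrow> real) \<Rightarrow> bool" where
  "sob m X f \<longleftrightarrow> L2 f \<and> 0 \<le> X \<and> (\<forall>N. (\<Sum>k\<in>KB N. JJ k ^ m * (norm (fc f k))\<^sup>2) \<le> X\<^sup>2)"

lemma JJ_ge1: "1 \<le> JJ k"
  by (simp add: JJ_def sum_nonneg)

lemma JJ_component: "(of_int (k i))\<^sup>2 \<le> JJ k"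
  using member_le_sum[of i UNIV "\<lambda>i. (real_of_int (k i))\<^sup>2"] by (simp add: JJ_def)

lemma sob_L2: "sob m X f \<Longrightarrow> L2 f"
  by (simp add: sob_def)

lemma sob_antimono_order:
  assumes "sob m X f" "n \<le> m" shows "sob n X f"
  unfolding sob_def
proof (intro conjI allI)
  fix N
  have "(\<Sum>k\<in>KB N. JJ k ^ n * (norm (fc f k))\<^sup>2) \<le> (\<Sum>k\<in>KB N. JJ k ^ m * (norm (fc f k))\<^sup>2)"
    using assms JJ_ge1 by (intro sum_mono mult_right_mono power_increasing) auto
  also have "\<dots> \<le> X\<^sup>2" using assms by (simp add: sob_def)
  finally show "(\<Sum>k\<in>KB N. JJ k ^ n * (norm (fc f k))\<^sup>2) \<le> X\<^sup>2" .
qed (use assms in \<open>auto simp: sob_def\<close>)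

lemma pi_sq_le: "pi\<^sup>2 \<le> 16"
  using power_mono[of pi 4 2] pi_less_4 by simp

lemma norm_mu: "norm (mu k i) = pi * \<bar>of_int (k i)\<bar>"
  by (simp add: mu_def norm_mult)

lemma norm_fd_sq:
  assumes "fd i f g"
  shows "(norm (fc g k))\<^sup>2 = pi\<^sup>2 * (of_int (k i))\<^sup>2 * (norm (fc f k))\<^sup>2"
  using assms by (simp add: fd_def norm_mult norm_mu power_mult_distrib)

text \<open>A derivative costs one power of \<open>JJ\<close> and a factor
  \<open>pi\<^sup>2 \<le> 16\<close>, that is 4 on the level of norms.\<close>

lemma sob_fd:
  assumes "sob (Suc m) X f" "fd i f g" "L2 g"
  shows "sob m (4 * X) g"
  unfolding sob_def
proof (intro conjI allI)
  fix N
  have le: "JJ k ^ m * (norm (fc g k))\<^sup>2 \<le> 16 * (JJ k ^ Suc m * (norm (fc f k))\<^sup>2)" for k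
  proof -
    have "JJ k ^ m * (norm (fc g k))\<^sup>2 = (JJ k ^ m * (norm (fc f k))\<^sup>2) * (pi\<^sup>2 * (of_int (k i))\<^sup>2)"
      by (simp add: norm_fd_sq[OF assms(2)])
    also have "\<dots> \<le> (JJ k ^ m * (norm (fc f k))\<^sup>2) * (16 * JJ k)"
      using JJ_ge1[of k] by (intro mult_left_mono mult_mono pi_sq_le JJ_component) auto
    finally show ?thesis by (simp add: mult_ac)
  qed
  have "(\<Sum>k\<in>KB N. JJ k ^ m * (norm (fc g k))\<^sup>2) \<le> 16 * (\<Sum>k\<in>KB N. JJ k ^ Suc m * (norm (fc f k))\<^sup>2)"
    unfolding sum_distrib_left by (rule sum_mono[OF le])
  also have "\<dots> \<le> 16 * X\<^sup>2" using assms(1) unfolding sob_def by (intro mult_left_mono) auto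
  finally show "(\<Sum>k\<in>KB N. JJ k ^ m * (norm (fc g k))\<^sup>2) \<le> (4 * X)\<^sup>2" by (simp add: power_mult_distrib)
qed (use assms in \<open>auto simp: sob_def\<close>)

lemma sob_diff:
  assumes "sob m X f" "sob m Y g"
  shows "sob m (2 * (X + Y)) (\<lambda>x. f x - g x)"
  unfolding sob_def
proof (intro conjI allI)
  fix N
  have L2: "L2 f" "L2 g" and 0: "0 \<le> X" "0 \<le> Y" using assms by (auto simp: sob_def)
  have le: "JJ k ^ m * (norm (fc (\<lambda>x. f x - g x) k))\<^sup>2 \<le> 2 * (JJ k ^ m * (norm (fc f k))\<^sup>2) + 2 * (JJ k ^ m * (norm (fc g k))\<^sup>2)" for k
  proof -
    have "(norm (fc (\<lambda>x. f x - g x) k))\<^sup>2 \<le> (norm (fc f k) + norm (fc g k))\<^sup>2"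
      using L2 by (intro power_mono) (auto simp: fc_diff L2_integrable norm_triangle_ineq4)
    also have "\<dots> \<le> 2 * (norm (fc f k))\<^sup>2 + 2 * (norm (fc g k))\<^sup>2"
      using sum_squares_bound[of "norm (fc f k)" "norm (fc g k)"] by (simp add: power2_sum)
    finally have "JJ k ^ m * (norm (fc (\<lambda>x. f x - g x) k))\<^sup>2 \<le> JJ k ^ m * (2 * (norm (fc f k))\<^sup>2 + 2 * (norm (fc g k))\<^sup>2)"
      using JJ_ge1[of k] by (intro mult_left_mono) auto
    then show ?thesis by (simp add: algebra_simps)
  qed
  have "(\<Sum>k\<in>KB N. JJ k ^ m * (norm (fc (\<lambda>x. f x - g x) k))\<^sup>2) \<le> 2 * (\<Sum>k\<in>KB N. JJ k ^ m * (norm (fc f k))\<^sup>2) + 2 * (\<Sum>k\<in>KB N. JJ k ^ m * (norm (fc g k))\<^sup>2)"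
    unfolding sum_distrib_left sum.distrib[symmetric] by (rule sum_mono[OF le])
  also have "\<dots> \<le> 2 * X\<^sup>2 + 2 * Y\<^sup>2"
    using assms unfolding sob_def by (intro add_mono mult_left_mono) auto
  also have "\<dots> \<le> (2 * (X + Y))\<^sup>2"
    using 0 by (simp add: power2_sum power_mult_distrib)
  finally show "(\<Sum>k\<in>KB N. JJ k ^ m * (norm (fc (\<lambda>x. f x - g x) k))\<^sup>2) \<le> (2 * (X + Y))\<^sup>2" .
qed (use assms in \<open>auto simp: sob_def intro: sqi_diff\<close>)

lemma card_KB: "card (KB N) = (2 * N + 1) ^ 3"
proof -
  have "KB N = PiE UNIV (\<lambda>_. {- int N..int N})"
  proof -
    have "\<bar>j\<bar> \<le> int N \<longleftrightarrow> - int N \<le> j \<and> j \<le> int N" for j by arith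
    then show ?thesis by (simp add: KB_def PiE_def Pi_def)
  qed
  moreover have "nat (2 * int N + 1) = Suc (2 * N)" by arith
  ultimately show ?thesis by (simp add: card_PiE)
qed

text \<open>With \<open>n = N + 1\<close>, the shell \<open>KB (Suc N) - KB N\<close> has
  \<open>24 * n\<^sup>2 + 2\<close> points, at each of which \<open>JJ k\<close> is at least
  \<open>n\<^sup>2\<close>; it contributes at most \<open>26 / n\<^sup>2\<close>. This is at most
  \<open>52 / n - 52 / (n + 1)\<close>, which telescopes. For \<open>N = 0\<close> the bound is an
  equality.\<close>

lemma sum_inverse_JJ: "(\<Sum>k\<in>KB N. 1 / (JJ k)\<^sup>2) \<le> 53 - 52 / (real N + 1)"
proof (induction N)
  case 0
  have "KB 0 = {\<lambda>_. 0}" by (auto simp: KB_def)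
  then show ?case by (simp add: JJ_def)
next
  case (Suc N)
  let ?n = "real N + 1"
  have sub: "KB N \<subseteq> KB (Suc N)" by (rule KB_mono) simp
  have J: "1 / (JJ k)\<^sup>2 \<le> 1 / ?n ^ 4" if k: "k \<in> KB (Suc N) - KB N" for k
  proof -
    obtain i where "\<not> \<bar>k i\<bar> \<le> int N" using k unfolding KB_def by blast
    then have "?n \<le> \<bar>real_of_int (k i)\<bar>" by linarith
    then have "?n\<^sup>2 \<le> (real_of_int (k i))\<^sup>2" using power_mono[of ?n "\<bar>real_of_int (k i)\<bar>" 2] by simp
    then have "?n\<^sup>2 \<le> JJ k" using JJ_component[of k i] by linarith
    then have "(?n\<^sup>2)\<^sup>2 \<le> (JJ k)\<^sup>2" by (intro power_mono) auto
    then have "?n ^ 4 \<le> (JJ k)\<^sup>2" by (simp flip: power_mult)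
    then show ?thesis by (intro divide_left_mono) (use JJ_ge1[of k] in auto)
  qed
  have card: "real (card (KB (Suc N) - KB N)) = 24 * ?n\<^sup>2 + 2"
  proof -
    have "card (KB (Suc N) - KB N) = (2 * Suc N + 1) ^ 3 - (2 * N + 1) ^ 3"
      by (simp add: card_Diff_subset sub card_KB del: power_Suc)
    then show ?thesis
      by (simp add: of_nat_diff power_mono power2_eq_square power3_eq_cube algebra_simps)
  qed
  have "(\<Sum>k\<in>KB (Suc N). 1 / (JJ k)\<^sup>2) = (\<Sum>k\<in>KB (Suc N) - KB N. 1 / (JJ k)\<^sup>2) + (\<Sum>k\<in>KB N. 1 / (JJ k)\<^sup>2)"
    by (rule sum.subset_diff[OF sub finite_KB])
  also have "(\<Sum>k\<in>KB (Suc N) - KB N. 1 / (JJ k)\<^sup>2) \<le> (24 * ?n\<^sup>2 + 2) * (1 / ?n ^ 4)"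
    unfolding card[symmetric] by (rule sum_bounded_above) (use J in auto)
  also have "\<dots> \<le> 26 * ?n\<^sup>2 * (1 / ?n ^ 4)"
  proof -
    have "1 \<le> ?n\<^sup>2" by (rule one_le_power) simp
    then show ?thesis by (intro mult_right_mono) auto
  qed
  also have "\<dots> = 26 / ?n\<^sup>2"
  proof -
    have "26 * x\<^sup>2 * (1 / x ^ 4) = 26 / x\<^sup>2" if "x \<noteq> 0" for x :: real
      using that by (simp add: field_simps power4_eq_xxxx power2_eq_square)
    then show ?thesis by simp
  qed
  also have "\<dots> \<le> 52 / (?n * (?n + 1))"
  proof -
    have "26 / x\<^sup>2 \<le> 52 / (x * (x + 1))" if "1 \<le> x" for x :: real
    proof -
      have "x * (x + 1) \<le> 2 * x\<^sup>2"
        using mult_left_mono[OF that, of x] that by (simp add: power2_eq_square algebra_simps)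
      then have "52 / (2 * x\<^sup>2) \<le> 52 / (x * (x + 1))"
        using that by (intro divide_left_mono) auto
      then show ?thesis by simp
    qed
    from this[of ?n] show ?thesis by simp
  qed
  also have "\<dots> = 52 / ?n - 52 / (?n + 1)"
    by (simp add: divide_simps)
  finally show ?case using Suc.IH by simp
qed

text \<open>Cauchy-Schwarz with the weights \<open>1 / JJ k\<close> and \<open>JJ k\<close>; the
  squared inverse weights are summable in three dimensions. Since 53 is at most 64, the moduli of
  the coefficients sum to at most \<open>8 * X\<close>, and the 8 cancels against the normalisation
  of \<open>ps\<close>.\<close>

lemma ps_bounded:
  assumes "sob 2 X f" shows "\<bar>ps N f x\<bar> \<le> X"
proof -
  have J0: "0 < JJ k" for k using JJ_ge1[of k] by linarith
  have "\<bar>ps N f x\<bar> = \<bar>\<Sum>k\<in>KB N. Re (fc f k * cnj (ek k x))\<bar> / 8"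
    by (simp add: ps_def)
  also have "\<bar>\<Sum>k\<in>KB N. Re (fc f k * cnj (ek k x))\<bar> \<le> (\<Sum>k\<in>KB N. norm (fc f k))"
  proof (rule order_trans[OF sum_abs], rule sum_mono)
    show "\<bar>Re (fc f k * cnj (ek k x))\<bar> \<le> norm (fc f k)" for k
      using abs_Re_le_cmod[of "fc f k * cnj (ek k x)"] by (simp add: norm_mult)
  qed
  also have "(\<Sum>k\<in>KB N. norm (fc f k)) \<le> 8 * X"
  proof (rule power2_le_imp_le)
    have "(\<Sum>k\<in>KB N. norm (fc f k))\<^sup>2 = (\<Sum>k\<in>KB N. (1 / JJ k) * (JJ k * norm (fc f k)))\<^sup>2"
      using J0 by (simp add: less_imp_neq[THEN not_sym])
    also have "\<dots> \<le> (\<Sum>k\<in>KB N. (1 / JJ k)\<^sup>2) * (\<Sum>k\<in>KB N. (JJ k * norm (fc f k))\<^sup>2)"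
      by (rule Cauchy_Schwarz_ineq_sum)
    also have "\<dots> \<le> 53 * X\<^sup>2"
    proof (rule mult_mono)
      have "0 \<le> 52 / (real N + 1)" by simp
      then show "(\<Sum>k\<in>KB N. (1 / JJ k)\<^sup>2) \<le> 53"
        using sum_inverse_JJ[of N] unfolding power_divide power_one by linarith
      show "(\<Sum>k\<in>KB N. (JJ k * norm (fc f k))\<^sup>2) \<le> X\<^sup>2"
        using assms by (simp add: sob_def power_mult_distrib)
    qed (auto intro: sum_nonneg)
    also have "\<dots> \<le> (8 * X)\<^sup>2" by (simp add: power_mult_distrib)
    finally show "(\<Sum>k\<in>KB N. norm (fc f k))\<^sup>2 \<le> (8 * X)\<^sup>2" .
  qed (use assms in \<open>simp add: sob_def\<close>)
  finally show ?thesis by simp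
qed

text \<open>All partial sums lie between \<open>- X\<close> and \<open>X\<close>. Clamping
  \<open>f\<close> to this interval yields a function that is, at each point, at least as close to
  \<open>f\<close> as any partial sum. As these converge to \<open>f\<close> in norm, the clamping
  changes nothing almost everywhere.\<close>

lemma sob_embedding:
  assumes "sob 2 X f" shows "AE x in torus. \<bar>f x\<bar> \<le> X"
proof -
  have X: "0 \<le> X" and f: "L2 f" using assms by (auto simp: sob_def)
  define g where "g x = max (-X) (min X (f x))" for x
  have gm: "g \<in> borel_measurable torus"
    unfolding g_def using sqi_meas[OF f] by measurable
  have gs: "L2 g"
    by (rule sqi_bounded[OF finite_measure_torus gm, of X]) (use clamp_le[OF X] in \<open>auto simp: g_def\<close>)
  have "nsq torus (\<lambda>x. f x - g x) \<le> nsq torus (\<lambda>x. f x - ps N f x)" for N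
    unfolding nsq_def
  proof (rule integral_mono)
    show "(f x - g x)\<^sup>2 \<le> (f x - ps N f x)\<^sup>2" for x
      using ps_bounded[OF assms, of N x] unfolding abs_le_square_iff[symmetric] g_def by linarith
  qed (use sqi_diff[OF f gs] sqi_diff[OF f sqi_ps] in \<open>auto simp: sqi_def\<close>)
  then have "nsq torus (\<lambda>x. f x - g x) \<le> 0"
    by (intro LIMSEQ_le_const[OF ps_tendsto[OF f]]) auto
  then have "(\<integral>x. (f x - g x)\<^sup>2 \<partial>torus) = 0"
    using nsq_nonneg[of torus "\<lambda>x. f x - g x"] unfolding nsq_def by linarith
  then have "AE x in torus. (f x - g x)\<^sup>2 = 0"
    using sqi_diff[OF f gs] by (subst (asm) integral_nonneg_eq_0_iff_AE) (auto simp: sqi_def)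
  then show ?thesis
  proof eventually_elim
    fix x assume "(f x - g x)\<^sup>2 = 0"
    then have "f x = g x" by simp
    then show "\<bar>f x\<bar> \<le> X" using clamp_le[OF X, of "f x"] by (simp add: g_def)
  qed
qed

text \<open>Frequencies with \<open>JJ k \<le> l\<close> are paid for by \<open>Y\<close>, the
  others by the Sobolev bound. The threshold \<open>l\<close> stays free and is later chosen as a
  power of \<open>\<epsilon>\<close>.\<close>

lemma interpolation:
  assumes "sob (Suc m) X f" "fd i f g" "L2 g" "0 < l" "nsq torus f \<le> Y"
  shows "nsq torus g \<le> 16 * (l * Y + X\<^sup>2 / l ^ m)"
proof -
  have f: "L2 f" using assms by (simp add: sob_def)
  have J: "JJ k \<le> l + JJ k ^ Suc m / l ^ m" for k
  proof (cases "JJ k \<le> l")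
    case True
    have "0 \<le> JJ k ^ Suc m / l ^ m" using JJ_ge1[of k] assms(4) by (intro divide_nonneg_pos zero_le_power) auto
    then show ?thesis using True by linarith
  next
    case False
    then have "l ^ m \<le> JJ k ^ m" using assms(4) by (intro power_mono) auto
    then have "JJ k * l ^ m \<le> JJ k * JJ k ^ m" using JJ_ge1[of k] by (intro mult_left_mono) auto
    then have "JJ k \<le> JJ k ^ Suc m / l ^ m" using assms(4) by (simp add: field_simps)
    then show ?thesis using assms(4) by linarith
  qed
  have "8 * nsq torus g \<le> 16 * (l * (8 * Y) + X\<^sup>2 / l ^ m)"
  proof (rule nsq_le_Parseval[OF assms(3)])
    fix N
    have le: "(norm (fc g k))\<^sup>2 \<le> 16 * (l * (norm (fc f k))\<^sup>2 + (JJ k ^ Suc m * (norm (fc f k))\<^sup>2) / l ^ m)" for k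
    proof -
      have "(norm (fc g k))\<^sup>2 = (pi\<^sup>2 * (of_int (k i))\<^sup>2) * (norm (fc f k))\<^sup>2"
        by (simp add: norm_fd_sq[OF assms(2)])
      also have "\<dots> \<le> (16 * (l + JJ k ^ Suc m / l ^ m)) * (norm (fc f k))\<^sup>2"
        by (intro mult_right_mono mult_mono pi_sq_le order_trans[OF JJ_component J]) auto
      finally show ?thesis by (simp add: algebra_simps)
    qed
    have "(\<Sum>k\<in>KB N. (norm (fc g k))\<^sup>2) \<le> 16 * (l * (\<Sum>k\<in>KB N. (norm (fc f k))\<^sup>2) + (\<Sum>k\<in>KB N. JJ k ^ Suc m * (norm (fc f k))\<^sup>2) / l ^ m)"
      unfolding sum_distrib_left sum_divide_distrib sum.distrib[symmetric] by (rule sum_mono[OF le])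
    also have "\<dots> \<le> 16 * (l * (8 * Y) + X\<^sup>2 / l ^ m)"
      using assms Bessel[OF f, of N] by (intro mult_left_mono add_mono divide_right_mono) (auto simp: sob_def)
    finally show "(\<Sum>k\<in>KB N. (norm (fc g k))\<^sup>2) \<le> 16 * (l * (8 * Y) + X\<^sup>2 / l ^ m)" .
  qed
  moreover have "0 \<le> X\<^sup>2 / l ^ m" using assms(4) by simp
  ultimately show ?thesis by simp
qed

section \<open>Comparison of \<open>Hsq\<close> with weighted Fourier sums\<close>

definition ei :: "nat \<Rightarrow> 3 \<Rightarrow> 3 \<Rightarrow> nat" where
  "ei m i = (\<lambda>j. if j = i then m else 0)"

lemma sum_ei [simp]: "(\<Sum>j\<in>UNIV. ei m i j) = m"
  by (simp add: ei_def)

lemma prod_ei: "(\<Prod>j\<in>UNIV. (f j :: 'a::comm_semiring_1) ^ ei m i j) = f i ^ m"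
proof -
  have "(\<Prod>j\<in>UNIV. f j ^ ei m i j) = (\<Prod>j\<in>UNIV. if j = i then f j ^ m else 1)"
    by (intro prod.cong) (auto simp: ei_def)
  then show ?thesis by simp
qed

lemma ei_multi_index [simp]: "ei n i \<in> multi_indices m \<longleftrightarrow> n \<le> m"
  by (simp add: multi_indices_def)

lemma has_weak_deriv_zero: "integrable torus f \<Longrightarrow> has_weak_deriv (\<lambda>_. 0) f f"
  by (simp add: has_weak_deriv_def mpderiv_def)

lemma weak_deriv_has:
  assumes "\<exists>g. has_weak_deriv \<alpha> f g"
  shows "has_weak_deriv \<alpha> f (weak_deriv \<alpha> f)"
proof (cases "\<alpha> = (\<lambda>_. 0)")
  case True
  then show ?thesis
    using assms has_weak_deriv_zero[of f] by (auto simp: weak_deriv_def has_weak_deriv_def)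
next
  case False
  then show ?thesis using someI_ex[OF assms] by (simp add: weak_deriv_def)
qed

lemma sqi_nn_integral:
  assumes "f \<in> borel_measurable M" "(\<integral>\<^sup>+x. ennreal ((f x)\<^sup>2) \<partial>M) < \<infinity>"
  shows "sqi M f" "ennreal (nsq M f) = (\<integral>\<^sup>+x. ennreal ((f x)\<^sup>2) \<partial>M)"
proof -
  show "sqi M f"
    unfolding sqi_def using assms by (auto intro!: integrableI_nonneg)
  then show "ennreal (nsq M f) = (\<integral>\<^sup>+x. ennreal ((f x)\<^sup>2) \<partial>M)"
    unfolding nsq_def by (subst nn_integral_eq_integral) (auto simp: sqi_def)
qed

lemma nn_integral_nsq: "sqi M f \<Longrightarrow> (\<integral>\<^sup>+x. ennreal ((f x)\<^sup>2) \<partial>M) = ennreal (nsq M f)"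
  unfolding nsq_def by (subst nn_integral_eq_integral) (auto simp: sqi_def)

lemma Hsq_finite:
  assumes "Hsq m f < \<infinity>" "\<alpha> \<in> multi_indices m"
  shows "has_weak_deriv \<alpha> f (weak_deriv \<alpha> f)" "L2 (weak_deriv \<alpha> f)"
    "ennreal (nsq torus (weak_deriv \<alpha> f)) \<le> Hsq m f"
proof -
  have ex: "\<forall>\<alpha>\<in>multi_indices m. \<exists>g. has_weak_deriv \<alpha> f g"
    using assms(1) by (auto simp: Hsq_def split: if_splits)
  then show w: "has_weak_deriv \<alpha> f (weak_deriv \<alpha> f)"
    using assms(2) by (intro weak_deriv_has) auto
  have eq: "Hsq m f = (\<Sum>\<alpha>\<in>multi_indices m. \<integral>\<^sup>+x. ennreal ((weak_deriv \<alpha> f x)\<^sup>2) \<partial>torus)"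
    using ex by (simp add: Hsq_def)
  have le: "(\<integral>\<^sup>+x. ennreal ((weak_deriv \<alpha> f x)\<^sup>2) \<partial>torus) \<le> Hsq m f"
    unfolding eq by (rule member_le_sum) (use assms(2) finite_multi_indices in auto)
  have m: "weak_deriv \<alpha> f \<in> borel_measurable torus"
    using w by (auto simp: has_weak_deriv_def)
  note * = sqi_nn_integral[OF m le_less_trans[OF le assms(1)]]
  show "L2 (weak_deriv \<alpha> f)" by (rule *(1))
  show "ennreal (nsq torus (weak_deriv \<alpha> f)) \<le> Hsq m f" using le *(2) by simp
qed

lemma Hsq_finite_L2:
  assumes "Hsq m f < \<infinity>" shows "L2 f" "ennreal (nsq torus f) \<le> Hsq m f"
  using Hsq_finite[OF assms, of "\<lambda>_. 0"] by (simp_all add: multi_indices_def weak_deriv_def)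

lemma wpd_eq: "wpd i f = weak_deriv (ei 1 i) f"
  unfolding wpd_def ei_def ..

lemma wpd2_eq: "wpd2 i f = weak_deriv (ei 2 i) f"
  unfolding wpd2_def ei_def ..

lemma Hsq_wpd:
  assumes "Hsq m f < \<infinity>" "1 \<le> m"
  shows "fd i f (wpd i f)" "L2 (wpd i f)" "ennreal (nsq torus (wpd i f)) \<le> Hsq m f"
  using Hsq_finite[OF assms(1), of "ei 1 i"] assms(2) fc_weak_deriv[of "ei 1 i" f]
  by (simp_all add: wpd_eq fd_def prod_ei del: One_nat_def)

lemma Hsq_wpd2:
  assumes "Hsq m f < \<infinity>" "2 \<le> m"
  shows "fd i (wpd i f) (wpd2 i f)" "L2 (wpd2 i f)" "ennreal (nsq torus (wpd2 i f)) \<le> Hsq m f"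
proof -
  have "fc (wpd2 i f) k = (- mu k i)\<^sup>2 * fc f k" for k
    using Hsq_finite(1)[OF assms(1), of "ei 2 i"] assms(2) fc_weak_deriv[of "ei 2 i" f "wpd2 i f" k]
    by (simp add: wpd2_eq prod_ei)
  then show "fd i (wpd i f) (wpd2 i f)"
    using Hsq_wpd(1)[OF assms(1), of i] assms(2) by (simp add: fd_def power2_eq_square)
  show "L2 (wpd2 i f)" "ennreal (nsq torus (wpd2 i f)) \<le> Hsq m f"
    using Hsq_finite(2,3)[OF assms(1), of "ei 2 i"] assms(2) by (simp_all add: wpd2_eq)
qed

text \<open>\<open>JJ k\<close> is a sum of four terms, hence at most four times their maximum.
  Consequently \<open>f\<close> and its pure derivatives of order \<open>m\<close> control the whole
  norm.\<close>

lemma JJ_power_le: "JJ k ^ m \<le> 4 ^ m * (1 + (\<Sum>i\<in>UNIV. ((of_int (k i))\<^sup>2) ^ m))"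
proof -
  define a b c :: real where "a = (of_int (k 1))\<^sup>2" and "b = (of_int (k 2))\<^sup>2" and "c = (of_int (k 3))\<^sup>2"
  have nn: "0 \<le> a" "0 \<le> b" "0 \<le> c" by (auto simp: a_def b_def c_def)
  define M where "M = max (max 1 a) (max b c)"
  have "JJ k \<le> 4 * M" by (simp add: JJ_def sum_3 M_def flip: a_def b_def c_def)
  then have "JJ k ^ m \<le> (4 * M) ^ m" using JJ_ge1[of k] by (intro power_mono) auto
  also have "\<dots> = 4 ^ m * M ^ m" by (simp add: power_mult_distrib)
  also have "M ^ m \<le> 1 + (a ^ m + b ^ m + c ^ m)"
  proof -
    have "M = 1 \<or> M = a \<or> M = b \<or> M = c" by (auto simp: M_def max_def)
    moreover have "0 \<le> a ^ m" "0 \<le> b ^ m" "0 \<le> c ^ m" using nn by auto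
    ultimately show ?thesis by auto
  qed
  finally show ?thesis by (simp add: sum_3 a_def b_def c_def)
qed

text \<open>Bessel's inequality for \<open>f\<close> and its three pure derivatives gives four times
  \<open>8 * X\<^sup>2\<close>, and 32 is below the square of 6. The factor \<open>2 ^ m\<close> is
  the root of \<open>4 ^ m\<close> in \<open>JJ_power_le\<close>.\<close>

lemma Hsq_imp_sob:
  assumes H: "Hsq m f \<le> ennreal (X\<^sup>2)" and X: "0 \<le> X"
  shows "sob m (6 * 2 ^ m * X) f"
proof -
  have fin: "Hsq m f < \<infinity>" using H by (rule le_less_trans) simp
  have f: "L2 f" by (rule Hsq_finite_L2[OF fin])
  have nf: "nsq torus f \<le> X\<^sup>2"
    using order_trans[OF Hsq_finite_L2(2)[OF fin] H] by simp
  define d where "d i = weak_deriv (ei m i) f" for i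
  have d: "L2 (d i)" "nsq torus (d i) \<le> X\<^sup>2" for i
    using Hsq_finite[OF fin, of "ei m i"] order_trans[OF Hsq_finite(3)[OF fin, of "ei m i"] H] by (auto simp: d_def)
  have fcd: "((of_int (k i))\<^sup>2) ^ m * (norm (fc f k))\<^sup>2 \<le> (norm (fc (d i) k))\<^sup>2" for k i
  proof -
    have "fc (d i) k = (- mu k i) ^ m * fc f k"
      using fc_weak_deriv[OF Hsq_finite(1)[OF fin, of "ei m i"], of k] by (simp add: d_def prod_ei)
    then have "(norm (fc (d i) k))\<^sup>2 = ((norm (mu k i))\<^sup>2) ^ m * (norm (fc f k))\<^sup>2"
      by (simp add: norm_mult norm_power power_mult_distrib power_commutes flip: power_mult) (simp add: mult.commute)
    moreover have "((of_int (k i))\<^sup>2) ^ m \<le> ((norm (mu k i))\<^sup>2) ^ m"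
    proof (rule power_mono)
      have "1 * (real_of_int (k i))\<^sup>2 \<le> pi\<^sup>2 * (real_of_int (k i))\<^sup>2"
        using pi_gt3 by (intro mult_right_mono one_le_power) auto
      then show "(real_of_int (k i))\<^sup>2 \<le> (norm (mu k i))\<^sup>2" by (simp add: norm_mu power_mult_distrib)
    qed auto
    ultimately show ?thesis by (simp add: mult_right_mono)
  qed
  have le: "JJ k ^ m * (norm (fc f k))\<^sup>2 \<le> 4 ^ m * ((norm (fc f k))\<^sup>2 + (\<Sum>i\<in>UNIV. (norm (fc (d i) k))\<^sup>2))" for k
  proof -
    have "JJ k ^ m * (norm (fc f k))\<^sup>2 \<le> (4 ^ m * (1 + (\<Sum>i\<in>UNIV. ((of_int (k i))\<^sup>2) ^ m))) * (norm (fc f k))\<^sup>2"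
      by (intro mult_right_mono JJ_power_le) simp
    also have "\<dots> = 4 ^ m * ((norm (fc f k))\<^sup>2 + (\<Sum>i\<in>UNIV. ((of_int (k i))\<^sup>2) ^ m * (norm (fc f k))\<^sup>2))"
      by (simp add: algebra_simps sum_distrib_left sum_distrib_right)
    also have "\<dots> \<le> 4 ^ m * ((norm (fc f k))\<^sup>2 + (\<Sum>i\<in>UNIV. (norm (fc (d i) k))\<^sup>2))"
      by (intro mult_left_mono add_left_mono sum_mono fcd) auto
    finally show ?thesis .
  qed
  have main: "(\<Sum>k\<in>KB N. JJ k ^ m * (norm (fc f k))\<^sup>2) \<le> (6 * 2 ^ m * X)\<^sup>2" for N
  proof -
  have "(\<Sum>k\<in>KB N. JJ k ^ m * (norm (fc f k))\<^sup>2) \<le> (\<Sum>k\<in>KB N. 4 ^ m * ((norm (fc f k))\<^sup>2 + (\<Sum>i\<in>UNIV. (norm (fc (d i) k))\<^sup>2)))"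
    by (rule sum_mono[OF le])
  also have "\<dots> = 4 ^ m * ((\<Sum>k\<in>KB N. (norm (fc f k))\<^sup>2) + (\<Sum>i\<in>UNIV. \<Sum>k\<in>KB N. (norm (fc (d i) k))\<^sup>2))"
    by (simp add: sum.distrib sum.swap[of _ UNIV] flip: sum_distrib_left)
  also have "\<dots> \<le> 4 ^ m * (8 * X\<^sup>2 + (\<Sum>i\<in>(UNIV::3 set). 8 * X\<^sup>2))"
    using order_trans[OF Bessel[OF f, of N]] order_trans[OF Bessel[OF d(1), where N=N]] nf d(2)
    by (intro mult_left_mono add_mono sum_mono) auto
  also have "\<dots> \<le> (6 * 2 ^ m * X)\<^sup>2"
    by (simp add: power_mult_distrib power2_eq_square[of "2 ^ m"] flip: power_mult_distrib[of 2 2 m])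
  finally show ?thesis .
  qed
  show ?thesis unfolding sob_def using f X main by simp
qed

lemma ennreal_sqrt_le:
  assumes "ennreal_sqrt a \<le> ennreal X" "0 \<le> X" shows "a \<le> ennreal (X\<^sup>2)"
proof -
  have a: "a \<noteq> \<infinity>" using assms by (auto simp: ennreal_sqrt_def top_unique)
  then have "sqrt (enn2real a) \<le> X" using assms by (simp add: ennreal_sqrt_def)
  then have "enn2real a \<le> X\<^sup>2" by (rule sqrt_le_D)
  then show ?thesis using a by (metis ennreal_enn2real ennreal_leI infinity_ennreal_def less_top)
qed

lemma Hnorm_le_Hsq:
  assumes "Hnorm m fs \<le> ennreal X" "0 \<le> X" "f \<in> set fs" shows "Hsq m f \<le> ennreal (X\<^sup>2)"
proof -
  have "Hsq m f \<le> (\<Sum>f\<leftarrow>fs. Hsq m f)"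
    using assms(3) by (intro member_le_sum_list) auto
  also have "\<dots> \<le> ennreal (X\<^sup>2)"
    using assms(1,2) unfolding Hnorm_def by (rule ennreal_sqrt_le)
  finally show ?thesis .
qed

lemma Hnorm_finite:
  assumes "Hnorm m fs < \<infinity>" "f \<in> set fs" shows "Hsq m f < \<infinity>"
proof -
  have "Hnorm m fs \<le> ennreal (enn2real (Hnorm m fs))" using assms(1) by simp
  from Hnorm_le_Hsq[OF this _ assms(2)] show ?thesis by (simp add: le_less_trans)
qed

lemma Hnorm_L2: "Hnorm m fs < \<infinity> \<Longrightarrow> f \<in> set fs \<Longrightarrow> L2 f"
  by (rule Hsq_finite_L2[OF Hnorm_finite])

lemma L2norm_eq:
  assumes "\<And>f. f \<in> set fs \<Longrightarrow> L2 f"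
  shows "L2norm fs = ennreal (sqrt (\<Sum>f\<leftarrow>fs. nsq torus f))"
proof -
  have "(\<Sum>f\<leftarrow>fs. Hsq 0 f) = ennreal (\<Sum>f\<leftarrow>fs. nsq torus f) \<and> 0 \<le> (\<Sum>f\<leftarrow>fs. nsq torus f)"
    using assms
  proof (induction fs)
    case (Cons f fs)
    then show ?case
      by (auto simp: Hsq_0 L2_integrable nn_integral_nsq simp flip: ennreal_plus)
  qed simp
  then show ?thesis by (simp add: Hnorm_def ennreal_sqrt_def)
qed

section \<open>Weak derivatives and first order norms of differences\<close>

lemma smooth_pderiv:
  fixes f :: "'a::euclidean_space \<Rightarrow> real"
  shows "smooth f \<Longrightarrow> b \<in> Basis \<Longrightarrow> smooth (pderiv_dir b f)"
  unfolding smooth_def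
proof (intro allI impI)
  fix bs :: "'a list" and x
  assume *: "\<forall>bs. set bs \<subseteq> Basis \<longrightarrow> (\<forall>x. foldr pderiv_dir bs f differentiable at x)" "b \<in> Basis" "set bs \<subseteq> Basis"
  then have "foldr pderiv_dir (bs @ [b]) f differentiable at x"
    using *(1)[rule_format, of "bs @ [b]"] by simp
  then show "foldr pderiv_dir bs (pderiv_dir b f) differentiable at x" by simp
qed

lemma smooth_continuous: "smooth f \<Longrightarrow> continuous_on UNIV f"
  unfolding smooth_def
  by (metis differentiable_imp_continuous_on differentiable_on_def differentiable_at_withinI empty_set empty_subsetI foldr.simps(1) id_apply)

lemma smooth_mpderiv: "smooth \<phi> \<Longrightarrow> smooth (mpderiv \<alpha> \<phi>)"
proof -
  have *: "smooth f \<Longrightarrow> smooth ((pderiv_dir (axis i 1) ^^ n) f)" for f :: "real^3 \<Rightarrow> real" and i n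
    by (induction n) (auto intro: smooth_pderiv simp: Basis_vec3)
  show "smooth \<phi> \<Longrightarrow> smooth (mpderiv \<alpha> \<phi>)"
    unfolding mpderiv_def by (intro *)
qed

lemma integrable_mult_continuous:
  assumes "integrable torus f" "continuous_on UNIV (g :: real^3 \<Rightarrow> real)"
  shows "integrable torus (\<lambda>x. f x * g x)"
proof -
  have "bounded (g ` cbox (-1) 1)"
    by (intro compact_imp_bounded compact_continuous_image continuous_on_subset[OF assms(2)]) auto
  then obtain B where B: "\<And>x. x \<in> cbox (-1) 1 \<Longrightarrow> \<bar>g x\<bar> \<le> B" by (auto simp: bounded_iff)
  show ?thesis
  proof (rule Bochner_Integration.integrable_bound)
    show "integrable torus (\<lambda>x. B * f x)" using assms(1) by simp
    show "(\<lambda>x. f x * g x) \<in> borel_measurable torus"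
      using assms(1) continuous_torus_measurable[OF assms(2)] by auto
    show "AE x in torus. norm (f x * g x) \<le> norm (B * f x)"
    proof (rule AE_torus_cbox)
      fix x :: "real^3" assume "x \<in> cbox (-1) 1"
      from B[OF this] have "\<bar>g x\<bar> * \<bar>f x\<bar> \<le> \<bar>B\<bar> * \<bar>f x\<bar>" by (intro mult_right_mono) auto
      then show "norm (f x * g x) \<le> norm (B * f x)" by (simp add: abs_mult mult.commute)
    qed
  qed
qed

lemma has_weak_deriv_diff:
  assumes f: "has_weak_deriv \<alpha> f f'" and g: "has_weak_deriv \<alpha> g g'"
  shows "has_weak_deriv \<alpha> (\<lambda>x. f x - g x) (\<lambda>x. f' x - g' x)"
  unfolding has_weak_deriv_def
proof (intro conjI allI impI)
  have int: "integrable torus f" "integrable torus f'" "integrable torus g" "integrable torus g'"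
    using assms by (auto simp: has_weak_deriv_def)
  then show "integrable torus (\<lambda>x. f x - g x)" "integrable torus (\<lambda>x. f' x - g' x)" by auto
  fix \<phi> :: "real^3 \<Rightarrow> real" assume \<phi>: "smooth \<phi> \<and> periodic2 \<phi>"
  have c: "continuous_on UNIV \<phi>" "continuous_on UNIV (mpderiv \<alpha> \<phi>)"
    using \<phi> by (auto intro: smooth_continuous smooth_mpderiv)
  show "(\<integral>x. (f x - g x) * mpderiv \<alpha> \<phi> x \<partial>torus) = (-1) ^ (\<Sum>i\<in>UNIV. \<alpha> i) * (\<integral>x. (f' x - g' x) * \<phi> x \<partial>torus)"
    using f g \<phi> by (simp add: left_diff_distrib integrable_mult_continuous c int has_weak_deriv_def right_diff_distrib)
qed

text \<open>\<open>Hsq\<close> uses a derivative chosen for the difference, which need not be the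
  difference of the chosen derivatives. Both have the same Fourier coefficients and hence agree
  almost everywhere by \<open>fc_zero_imp_AE_zero\<close>.\<close>

lemma Hsq1_diff:
  assumes "Hsq 1 f < \<infinity>" "Hsq 1 g < \<infinity>"
  shows "Hsq 1 (\<lambda>x. f x - g x) = ennreal (nsq torus (\<lambda>x. f x - g x) + (\<Sum>i\<in>UNIV. nsq torus (\<lambda>x. wpd i f x - wpd i g x)))"
proof -
  have mi: "multi_indices 1 = insert (\<lambda>_. 0) (range (ei 1))"
  proof (intro set_eqI iffI)
    fix \<alpha> :: "3 \<Rightarrow> nat" assume "\<alpha> \<in> multi_indices 1"
    then have le: "\<alpha> 1 + \<alpha> 2 + \<alpha> 3 \<le> 1" by (simp add: multi_indices_def sum_3)
    show "\<alpha> \<in> insert (\<lambda>_. 0) (range (ei 1))"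
    proof (cases "\<alpha> = (\<lambda>_. 0)")
      case False
      then obtain i where i: "\<alpha> i \<noteq> 0" by auto
      have "\<alpha> = ei 1 i"
      proof
        fix j
        show "\<alpha> j = ei 1 i j"
          using le i exhaust_3[of i] exhaust_3[of j] by (auto simp: ei_def)
      qed
      then show ?thesis by auto
    qed auto
  next
    fix \<alpha> :: "3 \<Rightarrow> nat" assume "\<alpha> \<in> insert (\<lambda>_. 0) (range (ei 1))"
    then show "\<alpha> \<in> multi_indices 1" by (auto simp del: One_nat_def) (simp add: multi_indices_def)
  qed
  have inj: "inj (ei 1)" by (auto simp: inj_def ei_def fun_eq_iff split: if_splits)
  have nz: "(\<lambda>_. 0) \<notin> range (ei 1)"
  proof
    assume "(\<lambda>_. 0) \<in> range (ei 1)"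
    then obtain i where "(\<lambda>_. 0) = ei 1 i" by auto
    from fun_cong[OF this, of i] show False by (simp add: ei_def)
  qed
  have s: "L2 (\<lambda>x. f x - g x)" "L2 (\<lambda>x. wpd i f x - wpd i g x)" for i
    using Hsq_finite_L2(1)[OF assms(1)] Hsq_finite_L2(1)[OF assms(2)] Hsq_wpd(2)[OF assms(1), of i] Hsq_wpd(2)[OF assms(2), of i]
    by (auto intro: sqi_diff)
  have w: "has_weak_deriv (ei 1 i) (\<lambda>x. f x - g x) (\<lambda>x. wpd i f x - wpd i g x)" for i
    unfolding wpd_eq by (intro has_weak_deriv_diff Hsq_finite(1)[of 1] assms) simp_all
  have ex: "\<forall>\<alpha>\<in>multi_indices 1. \<exists>h. has_weak_deriv \<alpha> (\<lambda>x. f x - g x) h"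
    unfolding mi using w has_weak_deriv_zero[OF L2_integrable[OF s(1)]] by blast
  have eq: "(\<integral>\<^sup>+x. ennreal ((weak_deriv (ei 1 i) (\<lambda>x. f x - g x) x)\<^sup>2) \<partial>torus) = ennreal (nsq torus (\<lambda>x. wpd i f x - wpd i g x))" for i
  proof -
    let ?d = "weak_deriv (ei 1 i) (\<lambda>x. f x - g x)" and ?e = "\<lambda>x. wpd i f x - wpd i g x"
    have h: "has_weak_deriv (ei 1 i) (\<lambda>x. f x - g x) ?d" by (rule weak_deriv_has) (use w in blast)
    then have int: "integrable torus ?d" by (simp add: has_weak_deriv_def)
    have "AE x in torus. ?d x - ?e x = 0"
    proof (rule fc_zero_imp_AE_zero)
      show "integrable torus (\<lambda>x. ?d x - ?e x)" using int L2_integrable[OF s(2)] by (rule Bochner_Integration.integrable_diff)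
      show "fc (\<lambda>x. ?d x - ?e x) k = 0" for k
        using int L2_integrable[OF s(2)] by (simp add: fc_diff fc_weak_deriv[OF h] fc_weak_deriv[OF w] del: One_nat_def)
    qed
    then have "(\<integral>\<^sup>+x. ennreal ((?d x)\<^sup>2) \<partial>torus) = (\<integral>\<^sup>+x. ennreal ((?e x)\<^sup>2) \<partial>torus)"
      by (intro nn_integral_cong_AE) auto
    then show ?thesis by (simp add: nn_integral_nsq[OF s(2)])
  qed
  have "Hsq 1 (\<lambda>x. f x - g x) = (\<Sum>\<alpha>\<in>insert (\<lambda>_. 0) (range (ei 1)). \<integral>\<^sup>+x. ennreal ((weak_deriv \<alpha> (\<lambda>x. f x - g x) x)\<^sup>2) \<partial>torus)"
    using ex unfolding Hsq_def mi by simp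
  also have "\<dots> = (\<integral>\<^sup>+x. ennreal ((weak_deriv (\<lambda>_. 0) (\<lambda>x. f x - g x) x)\<^sup>2) \<partial>torus) + (\<Sum>i\<in>UNIV. \<integral>\<^sup>+x. ennreal ((weak_deriv (ei 1 i) (\<lambda>x. f x - g x) x)\<^sup>2) \<partial>torus)"
    using nz by (simp add: sum.reindex[OF inj] del: One_nat_def)
  also have "\<dots> = ennreal (nsq torus (\<lambda>x. f x - g x)) + (\<Sum>i\<in>UNIV. ennreal (nsq torus (\<lambda>x. wpd i f x - wpd i g x)))"
    unfolding eq by (simp add: weak_deriv_def nn_integral_nsq[OF s(1)])
  finally show ?thesis by (simp add: sum_nonneg)
qed

section \<open>Trigonometric polynomials and bounded multipliers\<close>

text \<open>Under the reflection a character with \<open>k 3 = 0\<close> is invariant while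
  \<open>W\<close> changes sign. These are exactly the modes that a vertical derivative cannot see,
  so the symmetry is what makes \<open>W\<close> recoverable from it.\<close>

lemma fc_reflect_odd:
  assumes W: "W \<in> borel_measurable torus" and odd: "\<And>x. W (reflect_z x) = - W x" and k: "k 3 = 0"
  shows "fc W k = 0"
proof -
  \<comment> \<open>The reflection, written in the diagonal form that the change of variables for
    \<open>lebesgue\<close> expects.\<close>
  define T :: "real^3 \<Rightarrow> real^3" where
    "T x = 0 + (\<Sum>j\<in>Basis. ((if j = (axis 3 1 :: real^3) then -1 else 1) * (x \<bullet> j)) *\<^sub>R j)" for x
  have T: "T x = reflect_z x" for x
  proof -
    have "T x = (\<Sum>i\<in>UNIV. ((if axis i 1 = (axis 3 1 :: real^3) then -1 else 1) * (x \<bullet> axis i 1)) *\<^sub>R axis i 1)"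
      unfolding T_def Basis_vec3 by (subst sum.reindex[OF inj_axis1]) simp
    then have "T x = (\<Sum>i\<in>UNIV. ((if i = 3 then -1 else 1) * (x $ i)) *\<^sub>R axis i 1)"
      by (simp add: axis_eq_axis inner_axis)
    also have "\<dots> = reflect_z x"
    proof (rule vec_eq_iff[THEN iffD2], rule allI)
      fix m :: 3
      have "(\<Sum>i\<in>UNIV. ((if i = 3 then -1 else 1) * (x $ i)) *\<^sub>R axis i (1::real)) $ m
        = (\<Sum>i\<in>UNIV. if i = m then (if i = 3 then -1 else 1) * (x $ i) else 0)"
        unfolding sum_component by (intro sum.cong) (auto simp: axis_def)
      then show "(\<Sum>i\<in>UNIV. ((if i = 3 then -1 else 1) * (x $ i)) *\<^sub>R axis i (1::real)) $ m = reflect_z x $ m"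
        by (simp add: reflect_z_def)
    qed
    finally show ?thesis .
  qed
  have "(lebesgue :: (real^3) measure) = density (distr lebesgue lebesgue T) (\<lambda>_. (\<Prod>j\<in>Basis. \<bar>if j = (axis 3 1 :: real^3) then -1 else 1 :: real\<bar>))"
    unfolding T_def by (rule lebesgue_affine_euclidean) simp
  also have "(\<Prod>j\<in>(Basis :: (real^3) set). \<bar>if j = (axis 3 1 :: real^3) then -1 else 1 :: real\<bar>) = 1"
    by (intro prod.neutral) simp
  finally have leb: "(lebesgue :: (real^3) measure) = distr lebesgue lebesgue T"
    by (simp add: density_1)
  have Tm: "T \<in> lebesgue \<rightarrow>\<^sub>M lebesgue"
    unfolding T_def by (rule lebesgue_affine_measurable) simp
  define F where "F x = indicator (cbox (-1) 1) x *\<^sub>R (complex_of_real (W x) * ek k x)" for x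
  have Fm: "F \<in> borel_measurable lebesgue"
    using W unfolding F_def torus_def
    by (subst borel_measurable_restrict_space_iff[symmetric]) (auto simp: torus_def[symmetric])
  have FT: "F (T x) = - F x" for x
  proof -
    have "indicator (cbox (-1) 1) (reflect_z x) = (indicator (cbox (-1) 1) x :: real)"
      by (auto simp: indicator_def mem_box_cart forall_3 reflect_z_def)
    moreover have "ek k (reflect_z x) = ek k x"
      using k by (simp add: ek_def sum_3 reflect_z_def)
    ultimately show ?thesis by (simp add: F_def T odd)
  qed
  have "fc W k = (\<integral>x. F x \<partial>lebesgue)"
    unfolding fc_def torus_def F_def by (rule integral_restrict_space) simp
  also have "\<dots> = (\<integral>x. F (T x) \<partial>lebesgue)"
    by (subst leb, rule integral_distr[OF Tm Fm])
  also have "\<dots> = - (\<integral>x. F x \<partial>lebesgue)"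
    unfolding FT by simp
  also have "(\<integral>x. F x \<partial>lebesgue) = fc W k"
    unfolding fc_def torus_def F_def by (rule integral_restrict_space[symmetric]) simp
  finally show ?thesis by (simp add: eq_neg_iff_add_eq_0)
qed

text \<open>Prescribing the coefficients freely allows vertical antiderivatives to be defined
  through division by \<open>- mu k 3\<close>.\<close>

definition tpoly :: "nat \<Rightarrow> ((3 \<Rightarrow> int) \<Rightarrow> complex) \<Rightarrow> real^3 \<Rightarrow> real" where
  "tpoly N A x = (\<Sum>k\<in>KB N. Re (A k * cnj (ek k x))) / 8"

lemma ps_eq_tpoly: "ps N f = tpoly N (fc f)"
  by (simp add: ps_def tpoly_def fun_eq_iff)

lemma L2_tpoly: "L2 (tpoly N A)"
proof -
  have "L2 (\<lambda>x. (1/8) * (\<Sum>k\<in>KB N. Re (A k * cnj (ek k x))))"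
    by (intro sqi_cmult sqi_sum sqi_Re_cnj_ek)
  then show ?thesis by (simp add: tpoly_def[abs_def])
qed

lemma fc_tpoly:
  assumes A: "\<And>k. A (\<lambda>i. - k i) = cnj (A k)"
  shows "fc (tpoly N A) l = (if l \<in> KB N then A l else 0)"
proof -
  have "fc (tpoly N A) l = fc (\<lambda>x. \<Sum>k\<in>KB N. (1/8) * Re (cnj (A k) * ek k x)) l"
    by (rule arg_cong[where f="\<lambda>h. fc h l"]) (simp add: tpoly_def fun_eq_iff sum_divide_distrib times_complex.sel)
  also have "\<dots> = (\<Sum>k\<in>KB N. (1/8) * (4 * ((if l = (\<lambda>i. - k i) then cnj (A k) else 0) + (if l = k then A k else 0))))"
  proof (subst fc_sum)
    show "integrable torus (\<lambda>x. 1 / 8 * Re (cnj (A k) * ek k x))" for k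
      by (intro L2_integrable sqi_cmult sqi_Re_ek)
    show "(\<Sum>k\<in>KB N. fc (\<lambda>x. 1 / 8 * Re (cnj (A k) * ek k x)) l) =
      (\<Sum>k\<in>KB N. (1/8) * (4 * ((if l = (\<lambda>i. - k i) then cnj (A k) else 0) + (if l = k then A k else 0))))"
      unfolding fc_cmult fc_Re_ek by (auto intro!: sum.cong)
  qed
  also have "\<dots> = (\<Sum>k\<in>KB N. (if k = (\<lambda>i. - l i) then cnj (A k) / 2 else 0)) + (\<Sum>k\<in>KB N. (if l = k then A k / 2 else 0))"
    by (subst sum.distrib[symmetric], rule sum.cong) (auto simp: fun_eq_iff)
  also have "\<dots> = (if l \<in> KB N then A l else 0)"
    by (simp add: KB_uminus sum.delta) (simp add: A)
  finally show ?thesis .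
qed

lemma ip_tpoly:
  assumes "L2 g"
  shows "ip torus g (tpoly N A) = (\<Sum>k\<in>KB N. Re (A k * cnj (fc g k))) / 8"
proof -
  have "ip torus g (tpoly N A) = (1/8) * ip torus g (\<lambda>x. \<Sum>k\<in>KB N. Re (A k * cnj (ek k x)))"
    unfolding tpoly_def[abs_def] ip_cmult_right[symmetric] by simp
  also have "ip torus g (\<lambda>x. \<Sum>k\<in>KB N. Re (A k * cnj (ek k x))) = (\<Sum>k\<in>KB N. Re (A k * cnj (fc g k)))"
    using Re_mult_fc[OF L2_integrable[OF assms]]
    by (subst ip_sum_right) (auto simp: assms ip_def cnj_ek sqi_Re_ek simp flip: fc_minus_index intro!: sum.cong)
  finally show ?thesis by simp
qed

lemma nrm_tpoly_le:
  assumes A: "\<And>k. A (\<lambda>i. - k i) = cnj (A k)" and F: "L2 F" and le: "\<And>k. norm (A k) \<le> norm (fc F k)"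
  shows "nrm torus (tpoly N A) \<le> nrm torus F"
proof -
  have "8 * nsq torus (tpoly N A) \<le> 8 * nsq torus F"
  proof (rule nsq_le_Parseval[OF L2_tpoly])
    fix M
    have "(\<Sum>k\<in>KB M. (norm (fc (tpoly N A) k))\<^sup>2) \<le> (\<Sum>k\<in>KB M. (norm (fc F k))\<^sup>2)"
      using le by (intro sum_mono power_mono) (auto simp: fc_tpoly[where A=A, OF A])
    also have "\<dots> \<le> 8 * nsq torus F" by (rule Bessel[OF F])
    finally show "(\<Sum>k\<in>KB M. (norm (fc (tpoly N A) k))\<^sup>2) \<le> 8 * nsq torus F" .
  qed
  then show ?thesis by (simp add: nrm_def)
qed

lemma fd_tpoly:
  assumes "\<And>k. A (\<lambda>i. - k i) = cnj (A k)" "\<And>k. A' (\<lambda>i. - k i) = cnj (A' k)"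
    "\<And>k. A' k = - mu k i * A k"
  shows "fd i (tpoly N A) (tpoly N A')"
  using assms(3) by (simp add: fd_def fc_tpoly[of A, OF assms(1)] fc_tpoly[of A', OF assms(2)])

lemma mu_uminus: "mu (\<lambda>i. - k i) i = cnj (mu k i)"
  by (simp add: mu_def)

lemma norm_mu_ge1: "k i \<noteq> 0 \<Longrightarrow> 1 \<le> norm (mu k i)"
proof -
  assume "k i \<noteq> 0"
  then have "1 * 1 \<le> pi * \<bar>real_of_int (k i)\<bar>"
    using pi_gt3 by (intro mult_mono) auto
  then show ?thesis by (simp add: norm_mu)
qed

definition Lb :: "real \<Rightarrow> (real^3 \<Rightarrow> real) \<Rightarrow> bool" where
  "Lb B f \<longleftrightarrow> f \<in> borel_measurable torus \<and> 0 \<le> B \<and> (AE x in torus. \<bar>f x\<bar> \<le> B)"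

lemma Lb_L2: "Lb B f \<Longrightarrow> L2 f"
  unfolding Lb_def using sqi_bounded[OF finite_measure_torus] by blast

lemma Lb_mult:
  assumes "Lb B f" "L2 g"
  shows "L2 (\<lambda>x. f x * g x)" "nrm torus (\<lambda>x. f x * g x) \<le> B * nrm torus g"
    "L2 (\<lambda>x. g x * f x)" "nrm torus (\<lambda>x. g x * f x) \<le> B * nrm torus g"
  using sqi_bounded_mult[OF assms(2), of f B] assms(1) by (auto simp: Lb_def mult.commute[of "g _"])

lemma Lb_diff:
  assumes "Lb B f" "Lb C g" shows "Lb (B + C) (\<lambda>x. f x - g x)"
proof -
  have "AE x in torus. \<bar>f x\<bar> \<le> B" "AE x in torus. \<bar>g x\<bar> \<le> C" using assms by (auto simp: Lb_def)
  then have "AE x in torus. \<bar>f x - g x\<bar> \<le> B + C" by eventually_elim linarith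
  then show ?thesis using assms by (auto simp: Lb_def)
qed

lemma sob_Lb: "sob 2 X f \<Longrightarrow> Lb X f"
  using sob_embedding[of X f] by (auto simp: Lb_def sob_def sqi_def)

lemma ip_mult_assoc: "ip torus (\<lambda>x. u x * f x) g = ip torus f (\<lambda>x. u x * g x)"
  by (simp add: ip_def mult_ac)

text \<open>The integrand is \<open>u\<close> times half the derivative of the square of
  \<open>f\<close>, so that after integration by parts only the derivative of \<open>u\<close>
  remains. Boundedness of \<open>f\<close> makes \<open>f * f\<close> and its derivative
  square-integrable, as \<open>fd_ibp\<close> requires.\<close>

lemma transport_ip:
  assumes "fd i u u'" "Lb b u" "Lb c u'" "fd i f f'" "Lb B f" "L2 f'"
  shows "2 * \<bar>ip torus (\<lambda>x. u x * f' x) f\<bar> \<le> c * nsq torus f"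
proof -
  note f = Lb_L2[OF assms(5)]
  have ff: "L2 (\<lambda>x. f x * f x)" "L2 (\<lambda>x. f' x * f x)" "L2 (\<lambda>x. f x * f' x)"
    using Lb_mult[OF assms(5) f] Lb_mult[OF assms(5,6)] by auto
  have "ip torus u (\<lambda>x. f' x * f x + f x * f' x) = - ip torus u' (\<lambda>x. f x * f x)"
  proof -
    have "ip torus u' (\<lambda>x. f x * f x) = - ip torus u (\<lambda>x. f' x * f x + f x * f' x)"
      by (intro fd_ibp[OF assms(1)] fd_mult assms f ff sqi_add Lb_L2[OF assms(2)] Lb_L2[OF assms(3)])
    then show ?thesis by simp
  qed
  moreover have "ip torus u (\<lambda>x. f' x * f x + f x * f' x) = 2 * ip torus (\<lambda>x. u x * f' x) f"
  proof -
    have "ip torus u (\<lambda>x. f' x * f x + f x * f' x) = (\<integral>x. 2 * (u x * f' x * f x) \<partial>torus)"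
      unfolding ip_def by (intro Bochner_Integration.integral_cong refl) (simp add: algebra_simps)
    then show ?thesis by (simp add: ip_def)
  qed
  moreover have "\<bar>ip torus u' (\<lambda>x. f x * f x)\<bar> \<le> c * nsq torus f"
  proof -
    have "ip torus u' (\<lambda>x. f x * f x) = ip torus (\<lambda>x. u' x * f x) f" by (simp add: ip_def mult.assoc)
    then have "\<bar>ip torus u' (\<lambda>x. f x * f x)\<bar> \<le> nrm torus (\<lambda>x. u' x * f x) * nrm torus f"
      using ip_Cauchy_Schwarz[OF Lb_mult(1)[OF assms(3) f] f] by simp
    also have "\<dots> \<le> (c * nrm torus f) * nrm torus f"
      by (intro mult_right_mono Lb_mult[OF assms(3) f]) simp
    finally show ?thesis by (simp add: mult.assoc flip: power2_eq_square)
  qed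
  ultimately show ?thesis by linarith
qed

section \<open>The energy estimate at a fixed time\<close>

lemma Lb_nrm: assumes "Lb B f" shows "nrm torus f \<le> 3 * B"
proof -
  have one: "L2 (\<lambda>x. 1)" by (simp add: sqi_def)
  have "nrm torus (\<lambda>x. 1) \<le> 3"
    using measure_torus by (simp add: nrm_def nsq_def real_le_lsqrt)
  then have "B * nrm torus (\<lambda>x. 1) \<le> B * 3" using assms by (intro mult_left_mono) (auto simp: Lb_def)
  then show ?thesis using Lb_mult(2)[OF assms one] by simp
qed

lemma hidx_simps [simp]: "hidx 1 = 1" "hidx 2 = 2"
  by (simp_all add: hidx_def)

lemma sum_UNIV_2: "(\<Sum>j\<in>(UNIV::2 set). f j) = f 1 + f 2"
  by (simp add: sum_2)

text \<open>The two systems at a fixed time; a prefix \<open>d\<close> marks spatial derivatives, a suffix \<open>t\<close> time derivatives,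
  and \<open>dvpz j i\<close> is \<open>\<partial>\<^sub>i \<partial>\<^sub>z\<close> of the velocity component \<open>j\<close>. The last quantity is bounded by the \<open>H\<^sup>4\<close> norm,
  which is only square integrable in time; hence the separate constant \<open>a\<close>.\<close>

locale pde_diff =
  fixes \<epsilon> a c :: real
    and se set sp spt we wet wp dset dwp3 :: "real^3 \<Rightarrow> real"
    and ve vp vet vpt :: "2 \<Rightarrow> real^3 \<Rightarrow> real"
    and dse dsp dwe ddwe :: "3 \<Rightarrow> real^3 \<Rightarrow> real"
    and dve dvp ddve ddvp dvpz :: "2 \<Rightarrow> 3 \<Rightarrow> real^3 \<Rightarrow> real"
  assumes eps: "0 < \<epsilon>" "\<epsilon> < 1" and c1: "1 \<le> c" and a0: "0 \<le> a"
    and fd_se: "\<And>i. fd i se (dse i)" and fd_sp: "\<And>i. fd i sp (dsp i)"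
    and L2_dse: "\<And>i. L2 (dse i)" and Lb_se: "Lb c se" and Lb_sp: "Lb c sp" and Lb_dsp: "\<And>i. Lb c (dsp i)"
    and Lb_ve: "\<And>j. Lb c (ve j)" and Lb_vp: "\<And>j. Lb c (vp j)"
    and fd_ve: "\<And>j i. fd i (ve j) (dve j i)" and fd_vp: "\<And>j i. fd i (vp j) (dvp j i)"
    and Lb_dve: "\<And>j i. Lb c (dve j i)" and Lb_dvp: "\<And>j i. Lb c (dvp j i)"
    and fd_dve: "\<And>j i. fd i (dve j i) (ddve j i)" and fd_dvp: "\<And>j i. fd i (dvp j i) (ddvp j i)"
    and L2_ddve: "\<And>j i. L2 (ddve j i)" and L2_ddvp: "\<And>j i. L2 (ddvp j i)"
    and nrm_ddvp: "\<And>j i. nrm torus (ddvp j i) \<le> c"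
    and fd_dvp3: "\<And>j i. fd i (dvp j 3) (dvpz j i)" and Lb_dvpz: "\<And>j i. Lb (c * a) (dvpz j i)"
    and Lb_we: "Lb c we" and Lb_wp: "Lb c wp" and fd_we: "fd 3 we (dwe 3)" and fd_wp: "fd 3 wp dwp3"
    and Lb_dwe3: "Lb c (dwe 3)" and L2_dwp3: "L2 dwp3"
    and L2_dwe: "\<And>i. L2 (dwe i)" and nrm_dwe: "\<And>i. nrm torus (dwe i) \<le> c"
    and L2_ddwe: "\<And>i. L2 (ddwe i)" and nrm_ddwe: "\<And>i. nrm torus (ddwe i) \<le> c"
    and L2_set: "L2 set" and L2_spt: "L2 spt" and L2_wet: "L2 wet" and nrm_wet: "nrm torus wet \<le> c"
    and L2_vet: "\<And>j. L2 (vet j)" and L2_vpt: "\<And>j. L2 (vpt j)"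
    and fd_set: "fd 3 set dset" and L2_dset: "L2 dset" and nrm_dset: "nrm torus dset \<le> c * \<epsilon>"
    and fc_spt: "\<And>k. k 3 \<noteq> 0 \<Longrightarrow> fc spt k = 0"
    and fc_we: "\<And>k. k 3 = 0 \<Longrightarrow> fc we k = 0" and fc_wp: "\<And>k. k 3 = 0 \<Longrightarrow> fc wp k = 0"
    and cf1: "AE x in torus. set x + ((\<Sum>j\<in>UNIV. ve j x * dse (hidx j) x) + we x * dse 3 x) + (\<Sum>j\<in>UNIV. dve j (hidx j) x) + dwe 3 x = 0"
    and cf2: "\<And>j. AE x in torus. vet j x + ((\<Sum>l\<in>UNIV. ve l x * dve j (hidx l) x) + we x * dve j 3 x) + dse (hidx j) x = (\<Sum>i\<in>UNIV. ddve j i x)"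
    and cf3: "AE x in torus. \<epsilon>\<^sup>2 * (wet x + ((\<Sum>j\<in>UNIV. ve j x * dwe (hidx j) x) + we x * dwe 3 x)) + dse 3 x = \<epsilon>\<^sup>2 * (\<Sum>i\<in>UNIV. ddwe i x)"
    and cp1: "AE x in torus. spt x + ((\<Sum>j\<in>UNIV. vp j x * dsp (hidx j) x) + wp x * dsp 3 x) + (\<Sum>j\<in>UNIV. dvp j (hidx j) x) + dwp3 x = 0"
    and cp2: "\<And>j. AE x in torus. vpt j x + ((\<Sum>l\<in>UNIV. vp l x * dvp j (hidx l) x) + wp x * dvp j 3 x) + dsp (hidx j) x = (\<Sum>i\<in>UNIV. ddvp j i x)"
    and cp3: "AE x in torus. dsp 3 x = 0"
begin

abbreviation "nt \<equiv> nrm torus"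
abbreviation "ipt \<equiv> ip torus"

definition "S x = se x - sp x"
definition "St x = set x - spt x"
definition "V j x = ve j x - vp j x"
definition "Vt j x = vet j x - vpt j x"
definition "W x = we x - wp x"
definition "dS i x = dse i x - dsp i x"
definition "dV j i x = dve j i x - dvp j i x"
definition "ddV j i x = ddve j i x - ddvp j i x"
definition "dW x = dwe 3 x - dwp3 x"
definition "y2 = nsq torus S + (\<Sum>j\<in>UNIV. nsq torus (V j))"
definition "d2 = (\<Sum>j\<in>UNIV. \<Sum>i\<in>UNIV. nsq torus (dV j i))"
text \<open>The continuity equations become \<open>St + R + dW = 0\<close>. The products are split
  so that \<open>W\<close> does not occur in \<open>R\<close>: it would be multiplied by the
  vertical derivative of \<open>sp\<close>, which is zero.\<close>

definition "R x = (\<Sum>j\<in>UNIV. ve j x * dS (hidx j) x) + (\<Sum>j\<in>UNIV. V j x * dsp (hidx j) x) + we x * dS 3 x + (\<Sum>j\<in>UNIV. dV j (hidx j) x)"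

lemma c0: "0 \<le> c" "0 < c" using c1 by auto

lemmas L2_Lb = Lb_se[THEN Lb_L2] Lb_sp[THEN Lb_L2] Lb_ve[THEN Lb_L2] Lb_vp[THEN Lb_L2]
  Lb_dve[THEN Lb_L2] Lb_dvp[THEN Lb_L2] Lb_we[THEN Lb_L2] Lb_wp[THEN Lb_L2] Lb_dsp[THEN Lb_L2] Lb_dvpz[THEN Lb_L2] Lb_dwe3[THEN Lb_L2]

lemma L2_diffs: "L2 S" "L2 St" "L2 (V j)" "L2 (Vt j)" "L2 W" "L2 (dS i)" "L2 (dV j i)" "L2 (ddV j i)" "L2 dW"
  unfolding S_def[abs_def] St_def[abs_def] V_def[abs_def] Vt_def[abs_def] W_def[abs_def] dS_def[abs_def] dV_def[abs_def] ddV_def[abs_def] dW_def[abs_def]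
  by (intro sqi_diff L2_Lb L2_set L2_spt L2_vet L2_vpt L2_dse L2_ddve L2_ddvp L2_dwp3)+

lemma fd_S: "fd i S (dS i)"
  unfolding S_def[abs_def] dS_def[abs_def] by (intro fd_diff fd_se fd_sp L2_Lb L2_dse)

lemma fd_V: "fd i (V j) (dV j i)"
  unfolding V_def[abs_def] dV_def[abs_def] by (intro fd_diff fd_ve fd_vp L2_Lb)

lemma fd_dV: "fd i (dV j i) (ddV j i)"
  unfolding ddV_def[abs_def] dV_def[abs_def] by (intro fd_diff fd_dve fd_dvp L2_Lb L2_ddve L2_ddvp)

lemma fd_W: "fd 3 W dW"
  unfolding W_def[abs_def] dW_def[abs_def] by (intro fd_diff fd_we fd_wp L2_Lb L2_dwp3)

lemma Lb_S: "Lb (c + c) S"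
  unfolding S_def[abs_def] by (intro Lb_diff Lb_se Lb_sp)

lemma Lb_V: "Lb (c + c) (V j)"
  unfolding V_def[abs_def] by (intro Lb_diff Lb_ve Lb_vp)

lemma Lb_W: "Lb (c + c) W"
  unfolding W_def[abs_def] by (intro Lb_diff Lb_we Lb_wp)

lemma y2_nonneg: "0 \<le> y2" and d2_nonneg: "0 \<le> d2"
  by (auto simp: y2_def d2_def intro!: sum_nonneg add_nonneg_nonneg)

definition "y = sqrt y2"
definition "d = sqrt d2"

lemma yd: "0 \<le> y" "0 \<le> d" "y\<^sup>2 = y2" "d\<^sup>2 = d2"
  by (simp_all add: y_def d_def y2_nonneg d2_nonneg)

lemma nS: "nt S \<le> y"
  unfolding nrm_def y_def by (intro real_sqrt_le_mono) (simp add: y2_def sum_nonneg)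

lemma nV: "nt (V j) \<le> y"
  unfolding nrm_def y_def y2_def
  by (intro real_sqrt_le_mono order_trans[OF member_le_sum[of j UNIV "\<lambda>j. nsq torus (V j)"]]) auto

lemma ndV: "nt (dV j i) \<le> d"
proof -
  have "nsq torus (dV j i) \<le> (\<Sum>i\<in>UNIV. nsq torus (dV j i))"
    by (rule member_le_sum[of i UNIV]) auto
  also have "\<dots> \<le> d2"
    unfolding d2_def by (rule member_le_sum[of j UNIV "\<lambda>j. \<Sum>i\<in>UNIV. nsq torus (dV j i)"]) (auto intro: sum_nonneg)
  finally show ?thesis unfolding nrm_def d_def by (rule real_sqrt_le_mono)
qed

lemma eq_S: "AE x in torus. St x = - (R x + dW x)"
  using cf1 cp1 cp3
  by eventually_elim (simp add: St_def R_def dW_def dS_def dV_def V_def sum_UNIV_2 algebra_simps)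

text \<open>Each product is split with the compressible velocity on derivatives of differences and
  the limit's derivatives on differences. The last product, containing \<open>W\<close>, is the one
  without a direct bound.\<close>

lemma eq_V: "AE x in torus. Vt j x = (\<Sum>i\<in>UNIV. ddV j i x) - dS (hidx j) x
   - (\<Sum>l\<in>UNIV. ve l x * dV j (hidx l) x) - (\<Sum>l\<in>UNIV. V l x * dvp j (hidx l) x) - we x * dV j 3 x - W x * dvp j 3 x"
  using cf2[of j] cp2[of j]
  by eventually_elim (simp add: Vt_def W_def dS_def dV_def V_def ddV_def sum_subtractf sum_UNIV_2 algebra_simps)

text \<open>The vertical momentum equation writes this derivative as
  \<open>\<epsilon>\<^sup>2 * Q\<close>. The seven terms of \<open>Q\<close> are three second
  derivatives, \<open>wet\<close> and three transport terms, each of norm at most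
  \<open>c\<^sup>2\<close> because \<open>1 \<le> c\<close>.\<close>

lemma n_dse3: "nt (dse 3) \<le> 7 * c\<^sup>2 * \<epsilon>\<^sup>2"
proof -
  define Q where "Q x = (\<Sum>i\<in>UNIV. ddwe i x) - (wet x + ((\<Sum>j\<in>UNIV. ve j x * dwe (hidx j) x) + we x * dwe 3 x))" for x
  have p: "L2 (\<lambda>x. ve j x * dwe i x)" "nt (\<lambda>x. ve j x * dwe i x) \<le> c * c"
    "L2 (\<lambda>x. we x * dwe i x)" "nt (\<lambda>x. we x * dwe i x) \<le> c * c" for i j
    using Lb_mult(1,2)[OF Lb_ve L2_dwe, of j i] Lb_mult(1,2)[OF Lb_we L2_dwe, of i]
      mult_left_mono[OF nrm_dwe[of i] c0(1)] by auto
  note s = L2_ddwe L2_wet p(1,3)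
  have L2Q: "L2 Q" unfolding Q_def[abs_def] by (intro sqi_diff sqi_add sqi_sum s)
  have "nt Q \<le> nt (\<lambda>x. \<Sum>i\<in>UNIV. ddwe i x) + nt (\<lambda>x. wet x + ((\<Sum>j\<in>UNIV. ve j x * dwe (hidx j) x) + we x * dwe 3 x))"
    unfolding Q_def[abs_def] by (intro nrm_triangle_diff sqi_diff sqi_add sqi_sum s)
  also have "nt (\<lambda>x. \<Sum>i\<in>UNIV. ddwe i x) \<le> (\<Sum>i\<in>(UNIV::3 set). nt (ddwe i))"
    by (rule nrm_sum_le) (rule s)
  also have "\<dots> \<le> (\<Sum>i\<in>(UNIV::3 set). c)" by (intro sum_mono nrm_ddwe)
  also have "nt (\<lambda>x. wet x + ((\<Sum>j\<in>UNIV. ve j x * dwe (hidx j) x) + we x * dwe 3 x))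
     \<le> nt wet + nt (\<lambda>x. (\<Sum>j\<in>UNIV. ve j x * dwe (hidx j) x) + we x * dwe 3 x)"
    by (intro nrm_triangle sqi_diff sqi_add sqi_sum s)
  also have "nt (\<lambda>x. (\<Sum>j\<in>UNIV. ve j x * dwe (hidx j) x) + we x * dwe 3 x)
     \<le> nt (\<lambda>x. \<Sum>j\<in>UNIV. ve j x * dwe (hidx j) x) + nt (\<lambda>x. we x * dwe 3 x)"
    by (intro nrm_triangle sqi_diff sqi_add sqi_sum s)
  also have "nt (\<lambda>x. \<Sum>j\<in>UNIV. ve j x * dwe (hidx j) x) \<le> (\<Sum>j\<in>(UNIV::2 set). nt (\<lambda>x. ve j x * dwe (hidx j) x))"
    by (rule nrm_sum_le) (rule s)
  also have "\<dots> \<le> (\<Sum>j\<in>(UNIV::2 set). c * c)" by (intro sum_mono p)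
  finally have "nt Q \<le> 3 * c + c + 3 * (c * c)"
    using nrm_wet p(4)[of 3] by simp
  also have "\<dots> \<le> 7 * c\<^sup>2"
    using mult_left_mono[OF c1 c0(1)] by (simp add: power2_eq_square)
  finally have nQ: "nt Q \<le> 7 * c\<^sup>2" .
  have "AE x in torus. dse 3 x = \<epsilon>\<^sup>2 * Q x"
    using cf3 by eventually_elim (simp add: Q_def algebra_simps)
  then have "nt (dse 3) = nt (\<lambda>x. \<epsilon>\<^sup>2 * Q x)"
    unfolding nrm_def using sqi_meas[OF L2_dse] sqi_meas[OF L2Q] by (subst nsq_cong_AE) auto
  also have "\<dots> = \<epsilon>\<^sup>2 * nt Q" by simp
  also have "\<dots> \<le> \<epsilon>\<^sup>2 * (7 * c\<^sup>2)" using nQ by (intro mult_left_mono) auto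
  finally show ?thesis by (simp add: mult.commute)
qed

lemma n_dS3: "nt (dS 3) \<le> 7 * c\<^sup>2 * \<epsilon>\<^sup>2"
proof -
  have "AE x in torus. dS 3 x = dse 3 x" using cp3 by eventually_elim (simp add: dS_def)
  then have "nt (dS 3) = nt (dse 3)"
    unfolding nrm_def using sqi_meas[OF L2_dse] sqi_meas[OF L2_diffs(6)] by (subst nsq_cong_AE) auto
  then show ?thesis using n_dse3 by simp
qed

lemma eps_sq: "\<epsilon>\<^sup>2 \<le> \<epsilon>"
  using eps by (simp add: power2_eq_square mult_left_le)

text \<open>All modes of \<open>spt\<close> have \<open>k 3 = 0\<close>, where \<open>mu k 3\<close>
  vanishes. Hence the vertical derivative of the difference is that of \<open>set\<close> alone,
  which is of order \<open>\<epsilon>\<close>.\<close>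

lemma fd_St: "fd 3 St dset"
  unfolding fd_def
proof
  fix k
  have "fc St k = fc set k - fc spt k"
    unfolding St_def[abs_def] by (intro fc_diff L2_integrable L2_set L2_spt)
  moreover have "mu k 3 = 0" if "k 3 = 0" using that by (simp add: mu_def)
  ultimately show "fc dset k = - mu k 3 * fc St k"
    using fd_set fc_spt[of k] by (cases "k 3 = 0") (auto simp: fd_def)
qed

section \<open>The product of \<open>W\<close> with the vertical shear of the limit\<close>

definition "F x = (\<Sum>j\<in>UNIV. dvp j 3 x * V j x)"
definition "dF l x = (\<Sum>j\<in>UNIV. dvpz j l x * V j x + dvp j 3 x * dV j l x)"

lemma L2_prod: "L2 (\<lambda>x. dvp j i x * V l x)" "L2 (\<lambda>x. dvpz j i x * V l x)" "L2 (\<lambda>x. dvp j i x * dV l m x)"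
  "L2 (\<lambda>x. ve j x * dS i x)" "L2 (\<lambda>x. V j x * dsp i x)" "L2 (\<lambda>x. we x * dS i x)"
  "L2 (\<lambda>x. ve j x * dV l i x)" "L2 (\<lambda>x. V j x * dvp l i x)" "L2 (\<lambda>x. we x * dV l i x)" "L2 (\<lambda>x. W x * dvp l i x)"
  by (intro Lb_mult(1)[OF Lb_dvp] Lb_mult(1)[OF Lb_dvpz] Lb_mult(1)[OF Lb_ve] Lb_mult(3)[OF Lb_dsp] Lb_mult(1)[OF Lb_we] Lb_mult(3)[OF Lb_dvp] L2_diffs)+

lemma L2_F: "L2 F" "L2 (dF l)"
  unfolding F_def[abs_def] dF_def[abs_def] by (intro sqi_sum sqi_add L2_prod)+

lemma fd_F: "fd l F (dF l)"
  unfolding F_def[abs_def] dF_def[abs_def]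
  by (intro fd_sum conjI fd_mult fd_dvp3 fd_V L2_prod sqi_add L2_Lb L2_diffs)

lemma n_F: "nt F \<le> 2 * c * y"
proof -
  have "nt F \<le> (\<Sum>j\<in>UNIV. nt (\<lambda>x. dvp j 3 x * V j x))"
    unfolding F_def[abs_def] by (intro nrm_sum_le L2_prod)
  also have "\<dots> \<le> (\<Sum>j\<in>(UNIV::2 set). c * y)"
    by (intro sum_mono order_trans[OF Lb_mult(2)[OF Lb_dvp L2_diffs(3)]] mult_left_mono nV c0)
  finally show ?thesis by simp
qed

lemma n_dF: "nt (dF l) \<le> 2 * c * (a * y + d)"
proof -
  have "nt (dF l) \<le> (\<Sum>j\<in>UNIV. nt (\<lambda>x. dvpz j l x * V j x + dvp j 3 x * dV j l x))"
    unfolding dF_def[abs_def] by (intro nrm_sum_le L2_prod sqi_add)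
  also have "\<dots> \<le> (\<Sum>j\<in>(UNIV::2 set). c * a * y + c * d)"
    by (intro sum_mono order_trans[OF nrm_triangle] add_mono order_trans[OF Lb_mult(2)[OF Lb_dvpz L2_diffs(3)]]
      order_trans[OF Lb_mult(2)[OF Lb_dvp L2_diffs(7)]] mult_left_mono mult_nonneg_nonneg nV ndV c0 a0 L2_prod)
  finally show ?thesis by (simp add: algebra_simps)
qed

lemma CS: "L2 f \<Longrightarrow> L2 g \<Longrightarrow> nt f \<le> A \<Longrightarrow> nt g \<le> B \<Longrightarrow> \<bar>ipt f g\<bar> \<le> A * B"
  using ip_Cauchy_Schwarz[of torus f g] mult_mono[of "nt f" A "nt g" B] order_trans[of 0 "nt f" A] by force

lemma n_prods: "nt (\<lambda>x. V j x * dsp i x) \<le> c * y" "nt (\<lambda>x. V j x * dvp l i x) \<le> c * y" "nt (\<lambda>x. we x * dS 3 x) \<le> c * (7 * c\<^sup>2 * \<epsilon>\<^sup>2)"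
  by (intro order_trans[OF Lb_mult(4)[OF Lb_dsp L2_diffs(3)]] order_trans[OF Lb_mult(4)[OF Lb_dvp L2_diffs(3)]]
     order_trans[OF Lb_mult(2)[OF Lb_we L2_diffs(6)]] mult_left_mono nV n_dS3 c0)+

lemma ip_R_split:
  assumes "L2 g"
  shows "ipt R g = (\<Sum>j\<in>UNIV. ipt (\<lambda>x. ve j x * dS (hidx j) x) g) + (\<Sum>j\<in>UNIV. ipt (\<lambda>x. V j x * dsp (hidx j) x) g)
    + ipt (\<lambda>x. we x * dS 3 x) g + (\<Sum>j\<in>UNIV. ipt (dV j (hidx j)) g)"
  unfolding R_def[abs_def]
  by (simp add: ip_add_left ip_sum_left sqi_add sqi_sum L2_prod L2_diffs assms)

lemma L2_R: "L2 R"
  unfolding R_def[abs_def] by (intro sqi_add sqi_sum L2_prod L2_diffs)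

text \<open>\<open>W\<close> is controlled only through \<open>\<partial>\<^sub>z W\<close>, which the continuity equations express by \<open>R\<close> and \<open>\<partial>\<^sub>t S\<close>. So
  \<open>ps N F\<close> is replaced by the \<open>z\<close>-derivative of its antiderivative \<open>G\<close>, and the derivatives in \<open>R\<close> are moved
  to \<open>G\<close>; the modes with \<open>k 3 = 0\<close> do not matter because \<open>W\<close> is odd in \<open>z\<close>.\<close>

lemma ip_W_ps_bound:
  "\<bar>ipt W (ps N F)\<bar> \<le> c * \<epsilon> * nt F + (2 * (y * (c * nt F + c * (2 * c * (a * y + d)))) + 2 * (c * y * nt F) + c * (7 * c\<^sup>2 * \<epsilon>\<^sup>2) * nt F + 2 * (d * nt F))"
proof -
  \<comment> \<open>\<open>A\<close> gives the coefficients of \<open>G\<close>, \<open>A1\<close>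
    those of \<open>ps N F\<close> without the modes \<open>k 3 = 0\<close>, \<open>A2\<close> those
    of a second antiderivative \<open>H\<close>, and \<open>B l\<close> those of the derivative of
    \<open>G\<close> in direction \<open>l\<close>.\<close>
  define A where "A k = (if k 3 = 0 then 0 else fc F k / (- mu k 3))" for k
  define A1 where "A1 k = (if k 3 = 0 then 0 else fc F k)" for k
  define A2 where "A2 k = (if k 3 = 0 then 0 else A k / (- mu k 3))" for k
  define B where "B l k = - mu k l * A k" for l k
  have mu0: "mu k 3 = 0 \<longleftrightarrow> k 3 = 0" for k by (simp add: mu_def)
  have her: "A (\<lambda>i. - k i) = cnj (A k)" "A1 (\<lambda>i. - k i) = cnj (A1 k)" "A2 (\<lambda>i. - k i) = cnj (A2 k)" "B l (\<lambda>i. - k i) = cnj (B l k)" for k l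
    by (simp_all add: A_def A1_def A2_def B_def fc_minus_index mu_uminus)
  \<comment> \<open>Taking a vertical antiderivative does not increase the norm, since
    \<open>mu k 3\<close> has modulus at least 1 whenever \<open>k 3 \<noteq> 0\<close>.\<close>
  have div_le: "norm (z / (- mu k 3)) \<le> norm z" if "k 3 \<noteq> 0" for z k
  proof -
    have m: "1 \<le> norm (mu k 3)" by (rule norm_mu_ge1[of k 3, OF that])
    from mult_left_mono[OF m norm_ge_zero[of z]] have "norm z \<le> norm z * norm (mu k 3)" by simp
    moreover have "0 < norm (mu k 3)" using m by linarith
    ultimately show ?thesis by (simp add: norm_divide divide_le_eq)
  qed
  have leA: "norm (A k) \<le> norm (fc F k)" for k
    using div_le[of k "fc F k"] by (auto simp: A_def)
  have leA2: "norm (A2 k) \<le> norm (fc F k)" for k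
    using order_trans[OF div_le[of k "A k"] leA[of k]] by (auto simp: A2_def)
  \<comment> \<open>The derivative of \<open>G\<close> is the vertical antiderivative of a
    derivative of \<open>F\<close>. This is where second derivatives of \<open>vp\<close> enter,
    through \<open>dF\<close>.\<close>
  have leB: "norm (B l k) \<le> norm (fc (dF l) k)" for l k
    using mult_left_mono[OF leA[of k] norm_ge_zero[of "mu k l"]] fd_F[of l] by (simp add: B_def fd_def norm_mult)
  define G H P where "G = tpoly N A" and "H = tpoly N A2" and "P = tpoly N A1"
  define dG where "dG l = tpoly N (B l)" for l
  have L2G: "L2 G" "L2 H" "L2 P" "L2 (dG l)" for l by (auto simp: G_def H_def P_def dG_def L2_tpoly)
  have nG: "nt G \<le> nt F" "nt H \<le> nt F" "nt (dG l) \<le> nt (dF l)" for l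
    unfolding G_def H_def dG_def by (intro nrm_tpoly_le her L2_F leA leA2 leB)+
  have fdG: "fd 3 G P" "fd 3 H G" "fd l G (dG l)" for l
    unfolding G_def H_def dG_def P_def
    by (intro fd_tpoly her; simp add: A_def A1_def A2_def B_def mu0)+
  have "ipt W (ps N F) = ipt W P"
    unfolding ps_eq_tpoly P_def ip_tpoly[OF L2_diffs(5)]
  proof (intro arg_cong[where f="\<lambda>x. x / 8"] sum.cong refl)
    fix k
    have "fc W k = fc we k - fc wp k"
      unfolding W_def[abs_def] by (intro fc_diff L2_integrable L2_Lb)
    then show "Re (fc F k * cnj (fc W k)) = Re (A1 k * cnj (fc W k))"
      using fc_we[of k] fc_wp[of k] by (auto simp: A1_def)
  qed
  also have "\<dots> = - ipt dW G"
    using fd_ibp[OF fd_W fdG(1) L2_diffs(5,9) L2G(1,3)] by simp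
  also have "ipt dW G = - ipt St G - ipt R G"
  proof -
    have "ipt dW G = ipt (\<lambda>x. - St x - R x) G"
      by (rule ip_cong_AE) (use eq_S L2_diffs L2_R L2G in \<open>auto simp: sqi_def\<close>)
    also have "\<dots> = ipt (\<lambda>x. - St x) G - ipt R G"
      by (intro ip_diff_left sqi_uminus L2_diffs L2_R L2G)
    finally show ?thesis by (simp add: ip_uminus_left)
  qed
  finally have WP: "\<bar>ipt W (ps N F)\<bar> \<le> \<bar>ipt St G\<bar> + \<bar>ipt R G\<bar>" by simp
  \<comment> \<open>\<open>St\<close> itself is not known to be small, but its vertical derivative
    is of order \<open>\<epsilon>\<close>. Therefore \<open>G\<close> is used as the vertical
    derivative of \<open>H\<close>.\<close>
  have "ipt dset H = - ipt St G"
    by (rule fd_ibp[OF fd_St fdG(2) L2_diffs(2) L2_dset L2G(2,1)])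
  then have b1: "\<bar>ipt St G\<bar> \<le> c * \<epsilon> * nt F"
    using CS[OF L2_dset L2G(2) nrm_dset nG(2)] by simp
  \<comment> \<open>No dissipation controls the gradient of \<open>S\<close>; the derivative is
    moved to the product of \<open>ve\<close> and \<open>G\<close>.\<close>
  have b2: "\<bar>ipt (\<lambda>x. ve j x * dS (hidx j) x) G\<bar> \<le> y * (c * nt F + c * (2 * c * (a * y + d)))" for j
  proof -
    let ?l = "hidx j"
    have l: "L2 (\<lambda>x. ve j x * G x)" "L2 (\<lambda>x. dve j ?l x * G x)" "L2 (\<lambda>x. ve j x * dG ?l x)"
      by (intro Lb_mult(1)[OF Lb_ve] Lb_mult(1)[OF Lb_dve] L2G)+
    have "ipt (\<lambda>x. ve j x * dS ?l x) G = ipt (dS ?l) (\<lambda>x. ve j x * G x)" by (rule ip_mult_assoc)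
    also have "\<dots> = - ipt S (\<lambda>x. dve j ?l x * G x + ve j x * dG ?l x)"
      by (intro fd_ibp[OF fd_S] fd_mult fd_ve fdG l sqi_add L2_diffs L2_Lb L2G)
    finally have *: "\<bar>ipt (\<lambda>x. ve j x * dS ?l x) G\<bar> = \<bar>ipt S (\<lambda>x. dve j ?l x * G x + ve j x * dG ?l x)\<bar>" by simp
    have "nt (\<lambda>x. dve j ?l x * G x + ve j x * dG ?l x) \<le> c * nt F + c * (2 * c * (a * y + d))"
      by (intro order_trans[OF nrm_triangle[OF l(2,3)]] add_mono order_trans[OF Lb_mult(2)[OF Lb_dve L2G(1)]]
        order_trans[OF Lb_mult(2)[OF Lb_ve L2G(4)]] mult_left_mono nG c0 order_trans[OF nG(3) n_dF])
    from CS[OF L2_diffs(1) sqi_add[OF l(2,3)] nS this] show ?thesis unfolding * .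
  qed
  have b3: "\<bar>ipt (\<lambda>x. V j x * dsp (hidx j) x) G\<bar> \<le> c * y * nt F" for j
    by (intro CS L2_prod L2G n_prods nG)
  have b4: "\<bar>ipt (\<lambda>x. we x * dS 3 x) G\<bar> \<le> c * (7 * c\<^sup>2 * \<epsilon>\<^sup>2) * nt F"
    by (intro CS L2_prod L2G n_prods nG)
  have b5: "\<bar>ipt (dV j (hidx j)) G\<bar> \<le> d * nt F" for j
    by (intro CS L2_diffs L2G ndV nG)
  have "\<bar>ipt R G\<bar> \<le> 2 * (y * (c * nt F + c * (2 * c * (a * y + d)))) + 2 * (c * y * nt F) + c * (7 * c\<^sup>2 * \<epsilon>\<^sup>2) * nt F + 2 * (d * nt F)"
    unfolding ip_R_split[OF L2G(1)] sum_UNIV_2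
    using b2[of 1] b2[of 2] b3[of 1] b3[of 2] b4 b5[of 1] b5[of 2] by linarith
  then show ?thesis using WP b1 by linarith
qed

text \<open>The bound for \<open>ps N F\<close> does not depend on \<open>N\<close> and passes to
  the limit. Young's inequality then uses up only half of the dissipation \<open>d2\<close>. The
  possibly large factor \<open>a\<close> stays attached to \<open>y2\<close>, where Gronwall's
  inequality can absorb it.\<close>

lemma ip_W_F: "\<bar>ipt W F\<bar> \<le> d2 / 2 + 48 * c ^ 4 * (1 + a) * y2 + 8 * c ^ 4 * \<epsilon>\<^sup>2"
proof -
  let ?B = "c * \<epsilon> * nt F + (2 * (y * (c * nt F + c * (2 * c * (a * y + d)))) + 2 * (c * y * nt F) + c * (7 * c\<^sup>2 * \<epsilon>\<^sup>2) * nt F + 2 * (d * nt F))"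
  have "(\<lambda>N. nsq torus (\<lambda>x. ps N F x - F x)) \<longlonglongrightarrow> 0"
    using ps_tendsto[OF L2_F(1)] by (simp add: nsq_def power2_commute)
  from tendsto_nrm_zero_ip[OF sqi_ps L2_F(1) L2_diffs(5) this]
  have "(\<lambda>N. \<bar>ipt W (ps N F)\<bar>) \<longlonglongrightarrow> \<bar>ipt W F\<bar>"
    by (subst (1 2) ip_commute) (rule tendsto_rabs)
  then have "\<bar>ipt W F\<bar> \<le> ?B"
    by (rule LIMSEQ_le_const2) (use ip_W_ps_bound in auto)
  also have "\<dots> = nt F * (c * \<epsilon> + 4 * c * y + 7 * c ^ 3 * \<epsilon>\<^sup>2 + 2 * d) + 4 * c\<^sup>2 * y * (a * y + d)"
    by (simp add: algebra_simps power2_eq_square power3_eq_cube)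
  also have "\<dots> \<le> (2 * c * y) * (c * \<epsilon> + 4 * c * y + 7 * c ^ 3 * \<epsilon> + 2 * d) + 4 * c\<^sup>2 * y * (a * y + d)"
    using n_F yd(1,2) c0 eps eps_sq
    by (intro add_right_mono mult_mono add_mono mult_left_mono) (auto intro!: add_nonneg_nonneg mult_nonneg_nonneg)
  also have "\<dots> = (2 * c\<^sup>2 + 14 * c ^ 4) * (\<epsilon> * y) + 8 * c\<^sup>2 * y2 + 4 * c\<^sup>2 * a * y2 + (4 * c + 4 * c\<^sup>2) * (y * d)"
    unfolding yd(3)[symmetric] by (simp add: algebra_simps power2_eq_square power4_eq_xxxx power3_eq_cube)
  also have "\<dots> \<le> (16 * c ^ 4) * (\<epsilon> * y) + 8 * c ^ 4 * y2 + 4 * c ^ 4 * a * y2 + 8 * c\<^sup>2 * (y * d)"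
  proof -
    have c2: "c\<^sup>2 \<le> c ^ 4" "c \<le> c\<^sup>2"
      using power_increasing[of 2 4 c] power_increasing[of 1 2 c] c1 by auto
    have nn: "0 \<le> \<epsilon> * y" "0 \<le> y * d" "0 \<le> a * y2" using yd eps a0 y2_nonneg by auto
    show ?thesis
      using mult_right_mono[OF c2(1) nn(1)] mult_right_mono[OF c2(1) y2_nonneg] mult_right_mono[OF c2(1) nn(3)] mult_right_mono[OF c2(2) nn(2)]
      by (simp add: algebra_simps)
  qed
  \<comment> \<open>The weight in the product \<open>y * d\<close> is chosen so that
    \<open>d2\<close> receives exactly one half. The terms in \<open>y2\<close> then add up to 8 + 8
    + 32 = 48.\<close>
  also have "\<dots> \<le> 8 * c ^ 4 * (\<epsilon>\<^sup>2 + y2) + 8 * c ^ 4 * y2 + 4 * c ^ 4 * a * y2 + (d2 / 2 + 32 * c ^ 4 * y2)"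
  proof -
    have "2 * (\<epsilon> * y) \<le> \<epsilon>\<^sup>2 + y2" using sum_squares_bound[of \<epsilon> y] yd(3) by simp
    from mult_left_mono[OF this, of "8 * c ^ 4"] have "16 * c ^ 4 * (\<epsilon> * y) \<le> 8 * c ^ 4 * (\<epsilon>\<^sup>2 + y2)" by simp
    moreover have "8 * c\<^sup>2 * (y * d) \<le> d2 / 2 + 32 * c ^ 4 * y2"
      using sum_squares_bound[of d "8 * c\<^sup>2 * y"] unfolding yd(3,4)[symmetric]
      by (simp add: power_mult_distrib power4_eq_xxxx power2_eq_square algebra_simps)
    ultimately show ?thesis by linarith
  qed
  also have "\<dots> \<le> d2 / 2 + 48 * c ^ 4 * (1 + a) * y2 + 8 * c ^ 4 * \<epsilon>\<^sup>2"
  proof -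
    have "0 \<le> c ^ 4 * (a * y2)" using a0 y2_nonneg by simp
    then show ?thesis by (simp add: algebra_simps)
  qed
  finally show ?thesis .
qed

text \<open>Here \<open>W\<close> is bounded but not small. Integration by parts pairs it with the
  vertical derivative of \<open>S\<close>, and that derivative has the order
  \<open>\<epsilon>\<^sup>2\<close> which the final estimate allows.\<close>

lemma ip_W_dS3: "\<bar>ipt dW S\<bar> \<le> 42 * c ^ 4 * \<epsilon>\<^sup>2"
proof -
  have "ipt dW S = - ipt W (dS 3)"
    by (intro fd_ibp[OF fd_W fd_S] L2_diffs)
  moreover have "\<bar>ipt W (dS 3)\<bar> \<le> (3 * (c + c)) * (7 * c\<^sup>2 * \<epsilon>\<^sup>2)"
    by (intro CS L2_diffs Lb_nrm Lb_W n_dS3)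
  moreover have "(3 * (c + c)) * (7 * c\<^sup>2 * \<epsilon>\<^sup>2) \<le> 42 * c ^ 4 * \<epsilon>\<^sup>2"
    using mult_right_mono[OF power_increasing[of 3 4 c], of "\<epsilon>\<^sup>2"] c1
    by (simp add: power3_eq_cube power4_eq_xxxx power2_eq_square algebra_simps)
  ultimately show ?thesis by linarith
qed

lemma nsq_le_y2: "nsq torus S \<le> y2" "nsq torus (V 1) + nsq torus (V 2) \<le> y2"
  by (simp_all add: y2_def sum_UNIV_2 add_nonneg_nonneg)

text \<open>The pressure gradient tested with \<open>V\<close> cancels the divergence tested with
  \<open>S\<close>, so the horizontal gradient of \<open>S\<close> leaves the balance. The remaining
  factors, 11 + 48 at \<open>y2\<close> and 42 + 8 at \<open>\<epsilon>\<^sup>2\<close>, are both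
  below 60.\<close>

theorem energy_inequality:
  "ipt St S + (\<Sum>j\<in>UNIV. ipt (Vt j) (V j)) \<le> - d2 / 2 + 60 * c ^ 4 * ((1 + a) * y2 + \<epsilon>\<^sup>2)"
proof -
  have St: "ipt St S = - ipt R S - ipt dW S"
  proof -
    have "ipt St S = ipt (\<lambda>x. - (R x + dW x)) S"
      by (rule ip_cong_AE) (use eq_S L2_diffs L2_R in \<open>auto simp: sqi_def\<close>)
    then show ?thesis unfolding ip_uminus_left ip_add_left[OF L2_R L2_diffs(9,1)] by simp
  qed
  have Vt: "ipt (Vt j) (V j) = (\<Sum>i\<in>UNIV. ipt (ddV j i) (V j)) - ipt (dS (hidx j)) (V j)
     - (\<Sum>l\<in>UNIV. ipt (\<lambda>x. ve l x * dV j (hidx l) x) (V j)) - (\<Sum>l\<in>UNIV. ipt (\<lambda>x. V l x * dvp j (hidx l) x) (V j))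
     - ipt (\<lambda>x. we x * dV j 3 x) (V j) - ipt (\<lambda>x. W x * dvp j 3 x) (V j)" for j
  proof -
    let ?Q = "\<lambda>x. (\<Sum>i\<in>UNIV. ddV j i x) - dS (hidx j) x - (\<Sum>l\<in>UNIV. ve l x * dV j (hidx l) x)
       - (\<Sum>l\<in>UNIV. V l x * dvp j (hidx l) x) - we x * dV j 3 x - W x * dvp j 3 x"
    have "L2 ?Q" by (intro sqi_diff sqi_sum L2_prod L2_diffs)
    then have "ipt (Vt j) (V j) = ipt ?Q (V j)"
      by (intro ip_cong_AE) (use eq_V[of j] L2_diffs in \<open>auto simp: sqi_def\<close>)
    then show ?thesis by (simp add: ip_diff_left ip_sum_left sqi_diff sqi_sum L2_prod L2_diffs)
  qed
  have dd: "ipt (ddV j i) (V j) = - nsq torus (dV j i)" for j i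
    unfolding ip_self[symmetric] by (intro fd_ibp[OF fd_dV fd_V] L2_diffs)
  have div: "ipt (dV j (hidx j)) S = - ipt (dS (hidx j)) (V j)" for j
  proof -
    have "ipt (dV j (hidx j)) S = - ipt (V j) (dS (hidx j))"
      by (intro fd_ibp[OF fd_V fd_S] L2_diffs)
    then show ?thesis by (simp add: ip_commute[of torus "V j"])
  qed
  have WF: "ipt (\<lambda>x. W x * dvp 1 3 x) (V 1) + ipt (\<lambda>x. W x * dvp 2 3 x) (V 2) = ipt W F"
  proof -
    have "ipt (\<lambda>x. W x * dvp j 3 x) (V j) = ipt W (\<lambda>x. dvp j 3 x * V j x)" for j
      by (simp add: ip_def mult.assoc)
    moreover have "ipt W F = (\<Sum>j\<in>UNIV. ipt W (\<lambda>x. dvp j 3 x * V j x))"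
      unfolding F_def[abs_def] by (intro ip_sum_right L2_prod L2_diffs)
    ultimately show ?thesis by (simp add: sum_UNIV_2)
  qed
  have half: "- x \<le> b / 2" if "2 * \<bar>x\<bar> \<le> b" for x b :: real using that by linarith
  have neg: "- x \<le> b" if "\<bar>x\<bar> \<le> b" for x b :: real using that by linarith
  have t1: "- ipt (\<lambda>x. ve j x * dS (hidx j) x) S \<le> c * nsq torus S / 2" for j
    by (intro half transport_ip[OF fd_ve Lb_ve Lb_dve fd_S Lb_S] L2_diffs)
  have t2: "- ipt (\<lambda>x. we x * dS 3 x) S \<le> c * nsq torus S / 2"
    by (intro half transport_ip[OF fd_we Lb_we Lb_dwe3 fd_S Lb_S] L2_diffs)
  have t3: "- ipt (\<lambda>x. ve l x * dV j (hidx l) x) (V j) \<le> c * nsq torus (V j) / 2" for l j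
    by (intro half transport_ip[OF fd_ve Lb_ve Lb_dve fd_V Lb_V] L2_diffs)
  have t4: "- ipt (\<lambda>x. we x * dV j 3 x) (V j) \<le> c * nsq torus (V j) / 2" for j
    by (intro half transport_ip[OF fd_we Lb_we Lb_dwe3 fd_V Lb_V] L2_diffs)
  have t5: "- ipt (\<lambda>x. V l x * dsp i x) S \<le> c * y2" for l i
    using neg[OF CS[OF L2_prod(5) L2_diffs(1) n_prods(1) nS, of l i]] yd(3) by (simp add: power2_eq_square mult.assoc)
  have t6: "- ipt (\<lambda>x. V l x * dvp j i x) (V j) \<le> c * y2" for l j i
    using neg[OF CS[OF L2_prod(8) L2_diffs(3) n_prods(2) nV, of l j i j]] yd(3) by (simp add: power2_eq_square mult.assoc)
  note t7 = neg[OF ip_W_dS3] and t8 = neg[OF ip_W_F]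
  have cS: "c * nsq torus S \<le> c * y2" "c * nsq torus (V 1) + c * nsq torus (V 2) \<le> c * y2"
    using mult_left_mono[OF nsq_le_y2(1) c0(1)] mult_left_mono[OF nsq_le_y2(2) c0(1)] by (simp_all add: algebra_simps)
  have "ipt St S + (\<Sum>j\<in>UNIV. ipt (Vt j) (V j)) \<le> - d2 + 11 * (c * y2) + 42 * c ^ 4 * \<epsilon>\<^sup>2 + (d2 / 2 + 48 * c ^ 4 * (1 + a) * y2 + 8 * c ^ 4 * \<epsilon>\<^sup>2)"
  proof -
    have Seq: "ipt St S = - (ipt (\<lambda>x. ve 1 x * dS 1 x) S + ipt (\<lambda>x. ve 2 x * dS 2 x) S + (ipt (\<lambda>x. V 1 x * dsp 1 x) S + ipt (\<lambda>x. V 2 x * dsp 2 x) S)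
       + ipt (\<lambda>x. we x * dS 3 x) S - (ipt (dS 1) (V 1) + ipt (dS 2) (V 2))) - ipt dW S"
      unfolding St ip_R_split[OF L2_diffs(1)] sum_UNIV_2 div by simp
    have Veq: "(\<Sum>j\<in>UNIV. ipt (Vt j) (V j)) = - d2 - (ipt (dS 1) (V 1) + ipt (dS 2) (V 2))
       - (ipt (\<lambda>x. ve 1 x * dV 1 1 x) (V 1) + ipt (\<lambda>x. ve 2 x * dV 1 2 x) (V 1) + ipt (\<lambda>x. ve 1 x * dV 2 1 x) (V 2) + ipt (\<lambda>x. ve 2 x * dV 2 2 x) (V 2))
       - (ipt (\<lambda>x. V 1 x * dvp 1 1 x) (V 1) + ipt (\<lambda>x. V 2 x * dvp 1 2 x) (V 1) + ipt (\<lambda>x. V 1 x * dvp 2 1 x) (V 2) + ipt (\<lambda>x. V 2 x * dvp 2 2 x) (V 2))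
       - (ipt (\<lambda>x. we x * dV 1 3 x) (V 1) + ipt (\<lambda>x. we x * dV 2 3 x) (V 2)) - ipt W F"
      unfolding Vt dd d2_def WF[symmetric] sum_UNIV_2 sum_negf hidx_simps by simp
    show ?thesis
      unfolding Seq Veq
      using t1[of 1] t1[of 2] t2 t3[of 1 1] t3[of 2 1] t3[of 1 2] t3[of 2 2] t4[of 1] t4[of 2]
        t5[of 1 1] t5[of 2 2] t6[of 1 1 1] t6[of 2 1 2] t6[of 1 2 1] t6[of 2 2 2] cS t7 t8
        mult_nonneg_nonneg[OF c0(1) y2_nonneg]
      unfolding hidx_simps by linarith
  qed
  also have "\<dots> \<le> - d2 / 2 + 60 * c ^ 4 * ((1 + a) * y2 + \<epsilon>\<^sup>2)"
  proof -
    have "c * y2 \<le> c ^ 4 * y2" using power_increasing[of 1 4 c] c1 y2_nonneg by (intro mult_right_mono) auto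
    moreover have "0 \<le> c ^ 4 * (a * y2)" "0 \<le> c ^ 4 * \<epsilon>\<^sup>2" using a0 y2_nonneg by auto
    moreover have "0 \<le> c ^ 4 * y2" using y2_nonneg by simp
    moreover have "- d2 + 11 * x + 42 * E + (d2 / 2 + (48 * P + 48 * Q) + 8 * E) \<le> - d2 / 2 + (60 * P + 60 * Q + 60 * E)"
      if "x \<le> P" "0 \<le> P" "0 \<le> Q" "0 \<le> E" for x P Q E :: real using that by linarith
    ultimately have "- d2 + 11 * (c * y2) + 42 * (c ^ 4 * \<epsilon>\<^sup>2) + (d2 / 2 + (48 * (c ^ 4 * y2) + 48 * (c ^ 4 * (a * y2))) + 8 * (c ^ 4 * \<epsilon>\<^sup>2))
      \<le> - d2 / 2 + (60 * (c ^ 4 * y2) + 60 * (c ^ 4 * (a * y2)) + 60 * (c ^ 4 * \<epsilon>\<^sup>2))" by blast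
    then show ?thesis by (simp add: algebra_simps)
  qed
  finally show ?thesis .
qed

section \<open>Recovery of \<open>W\<close> from its vertical derivative\<close>

lemma n_R: "nt R \<le> c * nt (dS 1) + c * nt (dS 2) + 2 * c * y + 7 * c ^ 3 * \<epsilon> + 2 * d"
proof -
  have e: "c * (7 * c\<^sup>2 * \<epsilon>\<^sup>2) \<le> 7 * c ^ 3 * \<epsilon>"
    using mult_left_mono[OF eps_sq, of "7 * c ^ 3"] c0 by (simp add: power2_eq_square power3_eq_cube mult_ac)
  have m: "nt (\<lambda>x. ve j x * dS i x) \<le> c * nt (dS i)" for i j
    by (rule Lb_mult(2)[OF Lb_ve L2_diffs(6)])
  have "nt R \<le> nt (\<lambda>x. (\<Sum>j\<in>UNIV. ve j x * dS (hidx j) x) + (\<Sum>j\<in>UNIV. V j x * dsp (hidx j) x) + we x * dS 3 x) + nt (\<lambda>x. \<Sum>j\<in>UNIV. dV j (hidx j) x)"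
    unfolding R_def[abs_def] by (intro nrm_triangle sqi_add sqi_sum L2_prod L2_diffs)
  moreover have "nt (\<lambda>x. (\<Sum>j\<in>UNIV. ve j x * dS (hidx j) x) + (\<Sum>j\<in>UNIV. V j x * dsp (hidx j) x) + we x * dS 3 x)
    \<le> nt (\<lambda>x. (\<Sum>j\<in>UNIV. ve j x * dS (hidx j) x) + (\<Sum>j\<in>UNIV. V j x * dsp (hidx j) x)) + nt (\<lambda>x. we x * dS 3 x)"
    by (intro nrm_triangle sqi_add sqi_sum L2_prod L2_diffs)
  moreover have "nt (\<lambda>x. (\<Sum>j\<in>UNIV. ve j x * dS (hidx j) x) + (\<Sum>j\<in>UNIV. V j x * dsp (hidx j) x))
    \<le> nt (\<lambda>x. (\<Sum>j\<in>UNIV. ve j x * dS (hidx j) x)) + nt (\<lambda>x. \<Sum>j\<in>UNIV. V j x * dsp (hidx j) x)"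
    by (intro nrm_triangle sqi_add sqi_sum L2_prod L2_diffs)
  moreover have "nt (\<lambda>x. \<Sum>j\<in>UNIV. ve j x * dS (hidx j) x) \<le> (\<Sum>j\<in>UNIV. nt (\<lambda>x. ve j x * dS (hidx j) x))"
    by (intro nrm_sum_le L2_prod)
  moreover have "nt (\<lambda>x. \<Sum>j\<in>UNIV. V j x * dsp (hidx j) x) \<le> (\<Sum>j\<in>UNIV. nt (\<lambda>x. V j x * dsp (hidx j) x))"
    by (intro nrm_sum_le L2_prod)
  moreover have "nt (\<lambda>x. \<Sum>j\<in>UNIV. dV j (hidx j) x) \<le> (\<Sum>j\<in>UNIV. nt (dV j (hidx j)))"
    by (intro nrm_sum_le L2_diffs)
  ultimately show ?thesis
    using n_prods(1)[of 1 1] n_prods(1)[of 2 2] n_prods(3) e m[of 1 1] m[of 2 2] ndV[of 1 1] ndV[of 2 2]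
    unfolding sum_UNIV_2 hidx_simps by linarith
qed

text \<open>A Poincare inequality in \<open>z\<close>: division by \<open>mu k 3\<close> does not
  enlarge the modes with \<open>k 3 \<noteq> 0\<close>, and the others vanish because
  \<open>W\<close> is odd. \<open>dW\<close> is expressed by \<open>R\<close> and \<open>St\<close>,
  and \<open>St\<close> is in turn estimated by its vertical derivative \<open>dset\<close>.\<close>

theorem W_bound: "nt W \<le> 2 * (c * \<epsilon> + (c * nt (dS 1) + c * nt (dS 2) + 2 * c * y + 7 * c ^ 3 * \<epsilon> + 2 * d))"
proof -
  have "8 * nsq torus W \<le> 16 * nsq torus dset + 16 * nsq torus R"
  proof (rule nsq_le_Parseval[OF L2_diffs(5)])
    fix N
    have le: "(norm (fc W k))\<^sup>2 \<le> 2 * (norm (fc dset k))\<^sup>2 + 2 * (norm (fc R k))\<^sup>2" for k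
    proof (cases "k 3 = 0")
      case True
      have "fc W k = fc we k - fc wp k"
        unfolding W_def[abs_def] by (intro fc_diff L2_integrable L2_Lb)
      then show ?thesis using fc_we[of k] fc_wp[of k] True by simp
    next
      case False
      have "fc St k = fc (\<lambda>x. - (R x + dW x)) k"
        by (rule fc_cong_AE) (use eq_S L2_diffs L2_R in \<open>auto simp: sqi_def\<close>)
      then have "fc dW k = - fc St k - fc R k"
        unfolding fc_uminus fc_add[OF L2_integrable[OF L2_R] L2_integrable[OF L2_diffs(9)]] by simp
      moreover have "norm (fc W k) \<le> norm (fc dW k)" "norm (fc St k) \<le> norm (fc dset k)"
        using fd_W fd_St mult_right_mono[OF norm_mu_ge1[of k 3, OF False]] by (auto simp: fd_def norm_mult)
      ultimately have "norm (fc W k) \<le> norm (fc dset k) + norm (fc R k)"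
        using norm_triangle_ineq4[of "- fc St k" "fc R k"] by simp
      then have "(norm (fc W k))\<^sup>2 \<le> (norm (fc dset k) + norm (fc R k))\<^sup>2" by (rule power_mono) simp
      also have "\<dots> \<le> 2 * (norm (fc dset k))\<^sup>2 + 2 * (norm (fc R k))\<^sup>2"
        using sum_squares_bound[of "norm (fc dset k)" "norm (fc R k)"] by (simp add: power2_sum)
      finally show ?thesis .
    qed
    have "(\<Sum>k\<in>KB N. (norm (fc W k))\<^sup>2) \<le> 2 * (\<Sum>k\<in>KB N. (norm (fc dset k))\<^sup>2) + 2 * (\<Sum>k\<in>KB N. (norm (fc R k))\<^sup>2)"
      unfolding sum_distrib_left sum.distrib[symmetric] by (rule sum_mono[OF le])
    then show "(\<Sum>k\<in>KB N. (norm (fc W k))\<^sup>2) \<le> 16 * nsq torus dset + 16 * nsq torus R"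
      using Bessel[OF L2_dset, of N] Bessel[OF L2_R, of N] by linarith
  qed
  then have "nsq torus W \<le> 2 * (nt dset)\<^sup>2 + 2 * (nt R)\<^sup>2" by simp
  also have "\<dots> \<le> (2 * (nt dset + nt R))\<^sup>2"
    by (simp add: power2_sum power_mult_distrib)
  finally have "nsq torus W \<le> (2 * (nt dset + nt R))\<^sup>2" .
  then have "nt W \<le> 2 * (nt dset + nt R)" unfolding nrm_def[of torus W] by (intro real_le_lsqrt) auto
  also have "\<dots> \<le> 2 * (c * \<epsilon> + (c * nt (dS 1) + c * nt (dS 2) + 2 * c * y + 7 * c ^ 3 * \<epsilon> + 2 * d))"
    by (intro mult_left_mono add_mono nrm_dset n_R) simp
  finally show ?thesis .
qed

text \<open>The bounds assumed on the limit do not include the time derivative of its velocity; the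
  momentum equation supplies one. It provides the domination in the energy identity.\<close>

theorem n_vpt: "nt (vpt j) \<le> 20 * c\<^sup>2"
proof -
  define Q where "Q x = (\<Sum>i\<in>UNIV. ddvp j i x) - ((\<Sum>l\<in>UNIV. vp l x * dvp j (hidx l) x) + wp x * dvp j 3 x + dsp (hidx j) x)" for x
  have n3: "nt (dvp j i) \<le> 3 * c" "nt (dsp i) \<le> 3 * c" for i by (intro Lb_nrm Lb_dvp Lb_dsp)+
  have p: "L2 (\<lambda>x. vp l x * dvp j i x)" "nt (\<lambda>x. vp l x * dvp j i x) \<le> c * (3 * c)"
    "L2 (\<lambda>x. wp x * dvp j i x)" "nt (\<lambda>x. wp x * dvp j i x) \<le> c * (3 * c)" for i l
    by (intro Lb_mult(1)[OF Lb_vp] Lb_mult(1)[OF Lb_wp] L2_Lb order_trans[OF Lb_mult(2)[OF Lb_vp L2_Lb(6)]]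
       order_trans[OF Lb_mult(2)[OF Lb_wp L2_Lb(6)]] mult_left_mono n3 c0)+
  note s = L2_ddvp L2_Lb p(1,3)
  have L2Q: "L2 Q" unfolding Q_def[abs_def] by (intro sqi_diff sqi_add sqi_sum s)
  have "AE x in torus. vpt j x = Q x"
    using cp2[of j] by eventually_elim (simp add: Q_def)
  then have "nt (vpt j) = nt Q"
    unfolding nrm_def using sqi_meas[OF L2_vpt] sqi_meas[OF L2Q] by (subst nsq_cong_AE) auto
  also have "nt Q \<le> nt (\<lambda>x. \<Sum>i\<in>UNIV. ddvp j i x) + nt (\<lambda>x. (\<Sum>l\<in>UNIV. vp l x * dvp j (hidx l) x) + wp x * dvp j 3 x + dsp (hidx j) x)"
    unfolding Q_def[abs_def] by (intro nrm_triangle_diff sqi_diff sqi_add sqi_sum s)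
  also have "nt (\<lambda>x. \<Sum>i\<in>UNIV. ddvp j i x) \<le> (\<Sum>i\<in>UNIV. nt (ddvp j i))"
    by (intro nrm_sum_le s)
  also have "\<dots> \<le> (\<Sum>i\<in>(UNIV::3 set). c)" by (intro sum_mono nrm_ddvp)
  also have "nt (\<lambda>x. (\<Sum>l\<in>UNIV. vp l x * dvp j (hidx l) x) + wp x * dvp j 3 x + dsp (hidx j) x)
     \<le> nt (\<lambda>x. (\<Sum>l\<in>UNIV. vp l x * dvp j (hidx l) x) + wp x * dvp j 3 x) + nt (dsp (hidx j))"
    by (intro nrm_triangle sqi_diff sqi_add sqi_sum s)
  also have "nt (\<lambda>x. (\<Sum>l\<in>UNIV. vp l x * dvp j (hidx l) x) + wp x * dvp j 3 x)
     \<le> nt (\<lambda>x. \<Sum>l\<in>UNIV. vp l x * dvp j (hidx l) x) + nt (\<lambda>x. wp x * dvp j 3 x)"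
    by (intro nrm_triangle sqi_diff sqi_add sqi_sum s)
  also have "nt (\<lambda>x. \<Sum>l\<in>UNIV. vp l x * dvp j (hidx l) x) \<le> (\<Sum>l\<in>UNIV. nt (\<lambda>x. vp l x * dvp j (hidx l) x))"
    by (intro nrm_sum_le s)
  also have "\<dots> \<le> (\<Sum>l\<in>(UNIV::2 set). c * (3 * c))" by (intro sum_mono p)
  finally have "nt (vpt j) \<le> 3 * c + 3 * c + 9 * (c * c)"
    using n3(2)[of "hidx j"] p(4)[of 3] by simp
  also have "\<dots> \<le> 20 * c\<^sup>2"
    using mult_left_mono[OF c1 c0(1)] mult_nonneg_nonneg[OF c0(1) c0(1)] unfolding power2_eq_square mult_1_right by linarith
  finally show ?thesis .
qed

end

section \<open>Test functions in time\<close>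

text \<open>The flat function \<open>exp (- (1 / x))\<close> with powers of \<open>1 / x\<close> in
  front: the family is closed under differentiation up to linear combinations, so that smoothness
  needs no formulas for higher derivatives.\<close>

definition psi :: "nat \<Rightarrow> real \<Rightarrow> real" where
  "psi n x = (if 0 < x then (1 / x) ^ n * exp (- (1 / x)) else 0)"

lemma psi_tendsto_zero: "(psi n \<longlongrightarrow> 0) (at 0)"
proof -
  have "((\<lambda>x. inverse x ^ n / exp (inverse x)) \<longlongrightarrow> (0::real)) (at_right 0)"
    by (rule filterlim_compose[OF tendsto_power_div_exp_0 filterlim_inverse_at_top_right])
  then have "(psi n \<longlongrightarrow> 0) (at_right 0)"
    by (rule Lim_transform_eventually)
      (auto simp: eventually_at_right_field psi_def field_simps exp_minus intro!: exI[of _ 1])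
  moreover have "(psi n \<longlongrightarrow> 0) (at_left 0)"
    by (rule Lim_transform_eventually[OF tendsto_const])
      (auto simp: eventually_at_left_field psi_def intro!: exI[of _ "-1"])
  ultimately show ?thesis by (simp add: filterlim_split_at)
qed

lemma psi_deriv: "(psi n has_real_derivative (psi (n + 2) x - real n * psi (n + 1) x)) (at x)"
proof -
  consider "0 < x" | "x < 0" | "x = 0" by linarith
  then show ?thesis
  proof cases
    case 1
    have "((\<lambda>x. (1 / x) ^ n * exp (- (1 / x))) has_real_derivative (psi (n + 2) x - real n * psi (n + 1) x)) (at x)"
    proof -
      have "((\<lambda>x. (1 / x) ^ n * exp (- (1 / x))) has_real_derivative
          real n * (1 / x) ^ (n - 1) * (- ((1 / x)\<^sup>2)) * exp (- (1 / x)) + (1 / x) ^ n * (exp (- (1 / x)) * (1 / x)\<^sup>2)) (at x)"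
        using 1 by (auto intro!: derivative_eq_intros simp: power2_eq_square)
      moreover have *: "real n * u ^ (n - 1) * (- (u\<^sup>2)) = - real n * u ^ (n + 1)" for u :: real
        by (cases n) (simp_all add: power2_eq_square algebra_simps)
      have "real n * (1 / x) ^ (n - 1) * (- ((1 / x)\<^sup>2)) * exp (- (1 / x)) + (1 / x) ^ n * (exp (- (1 / x)) * (1 / x)\<^sup>2)
         = psi (n + 2) x - real n * psi (n + 1) x"
        unfolding * psi_def using 1 by (simp add: power2_eq_square)
      ultimately show ?thesis by simp
    qed
    then show ?thesis
      by (rule has_field_derivative_transform_within_open[where S="{0<..}"]) (use 1 in \<open>auto simp: psi_def\<close>)
  next
    case 2
    have "((\<lambda>x. 0) has_real_derivative 0) (at x)" by simp
    then have "(psi n has_real_derivative 0) (at x)"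
      by (rule has_field_derivative_transform_within_open[where S="{..<0}"]) (use 2 in \<open>auto simp: psi_def\<close>)
    then show ?thesis using 2 by (simp add: psi_def)
  next
    case 3
    \<comment> \<open>At 0 the difference quotient is again a member of the family, so its limit is
      known.\<close>
    have "(\<lambda>h. (psi n (0 + h) - psi n 0) / h) = psi (n + 1)"
    proof
      show "(psi n (0 + h) - psi n 0) / h = psi (n + 1) h" for h
        by (cases "0 < h") (simp_all add: psi_def)
    qed
    then have "(psi n has_real_derivative 0) (at 0)"
      using psi_tendsto_zero[of "n + 1"] by (simp add: DERIV_def)
    then show ?thesis using 3 by (simp add: psi_def)
  qed
qed

lemma psi_continuous: "continuous_on S (psi n)"
  by (rule continuous_on_subset[of UNIV]) (auto intro!: DERIV_continuous_on psi_deriv intro: DERIV_subset)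

text \<open>Two factors, one for each end of the support; the affine arguments allow scaling and
  translation.\<close>

inductive bump_span :: "(real \<Rightarrow> real) \<Rightarrow> bool" where
  base: "bump_span (\<lambda>t. c * (psi n (\<alpha> * t + \<beta>) * psi m (\<gamma> * t + \<delta>)))"
| add: "bump_span f \<Longrightarrow> bump_span g \<Longrightarrow> bump_span (\<lambda>t. f t + g t)"

lemma bump_span_deriv: "bump_span f \<Longrightarrow> \<exists>f'. bump_span f' \<and> (\<forall>t. (f has_real_derivative f' t) (at t))"
proof (induction rule: bump_span.induct)
  case (base c n \<alpha> \<beta> m \<gamma> \<delta>)
  have d: "((\<lambda>t. psi n (\<alpha> * t + \<beta>)) has_real_derivative (psi (n + 2) (\<alpha> * t + \<beta>) - real n * psi (n + 1) (\<alpha> * t + \<beta>)) * \<alpha>) (at t)" for n \<alpha> \<beta> t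
    by (rule DERIV_chain2[OF psi_deriv]) (auto intro!: derivative_eq_intros)
  let ?f' = "\<lambda>t. ((\<alpha> * c) * (psi (n + 2) (\<alpha> * t + \<beta>) * psi m (\<gamma> * t + \<delta>)) + (- real n * \<alpha> * c) * (psi (n + 1) (\<alpha> * t + \<beta>) * psi m (\<gamma> * t + \<delta>)))
     + ((\<gamma> * c) * (psi n (\<alpha> * t + \<beta>) * psi (m + 2) (\<gamma> * t + \<delta>)) + (- real m * \<gamma> * c) * (psi n (\<alpha> * t + \<beta>) * psi (m + 1) (\<gamma> * t + \<delta>)))"
  have "bump_span ?f'" by (intro bump_span.add bump_span.base)
  moreover have "((\<lambda>t. c * (psi n (\<alpha> * t + \<beta>) * psi m (\<gamma> * t + \<delta>))) has_real_derivative ?f' t) (at t)" for t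
    by (rule derivative_eq_intros d refl)+ (simp add: algebra_simps)
  ultimately show ?case by blast
next
  case (add f g)
  then obtain f' g' where "bump_span f'" "bump_span g'" "\<And>t. (f has_real_derivative f' t) (at t)" "\<And>t. (g has_real_derivative g' t) (at t)"
    by blast
  then show ?case
    by (intro exI[of _ "\<lambda>t. f' t + g' t"]) (auto intro: bump_span.add DERIV_add)
qed

definition rho :: "real \<Rightarrow> real" where "rho s = psi 0 s * psi 0 (1 - s)"

lemma rho_props: "0 \<le> rho s" "s \<le> 0 \<Longrightarrow> rho s = 0" "1 \<le> s \<Longrightarrow> rho s = 0" "0 < s \<Longrightarrow> s < 1 \<Longrightarrow> 0 < rho s"
  by (auto simp: rho_def psi_def)

lemma rho_continuous: "continuous_on S rho"
  unfolding rho_def by (intro continuous_intros continuous_on_compose2[OF psi_continuous[of UNIV]]) auto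

text \<open>A smooth step from 0 to \<open>eta 1\<close>. It is not normalised; the positive height
  cancels in \<open>time_deriv_mode\<close>.\<close>

definition eta :: "real \<Rightarrow> real" where "eta t = (LBINT s=0..t. rho s)"

lemma eta_deriv: "(eta has_real_derivative rho t) (at t)"
proof -
  \<comment> \<open>The interval contains 0 and has \<open>t\<close> in its interior, so that the
    derivative within the interval is the two-sided one.\<close>
  define a b where "a = min 0 t - 1" and "b = max 0 t + 1"
  have ab: "a < t" "t < b" "a \<le> 0" "0 \<le> b" by (auto simp: a_def b_def)
  have "((\<lambda>u. LBINT s=0..u. rho s) has_vector_derivative rho t) (at t within {a..b})"
    using interval_integral_FTC2[of a 0 b rho t] rho_continuous ab by (simp add: zero_ereal_def)
  then show ?thesis
    using ab by (simp add: eta_def[abs_def] has_real_derivative_iff_has_vector_derivative at_within_Icc_at)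
qed

lemma eta_mono: "s \<le> t \<Longrightarrow> eta s \<le> eta t"
proof (erule DERIV_nonneg_imp_nondecreasing)
  show "\<exists>y. (eta has_real_derivative y) (at x) \<and> 0 \<le> y" for x
    using eta_deriv[of x] rho_props(1)[of x] by blast
qed

lemma eta_zero: "eta 0 = 0"
  by (simp add: eta_def zero_ereal_def)

lemma eta_nonpos: assumes "t \<le> 0" shows "eta t = 0"
proof -
  have "eta 0 \<le> eta t"
  proof (rule DERIV_nonpos_imp_nonincreasing[OF assms])
    show "\<exists>y. (eta has_real_derivative y) (at x) \<and> y \<le> 0" if "x \<le> 0" for x
      using eta_deriv[of x] rho_props(2)[OF that] by (intro exI[of _ "rho x"]) simp
  qed
  then show ?thesis using eta_mono[OF assms] eta_zero by simp
qed

lemma eta_ge1: assumes "1 \<le> t" shows "eta t = eta 1"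
proof -
  have "eta t \<le> eta 1"
  proof (rule DERIV_nonpos_imp_nonincreasing[OF assms])
    show "\<exists>y. (eta has_real_derivative y) (at x) \<and> y \<le> 0" if "1 \<le> x" for x
      using eta_deriv[of x] rho_props(3)[OF that] by (intro exI[of _ "rho x"]) simp
  qed
  then show ?thesis using eta_mono[OF assms] by simp
qed

lemma eta_continuous: "continuous_on S eta"
  by (meson DERIV_isCont continuous_at_imp_continuous_on eta_deriv)

lemma eta_pos: "0 < eta 1"
proof -
  have "eta 0 < eta 1"
  proof (rule DERIV_pos_imp_increasing_open[OF zero_less_one _ eta_continuous])
    show "\<exists>y. (eta has_real_derivative y) (at x) \<and> 0 < y" if "0 < x" "x < 1" for x
      using eta_deriv[of x] rho_props(4)[OF that] by (intro exI[of _ "rho x"]) simp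
  qed
  then show ?thesis by (simp add: eta_zero)
qed

lemma eta_bounds: "0 \<le> eta t" "eta t \<le> eta 1"
  using eta_nonpos[of t] eta_ge1[of t] eta_mono[of 0 t] eta_mono[of t 1] eta_pos eta_zero
  by (cases "t \<le> 0"; cases "1 \<le> t"; simp)+

lemma smooth_product_test:
  assumes d: "\<And>t. (X has_real_derivative X' t) (at t)" "bump_span X'"
  shows "smooth (\<lambda>p :: real \<times> (real^3). X (fst p) * Re (c * ek k (snd p)))"
    and "pderiv_dir (1, 0) (\<lambda>p :: real \<times> (real^3). X (fst p) * Re (c * ek k (snd p))) (t, x) = X' t * Re (c * ek k x)"
proof -
  have D: "((\<lambda>p :: real \<times> (real^3). f (fst p) * Re (c * ek k (snd p))) has_derivative
     (\<lambda>h. f (fst p) * Re (c * (\<i> * of_real pi * (\<Sum>i\<in>UNIV. of_int (k i) * of_real (snd h $ i))) * ek k (snd p)) + (f' (fst p) * fst h) * Re (c * ek k (snd p)))) (at p)"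
    if "\<And>t. (f has_real_derivative f' t) (at t)" for f f' c p
  proof -
    have 1: "((\<lambda>p :: real \<times> (real^3). f (fst p)) has_derivative (\<lambda>h. f' (fst p) * fst h)) (at p)"
      by (rule has_derivative_compose[OF has_derivative_fst[OF has_derivative_ident] that[unfolded has_field_derivative_def]])
    have 2: "((\<lambda>p :: real \<times> (real^3). Re (c * ek k (snd p))) has_derivative
      (\<lambda>h. Re (c * (\<i> * of_real pi * (\<Sum>i\<in>UNIV. of_int (k i) * of_real (snd h $ i))) * ek k (snd p)))) (at p)"
      by (rule has_derivative_compose[OF has_derivative_snd[OF has_derivative_ident] Re_ek_has_derivative])
    show ?thesis by (rule has_derivative_mult[OF 1 2])
  qed
  \<comment> \<open>The profile \<open>X\<close> will be a difference of smooth steps, of which only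
    the derivative is known to lie in \<open>bump_span\<close>; hence the class is
    \<open>bump_span\<close> with \<open>X\<close> added.\<close>
  define Q where "Q f \<longleftrightarrow> f = X \<or> bump_span f" for f
  have Q: "\<exists>f'. Q f' \<and> (\<forall>t. (f has_real_derivative f' t) (at t))" if "Q f" for f
  proof (cases "f = X")
    case True
    then show ?thesis using d unfolding Q_def by blast
  next
    case False
    then show ?thesis using that bump_span_deriv[of f] unfolding Q_def by blast
  qed
  show "smooth (\<lambda>p :: real \<times> (real^3). X (fst p) * Re (c * ek k (snd p)))"
  proof (rule smooth_coinduct[where C="{\<lambda>p. f (fst p) * Re (c * ek k (snd p)) | f c. Q f}"])
    fix F :: "real \<times> (real^3) \<Rightarrow> real" and x
    assume "F \<in> {\<lambda>p. f (fst p) * Re (c * ek k (snd p)) | f c. Q f}"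
    then obtain f c where F: "F = (\<lambda>p. f (fst p) * Re (c * ek k (snd p)))" "Q f" by blast
    obtain f' where f': "Q f'" "\<And>t. (f has_real_derivative f' t) (at t)" using Q[OF F(2)] by blast
    show "F differentiable at x"
      unfolding F(1) by (rule differentiableI[OF D[OF f'(2)]])
    fix b :: "real \<times> (real^3)" assume "b \<in> Basis"
    then consider "b = (1, 0)" | i where "b = (0, axis i 1)"
      by (auto simp: Basis_prod_def Basis_vec3)
    then show "pderiv_dir b F \<in> {\<lambda>p. f (fst p) * Re (c * ek k (snd p)) | f c. Q f}"
    proof cases
      case 1
      have "pderiv_dir b F = (\<lambda>p. f' (fst p) * Re (c * ek k (snd p)))"
        unfolding pderiv_dir_def F(1) frechet_derivative_at[OF D[OF f'(2)], symmetric] 1 by simp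
      then show ?thesis using f'(1) by blast
    next
      case 2
      have "(\<Sum>j\<in>UNIV. of_int (k j) * complex_of_real ((axis i 1 :: real^3) $ j)) = of_int (k i)"
        by (simp add: axis_def if_distrib[of of_real] if_distrib[of "\<lambda>t. _ * t"] cong: if_cong)
      then have "pderiv_dir b F = (\<lambda>p. f (fst p) * Re ((c * mu k i) * ek k (snd p)))"
        unfolding pderiv_dir_def F(1) frechet_derivative_at[OF D[OF f'(2)], symmetric] 2 by (simp add: mu_def mult.assoc)
      then show ?thesis using F(2) by blast
    qed
  qed (auto simp: Q_def)
  show "pderiv_dir (1, 0) (\<lambda>p :: real \<times> (real^3). X (fst p) * Re (c * ek k (snd p))) (t, x) = X' t * Re (c * ek k x)"
    unfolding pderiv_dir_def frechet_derivative_at[OF D[OF d(1)], symmetric] by simp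
qed

section \<open>Integration over the time interval\<close>

lemma space_time [simp]: "space (time T) = {0<..<T}"
  by (simp add: time_def)

lemma time_integrable_mono:
  fixes q :: "real \<Rightarrow> 'a::{banach, second_countable_topology}"
  assumes "integrable (time T) q" "t \<le> T" shows "integrable (time t) q"
proof -
  have "set_integrable lebesgue {0<..<T} q"
    using assms(1) by (simp add: time_def integrable_restrict_space set_integrable_def)
  then have "set_integrable lebesgue {0<..<t} q"
    by (rule set_integrable_subset) (use assms(2) in auto)
  then show ?thesis by (simp add: time_def integrable_restrict_space set_integrable_def)
qed

lemma time_integral_indicator:
  fixes q :: "real \<Rightarrow> real"
  assumes "t \<le> T"
  shows "(\<integral>s. q s \<partial>time t) = (\<integral>s. indicator {0<..<t} s * q s \<partial>time T)"
proof -
  have "(\<integral>s. q s \<partial>time t) = (\<integral>s. indicator {0<..<t} s *\<^sub>R q s \<partial>lebesgue)"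
    unfolding time_def by (rule integral_restrict_space) simp
  also have "\<dots> = (\<integral>s. indicator {0<..<T} s *\<^sub>R (indicator {0<..<t} s * q s) \<partial>lebesgue)"
    by (intro Bochner_Integration.integral_cong refl) (use assms in \<open>auto simp: indicator_def\<close>)
  also have "\<dots> = (\<integral>s. indicator {0<..<t} s * q s \<partial>time T)"
    unfolding time_def by (rule integral_restrict_space[symmetric]) simp
  finally show ?thesis .
qed

lemma time_integral_HK:
  assumes "integrable (time t) (q :: real \<Rightarrow> real)"
  shows "(\<integral>s. q s \<partial>time t) = integral {0..t} q" "q integrable_on {0..t}"
proof -
  show "(\<integral>s. q s \<partial>time t) = integral {0..t} q"
    using lebesgue_integral_eq_integral[of "{0<..<t}" q] assms by (simp add: time_def integral_open_interval_real)
  show "q integrable_on {0..t}"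
    using integrable_on_lebesgue_on[of "{0<..<t}" q] assms by (simp add: time_def integrable_on_Icc_iff_Ioo)
qed

lemma finite_measure_time: "finite_measure (time T)"
proof
  show "emeasure (time T) (space (time T)) \<noteq> \<infinity>"
    by (cases "0 \<le> T") (simp_all add: time_def emeasure_restrict_space)
qed

lemma continuous_time_measurable:
  fixes f :: "real \<Rightarrow> 'b::real_normed_vector"
  shows "continuous_on {0<..<T} f \<Longrightarrow> f \<in> borel_measurable (time T)"
  unfolding time_def by (rule continuous_imp_measurable_on_sets_lebesgue) auto

lemma time_integral_Icc:
  assumes "continuous_on {a..b} f" "0 < a" "b < T" "\<And>x. x \<notin> {a..b} \<Longrightarrow> f x = (0::real)"
  shows "(\<integral>s. f s \<partial>time T) = (\<integral>x. indicator {a..b} x *\<^sub>R f x \<partial>lborel)"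
proof -
  have m: "(\<lambda>x. indicator {a..b} x *\<^sub>R f x) \<in> borel_measurable borel"
    using borel_measurable_integrable[OF borel_integrable_compact[OF compact_Icc assms(1)]] by simp
  have "(\<integral>s. f s \<partial>time T) = (\<integral>s. indicator {0<..<T} s *\<^sub>R f s \<partial>lebesgue)"
    unfolding time_def by (rule integral_restrict_space) simp
  also have "\<dots> = (\<integral>s. indicator {a..b} s *\<^sub>R f s \<partial>lebesgue)"
    by (intro Bochner_Integration.integral_cong refl) (use assms in \<open>auto simp: indicator_def\<close>)
  also have "\<dots> = (\<integral>s. indicator {a..b} s *\<^sub>R f s \<partial>lborel)"
    by (rule integral_completion) (use m in simp)
  finally show ?thesis .
qed

text \<open>An approximate identity of total mass \<open>eta 1\<close>, supported between
  \<open>s\<close> and \<open>s + 1 / real n\<close>. As \<open>h\<close> is continuous only inside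
  the interval, the support has to stay below \<open>T\<close>.\<close>

lemma bump_limit:
  assumes h: "continuous_on {0<..<T} h" and s: "0 < s" "s < T"
  shows "(\<lambda>n. \<integral>\<tau>. h \<tau> * (real n * rho (real n * (\<tau> - s))) \<partial>time T) \<longlonglongrightarrow> h s * eta 1"
proof (rule LIMSEQ_I)
  fix e :: real assume e: "0 < e"
  define e' where "e' = e / (2 * eta 1)"
  have e': "0 < e'" using e eta_pos by (simp add: e'_def)
  have "isCont h s"
    using h s by (simp add: continuous_on_eq_continuous_at)
  then obtain d where d: "0 < d" "\<And>\<tau>. \<bar>\<tau> - s\<bar> < d \<Longrightarrow> \<bar>h \<tau> - h s\<bar> < e'"
    using e' unfolding continuous_at_real_range by auto
  obtain M :: nat where M: "1 / min d (T - s) < real M" using reals_Archimedean2 by blast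
  have md: "0 < min d (T - s)" using d s by simp
  show "\<exists>M. \<forall>n\<ge>M. norm ((\<integral>\<tau>. h \<tau> * (real n * rho (real n * (\<tau> - s))) \<partial>time T) - h s * eta 1) < e"
  proof (intro exI[of _ M] allI impI)
    fix n assume "M \<le> n"
    then have n1: "1 / min d (T - s) < real n" using M by linarith
    have n0: "0 < real n" using n1 md by (meson divide_pos_pos less_trans zero_less_one)
    have "1 / real n < min d (T - s)"
    proof -
      have "1 / x < m" if "1 / m < x" "0 < m" "0 < x" for x m :: real
        using that by (simp add: field_simps)
      then show ?thesis using n1 md n0 by blast
    qed
    then have nd: "1 / real n < d" "s + 1 / real n < T" by auto
    let ?g = "\<lambda>\<tau>. real n * rho (real n * (\<tau> - s))" and ?b = "s + 1 / real n"
    have sb: "s \<le> ?b" using n0 by simp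
    have g0: "?g \<tau> = 0" if "\<tau> \<notin> {s..?b}" for \<tau>
    proof -
      have "real n * (\<tau> - s) \<le> 0 \<or> 1 \<le> real n * (\<tau> - s)"
        using that n0 by (auto simp: field_simps mult_le_0_iff)
      then show ?thesis using rho_props(2,3) by auto
    qed
    have gc: "continuous_on S ?g" for S
      by (intro continuous_intros continuous_on_compose2[OF rho_continuous[of UNIV]]) auto
    have hc: "continuous_on {s..?b} h"
      by (rule continuous_on_subset[OF h]) (use s nd in auto)
    have der: "((\<lambda>\<tau>. eta (real n * (\<tau> - s))) has_real_derivative ?g \<tau>) (at \<tau>)" for \<tau>
    proof -
      have "((\<lambda>\<tau>. real n * (\<tau> - s)) has_real_derivative real n) (at \<tau>)"
        by (auto intro!: derivative_eq_intros)
      from DERIV_chain2[OF eta_deriv this] show ?thesis by (simp add: mult.commute)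
    qed
    have gint: "(\<integral>x. indicator {s..?b} x *\<^sub>R ?g x \<partial>lborel) = eta 1"
    proof -
      have "(\<integral>x. indicator {s..?b} x *\<^sub>R ?g x \<partial>lborel) = eta (real n * (?b - s)) - eta (real n * (s - s))"
        using sb der gc by (intro integral_FTC_atLeastAtMost)
          (auto simp: has_real_derivative_iff_has_vector_derivative[symmetric] intro: DERIV_subset)
      then show ?thesis using n0 by (simp add: eta_zero)
    qed
    have i1: "integrable lborel (\<lambda>x. indicator {s..?b} x *\<^sub>R ?g x)"
      by (rule borel_integrable_compact[OF compact_Icc gc])
    have i2: "integrable lborel (\<lambda>x. indicator {s..?b} x *\<^sub>R (h x * ?g x))"
      by (rule borel_integrable_compact[OF compact_Icc]) (intro continuous_intros hc gc)
    have eq: "(\<integral>\<tau>. h \<tau> * ?g \<tau> \<partial>time T) = (\<integral>x. indicator {s..?b} x *\<^sub>R (h x * ?g x) \<partial>lborel)"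
      by (rule time_integral_Icc) (use s nd g0 in \<open>auto intro!: continuous_intros hc gc\<close>)
    have diff: "(\<integral>\<tau>. h \<tau> * ?g \<tau> \<partial>time T) - h s * eta 1 = (\<integral>x. indicator {s..?b} x *\<^sub>R (h x * ?g x) - h s * (indicator {s..?b} x *\<^sub>R ?g x) \<partial>lborel)"
      unfolding eq gint[symmetric] using i1 i2 by (subst Bochner_Integration.integral_diff) auto
    have "norm ((\<integral>\<tau>. h \<tau> * ?g \<tau> \<partial>time T) - h s * eta 1) \<le> (\<integral>x. e' * (indicator {s..?b} x *\<^sub>R ?g x) \<partial>lborel)"
      unfolding diff
    proof (rule order_trans[OF integral_norm_bound integral_mono])
      show "integrable lborel (\<lambda>x. norm (indicator {s..?b} x *\<^sub>R (h x * ?g x) - h s * (indicator {s..?b} x *\<^sub>R ?g x)))"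
        using i1 i2 by (intro integrable_norm Bochner_Integration.integrable_diff integrable_mult_right)
      show "integrable lborel (\<lambda>x. e' * (indicator {s..?b} x *\<^sub>R ?g x))" using i1 by auto
      fix x
      show "norm (indicator {s..?b} x *\<^sub>R (h x * ?g x) - h s * (indicator {s..?b} x *\<^sub>R ?g x)) \<le> e' * (indicator {s..?b} x *\<^sub>R ?g x)"
      proof (cases "x \<in> {s..?b}")
        case True
        then have "\<bar>h x - h s\<bar> \<le> e'" using d(2)[of x] nd by auto
        moreover have "0 \<le> ?g x" using n0 rho_props(1) by simp
        ultimately have "\<bar>h x - h s\<bar> * ?g x \<le> e' * ?g x" by (rule mult_right_mono)
        moreover have "\<bar>h x * ?g x - h s * ?g x\<bar> = \<bar>h x - h s\<bar> * ?g x"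
          using rho_props(1) by (simp add: abs_mult flip: left_diff_distrib)
        ultimately show ?thesis using True by simp
      qed simp
    qed
    moreover have "(\<integral>x. e' * (indicator {s..?b} x *\<^sub>R ?g x) \<partial>lborel) = e / 2"
    proof -
      have "e / (2 * x) * x = e / 2" if "0 < x" for x :: real using that by simp
      then show ?thesis unfolding Bochner_Integration.integral_mult_right_zero gint e'_def using eta_pos by blast
    qed
    ultimately show "norm ((\<integral>\<tau>. h \<tau> * ?g \<tau> \<partial>time T) - h s * eta 1) < e" using e by linarith
  qed
qed

lemma eta_step_limit: "(\<lambda>n. eta (real n * (\<tau> - s))) \<longlonglongrightarrow> (if s < \<tau> then eta 1 else 0)"
proof (cases "s < \<tau>")
  case True
  then obtain M :: nat where M: "1 < real M * (\<tau> - s)" using reals_Archimedean3[of "\<tau> - s"] by auto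
  have "eta (real n * (\<tau> - s)) = eta 1" if "M \<le> n" for n
  proof (rule eta_ge1)
    have "real M * (\<tau> - s) \<le> real n * (\<tau> - s)" using that True by (intro mult_right_mono) auto
    then show "1 \<le> real n * (\<tau> - s)" using M by linarith
  qed
  then show ?thesis using True
    by (intro tendsto_eventually) (auto simp: eventually_sequentially intro!: exI[of _ M])
next
  case False
  then have "eta (real n * (\<tau> - s)) = 0" for n by (intro eta_nonpos) (simp add: mult_nonneg_nonpos)
  then show ?thesis using False by simp
qed

text \<open>The weak formulation is tested with smooth approximations of the indicator of
  \<open>{s<..r}\<close>. Their derivatives concentrate at \<open>s\<close> and \<open>r\<close> and
  produce values of \<open>h\<close>, while dominated convergence produces the integral of
  \<open>q\<close>. Continuity of \<open>h\<close> at 0 finally allows \<open>s\<close> to tend to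
  0.\<close>

lemma time_deriv_mode:
  assumes h: "continuous_on {0..<T} h" and q: "integrable (time T) q"
    and weak: "\<And>X X'. (\<And>t. (X has_real_derivative X' t) (at t)) \<Longrightarrow> bump_span X' \<Longrightarrow>
      (\<exists>a b. 0 < a \<and> b < T \<and> (\<forall>t. t \<notin> {a..b} \<longrightarrow> X t = 0)) \<Longrightarrow>
      (\<integral>t. h t * X' t \<partial>time T) = - (\<integral>t. q t * X t \<partial>time T)"
    and t: "0 \<le> t" "t < T"
  shows "h t = h 0 + (\<integral>s. q s \<partial>time t)"
proof -
  have hc: "continuous_on {0<..<T} h" by (rule continuous_on_subset[OF h]) auto
  have qm: "q \<in> borel_measurable (time T)" using q by auto
  have main: "h r - h s = integral {s..r} q" if sr: "0 < s" "s < r" "r < T" for s r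
  proof -
    define X where "X n \<tau> = eta (real n * (\<tau> - s)) - eta (real n * (\<tau> - r))" for n \<tau>
    define X' where "X' n \<tau> = real n * rho (real n * (\<tau> - s)) - real n * rho (real n * (\<tau> - r))" for n \<tau>
    have der: "(X n has_real_derivative X' n \<tau>) (at \<tau>)" for n \<tau>
      unfolding X_def X'_def
      by (rule derivative_eq_intros DERIV_chain2[OF eta_deriv] refl)+ (simp add: mult.commute)
    have bpX': "bump_span (X' n)" for n
    proof -
      have "X' n = (\<lambda>\<tau>. real n * (psi 0 (real n * \<tau> + - real n * s) * psi 0 (- real n * \<tau> + (1 + real n * s)))
         + (- real n) * (psi 0 (real n * \<tau> + - real n * r) * psi 0 (- real n * \<tau> + (1 + real n * r))))"
        by (simp add: X'_def rho_def fun_eq_iff algebra_simps)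
      then show ?thesis by (simp only:) (intro bump_span.intros)
    qed
    \<comment> \<open>The smoothed step at \<open>r\<close> ends at \<open>r + 1 / real n\<close>;
      from \<open>M\<close> on this is below \<open>T\<close>, as the compact support
      requires.\<close>
    obtain M :: nat where M: "1 / (T - r) < real M" using reals_Archimedean2 by blast
    have w: "(\<integral>t. h t * X' n t \<partial>time T) = - (\<integral>t. q t * X n t \<partial>time T)" if "M \<le> n" for n
    proof (rule weak[OF der bpX'])
      have Tr: "0 < T - r" using sr by simp
      have n1: "1 / (T - r) < real n" using M that by linarith
      have n0: "0 < real n" using n1 Tr by (meson divide_pos_pos less_trans zero_less_one)
      have "1 / real n < T - r" using n1 Tr n0 by (simp add: divide_less_eq mult.commute)
      moreover have "X n \<tau> = 0" if "\<tau> \<notin> {s..r + 1 / real n}" for \<tau>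
      proof (cases "\<tau> < s")
        case True
        then show ?thesis using sr by (simp add: X_def eta_nonpos mult_nonneg_nonpos)
      next
        case False
        then have "r + 1 / real n < \<tau>" using that by auto
        then have "1 \<le> real n * (\<tau> - r)" using n0 by (simp add: field_simps)
        moreover have "real n * (\<tau> - r) \<le> real n * (\<tau> - s)" using sr by (intro mult_left_mono) auto
        ultimately show ?thesis by (simp add: X_def eta_ge1[of "real n * (\<tau> - r)"] eta_ge1[of "real n * (\<tau> - s)"])
      qed
      ultimately show "\<exists>a b. 0 < a \<and> b < T \<and> (\<forall>t. t \<notin> {a..b} \<longrightarrow> X n t = 0)"
        using sr by (intro exI[of _ s] exI[of _ "r + 1 / real n"]) auto
    qed
    have L1: "(\<lambda>n. \<integral>t. h t * X' n t \<partial>time T) \<longlonglongrightarrow> h s * eta 1 - h r * eta 1"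
    proof -
      have intg: "integrable (time T) (\<lambda>\<tau>. h \<tau> * (real n * rho (real n * (\<tau> - s))))" if "0 < s" "s < T" "s + 1 / real n < T" "0 < n" for n s
      proof -
        let ?g = "\<lambda>\<tau>. h \<tau> * (real n * rho (real n * (\<tau> - s)))" and ?b = "s + 1 / real n"
        have g0: "?g \<tau> = 0" if "\<tau> \<notin> {s..?b}" for \<tau>
        proof -
          have "real n * (\<tau> - s) \<le> 0 \<or> 1 \<le> real n * (\<tau> - s)"
            using that \<open>0 < n\<close> by (auto simp: field_simps mult_le_0_iff)
          then show ?thesis using rho_props(2,3) by auto
        qed
        have c: "continuous_on {s..?b} ?g"
          by (intro continuous_intros continuous_on_subset[OF hc] continuous_on_compose2[OF rho_continuous[of UNIV]]) (use that in auto)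
        have "integrable lborel (\<lambda>x. indicator {s..?b} x *\<^sub>R ?g x)"
          by (rule borel_integrable_compact[OF compact_Icc c])
        then have "integrable lebesgue (\<lambda>x. indicator {s..?b} x *\<^sub>R ?g x)"
          by (subst integrable_completion) (auto dest: borel_measurable_integrable)
        also have "(\<lambda>x. indicator {s..?b} x *\<^sub>R ?g x) = (\<lambda>x. indicator {0<..<T} x *\<^sub>R ?g x)"
          using g0 that by (auto simp: indicator_def fun_eq_iff)
        finally show ?thesis by (simp add: time_def integrable_restrict_space)
      qed
      have lim: "(\<lambda>n. (\<integral>t. h t * (real n * rho (real n * (t - s))) \<partial>time T) - (\<integral>t. h t * (real n * rho (real n * (t - r))) \<partial>time T)) \<longlonglongrightarrow> h s * eta 1 - h r * eta 1"
        by (intro tendsto_diff bump_limit hc) (use sr in auto)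
      moreover have "(\<integral>t. h t * (real n * rho (real n * (t - s))) \<partial>time T) - (\<integral>t. h t * (real n * rho (real n * (t - r))) \<partial>time T) = (\<integral>t. h t * X' n t \<partial>time T)" if "M + 1 \<le> n" for n
      proof -
        have Tr: "0 < T - r" using sr by simp
        have n1: "1 / (T - r) < real n" using M that by linarith
        have n0: "0 < real n" using that by simp
        have "1 / real n < T - r" using n1 Tr n0 by (simp add: divide_less_eq mult.commute)
        then have "integrable (time T) (\<lambda>\<tau>. h \<tau> * (real n * rho (real n * (\<tau> - s))))" "integrable (time T) (\<lambda>\<tau>. h \<tau> * (real n * rho (real n * (\<tau> - r))))"
          using sr n0 by (auto intro!: intg)
        then show ?thesis
          unfolding X'_def right_diff_distrib by (rule Bochner_Integration.integral_diff[symmetric])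
      qed
      ultimately show ?thesis
        by (intro Lim_transform_eventually[OF lim]) (auto simp: eventually_sequentially intro!: exI[of _ "M + 1"])
    qed
    have L2: "(\<lambda>n. \<integral>t. q t * X n t \<partial>time T) \<longlonglongrightarrow> (\<integral>t. q t * (eta 1 * indicator {s<..r} t) \<partial>time T)"
    proof (rule integral_dominated_convergence)
      show "integrable (time T) (\<lambda>t. \<bar>q t\<bar> * eta 1)" using q by simp
      show "(\<lambda>t. q t * (eta 1 * indicator {s<..r} t)) \<in> borel_measurable (time T)"
      proof -
        have "(indicator {s<..r} :: real \<Rightarrow> real) \<in> borel_measurable (time T)"
          unfolding time_def by (intro borel_measurable_indicator' measurable_restrict_space1) (auto intro!: measurable_completion)
        then show ?thesis using qm by simp
      qed
      show "(\<lambda>t. q t * X n t) \<in> borel_measurable (time T)" for n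
      proof -
        have "continuous_on {0<..<T} (X n)"
          unfolding X_def by (intro continuous_intros continuous_on_compose2[OF eta_continuous[of UNIV]]) auto
        from continuous_time_measurable[OF this] qm show ?thesis by simp
      qed
      show "AE t in time T. (\<lambda>n. q t * X n t) \<longlonglongrightarrow> q t * (eta 1 * indicator {s<..r} t)"
      proof (rule AE_I2)
        fix t
        have "(\<lambda>n. X n t) \<longlonglongrightarrow> (if s < t then eta 1 else 0) - (if r < t then eta 1 else 0)"
          unfolding X_def by (intro tendsto_diff eta_step_limit)
        also have "(if s < t then eta 1 else 0) - (if r < t then eta 1 else 0) = eta 1 * indicator {s<..r} t"
          using sr by (auto simp: indicator_def)
        finally show "(\<lambda>n. q t * X n t) \<longlonglongrightarrow> q t * (eta 1 * indicator {s<..r} t)"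
          by (intro tendsto_mult tendsto_const)
      qed
      show "AE t in time T. norm (q t * X n t) \<le> \<bar>q t\<bar> * eta 1" for n
      proof (rule AE_I2)
        fix t
        have "\<bar>X n t\<bar> \<le> eta 1"
          using eta_bounds[of "real n * (t - s)"] eta_bounds[of "real n * (t - r)"] unfolding X_def by linarith
        then show "norm (q t * X n t) \<le> \<bar>q t\<bar> * eta 1" by (simp add: abs_mult mult_left_mono)
      qed
    qed
    have "(\<lambda>n. \<integral>t. h t * X' n t \<partial>time T) \<longlonglongrightarrow> - (\<integral>t. q t * (eta 1 * indicator {s<..r} t) \<partial>time T)"
      by (rule Lim_transform_eventually[OF tendsto_minus[OF L2]]) (use w in \<open>auto simp: eventually_sequentially intro!: exI[of _ M]\<close>)
    from LIMSEQ_unique[OF this L1] have "h s * eta 1 - h r * eta 1 = - (\<integral>t. eta 1 * (q t * indicator {s<..r} t) \<partial>time T)"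
      by (simp add: mult.left_commute)
    then have "eta 1 * (h r - h s) = eta 1 * (\<integral>t. q t * indicator {s<..r} t \<partial>time T)"
      by (simp add: algebra_simps)
    then have "h r - h s = (\<integral>t. q t * indicator {s<..r} t \<partial>time T)"
      using eta_pos by simp
    also have "\<dots> = (\<integral>t. indicator {0<..<T} t *\<^sub>R (q t * indicator {s<..r} t) \<partial>lebesgue)"
      unfolding time_def by (rule integral_restrict_space) simp
    also have "\<dots> = (\<integral>t. indicator {s<..r} t *\<^sub>R q t \<partial>lebesgue)"
      by (intro Bochner_Integration.integral_cong refl) (use sr in \<open>auto simp: indicator_def\<close>)
    also have "\<dots> = (\<integral>t. q t \<partial>lebesgue_on {s<..r})"
      by (rule integral_restrict_space[symmetric]) simp
    also have "\<dots> = integral {s<..r} q"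
    proof (rule lebesgue_integral_eq_integral)
      have "set_integrable lebesgue {0<..<T} q" using q by (simp add: time_def integrable_restrict_space set_integrable_def)
      then have "set_integrable lebesgue {s<..r} q" by (rule set_integrable_subset) (use sr in auto)
      then show "integrable (lebesgue_on {s<..r}) q" by (simp add: integrable_restrict_space set_integrable_def)
    qed simp
    also have "\<dots> = integral {s..r} q"
      by (rule integral_spike_set) (rule negligible_subset[of "{s}"], simp, force)+
    finally show ?thesis .
  qed
  show ?thesis
  proof (cases "t = 0")
    case True
    have "integral\<^sup>L (time t) q = 0"
      using time_integral_HK(1)[OF time_integrable_mono[OF q, of t]] t True by simp
    then show ?thesis using True by simp
  next
    case False
    then have t0: "0 < t" using t by simp
    have qt: "integrable (time t) q" by (rule time_integrable_mono[OF q]) (use t in simp)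
    note qi = time_integral_HK(2)[OF qt]
    have c1: "continuous_on {0..t} (\<lambda>s. integral {s..t} q)"
      by (rule indefinite_integral_continuous_1'[OF qi])
    have c2: "continuous_on {0..t} (\<lambda>s. h t - h s)"
      by (intro continuous_intros continuous_on_subset[OF h]) (use t in auto)
    \<comment> \<open>The shift by 2 keeps the points strictly between 0 and \<open>t\<close>, where
      \<open>main\<close> applies.\<close>
    have lim: "(\<lambda>n. t / real (Suc (Suc n))) \<longlonglongrightarrow> 0"
      using LIMSEQ_Suc[OF LIMSEQ_Suc[OF lim_const_over_n[of t]]] by simp
    have in0t: "t / real (Suc (Suc n)) \<in> {0..t}" "0 < t / real (Suc (Suc n))" "t / real (Suc (Suc n)) < t" for n
      using t0 by (auto simp: field_simps intro: add_pos_nonneg)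
    have "(\<lambda>n. integral {t / real (Suc (Suc n))..t} q) \<longlonglongrightarrow> integral {0..t} q"
      by (rule continuous_on_tendsto_compose[OF c1 lim]) (use in0t t0 in auto)
    moreover have "(\<lambda>n. h t - h (t / real (Suc (Suc n)))) \<longlonglongrightarrow> h t - h 0"
      by (rule continuous_on_tendsto_compose[OF c2 lim]) (use in0t t0 in auto)
    moreover have "h t - h (t / real (Suc (Suc n))) = integral {t / real (Suc (Suc n))..t} q" for n
      by (rule main) (use in0t t in auto)
    ultimately have "h t - h 0 = integral {0..t} q" using LIMSEQ_unique by simp
    then show ?thesis using time_integral_HK(1)[OF qt] by simp
  qed
qed

section \<open>Energy identity and Gronwall inequality\<close>

text \<open>On a fine partition every increment of \<open>M\<close> is below \<open>e\<close>, so
  each increment of \<open>D\<close> is at most \<open>e * C\<close> times that of \<open>M\<close>.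
  The increments of \<open>M\<close> telescope, and \<open>e\<close> is arbitrary.\<close>

lemma constant_if_quadratic_increments:
  fixes D M :: "real \<Rightarrow> real"
  assumes "continuous_on {0..t} M" "0 \<le> t"
    and mono: "\<And>r s. 0 \<le> r \<Longrightarrow> r \<le> s \<Longrightarrow> s \<le> t \<Longrightarrow> M r \<le> M s"
    and D: "\<And>r s. 0 \<le> r \<Longrightarrow> r \<le> s \<Longrightarrow> s \<le> t \<Longrightarrow> \<bar>D s - D r\<bar> \<le> C * (M s - M r)\<^sup>2" and C: "0 \<le> C"
  shows "D t = D 0"
proof -
  have "\<bar>D t - D 0\<bar> \<le> e * (C * (M t - M 0))" if "0 < e" for e
  proof -
    have "uniformly_continuous_on {0..t} M"
      by (rule compact_uniformly_continuous[OF assms(1)]) simp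
    then have "\<exists>d>0. \<forall>r\<in>{0..t}. \<forall>s\<in>{0..t}. \<bar>s - r\<bar> < d \<longrightarrow> \<bar>M s - M r\<bar> < e"
      using that unfolding uniformly_continuous_on_def dist_real_def by blast
    then obtain d where d: "0 < d" "\<And>r s. r \<in> {0..t} \<Longrightarrow> s \<in> {0..t} \<Longrightarrow> \<bar>s - r\<bar> < d \<Longrightarrow> \<bar>M s - M r\<bar> < e"
      by blast
    obtain n :: nat where n: "t / d < real n" using reals_Archimedean2 by blast
    have n0: "0 < n"
    proof (rule ccontr)
      assume "\<not> 0 < n"
      then have "t / d < 0" using n by simp
      then show False using d(1) assms(2) by (simp add: divide_less_0_iff)
    qed
    define p where "p i = real i * t / real n" for i
    have p: "p 0 = 0" "p n = t" using n0 by (simp_all add: p_def)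
    have pin: "p i \<in> {0..t}" if "i \<le> n" for i
      using that n0 assms(2) mult_right_mono[of "real i" "real n" t] by (auto simp: p_def field_simps)
    have pmono: "p i \<le> p (Suc i)" for i
      using assms(2) by (simp add: p_def divide_right_mono mult_right_mono)
    have pd: "\<bar>p (Suc i) - p i\<bar> < d" for i
    proof -
      have "p (Suc i) - p i = t / real n" by (simp add: p_def add_divide_distrib distrib_right)
      moreover have "t / real n < d" using n n0 d(1) by (simp add: field_simps)
      ultimately show ?thesis using assms(2) by simp
    qed
    have "\<bar>D t - D 0\<bar> = \<bar>\<Sum>i<n. D (p (Suc i)) - D (p i)\<bar>"
      using sum_lessThan_telescope[of "\<lambda>i. D (p i)" n] p by simp
    also have "\<dots> \<le> (\<Sum>i<n. \<bar>D (p (Suc i)) - D (p i)\<bar>)" by (rule sum_abs)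
    also have "\<dots> \<le> (\<Sum>i<n. e * (C * (M (p (Suc i)) - M (p i))))"
    proof (rule sum_mono)
      fix i assume "i \<in> {..<n}"
      then have i: "p i \<in> {0..t}" "p (Suc i) \<in> {0..t}" using pin by auto
      have m: "M (p i) \<le> M (p (Suc i))" using i pmono by (intro mono) auto
      have "\<bar>D (p (Suc i)) - D (p i)\<bar> \<le> C * (M (p (Suc i)) - M (p i))\<^sup>2"
        using i pmono by (intro D) auto
      also have "\<dots> = (M (p (Suc i)) - M (p i)) * (C * (M (p (Suc i)) - M (p i)))"
        by (simp add: power2_eq_square)
      also have "\<dots> \<le> e * (C * (M (p (Suc i)) - M (p i)))"
        using d(2)[OF i pd] m C by (intro mult_right_mono) auto
      finally show "\<bar>D (p (Suc i)) - D (p i)\<bar> \<le> e * (C * (M (p (Suc i)) - M (p i)))" .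
    qed
    also have "\<dots> = e * (C * (M t - M 0))"
      using sum_lessThan_telescope[of "\<lambda>i. M (p i)" n] p by (simp flip: sum_distrib_left)
    finally show ?thesis .
  qed
  note * = this
  have "\<bar>D t - D 0\<bar> \<le> 0"
  proof (rule field_le_epsilon)
    fix e :: real assume e: "0 < e"
    let ?K = "C * (M t - M 0)"
    have K: "0 \<le> ?K" using C mono[of 0 t] assms(2) by simp
    have "\<bar>D t - D 0\<bar> \<le> e / (?K + 1) * ?K" using e K by (intro *) simp
    also have "\<dots> \<le> e" using e K by (simp add: field_simps)
    finally show "\<bar>D t - D 0\<bar> \<le> 0 + e" by simp
  qed
  then show ?thesis by simp
qed

lemma time_indefinite_continuous:
  assumes q: "integrable (time T) (q :: real \<Rightarrow> real)"
  shows "continuous_on {0..T} (\<lambda>t. \<integral>s. q s \<partial>time t)"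
proof -
  have "continuous_on {0..T} (\<lambda>t. integral {0..t} q)"
    by (rule indefinite_integral_continuous_1[OF time_integral_HK(2)[OF q]])
  moreover have "(\<integral>s. q s \<partial>time t) = integral {0..t} q" if "t \<in> {0..T}" for t
    using that by (intro time_integral_HK time_integrable_mono[OF q]) simp
  ultimately show ?thesis
    by (metis (mono_tags, lifting) continuous_on_eq)
qed

lemma time_integrable_mult_continuous:
  assumes q: "integrable (time T) (q :: real \<Rightarrow> real)" and h: "continuous_on {0..T} h"
  shows "integrable (time T) (\<lambda>s. h s * q s)"
proof -
  have "bounded (h ` {0..T})" by (intro compact_imp_bounded compact_continuous_image h) simp
  then obtain B where "\<forall>s\<in>{0..T}. \<bar>h s\<bar> \<le> B" by (auto simp: bounded_iff)
  then have B: "\<bar>h s\<bar> \<le> B" if "s \<in> {0..T}" for s using that by blast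
  show ?thesis
  proof (rule Bochner_Integration.integrable_bound)
    show "integrable (time T) (\<lambda>s. B * q s)" using q by simp
    show "(\<lambda>s. h s * q s) \<in> borel_measurable (time T)"
      by (intro borel_measurable_times continuous_time_measurable[OF continuous_on_subset[OF h]]) (use q in auto)
    show "AE s in time T. norm (h s * q s) \<le> norm (B * q s)"
    proof (rule AE_I2)
      fix s assume "s \<in> space (time T)"
      then have "\<bar>h s\<bar> \<le> \<bar>B\<bar>" using B[of s] by auto
      then show "norm (h s * q s) \<le> norm (B * q s)" by (simp add: abs_mult mult_right_mono)
    qed
  qed
qed

text \<open>The chain rule for an absolutely continuous function, obtained without pointwise
  derivatives: the defect \<open>D\<close> of the formula has increments quadratic in those of
  \<open>M\<close>, the integral of \<open>\<bar>q s\<bar>\<close>.\<close>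

lemma square_of_indefinite_integral:
  fixes q h :: "real \<Rightarrow> real"
  assumes q: "integrable (time T) q" and h: "\<And>t. 0 \<le> t \<Longrightarrow> t < T \<Longrightarrow> h t = h 0 + (\<integral>s. q s \<partial>time t)"
    and t: "0 \<le> t" "t < T"
  shows "(h t)\<^sup>2 = (h 0)\<^sup>2 + 2 * (\<integral>s. h s * q s \<partial>time t)" "continuous_on {0..t} h" "integrable (time t) (\<lambda>s. h s * q s)"
proof -
  have qt: "integrable (time t) q" by (rule time_integrable_mono[OF q]) (use t in simp)
  have "continuous_on {0..t} (\<lambda>t. h 0 + (\<integral>s. q s \<partial>time t))"
    by (intro continuous_intros time_indefinite_continuous qt)
  then show hc: "continuous_on {0..t} h"
    by (rule continuous_on_eq) (rule h[symmetric], use t in auto)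
  show hq: "integrable (time t) (\<lambda>s. h s * q s)"
    by (rule time_integrable_mult_continuous[OF qt hc])
  have aq: "integrable (time t) (\<lambda>s. \<bar>q s\<bar>)" using qt by simp
  define M where "M r = integral {0..r} (\<lambda>s. \<bar>q s\<bar>)" for r
  define D where "D r = (h r)\<^sup>2 - 2 * integral {0..r} (\<lambda>s. h s * q s)" for r
  note qi = time_integral_HK(2)[OF qt] and aqi = time_integral_HK(2)[OF aq] and hqi = time_integral_HK(2)[OF hq]
  have sub: "f integrable_on {r..s}" if "f integrable_on {0..t}" "0 \<le> r" "s \<le> t" for f :: "real \<Rightarrow> real" and r s
    by (rule integrable_on_subinterval[OF that(1)]) (use that in auto)
  have hd: "h s - h r = integral {r..s} q" if "0 \<le> r" "r \<le> s" "s \<le> t" for r s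
  proof -
    have "h s = h 0 + integral {0..s} q" "h r = h 0 + integral {0..r} q"
      using h[of s] h[of r] time_integral_HK(1)[OF time_integrable_mono[OF q, of s]] time_integral_HK(1)[OF time_integrable_mono[OF q, of r]] that t by linarith+
    moreover have "integral {0..r} q + integral {r..s} q = integral {0..s} q"
      by (rule Henstock_Kurzweil_Integration.integral_combine) (use that sub[OF qi] in auto)
    ultimately show ?thesis by linarith
  qed
  have Md: "M s - M r = integral {r..s} (\<lambda>s. \<bar>q s\<bar>)" if "0 \<le> r" "r \<le> s" "s \<le> t" for r s
    using Henstock_Kurzweil_Integration.integral_combine[of 0 r s "\<lambda>s. \<bar>q s\<bar>"] that sub[OF aqi] by (auto simp: M_def)
  have Mm: "M r \<le> M s" if "0 \<le> r" "r \<le> s" "s \<le> t" for r s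
    using Md[OF that] integral_nonneg[OF sub[OF aqi, of r s]] that by auto
  have hM: "\<bar>h s - h r\<bar> \<le> M s - M r" if "0 \<le> r" "r \<le> s" "s \<le> t" for r s
    unfolding hd[OF that] Md[OF that] real_norm_def[symmetric]
    by (rule integral_norm_bound_integral) (use that sub[OF qi] sub[OF aqi] in auto)
  have "D t = D 0"
  proof (rule constant_if_quadratic_increments[where D=D and M=M and C=2, OF _ t(1) Mm])
    show "continuous_on {0..t} M" unfolding M_def by (rule indefinite_integral_continuous_1[OF aqi])
    fix r s assume rs: "0 \<le> r" "r \<le> s" "s \<le> t"
    let ?m = "M s - M r"
    have "integral {r..s} (\<lambda>x. h x * q x) = integral {0..s} (\<lambda>s. h s * q s) - integral {0..r} (\<lambda>s. h s * q s)"
      using Henstock_Kurzweil_Integration.integral_combine[of 0 r s "\<lambda>s. h s * q s"] rs sub[OF hqi] by auto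
    then have "D s - D r = (h s + h r) * integral {r..s} q - 2 * integral {r..s} (\<lambda>x. h x * q x)"
      unfolding hd[OF rs, symmetric] by (simp add: D_def power2_eq_square algebra_simps)
    also have "\<dots> = integral {r..s} (\<lambda>x. (h s + h r) * q x - 2 * (h x * q x))"
      using sub[OF qi, of r s] sub[OF hqi, of r s] rs by (subst Henstock_Kurzweil_Integration.integral_diff) (auto intro: integrable_on_mult_right)
    finally have eq: "D s - D r = integral {r..s} (\<lambda>x. (h s + h r) * q x - 2 * (h x * q x))" .
    have "norm (D s - D r) \<le> integral {r..s} (\<lambda>x. (2 * ?m) * \<bar>q x\<bar>)"
      unfolding eq
    proof (rule integral_norm_bound_integral)
      show "(\<lambda>x. (h s + h r) * q x - 2 * (h x * q x)) integrable_on {r..s}"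
        using sub[OF qi, of r s] sub[OF hqi, of r s] rs by (intro Henstock_Kurzweil_Integration.integrable_diff integrable_on_mult_right) auto
      show "(\<lambda>x. (2 * ?m) * \<bar>q x\<bar>) integrable_on {r..s}"
        using sub[OF aqi, of r s] rs by (intro integrable_on_mult_right) auto
      fix x assume x: "x \<in> {r..s}"
      \<comment> \<open>The integrand is \<open>q x\<close> times a combination of two increments of
        \<open>h\<close>, each at most \<open>?m\<close>. Integrating \<open>\<bar>q x\<bar>\<close>
        contributes the second factor \<open>?m\<close>.\<close>
      have "\<bar>h s - h x\<bar> \<le> ?m" "\<bar>h x - h r\<bar> \<le> ?m"
        using hM[of x s] hM[of r x] Mm[of r x] Mm[of x s] x rs by auto
      then have "\<bar>(h s - h x) - (h x - h r)\<bar> \<le> 2 * ?m"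
        using order_trans[OF abs_triangle_ineq4[of "h s - h x" "h x - h r"] add_mono] by (simp only: mult_2)
      then have "\<bar>(h s - h x) - (h x - h r)\<bar> * \<bar>q x\<bar> \<le> (2 * ?m) * \<bar>q x\<bar>" by (rule mult_right_mono) simp
      moreover have "(h s + h r) * q x - 2 * (h x * q x) = ((h s - h x) - (h x - h r)) * q x" by (simp add: algebra_simps)
      ultimately show "norm ((h s + h r) * q x - 2 * (h x * q x)) \<le> (2 * ?m) * \<bar>q x\<bar>" by (simp add: abs_mult)
    qed
    also have "\<dots> = 2 * ?m\<^sup>2" using Md[OF rs] by (simp add: power2_eq_square)
    finally show "\<bar>D s - D r\<bar> \<le> 2 * (M s - M r)\<^sup>2" by simp
  qed simp_all
  then show "(h t)\<^sup>2 = (h 0)\<^sup>2 + 2 * (\<integral>s. h s * q s \<partial>time t)"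
    using time_integral_HK(1)[OF hq] by (simp add: D_def)
qed

section \<open>Null sets and complete measures\<close>

lemma complete_lebesgue_on:
  assumes "S \<in> sets lebesgue" shows "complete_measure (lebesgue_on S)"
proof
  fix A B assume "B \<subseteq> A" "A \<in> null_sets (lebesgue_on S)"
  then have A: "A \<in> null_sets lebesgue" "A \<subseteq> S" "B \<subseteq> A" using assms by (auto simp: null_sets_restrict_space)
  then have "B \<in> sets lebesgue" by (meson completion.complete)
  then show "B \<in> sets (lebesgue_on S)" using A assms by (simp add: sets_restrict_space_iff)
qed

text \<open>Quantities built from chosen representatives become measurable by comparison with a good
  representative; completeness makes a comparison almost everywhere sufficient.\<close>

lemma measurable_AE_complete:
  assumes "complete_measure M" "f \<in> measurable M N" "g \<in> space M \<rightarrow> space N" "AE x in M. f x = g x"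
  shows "g \<in> measurable M N"
proof (rule measurableI)
  interpret complete_measure M by fact
  show "g x \<in> space N" if "x \<in> space M" for x using assms(3) that by auto
  fix A assume "A \<in> sets N"
  then have A: "f -` A \<inter> space M \<in> sets M" using assms(2) by (simp add: measurable_sets)
  have ae: "AE x in M. x \<in> f -` A \<inter> space M \<longleftrightarrow> x \<in> g -` A \<inter> space M"
    using assms(4) by eventually_elim auto
  show "g -` A \<inter> space M \<in> sets M"
    by (rule in_sets_AE[OF ae A]) simp
qed

lemma complete_time: "complete_measure (time T)"
  unfolding time_def by (rule complete_lebesgue_on) simp

lemma complete_torus: "complete_measure torus"
  unfolding torus_def by (rule complete_lebesgue_on) simp

lemma borel_measurable_AE_complete:
  fixes g :: "'a \<Rightarrow> 'b::topological_space"
  assumes "complete_measure M" "f \<in> borel_measurable M" "AE x in M. f x = g x"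
  shows "g \<in> borel_measurable M"
  by (rule measurable_AE_complete[OF assms(1,2) _ assms(3)]) simp

lemma borel_measurable_lim_AE:
  fixes f :: "nat \<Rightarrow> 'a \<Rightarrow> real"
  assumes "complete_measure M" "\<And>n. f n \<in> borel_measurable M" "AE x in M. (\<lambda>n. f n x) \<longlonglongrightarrow> g x"
  shows "g \<in> borel_measurable M"
proof (rule borel_measurable_AE_complete[OF assms(1)])
  show "(\<lambda>x. lim (\<lambda>n. f n x)) \<in> borel_measurable M"
    using assms(2) by (rule borel_measurable_lim_metric)
  show "AE x in M. lim (\<lambda>n. f n x) = g x"
    using assms(3) by eventually_elim (rule limI)
qed

lemma AE_time_mono:
  assumes "AE s in time T. P s" "t \<le> T" shows "AE s in time t. P s"
proof -
  obtain N where "N \<in> null_sets (time T)" "{s\<in>space (time T). \<not> P s} \<subseteq> N"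
    using assms(1) by (auto simp: eventually_ae_filter)
  then have neg: "negligible N" and N: "\<And>s. s \<in> {0<..<T} \<Longrightarrow> s \<notin> N \<Longrightarrow> P s"
    by (auto simp: time_def null_sets_restrict_space negligible_iff_null_sets)
  show ?thesis
    unfolding time_def by (subst AE_restrict_space_iff)
      (use neg N assms(2) in \<open>auto intro!: AE_I'[of N] simp: negligible_iff_null_sets\<close>)
qed

lemma nrm_ps_le: "L2 f \<Longrightarrow> nrm torus (ps N f) \<le> nrm torus f"
  using Bessel[of f N] by (simp add: nrm_def nsq_ps)

text \<open>\<open>square_of_indefinite_integral\<close> is applied to the real and imaginary part
  of each mode and summed over \<open>KB N\<close>. The sum under the time integral is 8 times an
  inner product with the partial sum of \<open>U\<close>, hence dominated by \<open>8 * B\<close>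
  uniformly in \<open>N\<close>, and Parseval's identity gives the limits.\<close>

lemma energy_identity:
  assumes U: "\<And>t. 0 \<le> t \<Longrightarrow> t < T \<Longrightarrow> L2 (U t)"
    and q: "\<And>k. integrable (time T) (\<lambda>s. fc (G s) k)"
    and mode: "\<And>k t. 0 \<le> t \<Longrightarrow> t < T \<Longrightarrow> fc (U t) k = fc (U 0) k + (\<integral>s. fc (G s) k \<partial>time t)"
    and G: "AE s in time T. L2 (G s) \<and> nrm torus (U s) * nrm torus (G s) \<le> B"
    and t: "0 \<le> t" "t < T"
  shows "nsq torus (U t) = nsq torus (U 0) + 2 * (\<integral>s. ip torus (U s) (G s) \<partial>time t)"
    "integrable (time t) (\<lambda>s. ip torus (U s) (G s))"
proof -
  have T0: "0 < T" using t by linarith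
  interpret ft: finite_measure "time t" by (rule finite_measure_time)
  define R where "R k s = Re (fc (U s) k)" for k s
  define I where "I k s = Im (fc (U s) k)" for k s
  define Rq where "Rq k s = Re (fc (G s) k)" for k s
  define Iq where "Iq k s = Im (fc (G s) k)" for k s
  have qi: "integrable (time T) (Rq k)" "integrable (time T) (Iq k)" for k
    unfolding Rq_def[abs_def] Iq_def[abs_def] using q[of k] by auto
  have qt: "integrable (time r) (\<lambda>s. fc (G s) k)" if "r < T" for k r
    by (rule time_integrable_mono[OF q]) (use that in simp)
  have mR: "R k r = R k 0 + (\<integral>s. Rq k s \<partial>time r)" "I k r = I k 0 + (\<integral>s. Iq k s \<partial>time r)" if "0 \<le> r" "r < T" for k r
    unfolding R_def I_def Rq_def Iq_def using mode[OF that, of k] qt[OF that(2), of k] by auto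
  note sR = square_of_indefinite_integral[OF qi(1) mR(1) t] and sI = square_of_indefinite_integral[OF qi(2) mR(2) t]
  have AEt: "AE s in time t. L2 (U s) \<and> L2 (G s) \<and> nrm torus (U s) * nrm torus (G s) \<le> B"
  proof -
    have "AE s in time t. s \<in> space (time t)" by (rule AE_space)
    moreover have "AE s in time t. L2 (G s) \<and> nrm torus (U s) * nrm torus (G s) \<le> B"
      by (rule AE_time_mono[OF G]) (use t in simp)
    ultimately show ?thesis
      by eventually_elim (use t in \<open>auto intro: U\<close>)
  qed
  define p where "p N s = (\<Sum>k\<in>KB N. R k s * Rq k s + I k s * Iq k s)" for N s
  have pi: "integrable (time t) (p N)" for N
    unfolding p_def by (intro Bochner_Integration.integrable_sum Bochner_Integration.integrable_add sR(3) sI(3))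
  have pe: "p N s = (\<Sum>k\<in>KB N. Re (fc (U s) k * cnj (fc (G s) k)))" for N s
    by (simp add: p_def R_def I_def Rq_def Iq_def times_complex.sel)
  have plim: "AE s in time t. (\<lambda>N. p N s) \<longlonglongrightarrow> 8 * ip torus (U s) (G s)"
    using AEt
  proof eventually_elim
    fix s assume "L2 (U s) \<and> L2 (G s) \<and> nrm torus (U s) * nrm torus (G s) \<le> B"
    then show "(\<lambda>N. p N s) \<longlonglongrightarrow> 8 * ip torus (U s) (G s)"
      using tendsto_mult_left[OF Parseval_ip[of "U s" "G s"], of 8] by (simp add: pe)
  qed
  have pb: "AE s in time t. norm (p N s) \<le> 8 * B" for N
    using AEt
  proof eventually_elim
    fix s assume a: "L2 (U s) \<and> L2 (G s) \<and> nrm torus (U s) * nrm torus (G s) \<le> B"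
    have "p N s = 8 * ip torus (G s) (ps N (U s))" using a by (simp add: pe ip_ps)
    moreover have "\<bar>ip torus (G s) (ps N (U s))\<bar> \<le> nrm torus (G s) * nrm torus (U s)"
      using a by (intro order_trans[OF ip_Cauchy_Schwarz] mult_left_mono nrm_ps_le sqi_ps) auto
    ultimately show "norm (p N s) \<le> 8 * B" using a by (simp add: abs_mult mult.commute)
  qed
  have m8: "(\<lambda>s. 8 * ip torus (U s) (G s)) \<in> borel_measurable (time t)"
    by (rule borel_measurable_lim_AE[OF complete_time _ plim]) (use pi in auto)
  have B: "integrable (time t) (\<lambda>s. 8 * B)" by simp
  have pm: "p N \<in> borel_measurable (time t)" for N using pi by auto
  have int8: "integrable (time t) (\<lambda>s. 8 * ip torus (U s) (G s))"
    and lim: "(\<lambda>N. \<integral>s. p N s \<partial>time t) \<longlonglongrightarrow> (\<integral>s. 8 * ip torus (U s) (G s) \<partial>time t)"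
    by (rule integrable_dominated_convergence[OF m8 pm B plim pb], rule integral_dominated_convergence[OF m8 pm B plim pb])
  show "integrable (time t) (\<lambda>s. ip torus (U s) (G s))"
    using integrable_mult_right[OF int8, of "1/8"] by simp
  have sum: "(\<Sum>k\<in>KB N. (norm (fc (U t) k))\<^sup>2) = (\<Sum>k\<in>KB N. (norm (fc (U 0) k))\<^sup>2) + 2 * (\<integral>s. p N s \<partial>time t)" for N
  proof -
    have "(norm (fc (U r) k))\<^sup>2 = (R k r)\<^sup>2 + (I k r)\<^sup>2" for k r by (simp add: cmod_power2 R_def I_def)
    then have "(\<Sum>k\<in>KB N. (norm (fc (U t) k))\<^sup>2) = (\<Sum>k\<in>KB N. (norm (fc (U 0) k))\<^sup>2 + 2 * ((\<integral>s. R k s * Rq k s \<partial>time t) + (\<integral>s. I k s * Iq k s \<partial>time t)))"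
      by (intro sum.cong refl) (simp add: sR(1) sI(1))
    also have "\<dots> = (\<Sum>k\<in>KB N. (norm (fc (U 0) k))\<^sup>2) + 2 * (\<Sum>k\<in>KB N. (\<integral>s. R k s * Rq k s + I k s * Iq k s \<partial>time t))"
      using sR(3) sI(3) by (simp add: sum.distrib sum_distrib_left)
    also have "(\<Sum>k\<in>KB N. (\<integral>s. R k s * Rq k s + I k s * Iq k s \<partial>time t)) = (\<integral>s. p N s \<partial>time t)"
      unfolding p_def using sR(3) sI(3) by (subst Bochner_Integration.integral_sum) auto
    finally show ?thesis .
  qed
  have "(\<lambda>N. \<Sum>k\<in>KB N. (norm (fc (U t) k))\<^sup>2) \<longlonglongrightarrow> 8 * nsq torus (U 0) + 2 * (\<integral>s. 8 * ip torus (U s) (G s) \<partial>time t)"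
    unfolding sum by (intro tendsto_intros Parseval U lim T0) simp_all
  from LIMSEQ_unique[OF Parseval[OF U[OF t]] this]
  show "nsq torus (U t) = nsq torus (U 0) + 2 * (\<integral>s. ip torus (U s) (G s) \<partial>time t)"
    by simp
qed

text \<open>As \<open>b\<close> is only square-integrable, Cauchy-Schwarz is applied to the integral
  first. Squaring then gives a linear differential inequality with constant rate
  \<open>2 * \<beta>\<close> for the integral \<open>z\<close> of the square of
  \<open>y\<close>.\<close>

lemma gronwall_L2:
  assumes b: "sqi (time T) b" "nsq (time T) b \<le> \<beta>" "0 < \<beta>"
    and y: "continuous_on {0..<T} y" "\<And>t. 0 \<le> t \<Longrightarrow> t < T \<Longrightarrow> 0 \<le> y t"
    and le: "\<And>t. 0 \<le> t \<Longrightarrow> t < T \<Longrightarrow> y t \<le> A + (\<integral>s. b s * y s \<partial>time t)"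
    and t: "0 \<le> t" "t < T"
  shows "(y t)\<^sup>2 \<le> 2 * A\<^sup>2 * exp (2 * \<beta> * T)"
proof -
  define z where "z r = integral {0..r} (\<lambda>s. (y s)\<^sup>2)" for r
  have yc: "continuous_on {0..t} y" by (rule continuous_on_subset[OF y(1)]) (use t in auto)
  have yc2: "continuous_on {0..t} (\<lambda>s. (y s)\<^sup>2)" by (intro continuous_intros yc)
  have zd: "(z has_real_derivative (y r)\<^sup>2) (at r within {0..t})" if "r \<in> {0..t}" for r
    unfolding z_def by (rule integral_has_real_derivative[OF yc2 that])
  have ys: "sqi (time r) y" if "r \<le> t" for r
  proof -
    have c: "continuous_on {0..r} y" by (rule continuous_on_subset[OF yc]) (use that in auto)
    then have "bounded (y ` {0..r})" by (intro compact_imp_bounded compact_continuous_image) auto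
    then obtain B where "\<forall>s\<in>{0..r}. \<bar>y s\<bar> \<le> B" by (auto simp: bounded_iff)
    then show ?thesis
      by (intro sqi_bounded[OF finite_measure_time, of _ _ B] continuous_time_measurable continuous_on_subset[OF c]) auto
  qed
  have sq: "(y r)\<^sup>2 \<le> 2 * A\<^sup>2 + 2 * \<beta> * z r" if r: "r \<in> {0..t}" for r
  proof -
    have rT: "r < T" "0 \<le> r" using r t by auto
    have bs: "sqi (time r) b" and nb: "nsq (time r) b \<le> \<beta>"
    proof -
      have bi: "integrable (time r) (\<lambda>s. (b s)\<^sup>2)"
        by (rule time_integrable_mono[of T]) (use b rT in \<open>auto simp: sqi_def\<close>)
      have "b \<in> borel_measurable (time r)"
      proof -
        have "b \<in> borel_measurable (lebesgue_on {0<..<T})" using b by (simp add: sqi_def time_def)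
        then show ?thesis unfolding time_def by (rule measurable_restrict_mono) (use rT in auto)
      qed
      then show "sqi (time r) b" using bi by (simp add: sqi_def)
      have "nsq (time r) b = (\<integral>s. indicator {0<..<r} s * (b s)\<^sup>2 \<partial>time T)"
        unfolding nsq_def by (rule time_integral_indicator) (use rT in simp)
      also have "\<dots> \<le> nsq (time T) b"
        unfolding nsq_def by (intro integral_mono' ) (use b in \<open>auto simp: sqi_def indicator_def\<close>)
      finally show "nsq (time r) b \<le> \<beta>" using b by simp
    qed
    have nz: "nsq (time r) y = z r"
      unfolding nsq_def z_def by (rule time_integral_HK) (use ys[of r] r in \<open>auto simp: sqi_def\<close>)
    have z0: "0 \<le> z r" using nz nsq_nonneg[of "time r" y] by simp
    have "(\<integral>s. b s * y s \<partial>time r) \<le> nrm (time r) b * nrm (time r) y"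
      using ip_Cauchy_Schwarz[OF bs ys, of] r by (simp add: ip_def abs_le_iff)
    also have "\<dots> \<le> sqrt \<beta> * sqrt (z r)"
      using nb nz b(3) z0 by (intro mult_mono) (auto simp: nrm_def)
    finally have "y r \<le> A + sqrt \<beta> * sqrt (z r)" using le[OF rT(2,1)] by linarith
    then have "(y r)\<^sup>2 \<le> (A + sqrt \<beta> * sqrt (z r))\<^sup>2" using y(2)[OF rT(2,1)] by (rule power_mono)
    also have "\<dots> \<le> 2 * A\<^sup>2 + 2 * (sqrt \<beta> * sqrt (z r))\<^sup>2"
      using sum_squares_bound[of A "sqrt \<beta> * sqrt (z r)"] by (simp add: power2_sum)
    also have "(sqrt \<beta> * sqrt (z r))\<^sup>2 = \<beta> * z r" using b(3) z0 by (simp add: power_mult_distrib)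
    finally show ?thesis by simp
  qed
  \<comment> \<open>The integrating factor: \<open>u\<close> does not increase, and
    \<open>2 * (A\<^sup>2 + \<beta> * z r)\<close> bounds the square of \<open>y r\<close>.\<close>
  define u where "u r = exp (- (2 * \<beta>) * r) * (A\<^sup>2 + \<beta> * z r)" for r
  have "u t \<le> u 0"
  proof (rule DERIV_nonpos_imp_decreasing_open[OF t(1)])
    have zc: "continuous_on {0..t} z"
      using zd by (meson DERIV_continuous continuous_on_eq_continuous_within)
    show "continuous_on {0..t} u" unfolding u_def by (intro continuous_intros zc)
    fix r assume r: "0 < r" "r < t"
    have zd': "(z has_real_derivative (y r)\<^sup>2) (at r)"
      using zd[of r] r by (simp add: at_within_Icc_at)
    have "(u has_real_derivative exp (- (2 * \<beta>) * r) * (\<beta> * ((y r)\<^sup>2 - 2 * A\<^sup>2 - 2 * \<beta> * z r))) (at r)"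
      unfolding u_def by (rule derivative_eq_intros zd' refl)+ (simp add: algebra_simps)
    moreover have "exp (- (2 * \<beta>) * r) * (\<beta> * ((y r)\<^sup>2 - 2 * A\<^sup>2 - 2 * \<beta> * z r)) \<le> 0"
      using sq[of r] r b(3) by (intro mult_nonneg_nonpos) auto
    ultimately show "\<exists>d. (u has_real_derivative d) (at r) \<and> d \<le> 0" by blast
  qed
  then have "exp (- (2 * \<beta>) * t) * (A\<^sup>2 + \<beta> * z t) \<le> A\<^sup>2"
    by (simp add: u_def z_def)
  then have "exp (2 * \<beta> * t) * (exp (- (2 * \<beta>) * t) * (A\<^sup>2 + \<beta> * z t)) \<le> exp (2 * \<beta> * t) * A\<^sup>2"
    by (intro mult_left_mono) auto
  then have "A\<^sup>2 + \<beta> * z t \<le> exp (2 * \<beta> * t) * A\<^sup>2"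
    by (simp add: mult.assoc[symmetric] exp_add[symmetric])
  then have "(y t)\<^sup>2 \<le> 2 * A\<^sup>2 * exp (2 * \<beta> * t)" using sq[of t] t by (simp add: algebra_simps)
  also have "\<dots> \<le> 2 * A\<^sup>2 * exp (2 * \<beta> * T)"
    using t b(3) by (intro mult_left_mono) auto
  finally show ?thesis .
qed

text \<open>All integrals over rays vanish, so the positive and the negative part have the same mass
  on every ray. The two measures with these densities then coincide, and so do the densities almost
  everywhere.\<close>

lemma time_integral_zero_imp_AE:
  assumes q: "integrable (time T) (q :: real \<Rightarrow> real)" and T: "0 < T"
    and z: "\<And>t. 0 \<le> t \<Longrightarrow> t < T \<Longrightarrow> (\<integral>s. q s \<partial>time t) = 0"
  shows "AE s in time T. q s = 0"
proof -
  \<comment> \<open>The assumption leaves out the endpoint \<open>T\<close>; it is reached by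
    continuity of the integral in its upper limit.\<close>
  have z': "(\<integral>s. q s \<partial>time t) = 0" if "0 \<le> t" "t \<le> T" for t
  proof (cases "t < T")
    case False
    have lim: "(\<lambda>n. T - T / real (Suc n)) \<longlonglongrightarrow> T - 0"
      by (intro tendsto_intros LIMSEQ_Suc[OF lim_const_over_n])
    have in0T: "T - T / real (Suc n) \<in> {0..<T}" for n
      using T by (auto simp: field_simps)
    have "(\<lambda>n. \<integral>s. q s \<partial>time (T - T / real (Suc n))) \<longlonglongrightarrow> (\<integral>s. q s \<partial>time T)"
      by (rule continuous_on_tendsto_compose[OF time_indefinite_continuous[OF q]])
        (use lim in0T T in \<open>auto intro: less_imp_le\<close>)
    moreover have "(\<integral>s. q s \<partial>time (T - T / real (Suc n))) = 0" for n using in0T[of n] by (intro z) auto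
    ultimately have "(\<integral>s. q s \<partial>time T) = 0" by (simp add: LIMSEQ_const_iff)
    then show ?thesis using False that by simp
  qed (use z that in simp)
  define f where "f s = indicator {0<..<T} s * q s" for s
  have fi: "integrable lebesgue f"
    using q by (simp add: time_def integrable_restrict_space f_def[abs_def])
  \<comment> \<open>The densities are compared over \<open>lborel\<close>, which calls for a Borel
    representative of the extension of \<open>q\<close> by zero.\<close>
  obtain g where g: "g \<in> borel_measurable borel" "AE x in lborel. f x = g x"
    using completion_ex_borel_measurable_real[OF borel_measurable_integrable[OF fi]] by auto
  have fg: "AE x in lebesgue. f x = g x" using g(2) by (rule AE_completion)
  have gi: "integrable lborel g"
  proof -
    have "integrable lebesgue g"
      using fi integrable_cong_AE[OF borel_measurable_integrable[OF fi] measurable_completion fg] g(1) by simp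
    then show ?thesis using integrable_completion[of g lborel] g(1) by simp
  qed
  have tail: "(\<integral>s. indicator {x<..} s * g s \<partial>lborel) = 0" for x
  proof -
    have m: "(\<lambda>s. indicator {x<..} s * g s) \<in> borel_measurable lborel" using g(1) by simp
    have mf: "(\<lambda>s. indicator {x<..} s * f s) \<in> borel_measurable lebesgue"
      by (intro borel_measurable_times borel_measurable_integrable[OF fi] borel_measurable_indicator) simp
    have "(\<integral>s. indicator {x<..} s * g s \<partial>lborel) = (\<integral>s. indicator {x<..} s * g s \<partial>lebesgue)"
      by (rule integral_completion[OF m, symmetric])
    also have "\<dots> = (\<integral>s. indicator {x<..} s * f s \<partial>lebesgue)"
      by (rule integral_cong_AE) (use fg mf m in \<open>auto intro: measurable_completion\<close>)
    also have "\<dots> = (\<integral>s. indicator {0<..<T} s *\<^sub>R (indicator {x<..} s * q s) \<partial>lebesgue)"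
      by (intro Bochner_Integration.integral_cong refl) (simp add: f_def)
    also have "\<dots> = (\<integral>s. indicator {x<..} s * q s \<partial>time T)"
      unfolding time_def by (rule integral_restrict_space[symmetric]) simp
    also have "\<dots> = 0"
    proof (cases "x < 0")
      case True
      then have "(\<integral>s. indicator {x<..} s * q s \<partial>time T) = (\<integral>s. q s \<partial>time T)"
        by (intro Bochner_Integration.integral_cong) (auto simp: indicator_def)
      then show ?thesis using z'[of T] T by simp
    next
      case x0: False
      show ?thesis
      proof (cases "x < T")
        case True
        have sing: "AE s in lebesgue. s \<noteq> x" by (rule AE_completion[OF AE_lborel_singleton])
        have neg: "AE s in time T. s \<noteq> x"
          unfolding time_def by (subst AE_restrict_space_iff) (simp, rule eventually_mono[OF sing], simp)
        have mq: "q \<in> borel_measurable (time T)" using q by auto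
        have ind: "(indicator A :: real \<Rightarrow> real) \<in> borel_measurable (time T)" if "A \<in> sets borel" for A :: "real set"
          unfolding time_def by (intro measurable_restrict_space1 measurable_completion) (use that in simp)
        have "(\<integral>s. indicator {x<..} s * q s \<partial>time T) = (\<integral>s. q s - indicator {0<..<x} s * q s \<partial>time T)"
        proof (rule integral_cong_AE)
          show "AE s in time T. indicator {x<..} s * q s = q s - indicator {0<..<x} s * q s"
            using neg AE_space by eventually_elim (auto simp: indicator_def)
        qed (intro borel_measurable_times borel_measurable_diff mq ind, simp)+
        also have "\<dots> = (\<integral>s. q s \<partial>time T) - (\<integral>s. indicator {0<..<x} s * q s \<partial>time T)"
        proof (rule Bochner_Integration.integral_diff[OF q])
          show "integrable (time T) (\<lambda>s. indicator {0<..<x} s * q s)"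
            proof (rule Bochner_Integration.integrable_bound[OF q])
            show "(\<lambda>s. indicator {0<..<x} s * q s) \<in> borel_measurable (time T)"
              by (intro borel_measurable_times mq ind) simp
          qed (auto simp: indicator_def)
        qed
        also have "\<dots> = 0"
          using z'[of T] z'[of x] time_integral_indicator[of x T q] T True x0 by simp
        finally show ?thesis .
      next
        case False
        then have "(\<integral>s. indicator {x<..} s * q s \<partial>time T) = (\<integral>s. 0 \<partial>time T)"
          by (intro Bochner_Integration.integral_cong) (auto simp: indicator_def)
        then show ?thesis by simp
      qed
    qed
    finally show ?thesis .
  qed
  let ?p = "\<lambda>x. ennreal (g x)" and ?n = "\<lambda>x. ennreal (- g x)"
  have ig: "integrable lborel (\<lambda>s. indicator {x<..} s * g s)" for x
    by (rule Bochner_Integration.integrable_bound[OF gi]) (use g(1) in \<open>auto simp: indicator_def\<close>)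
  have parts: "(\<integral>\<^sup>+s. ?p s * indicator {x<..} s \<partial>lborel) = (\<integral>\<^sup>+s. ?n s * indicator {x<..} s \<partial>lborel) \<and> (\<integral>\<^sup>+s. ?p s * indicator {x<..} s \<partial>lborel) < \<infinity>" for x
  proof -
    have e: "(\<integral>\<^sup>+s. ?p s * indicator {x<..} s \<partial>lborel) = (\<integral>\<^sup>+s. ennreal (indicator {x<..} s * g s) \<partial>lborel)"
      "(\<integral>\<^sup>+s. ?n s * indicator {x<..} s \<partial>lborel) = (\<integral>\<^sup>+s. ennreal (- (indicator {x<..} s * g s)) \<partial>lborel)"
      by (intro nn_integral_cong; auto simp: indicator_def)+
    have fin: "(\<integral>\<^sup>+s. ennreal (indicator {x<..} s * g s) \<partial>lborel) \<noteq> \<infinity>" "(\<integral>\<^sup>+s. ennreal (- (indicator {x<..} s * g s)) \<partial>lborel) \<noteq> \<infinity>"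
      using ig[of x] by (auto simp: real_integrable_def)
    have "enn2real (\<integral>\<^sup>+s. ennreal (indicator {x<..} s * g s) \<partial>lborel) = enn2real (\<integral>\<^sup>+s. ennreal (- (indicator {x<..} s * g s)) \<partial>lborel)"
      using real_lebesgue_integral_def[OF ig[of x]] tail[of x] by simp
    then show ?thesis
      using fin unfolding e by (metis ennreal_enn2real infinity_ennreal_def less_top)
  qed
  have "density lborel ?p = density lborel ?n"
    by (rule measure_eqI_lessThan) (use parts[THEN conjunct1] parts[THEN conjunct1, symmetric] parts[THEN conjunct2] g(1) in \<open>simp_all add: emeasure_density del: infinity_ennreal_def\<close>)
  then have "AE x in lborel. ?p x = ?n x"
    by (intro sigma_finite_measure.density_unique_iff[OF sigma_finite_lborel, THEN iffD1]) (use g(1) in auto)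
  then have "AE x in lborel. g x = 0"
  proof eventually_elim
    fix x assume "ennreal (g x) = ennreal (- g x)"
    then show "g x = 0" by (cases "0 \<le> g x") (auto simp: ennreal_neg ennreal_eq_0_iff dest: sym)
  qed
  then have "AE x in lebesgue. g x = 0" by (rule AE_completion)
  then have f0: "AE x in lebesgue. f x = 0" using fg by eventually_elim simp
  show ?thesis
    unfolding time_def by (subst AE_restrict_space_iff) (simp, rule eventually_mono[OF f0], auto simp: f_def)
qed

section \<open>Fourier coefficients and square norms as functions of time\<close>

lemma sigma_finite_torus: "sigma_finite_measure torus"
  by unfold_locales (rule torus.sigma_finite_countable)

lemma time_measurable_representative:
  assumes "time_measurable T f"
  obtains g where "(\<lambda>(t, x). g t x) \<in> borel_measurable (time T \<Otimes>\<^sub>M torus)"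
    "AE t in time T. f t \<in> borel_measurable torus \<and> g t \<in> borel_measurable torus \<and> (AE x in torus. f t x = g t x)"
proof -
  obtain g where g: "(\<lambda>(t, x). g t x) \<in> borel_measurable (time T \<Otimes>\<^sub>M torus)"
    "AE t in time T. AE x in torus. f t x = g t x"
    using assms by (auto simp: time_measurable_def)
  have gm: "g t \<in> borel_measurable torus" if "t \<in> space (time T)" for t
    using measurable_Pair2[OF g(1) that] by simp
  have "AE t in time T. f t \<in> borel_measurable torus \<and> g t \<in> borel_measurable torus \<and> (AE x in torus. f t x = g t x)"
    using g(2) AE_space
  proof eventually_elim
    fix t assume t: "AE x in torus. f t x = g t x" "t \<in> space (time T)"
    then have "AE x in torus. g t x = f t x" by (auto elim: eventually_mono)
    then show "f t \<in> borel_measurable torus \<and> g t \<in> borel_measurable torus \<and> (AE x in torus. f t x = g t x)"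
      using borel_measurable_AE_complete[OF complete_torus gm[OF t(2)]] gm[OF t(2)] t(1) by blast
  qed
  then show ?thesis using that g(1) by blast
qed

text \<open>At order 0 no weak derivative is chosen, so the norm can be computed from the jointly
  measurable representative.\<close>

lemma time_measurable_Hsq0:
  assumes "time_measurable T f"
  shows "(\<lambda>t. Hsq 0 (f t)) \<in> borel_measurable (time T)"
    "AE t in time T. Hsq 0 (f t) < \<infinity> \<longleftrightarrow> L2 (f t)"
proof -
  obtain g where g: "(\<lambda>(t, x). g t x) \<in> borel_measurable (time T \<Otimes>\<^sub>M torus)"
    "AE t in time T. f t \<in> borel_measurable torus \<and> g t \<in> borel_measurable torus \<and> (AE x in torus. f t x = g t x)"
    by (rule time_measurable_representative[OF assms])
  \<comment> \<open>The convention that \<open>Hsq 0\<close> is infinite for functions that are not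
    integrable agrees with the integral of the square, because the torus has finite measure.\<close>
  have nn: "(\<integral>\<^sup>+x. ennreal ((h x)\<^sup>2) \<partial>torus) = \<infinity>" if "\<not> integrable torus h" "h \<in> borel_measurable torus" for h
    using sqi_nn_integral(1)[OF that(2)] L2_integrable[of h] that(1) by (cases "(\<integral>\<^sup>+x. ennreal ((h x)\<^sup>2) \<partial>torus) = \<infinity>") (auto simp: less_top)
  have "(\<lambda>t. \<integral>\<^sup>+x. ennreal ((g t x)\<^sup>2) \<partial>torus) \<in> borel_measurable (time T)"
    by (rule sigma_finite_measure.borel_measurable_nn_integral[OF sigma_finite_torus]) (use g(1) in \<open>simp add: case_prod_unfold\<close>)
  then show "(\<lambda>t. Hsq 0 (f t)) \<in> borel_measurable (time T)"
  proof (rule borel_measurable_AE_complete[OF complete_time])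
    show "AE t in time T. (\<integral>\<^sup>+x. ennreal ((g t x)\<^sup>2) \<partial>torus) = Hsq 0 (f t)"
      using g(2)
    proof eventually_elim
      fix t assume *: "f t \<in> borel_measurable torus \<and> g t \<in> borel_measurable torus \<and> (AE x in torus. f t x = g t x)"
      then have "(\<integral>\<^sup>+x. ennreal ((g t x)\<^sup>2) \<partial>torus) = (\<integral>\<^sup>+x. ennreal ((f t x)\<^sup>2) \<partial>torus)"
        by (intro nn_integral_cong_AE) auto
      then show "(\<integral>\<^sup>+x. ennreal ((g t x)\<^sup>2) \<partial>torus) = Hsq 0 (f t)"
        using nn[of "f t"] * by (simp add: Hsq_0)
    qed
  qed
  show "AE t in time T. Hsq 0 (f t) < \<infinity> \<longleftrightarrow> L2 (f t)"
    using g(2)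
  proof eventually_elim
    fix t assume *: "f t \<in> borel_measurable torus \<and> g t \<in> borel_measurable torus \<and> (AE x in torus. f t x = g t x)"
    show "Hsq 0 (f t) < \<infinity> \<longleftrightarrow> L2 (f t)"
    proof
      assume "L2 (f t)"
      then show "Hsq 0 (f t) < \<infinity>" by (simp add: Hsq_0 L2_integrable nn_integral_nsq)
    qed (rule Hsq_finite_L2(1))
  qed
qed

lemma Hnorm_sq: "(Hnorm m fs)\<^sup>2 = (\<Sum>f\<leftarrow>fs. Hsq m f)"
proof (cases "(\<Sum>f\<leftarrow>fs. Hsq m f) = \<infinity>")
  case False
  then obtain r where r: "(\<Sum>f\<leftarrow>fs. Hsq m f) = ennreal r" "0 \<le> r" by (cases "\<Sum>f\<leftarrow>fs. Hsq m f") auto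
  then show ?thesis by (simp add: Hnorm_def ennreal_sqrt_def ennreal_power)
qed (simp add: Hnorm_def ennreal_sqrt_def)

lemma in_L2H_AE_L2:
  assumes "in_L2H T 0 f" shows "AE t in time T. L2 (f t)"
proof -
  have tm: "time_measurable T f" and fin: "L2_time T (\<lambda>t. Hnorm 0 [f t]) < \<infinity>"
    using assms by (auto simp: in_L2H_def)
  have "(\<integral>\<^sup>+t. Hsq 0 (f t) \<partial>time T) \<noteq> \<infinity>"
    using fin by (auto simp: L2_time_def ennreal_sqrt_def Hnorm_sq split: if_splits)
  then have "AE t in time T. Hsq 0 (f t) \<noteq> \<infinity>"
    by (rule nn_integral_PInf_AE[OF time_measurable_Hsq0(1)[OF tm]])
  then show ?thesis
    using time_measurable_Hsq0(2)[OF tm] by eventually_elim (auto simp: less_top)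
qed

text \<open>Measurability in time comes from the jointly measurable representative; the size is
  bounded by the spatial integral of \<open>\<bar>f t x\<bar>\<close>, since characters have modulus
  1.\<close>

lemma has_time_deriv_fc_integrable:
  assumes g: "time_measurable T f" and fin: "(\<integral>\<^sup>+t. \<integral>\<^sup>+x. ennreal \<bar>f t x\<bar> \<partial>torus \<partial>time T) < \<infinity>"
  shows "integrable (time T) (\<lambda>t. fc (f t) k)" "AE t in time T. integrable torus (f t)"
proof -
  obtain g where g: "(\<lambda>(t, x). g t x) \<in> borel_measurable (time T \<Otimes>\<^sub>M torus)"
    "AE t in time T. f t \<in> borel_measurable torus \<and> g t \<in> borel_measurable torus \<and> (AE x in torus. f t x = g t x)"
    by (rule time_measurable_representative[OF g])
  have gm: "(\<lambda>p. g (fst p) (snd p)) \<in> borel_measurable (time T \<Otimes>\<^sub>M torus)"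
    using g(1) by (simp add: case_prod_unfold)
  have nm: "(\<lambda>t. \<integral>\<^sup>+x. ennreal \<bar>g t x\<bar> \<partial>torus) \<in> borel_measurable (time T)"
    by (rule sigma_finite_measure.borel_measurable_nn_integral[OF sigma_finite_torus]) (use gm in \<open>simp add: case_prod_unfold\<close>)
  have "(\<integral>\<^sup>+t. \<integral>\<^sup>+x. ennreal \<bar>f t x\<bar> \<partial>torus \<partial>time T) = (\<integral>\<^sup>+t. \<integral>\<^sup>+x. ennreal \<bar>g t x\<bar> \<partial>torus \<partial>time T)"
  proof (rule nn_integral_cong_AE)
    show "AE t in time T. (\<integral>\<^sup>+x. ennreal \<bar>f t x\<bar> \<partial>torus) = (\<integral>\<^sup>+x. ennreal \<bar>g t x\<bar> \<partial>torus)"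
      using g(2) by eventually_elim (intro nn_integral_cong_AE, auto)
  qed
  then have fing: "(\<integral>\<^sup>+t. \<integral>\<^sup>+x. ennreal \<bar>g t x\<bar> \<partial>torus \<partial>time T) < \<infinity>" using fin by simp
  have gint: "AE t in time T. integrable torus (g t)"
    using nn_integral_PInf_AE[OF nm] fing g(2)
    by (auto elim!: eventually_elim2 simp: integrable_iff_bounded less_top)
  show "AE t in time T. integrable torus (f t)"
    using gint g(2)
  proof eventually_elim
    fix t assume "integrable torus (g t)" "f t \<in> borel_measurable torus \<and> g t \<in> borel_measurable torus \<and> (AE x in torus. f t x = g t x)"
    then show "integrable torus (f t)" using integrable_cong_AE[of "f t" torus "g t"] by blast
  qed
  have "(\<lambda>t. fc (g t) k) \<in> borel_measurable (time T)"
    unfolding fc_def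
  proof (rule sigma_finite_measure.borel_measurable_lebesgue_integral[OF sigma_finite_torus])
    have "(\<lambda>p. ek k (snd p)) \<in> borel_measurable (time T \<Otimes>\<^sub>M torus)" by measurable
    then show "(\<lambda>(t, x). complex_of_real (g t x) * ek k x) \<in> borel_measurable (time T \<Otimes>\<^sub>M torus)"
      using gm by (simp add: case_prod_unfold)
  qed
  moreover have "(\<integral>\<^sup>+t. ennreal (norm (fc (g t) k)) \<partial>time T) < \<infinity>"
  proof (rule le_less_trans[OF nn_integral_mono_AE fing])
    show "AE t in time T. ennreal (norm (fc (g t) k)) \<le> (\<integral>\<^sup>+x. ennreal \<bar>g t x\<bar> \<partial>torus)"
      using gint
    proof eventually_elim
      fix t assume "integrable torus (g t)"
      from integral_norm_bound_ennreal[OF integrable_ek_mult[OF this]]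
      show "ennreal (norm (fc (g t) k)) \<le> (\<integral>\<^sup>+x. ennreal \<bar>g t x\<bar> \<partial>torus)"
        by (simp add: fc_def norm_mult)
    qed
  qed
  ultimately have gi: "integrable (time T) (\<lambda>t. fc (g t) k)"
    by (simp add: integrable_iff_bounded)
  have eq: "AE t in time T. fc (g t) k = fc (f t) k"
    using g(2)
  proof eventually_elim
    fix t assume "f t \<in> borel_measurable torus \<and> g t \<in> borel_measurable torus \<and> (AE x in torus. f t x = g t x)"
    then show "fc (g t) k = fc (f t) k" by (intro fc_cong_AE) auto
  qed
  have "(\<lambda>t. fc (f t) k) \<in> borel_measurable (time T)"
    by (rule borel_measurable_AE_complete[OF complete_time _ eq]) (use gi in auto)
  then show "integrable (time T) (\<lambda>t. fc (f t) k)"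
    using gi integrable_cong_AE[OF borel_measurable_integrable[OF gi] _ eq] by blast
qed

lemma in_CH_L2: "in_CH T 0 f \<Longrightarrow> t \<in> {0..T} \<Longrightarrow> L2 (f t)"
  by (auto simp: in_CH_def intro!: Hnorm_L2[of 0 "[f t]"])

lemma in_CH_fc_continuous:
  assumes "in_CH T 0 f" shows "continuous_on {0..T} (\<lambda>t. fc (f t) k)"
  unfolding continuous_on_def
proof
  fix t assume t: "t \<in> {0..T}"
  have lim: "((\<lambda>s. Hnorm 0 [\<lambda>x. f s x - f t x]) \<longlongrightarrow> 0) (at t within {0..T})"
    using assms t by (simp add: in_CH_def)
  have eq: "Hnorm 0 [\<lambda>x. f s x - f t x] = ennreal (nrm torus (\<lambda>x. f s x - f t x))" if "s \<in> {0..T}" for s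
    using L2norm_eq[of "[\<lambda>x. f s x - f t x]"] sqi_diff[OF in_CH_L2[OF assms that] in_CH_L2[OF assms t]] by (simp add: nrm_def)
  have "((\<lambda>s. ennreal (nrm torus (\<lambda>x. f s x - f t x))) \<longlongrightarrow> 0) (at t within {0..T})"
    by (rule Lim_transform_eventually[OF lim]) (auto simp: eventually_at_filter eq)
  then have "((\<lambda>s. ennreal (nrm torus (\<lambda>x. f s x - f t x))) \<longlongrightarrow> ennreal 0) (at t within {0..T})" by simp
  then have "((\<lambda>s. nrm torus (\<lambda>x. f s x - f t x)) \<longlongrightarrow> 0) (at t within {0..T})"
    by (rule tendsto_ennrealD) auto
  then have l2: "((\<lambda>s. sqrt 8 * nrm torus (\<lambda>x. f s x - f t x)) \<longlongrightarrow> 0) (at t within {0..T})"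
    by (rule tendsto_mult_right_zero)
  have "((\<lambda>s. fc (f s) k - fc (f t) k) \<longlongrightarrow> 0) (at t within {0..T})"
  proof (rule Lim_null_comparison[OF _ l2])
    have "norm (fc (f s) k - fc (f t) k) \<le> sqrt 8 * nrm torus (\<lambda>x. f s x - f t x)" if "s \<in> {0..T}" for s
      using norm_fc_le[OF sqi_diff[OF in_CH_L2[OF assms that] in_CH_L2[OF assms t]], of k]
      by (simp add: fc_diff L2_integrable in_CH_L2[OF assms that] in_CH_L2[OF assms t])
    then show "\<forall>\<^sub>F s in at t within {0..T}. norm (fc (f s) k - fc (f t) k) \<le> sqrt 8 * nrm torus (\<lambda>x. f s x - f t x)"
      by (auto simp: eventually_at_filter)
  qed
  then show "((\<lambda>t. fc (f t) k) \<longlongrightarrow> fc (f t) k) (at t within {0..T})"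
    by (rule LIM_zero_cancel)
qed

text \<open>Testing with products \<open>X t * Re (c * ek k x)\<close> reduces the distributional
  derivative in space-time to the scalar lemma \<open>time_deriv_mode\<close>, one mode at a
  time.\<close>

lemma has_time_deriv_mode:
  assumes C: "in_CH T 0 f" and d: "has_time_deriv T f g" and t: "0 \<le> t" "t < T"
  shows "fc (f t) k = fc (f 0) k + (\<integral>s. fc (g s) k \<partial>time t)"
proof (rule complex_eqI_Re)
  fix c
  have fi: "integrable torus (f t)" if "t \<in> {0..T}" for t by (rule L2_integrable[OF in_CH_L2[OF C that]])
  have gq: "integrable (time T) (\<lambda>t. fc (g t) k)" "AE t in time T. integrable torus (g t)"
    by (rule has_time_deriv_fc_integrable, use d in \<open>auto simp: has_time_deriv_def\<close>)+
  have "Re (c * fc (f t) k) = Re (c * fc (f 0) k) + (\<integral>s. Re (c * fc (g s) k) \<partial>time t)"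
  proof (rule time_deriv_mode[OF _ _ _ t])
    show "continuous_on {0..<T} (\<lambda>t. Re (c * fc (f t) k))"
      by (intro continuous_intros continuous_on_subset[OF in_CH_fc_continuous[OF C]]) auto
    show "integrable (time T) (\<lambda>t. Re (c * fc (g t) k))"
      by (intro integrable_Re integrable_mult_right gq)
    fix X X' :: "real \<Rightarrow> real"
    assume X: "\<And>t. (X has_real_derivative X' t) (at t)" "bump_span X'" "\<exists>a b. 0 < a \<and> b < T \<and> (\<forall>t. t \<notin> {a..b} \<longrightarrow> X t = 0)"
    let ?\<phi> = "\<lambda>p :: real \<times> (real^3). X (fst p) * Re (c * ek k (snd p))"
    have "smooth ?\<phi>" by (rule smooth_product_test[OF X(1,2)])
    moreover have "\<forall>t. periodic2 (\<lambda>x. ?\<phi> (t, x))" by (simp add: periodic2_def periodic2_ek)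
    moreover have "\<exists>a b. 0 < a \<and> b < T \<and> (\<forall>t x. t \<notin> {a..b} \<longrightarrow> ?\<phi> (t, x) = 0)"
    proof -
      obtain a b where "0 < a" "b < T" "\<forall>t. t \<notin> {a..b} \<longrightarrow> X t = 0" using X(3) by blast
      then show ?thesis by (intro exI[of _ a] exI[of _ b]) auto
    qed
    ultimately have "(\<integral>t. (\<integral>x. f t x * pderiv_dir (1, 0) ?\<phi> (t, x) \<partial>torus) \<partial>time T) = - (\<integral>t. (\<integral>x. g t x * ?\<phi> (t, x) \<partial>torus) \<partial>time T)"
      using d unfolding has_time_deriv_def by blast
    moreover have "(\<integral>x. f t x * pderiv_dir (1, 0) ?\<phi> (t, x) \<partial>torus) = Re (c * fc (f t) k) * X' t" if "t \<in> space (time T)" for t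
      unfolding smooth_product_test(2)[OF X(1,2)] using that Re_mult_fc[OF fi[of t], of c k]
      by (simp add: mult.left_commute[of _ "X' t"])
    then have "(\<integral>t. (\<integral>x. f t x * pderiv_dir (1, 0) ?\<phi> (t, x) \<partial>torus) \<partial>time T) = (\<integral>t. Re (c * fc (f t) k) * X' t \<partial>time T)"
      by (intro Bochner_Integration.integral_cong) auto
    moreover have "(\<integral>t. (\<integral>x. g t x * ?\<phi> (t, x) \<partial>torus) \<partial>time T) = (\<integral>t. Re (c * fc (g t) k) * X t \<partial>time T)"
    proof -
      have e1: "AE t in time T. Re (c * fc (g t) k) * X t = (\<integral>x. g t x * ?\<phi> (t, x) \<partial>torus)"
        using gq(2)
      proof eventually_elim
        fix t assume "integrable torus (g t)"
        from Re_mult_fc[OF this, of c k] show "Re (c * fc (g t) k) * X t = (\<integral>x. g t x * ?\<phi> (t, x) \<partial>torus)"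
          by (simp add: mult.left_commute[of _ "X t"])
      qed
      have m1: "(\<lambda>t. Re (c * fc (g t) k) * X t) \<in> borel_measurable (time T)"
      proof (rule borel_measurable_times)
        show "(\<lambda>t. Re (c * fc (g t) k)) \<in> borel_measurable (time T)"
          by (rule borel_measurable_integrable) (intro integrable_Re integrable_mult_right gq)
        show "X \<in> borel_measurable (time T)"
          by (rule continuous_time_measurable) (meson DERIV_isCont X(1) continuous_at_imp_continuous_on)
      qed
      show ?thesis
        by (rule integral_cong_AE[OF borel_measurable_AE_complete[OF complete_time m1 e1] m1]) (use e1 in auto)
    qed
    ultimately show "(\<integral>t. Re (c * fc (f t) k) * X' t \<partial>time T) = - (\<integral>t. Re (c * fc (g t) k) * X t \<partial>time T)" by simp
  qed
  also have "(\<integral>s. Re (c * fc (g s) k) \<partial>time t) = Re (c * (\<integral>s. fc (g s) k \<partial>time t))"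
  proof -
    have "integrable (time t) (\<lambda>s. fc (g s) k)" by (rule time_integrable_mono[OF gq(1)]) (use t in simp)
    then show ?thesis by (subst integral_Re) auto
  qed
  finally show "Re (c * fc (f t) k) = Re (c * (fc (f 0) k + (\<integral>s. fc (g s) k \<partial>time t)))"
    by (simp add: distrib_left)
qed

section \<open>Sobolev norms at a fixed time\<close>

lemma Lb_mono: "Lb B f \<Longrightarrow> B \<le> C \<Longrightarrow> Lb C f"
  by (auto simp: Lb_def elim!: eventually_mono)

lemma ennreal_sum4_le:
  assumes "a + b + c + d \<le> (X :: ennreal)" shows "a \<le> X" "b \<le> X" "c \<le> X" "d \<le> X"
  using assms by (auto intro: order_trans[rotated] simp: add_increasing add_increasing2)

text \<open>The second derivative is taken of \<open>f\<close> itself and compared with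
  \<open>wpd l f\<close> through Fourier coefficients. Written as a sum of unit vectors, the
  multi-index also covers \<open>i = l\<close>.\<close>

lemma Hsq_wpd_wpd:
  assumes "Hsq m f < \<infinity>" "2 \<le> m"
  obtains g where "fd i (wpd l f) g" "L2 g"
proof -
  let ?\<alpha> = "\<lambda>j. ei 1 l j + ei 1 i j"
  have \<alpha>: "?\<alpha> \<in> multi_indices m"
    using assms(2) by (simp add: multi_indices_def sum.distrib)
  have "fc (weak_deriv ?\<alpha> f) k = (- mu k l) * (- mu k i) * fc f k" for k
    using fc_weak_deriv[OF Hsq_finite(1)[OF assms(1) \<alpha>], of k] by (simp add: power_add prod.distrib prod_ei)
  moreover have "fc (wpd l f) k = - mu k l * fc f k" for k
    using Hsq_wpd(1)[OF assms(1), of l] assms(2) by (simp add: fd_def)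
  ultimately have "fd i (wpd l f) (weak_deriv ?\<alpha> f)" by (simp add: fd_def)
  then show ?thesis using Hsq_finite(2)[OF assms(1) \<alpha>] that by blast
qed

lemma Hsq_finite_mono: "Hsq m f < \<infinity> \<Longrightarrow> n \<le> m \<Longrightarrow> Hsq n f < \<infinity>"
proof -
  assume f: "Hsq m f < \<infinity>" and "n \<le> m"
  then have sub: "\<alpha> \<in> multi_indices m" if "\<alpha> \<in> multi_indices n" for \<alpha> using that by (auto simp: multi_indices_def)
  have "(\<Sum>\<alpha>\<in>multi_indices n. \<integral>\<^sup>+x. ennreal ((weak_deriv \<alpha> f x)\<^sup>2) \<partial>torus) < \<infinity>"
    using Hsq_finite(2)[OF f sub] by (auto simp: nn_integral_nsq sum_ennreal simp flip: less_top)
  moreover have "\<forall>\<alpha>\<in>multi_indices n. \<exists>g. has_weak_deriv \<alpha> f g" using Hsq_finite(1)[OF f sub] by blast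
  ultimately show ?thesis by (simp add: Hsq_def)
qed

definition Y2 :: "(real^3 \<Rightarrow> real) \<Rightarrow> (real^3 \<Rightarrow> real^2) \<Rightarrow> (real^3 \<Rightarrow> real) \<Rightarrow> (real^3 \<Rightarrow> real^2) \<Rightarrow> real" where
  "Y2 s v sp vp = nsq torus (\<lambda>x. s x - sp x) + (\<Sum>j\<in>UNIV. nsq torus (\<lambda>x. v x $ j - vp x $ j))"

definition D2 :: "(real^3 \<Rightarrow> real^2) \<Rightarrow> (real^3 \<Rightarrow> real^2) \<Rightarrow> real" where
  "D2 v vp = (\<Sum>j\<in>UNIV. \<Sum>i\<in>UNIV. nsq torus (\<lambda>x. wpd i (\<lambda>y. v y $ j) x - wpd i (\<lambda>y. vp y $ j) x))"

text \<open>What is known at almost every single time. \<open>A\<close> bounds the fourth order norm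
  of \<open>vp\<close> at this time only and is therefore kept apart from \<open>X\<close>. The
  condition on the modes of \<open>spt\<close> is an assumption here because it comes from the
  evolution of \<open>sp\<close>, not from the equations at one time.\<close>

locale time_slice =
  fixes \<epsilon> X A :: real and s st stt w wt sp spt wp :: "real^3 \<Rightarrow> real" and v vt vp vpt :: "real^3 \<Rightarrow> real^2"
  assumes eps: "0 < \<epsilon>" "\<epsilon> < 1" and X: "1 \<le> X" and A: "0 \<le> A"
    and E: "energy_E \<epsilon> s st v w \<le> ennreal X" and E1: "energy_E1 \<epsilon> st stt vt wt \<le> ennreal X"
    and sp4: "Hnorm 4 [sp] \<le> ennreal X" and spt2: "Hnorm 2 [spt] \<le> ennreal X"
    and vp3: "Hnorm 3 (comps vp) \<le> ennreal X" and wp2: "Hnorm 2 [wp] \<le> ennreal X"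
    and vp4: "\<And>j. sob 4 A (\<lambda>x. vp x $ j)" and vpt: "\<And>j. L2 (\<lambda>x. vpt x $ j)"
    and fc_spt: "\<And>k. k 3 \<noteq> 0 \<Longrightarrow> fc spt k = 0"
    and sym: "periodic_sym s v w" and symp: "periodic_sym sp vp wp"
    and cf: "AE x in torus.
        st x + transport v w s x + div_h v x + wpd 3 w x = 0 \<and>
        (\<forall>j. vt x $ j + transport v w (\<lambda>y. v y $ j) x + wpd (hidx j) s x = laplacian (\<lambda>y. v y $ j) x) \<and>
        \<epsilon>\<^sup>2 * (wt x + transport v w w x) + wpd 3 s x = \<epsilon>\<^sup>2 * laplacian w x"
    and cp: "AE x in torus.
        spt x + transport vp wp sp x + div_h vp x + wpd 3 wp x = 0 \<and>
        (\<forall>j. vpt x $ j + transport vp wp (\<lambda>y. vp y $ j) x + wpd (hidx j) sp x = laplacian (\<lambda>y. vp y $ j) x) \<and>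
        wpd 3 sp x = 0"
begin

abbreviation "vj j \<equiv> (\<lambda>x. v x $ j)"
abbreviation "vpj j \<equiv> (\<lambda>x. vp x $ j)"

lemma comps_mem: "(\<lambda>x. u x $ j) \<in> set (comps u)"
  using exhaust_2[of j] by (auto simp: comps_def)

lemma X0: "0 \<le> X" using X by simp

lemma Hsq_bounds:
  "Hsq 4 s \<le> ennreal (X\<^sup>2)" "Hsq 2 st \<le> ennreal (X\<^sup>2)" "Hsq 3 (vj j) \<le> ennreal (X\<^sup>2)"
  "Hsq 2 w \<le> ennreal (X\<^sup>2)" "Hsq 2 (wpd 3 w) \<le> ennreal (X\<^sup>2)" "Hsq 1 (\<lambda>x. vt x $ j) \<le> ennreal (X\<^sup>2)"
  "Hsq 0 wt \<le> ennreal (X\<^sup>2)" "Hsq 0 (\<lambda>x. wpd 3 st x / \<epsilon>) \<le> ennreal (X\<^sup>2)"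
  "Hsq 4 sp \<le> ennreal (X\<^sup>2)" "Hsq 2 spt \<le> ennreal (X\<^sup>2)" "Hsq 3 (vpj j) \<le> ennreal (X\<^sup>2)" "Hsq 2 wp \<le> ennreal (X\<^sup>2)"
proof -
  note e = ennreal_sum4_le[OF E[unfolded energy_E_def]] and e1 = ennreal_sum4_le[OF E1[unfolded energy_E1_def]]
  note l = Hnorm_le_Hsq[OF _ X0]
  show "Hsq 3 (vj j) \<le> ennreal (X\<^sup>2)" by (rule l[OF e(1)]) (use comps_mem in auto)
  show "Hsq 4 s \<le> ennreal (X\<^sup>2)" by (rule l[OF e(3)]) simp
  show "Hsq 2 w \<le> ennreal (X\<^sup>2)" "Hsq 2 (wpd 3 w) \<le> ennreal (X\<^sup>2)" by (rule l[OF e(4)]; simp)+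
  show "Hsq 2 st \<le> ennreal (X\<^sup>2)" by (rule l[OF e1(3)]) simp
  show "Hsq 1 (\<lambda>x. vt x $ j) \<le> ennreal (X\<^sup>2)" by (rule l[OF e1(1)]) (use comps_mem in auto)
  show "Hsq 0 wt \<le> ennreal (X\<^sup>2)" by (rule l[OF e1(4)]) simp
  show "Hsq 0 (\<lambda>x. wpd 3 st x / \<epsilon>) \<le> ennreal (X\<^sup>2)" by (rule l[OF e1(2)]) simp
  show "Hsq 4 sp \<le> ennreal (X\<^sup>2)" by (rule l[OF sp4]) simp
  show "Hsq 2 spt \<le> ennreal (X\<^sup>2)" by (rule l[OF spt2]) simp
  show "Hsq 3 (vpj j) \<le> ennreal (X\<^sup>2)" by (rule l[OF vp3]) (use comps_mem in auto)
  show "Hsq 2 wp \<le> ennreal (X\<^sup>2)" by (rule l[OF wp2]) simp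
qed

lemmas fin = Hsq_bounds[THEN le_less_trans, OF ennreal_less_top, folded infinity_ennreal_def]

lemma nrm_le: "ennreal (nsq torus f) \<le> Hsq m g \<Longrightarrow> Hsq m g \<le> ennreal (X\<^sup>2) \<Longrightarrow> nrm torus f \<le> X"
proof -
  assume "ennreal (nsq torus f) \<le> Hsq m g" "Hsq m g \<le> ennreal (X\<^sup>2)"
  then have "ennreal (nsq torus f) \<le> ennreal (X\<^sup>2)" by (rule order_trans)
  then have "nsq torus f \<le> X\<^sup>2" by (simp add: ennreal_le_iff)
  then show ?thesis unfolding nrm_def using X0 by (rule real_le_lsqrt[rotated])
qed

lemma sobs: "sob 4 (96 * X) s" "sob 4 (96 * X) sp" "sob 3 (48 * X) (vj j)" "sob 3 (48 * X) (vpj j)"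
  "sob 2 (24 * X) w" "sob 2 (24 * X) wp" "sob 2 (24 * X) (wpd 3 w)"
  using Hsq_bounds[THEN Hsq_imp_sob[OF _ X0]] by (simp_all add: eval_nat_numeral)

text \<open>The largest requirement is \<open>4 * (96 * X)\<close> for the gradient of
  \<open>sp\<close> in the sup norm: 96 stems from \<open>Hsq_imp_sob\<close> at order 4, the factor
  4 from \<open>sob_fd\<close>.\<close>

definition "c = 400 * X"

lemma c_ge: "1 \<le> c" "16 \<le> c" "96 * X \<le> c" "48 * X \<le> c" "24 * X \<le> c" "X \<le> c" "4 * (96 * X) \<le> c" "4 * (48 * X) \<le> c"
  using X by (auto simp: c_def)

lemma Lb_sob: "sob m B f \<Longrightarrow> 2 \<le> m \<Longrightarrow> B \<le> C \<Longrightarrow> Lb C f"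
  by (blast intro: Lb_mono sob_Lb sob_antimono_order)

lemma wpd_s: "fd i s (wpd i s)" "L2 (wpd i s)" and wpd_sp: "fd i sp (wpd i sp)" "L2 (wpd i sp)"
  by (rule Hsq_wpd[OF fin(1)] Hsq_wpd[OF fin(9)]; simp)+

lemma wpd_v: "fd i (vj j) (wpd i (vj j))" "L2 (wpd i (vj j))"
  and wpd_vp: "fd i (vpj j) (wpd i (vpj j))" "L2 (wpd i (vpj j))"
  by (rule Hsq_wpd[OF fin(3)] Hsq_wpd[OF fin(11)]; simp)+

lemma wpd2_v: "fd i (wpd i (vj j)) (wpd2 i (vj j))" "L2 (wpd2 i (vj j))"
  and wpd2_vp: "fd i (wpd i (vpj j)) (wpd2 i (vpj j))" "L2 (wpd2 i (vpj j))"
  by (rule Hsq_wpd2[OF fin(3)] Hsq_wpd2[OF fin(11)]; simp)+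

lemma nrm_wpd2_vp: "nrm torus (wpd2 i (vpj j)) \<le> X"
  by (rule nrm_le[OF Hsq_wpd2(3)[OF fin(11)] Hsq_bounds(11)]; simp)

lemma wpd_w: "fd i w (wpd i w)" "L2 (wpd i w)" and wpd_wp: "fd i wp (wpd i wp)" "L2 (wpd i wp)"
  and wpd_st: "fd i st (wpd i st)" "L2 (wpd i st)"
  by (rule Hsq_wpd[OF fin(4)] Hsq_wpd[OF fin(12)] Hsq_wpd[OF fin(2)]; simp)+

lemma wpd2_w: "L2 (wpd2 i w)" by (rule Hsq_wpd2[OF fin(4)]; simp)

lemma nrm_wpd_w: "nrm torus (wpd i w) \<le> X"
  by (rule nrm_le[OF Hsq_wpd(3)[OF fin(4)] Hsq_bounds(4)]; simp)

lemma nrm_wpd2_w: "nrm torus (wpd2 i w) \<le> X"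
  by (rule nrm_le[OF Hsq_wpd2(3)[OF fin(4)] Hsq_bounds(4)]; simp)

lemma times_L2: "L2 st" "L2 spt" "L2 wt" "L2 (\<lambda>x. vt x $ j)"
  by (rule Hsq_finite_L2(1)[OF fin(2)] Hsq_finite_L2(1)[OF fin(10)] Hsq_finite_L2(1)[OF fin(7)] Hsq_finite_L2(1)[OF fin(6)])+

lemma nrm_times: "nrm torus st \<le> X" "nrm torus spt \<le> X" "nrm torus wt \<le> X" "nrm torus (\<lambda>x. vt x $ j) \<le> X"
  by (rule nrm_le[OF Hsq_finite_L2(2)[OF fin(2)] Hsq_bounds(2)] nrm_le[OF Hsq_finite_L2(2)[OF fin(10)] Hsq_bounds(10)]
    nrm_le[OF Hsq_finite_L2(2)[OF fin(7)] Hsq_bounds(7)] nrm_le[OF Hsq_finite_L2(2)[OF fin(6)] Hsq_bounds(6)])+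

lemma nrms: "nrm torus s \<le> X" "nrm torus sp \<le> X" "nrm torus (vj j) \<le> X" "nrm torus (vpj j) \<le> X"
  by (rule nrm_le[OF Hsq_finite_L2(2)[OF fin(1)] Hsq_bounds(1)] nrm_le[OF Hsq_finite_L2(2)[OF fin(9)] Hsq_bounds(9)]
    nrm_le[OF Hsq_finite_L2(2)[OF fin(3)] Hsq_bounds(3)] nrm_le[OF Hsq_finite_L2(2)[OF fin(11)] Hsq_bounds(11)])+

lemma L2s: "L2 s" "L2 sp" "L2 (vj j)" "L2 (vpj j)" "L2 w" "L2 wp"
  by (rule sobs[THEN sob_L2])+

lemma sob_wpd: "sob 3 (4 * (96 * X)) (wpd i s)" "sob 3 (4 * (96 * X)) (wpd i sp)"
    "sob 2 (4 * (48 * X)) (wpd i (vj j))" "sob 2 (4 * (48 * X)) (wpd i (vpj j))"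
  by (rule sob_fd[OF _ wpd_s] sob_fd[OF _ wpd_sp] sob_fd[OF _ wpd_v] sob_fd[OF _ wpd_vp], simp only: Suc_numeral semiring_norm, rule sobs)+

text \<open>The weight \<open>1 / \<epsilon>\<close> inside \<open>energy_E1\<close> is the source
  of this order in \<open>\<epsilon>\<close>.\<close>

lemma nrm_wpd3_st: "nrm torus (wpd 3 st) \<le> X * \<epsilon>"
proof -
  have eq: "(\<lambda>x. wpd 3 st x / \<epsilon>) = (\<lambda>x. (1 / \<epsilon>) * wpd 3 st x)" by (simp add: fun_eq_iff)
  have "nrm torus (\<lambda>x. wpd 3 st x / \<epsilon>) \<le> X" by (rule nrm_le[OF Hsq_finite_L2(2)[OF fin(8)] Hsq_bounds(8)])
  then have "(1 / \<epsilon>) * nrm torus (wpd 3 st) \<le> X" unfolding eq nrm_cmult using eps(1) by simp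
  then show ?thesis using eps(1) by (simp add: divide_le_eq)
qed

lemma pde_diff:
  obtains dvpz where "pde_diff \<epsilon> A c s st sp spt w wt wp (wpd 3 st) (wpd 3 wp) vj vpj (\<lambda>j x. vt x $ j) (\<lambda>j x. vpt x $ j)
     (\<lambda>i. wpd i s) (\<lambda>i. wpd i sp) (\<lambda>i. wpd i w) (\<lambda>i. wpd2 i w)
     (\<lambda>j i. wpd i (vj j)) (\<lambda>j i. wpd i (vpj j)) (\<lambda>j i. wpd2 i (vj j)) (\<lambda>j i. wpd2 i (vpj j)) dvpz"
proof -
  have "\<exists>g. fd i (wpd 3 (vpj j)) g \<and> L2 g" for j i
    by (rule Hsq_wpd_wpd[OF fin(11), of i 3 j]) (simp, blast)
  note ex = someI_ex[OF this]
  define dvpz where "dvpz j i = (SOME g. fd i (wpd 3 (vpj j)) g \<and> L2 g)" for j i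
  have dz: "fd i (wpd 3 (vpj j)) (dvpz j i)" "L2 (dvpz j i)" for j i
    unfolding dvpz_def using ex[of i j] by (rule conjunct1, rule conjunct2)
  have s3: "sob 3 (4 * A) (wpd 3 (vpj j))" for j
    by (rule sob_fd[OF _ wpd_vp], simp only: Suc_numeral semiring_norm, rule vp4)
  have s2: "sob 2 (4 * (4 * A)) (dvpz j i)" for j i
    by (rule sob_fd[OF _ dz], simp only: Suc_numeral semiring_norm, rule s3)
  \<comment> \<open>Two derivatives cost 4 each; \<open>c\<close> absorbs the 16, so that
    \<open>A\<close> itself can serve as the parameter \<open>a\<close> of
    \<open>pde_diff\<close>.\<close>
  have "4 * (4 * A) \<le> c * A" using mult_right_mono[OF c_ge(2) A] by simp
  then have Lbz: "Lb (c * A) (dvpz j i)" for j i by (rule Lb_sob[OF s2 order_refl])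
  have "pde_diff \<epsilon> A c s st sp spt w wt wp (wpd 3 st) (wpd 3 wp) vj vpj (\<lambda>j x. vt x $ j) (\<lambda>j x. vpt x $ j)
     (\<lambda>i. wpd i s) (\<lambda>i. wpd i sp) (\<lambda>i. wpd i w) (\<lambda>i. wpd2 i w)
     (\<lambda>j i. wpd i (vj j)) (\<lambda>j i. wpd i (vpj j)) (\<lambda>j i. wpd2 i (vj j)) (\<lambda>j i. wpd2 i (vpj j)) dvpz"
  proof
    show "AE x in torus. st x + ((\<Sum>j\<in>UNIV. v x $ j * wpd (hidx j) s x) + w x * wpd 3 s x) + (\<Sum>j\<in>UNIV. wpd (hidx j) (vj j) x) + wpd 3 w x = 0"
      using cf by eventually_elim (unfold transport_def div_h_def laplacian_def, elim conjE, assumption)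
    show "AE x in torus. vt x $ j + ((\<Sum>l\<in>UNIV. v x $ l * wpd (hidx l) (vj j) x) + w x * wpd 3 (vj j) x) + wpd (hidx j) s x = (\<Sum>i\<in>UNIV. wpd2 i (vj j) x)" for j
      using cf by eventually_elim (unfold transport_def div_h_def laplacian_def, blast)
    show "AE x in torus. \<epsilon>\<^sup>2 * (wt x + ((\<Sum>j\<in>UNIV. v x $ j * wpd (hidx j) w x) + w x * wpd 3 w x)) + wpd 3 s x = \<epsilon>\<^sup>2 * (\<Sum>i\<in>UNIV. wpd2 i w x)"
      using cf by eventually_elim (unfold transport_def div_h_def laplacian_def, blast)
    show "AE x in torus. spt x + ((\<Sum>j\<in>UNIV. vp x $ j * wpd (hidx j) sp x) + wp x * wpd 3 sp x) + (\<Sum>j\<in>UNIV. wpd (hidx j) (vpj j) x) + wpd 3 wp x = 0"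
      using cp by eventually_elim (unfold transport_def div_h_def laplacian_def, elim conjE, assumption)
    show "AE x in torus. vpt x $ j + ((\<Sum>l\<in>UNIV. vp x $ l * wpd (hidx l) (vpj j) x) + wp x * wpd 3 (vpj j) x) + wpd (hidx j) sp x = (\<Sum>i\<in>UNIV. wpd2 i (vpj j) x)" for j
      using cp by eventually_elim (unfold transport_def div_h_def laplacian_def, blast)
    show "AE x in torus. wpd 3 sp x = 0" using cp by eventually_elim simp
    show "fc w k = 0" "fc wp k = 0" if "k 3 = 0" for k
      using that sym symp sqi_meas[OF L2s(5)] sqi_meas[OF L2s(6)] by (auto intro!: fc_reflect_odd simp: periodic_sym_def)
    show "nrm torus (wpd 3 st) \<le> c * \<epsilon>"
      using nrm_wpd3_st mult_right_mono[OF c_ge(6), of \<epsilon>] eps by linarith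
    show "Lb c s" "Lb c sp" "Lb c (wpd i sp)" "Lb c (vj j)" "Lb c (vpj j)" "Lb c (wpd i (vj j))" "Lb c (wpd i (vpj j))"
      "Lb c w" "Lb c wp" "Lb c (wpd 3 w)" for i j
      by (rule Lb_sob[OF sobs(1)] Lb_sob[OF sobs(2)] Lb_sob[OF sobs(3)] Lb_sob[OF sobs(4)]
        Lb_sob[OF sobs(5)] Lb_sob[OF sobs(6)] Lb_sob[OF sobs(7)] Lb_sob[OF sob_wpd(2)] Lb_sob[OF sob_wpd(3)] Lb_sob[OF sob_wpd(4)], simp, rule c_ge)+
    show "nrm torus (wpd2 i (vpj j)) \<le> c" "nrm torus (wpd i w) \<le> c" "nrm torus (wpd2 i w) \<le> c" "nrm torus wt \<le> c" for i j
      by (rule order_trans[OF _ c_ge(6)], rule nrm_wpd2_vp nrm_wpd_w nrm_wpd2_w nrm_times(3))+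
  qed (rule eps c_ge A wpd_s wpd_sp wpd_v wpd_vp wpd2_v wpd2_vp wpd_w wpd_wp wpd2_w wpd_st times_L2 vpt fc_spt Lbz dz; assumption)+
  then show ?thesis by (rule that)
qed

lemma energy_estimate:
    "ip torus (\<lambda>x. s x - sp x) (\<lambda>x. st x - spt x) + (\<Sum>j\<in>UNIV. ip torus (\<lambda>x. v x $ j - vp x $ j) (\<lambda>x. vt x $ j - vpt x $ j))
      \<le> - D2 v vp / 2 + 60 * c ^ 4 * ((1 + A) * Y2 s v sp vp + \<epsilon>\<^sup>2)" (is ?th1)
  and vertical_velocity_estimate: "nrm torus (\<lambda>x. w x - wp x) \<le> 2 * (c * \<epsilon> + (c * nrm torus (\<lambda>x. wpd 1 s x - wpd 1 sp x)
      + c * nrm torus (\<lambda>x. wpd 2 s x - wpd 2 sp x) + 2 * c * sqrt (Y2 s v sp vp) + 7 * c ^ 3 * \<epsilon> + 2 * sqrt (D2 v vp)))" (is ?th2)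
  and vpt_estimate: "nrm torus (\<lambda>x. vpt x $ j) \<le> 20 * c\<^sup>2" (is ?th3)
proof -
  obtain dvpz where p: "pde_diff \<epsilon> A c s st sp spt w wt wp (wpd 3 st) (wpd 3 wp) vj vpj (\<lambda>j x. vt x $ j) (\<lambda>j x. vpt x $ j)
     (\<lambda>i. wpd i s) (\<lambda>i. wpd i sp) (\<lambda>i. wpd i w) (\<lambda>i. wpd2 i w)
     (\<lambda>j i. wpd i (vj j)) (\<lambda>j i. wpd i (vpj j)) (\<lambda>j i. wpd2 i (vj j)) (\<lambda>j i. wpd2 i (vpj j)) dvpz"
    by (rule pde_diff)
  interpret P: pde_diff \<epsilon> A c s st sp spt w wt wp "wpd 3 st" "wpd 3 wp" vj vpj "\<lambda>j x. vt x $ j" "\<lambda>j x. vpt x $ j"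
     "\<lambda>i. wpd i s" "\<lambda>i. wpd i sp" "\<lambda>i. wpd i w" "\<lambda>i. wpd2 i w"
     "\<lambda>j i. wpd i (vj j)" "\<lambda>j i. wpd i (vpj j)" "\<lambda>j i. wpd2 i (vj j)" "\<lambda>j i. wpd2 i (vpj j)" dvpz by (rule p)
  have y2: "P.y2 = Y2 s v sp vp" unfolding P.y2_def Y2_def P.S_def[abs_def] P.V_def[abs_def] ..
  have d2: "P.d2 = D2 v vp" unfolding P.d2_def D2_def P.dV_def[abs_def] ..
  show ?th1
    using P.energy_inequality unfolding y2 d2 P.S_def[abs_def] P.V_def[abs_def] P.St_def[abs_def] P.Vt_def[abs_def]
    by (simp add: ip_commute)
  show ?th2
    using P.W_bound unfolding P.y_def P.d_def y2 d2 P.W_def[abs_def] P.dS_def[abs_def] by simp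
  show ?th3 by (rule P.n_vpt)
qed

lemma L2_differences: "L2 (\<lambda>x. st x - spt x)" "L2 (\<lambda>x. vt x $ j - vpt x $ j)" "L2 (\<lambda>x. s x - sp x)" "L2 (\<lambda>x. v x $ j - vp x $ j)" "L2 (\<lambda>x. w x - wp x)"
  "L2 (\<lambda>x. wpd i s x - wpd i sp x)" "L2 (\<lambda>x. wpd i (vj j) x - wpd i (vpj j) x)"
  by (intro sqi_diff times_L2 vpt L2s wpd_s wpd_sp wpd_v wpd_vp)+

lemma fd_differences:
  "fd i (\<lambda>x. s x - sp x) (\<lambda>x. wpd i s x - wpd i sp x)" "fd i (\<lambda>x. v x $ j - vp x $ j) (\<lambda>x. wpd i (vj j) x - wpd i (vpj j) x)"
  by (intro fd_diff wpd_s wpd_sp wpd_v wpd_vp L2s)+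

lemma Hsq_finite_1: "Hsq 1 (vj j) < \<infinity>" "Hsq 1 (vpj j) < \<infinity>"
  by (rule Hsq_finite_mono[OF fin(3)] Hsq_finite_mono[OF fin(11)], simp)+

text \<open>Supplies the constant \<open>B\<close> in the energy identity; it dominates and does not
  have to be small.\<close>

lemma nrm_products:
  "nrm torus (\<lambda>x. s x - sp x) * nrm torus (\<lambda>x. st x - spt x) \<le> 2 * X * (X + 20 * c\<^sup>2)"
  "nrm torus (\<lambda>x. v x $ j - vp x $ j) * nrm torus (\<lambda>x. vt x $ j - vpt x $ j) \<le> 2 * X * (X + 20 * c\<^sup>2)"
proof -
  have "1 * c \<le> c * c" using c_ge(1) by (intro mult_right_mono) auto
  then have cX: "X \<le> 20 * c\<^sup>2" using c_ge(1,6) unfolding power2_eq_square by linarith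
  have "nrm torus (\<lambda>x. s x - sp x) \<le> 2 * X" "nrm torus (\<lambda>x. st x - spt x) \<le> X + 20 * c\<^sup>2"
    "nrm torus (\<lambda>x. v x $ j - vp x $ j) \<le> 2 * X" "nrm torus (\<lambda>x. vt x $ j - vpt x $ j) \<le> X + 20 * c\<^sup>2"
    using nrm_triangle_diff[OF L2s(1,2)] nrm_triangle_diff[OF times_L2(1,2)] nrm_triangle_diff[OF L2s(3)[of j] L2s(4)[of j]]
      nrm_triangle_diff[OF times_L2(4)[of j] vpt[of j]] nrms(1,2) nrms(3)[of j] nrms(4)[of j] nrm_times(1,2) nrm_times(4)[of j] vpt_estimate[of j] cX by linarith+
  then show "nrm torus (\<lambda>x. s x - sp x) * nrm torus (\<lambda>x. st x - spt x) \<le> 2 * X * (X + 20 * c\<^sup>2)"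
    "nrm torus (\<lambda>x. v x $ j - vp x $ j) * nrm torus (\<lambda>x. vt x $ j - vpt x $ j) \<le> 2 * X * (X + 20 * c\<^sup>2)"
    using X0 by (auto intro!: mult_mono)
qed

text \<open>By \<open>sob_diff\<close>, 384 is twice 96 + 96 and 192 is twice 48 + 48; the 96 in
  front counts six derivatives with 16 each. The exponents differ because the density is bounded at
  order 4 and the velocity at order 3.\<close>

lemma gradient_interpolation:
  assumes l: "0 < l"
  shows "nsq torus (\<lambda>x. wpd i s x - wpd i sp x) \<le> 16 * (l * Y2 s v sp vp + (384 * X)\<^sup>2 / l ^ 3)"
    and "D2 v vp \<le> 96 * (l * Y2 s v sp vp + (192 * X)\<^sup>2 / l ^ 2)"
proof -
  have y: "nsq torus (\<lambda>x. s x - sp x) \<le> Y2 s v sp vp" "nsq torus (\<lambda>x. v x $ j - vp x $ j) \<le> Y2 s v sp vp" for j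
    using member_le_sum[of j UNIV "\<lambda>j. nsq torus (\<lambda>x. v x $ j - vp x $ j)"]
    by (auto simp: Y2_def intro!: sum_nonneg add_increasing)
  have s: "sob (Suc 3) (384 * X) (\<lambda>x. s x - sp x)" "sob (Suc 2) (192 * X) (\<lambda>x. v x $ j - vp x $ j)" for j
    using sob_diff[OF sobs(1,2)] sob_diff[OF sobs(3,4), of j j] by (simp_all add: eval_nat_numeral)
  show "nsq torus (\<lambda>x. wpd i s x - wpd i sp x) \<le> 16 * (l * Y2 s v sp vp + (384 * X)\<^sup>2 / l ^ 3)"
    by (rule interpolation[OF s(1) fd_differences(1) L2_differences(6) l y(1)])
  have "D2 v vp \<le> (\<Sum>j\<in>(UNIV::2 set). \<Sum>i\<in>(UNIV::3 set). 16 * (l * Y2 s v sp vp + (192 * X)\<^sup>2 / l ^ 2))"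
    unfolding D2_def by (intro sum_mono interpolation[OF s(2) fd_differences(2) L2_differences(7) l y(2)])
  then show "D2 v vp \<le> 96 * (l * Y2 s v sp vp + (192 * X)\<^sup>2 / l ^ 2)" by simp
qed

end

section \<open>Measurability in time\<close>

text \<open>Unlike \<open>Hsq\<close>, this quantity is measurable in time as soon as the Fourier coefficients are.\<close>

definition sobsq :: "nat \<Rightarrow> (real^3 \<Rightarrow> real) \<Rightarrow> ennreal" where
  "sobsq m f = (SUP N. ennreal (\<Sum>k\<in>KB N. JJ k ^ m * (norm (fc f k))\<^sup>2))"

lemma sobsq_le: "sobsq m f \<le> ennreal ((6 * 2 ^ m)\<^sup>2) * Hsq m f"
proof (cases "Hsq m f = \<infinity>")
  case True
  have "(6 * 2 ^ m :: real)\<^sup>2 > 0" by simp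
  then show ?thesis using True by (simp add: ennreal_mult_top)
next
  case False
  then obtain r where r: "Hsq m f = ennreal r" "0 \<le> r" by (cases "Hsq m f") auto
  have s: "sob m (6 * 2 ^ m * sqrt r) f"
    by (rule Hsq_imp_sob) (use r in auto)
  have "sobsq m f \<le> ennreal ((6 * 2 ^ m * sqrt r)\<^sup>2)"
    unfolding sobsq_def by (rule SUP_least, rule ennreal_leI) (use s in \<open>simp add: sob_def\<close>)
  also have "\<dots> = ennreal ((6 * 2 ^ m)\<^sup>2) * Hsq m f"
    using r by (simp add: power_mult_distrib ennreal_mult)
  finally show ?thesis .
qed

lemma sobsq_sob:
  assumes "L2 f" "sobsq m f \<le> ennreal (B\<^sup>2)" "0 \<le> B" shows "sob m B f"
  unfolding sob_def
proof (intro conjI assms allI)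
  fix N
  have "ennreal (\<Sum>k\<in>KB N. JJ k ^ m * (norm (fc f k))\<^sup>2) \<le> sobsq m f"
    unfolding sobsq_def by (rule SUP_upper) simp
  also note assms(2)
  finally show "(\<Sum>k\<in>KB N. JJ k ^ m * (norm (fc f k))\<^sup>2) \<le> B\<^sup>2" by (simp add: ennreal_le_iff)
qed

lemma sobsq_measurable:
  assumes "\<And>k. (\<lambda>t. fc (f t) k) \<in> borel_measurable M"
  shows "(\<lambda>t. sobsq m (f t)) \<in> borel_measurable M"
proof -
  note assms [measurable]
  show ?thesis unfolding sobsq_def by measurable
qed

lemma ennreal_sqrt_measurable [measurable]: "ennreal_sqrt \<in> borel_measurable borel"
  unfolding ennreal_sqrt_def[abs_def] by measurable

lemma ennreal_sqrt_leI: "a \<le> ennreal (X\<^sup>2) \<Longrightarrow> 0 \<le> X \<Longrightarrow> ennreal_sqrt a \<le> ennreal X"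
proof -
  assume a: "a \<le> ennreal (X\<^sup>2)" "0 \<le> X"
  then obtain r where r: "a = ennreal r" "0 \<le> r" by (cases a) (auto simp: top_unique)
  then have "sqrt r \<le> X" using a by (intro real_le_lsqrt) (auto simp: ennreal_le_iff)
  then show ?thesis using r by (simp add: ennreal_sqrt_def ennreal_leI)
qed

lemma power2_le_imp_le_ennreal:
  assumes "a\<^sup>2 \<le> ennreal (X\<^sup>2)" "0 \<le> X" shows "a \<le> ennreal X"
proof (cases a)
  case (real r)
  then have "r\<^sup>2 \<le> X\<^sup>2" using assms(1) by (simp add: ennreal_power ennreal_le_iff)
  then have "r \<le> X" using assms(2) by (rule power2_le_imp_le)
  then show ?thesis using real by (simp add: ennreal_leI)
qed (use assms in \<open>simp add: top_unique power2_eq_square ennreal_mult_top\<close>)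

lemma ennreal_inverse_cancel: "0 < c \<Longrightarrow> ennreal (1 / c) * (ennreal c * x) = x" "0 < c \<Longrightarrow> ennreal c * (ennreal (1 / c) * x) = x"
  by (simp_all add: mult.assoc[symmetric] ennreal_mult'[symmetric])

text \<open>The constant is moved to the measurable side \<open>f\<close>: it is not known whether \<open>Hnorm\<close> depends measurably
  on time, and \<open>nn_integral_cmult\<close> fails for non-measurable functions.\<close>

lemma nn_integral_le_cmult:
  assumes f: "f \<in> borel_measurable M" and le: "\<And>t. f t \<le> ennreal c * g t"
    and g: "(\<integral>\<^sup>+t. g t \<partial>M) \<le> B" and c: "0 < c"
  shows "(\<integral>\<^sup>+t. f t \<partial>M) \<le> ennreal c * B"
proof -
  have "ennreal (1 / c) * f t \<le> g t" for t
    using mult_left_mono[OF le[of t], of "ennreal (1 / c)"] by (simp only: ennreal_inverse_cancel[OF c] zero_le)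
  then have "(\<integral>\<^sup>+t. ennreal (1 / c) * f t \<partial>M) \<le> B"
    by (intro order_trans[OF nn_integral_mono g])
  then have "ennreal (1 / c) * (\<integral>\<^sup>+t. f t \<partial>M) \<le> B"
    by (simp only: nn_integral_cmult[OF f])
  from mult_left_mono[OF this, of "ennreal c"] show ?thesis
    by (simp only: ennreal_inverse_cancel[OF c] zero_le)
qed

lemma Linf_time_AE: "Linf_time T N \<le> C \<Longrightarrow> AE t in time T. N t \<le> C"
  using esssup_AE[of N "time T"] unfolding Linf_time_def by (auto elim!: eventually_mono intro: order_trans)

lemma nn_integral_time_mono: "t \<le> T \<Longrightarrow> (\<integral>\<^sup>+s. f s \<partial>time t) = (\<integral>\<^sup>+s. f s * indicator {0<..<t} s \<partial>time T)"
  unfolding time_def by (subst (1 2) nn_integral_restrict_space) (auto intro!: nn_integral_cong simp: indicator_def)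

text \<open>Monotone convergence along times increasing to \<open>T\<close>; the energy identity is
  available only strictly before \<open>T\<close>.\<close>

lemma nn_integral_time_le:
  assumes f: "f \<in> borel_measurable (time T)" and T: "0 < T"
    and le: "\<And>t. 0 \<le> t \<Longrightarrow> t < T \<Longrightarrow> (\<integral>\<^sup>+s. f s \<partial>time t) \<le> C"
  shows "(\<integral>\<^sup>+s. f s \<partial>time T) \<le> C"
proof -
  define t where "t n = T - T / real (Suc n)" for n
  have t: "0 \<le> t n" "t n < T" for n using T by (auto simp: t_def field_simps)
  have tm: "t m \<le> t n" if "m \<le> n" for m n
    using T that by (auto simp: t_def intro!: divide_left_mono)
  have lim: "t \<longlonglongrightarrow> T"
    unfolding t_def using tendsto_diff[OF tendsto_const LIMSEQ_Suc[OF lim_const_over_n[of T]], of T] by simp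
  have meas: "(\<lambda>s. f s * indicator {0<..<t n} s) \<in> borel_measurable (time T)" for n
  proof -
    have "(indicator {0<..<t n} :: real \<Rightarrow> ennreal) \<in> borel_measurable (time T)"
      unfolding time_def by (intro measurable_restrict_space1 measurable_completion) simp
    then show ?thesis using f by simp
  qed
  have "(\<integral>\<^sup>+s. f s \<partial>time T) = (\<integral>\<^sup>+s. (SUP n. f s * indicator {0<..<t n} s) \<partial>time T)"
  proof (rule nn_integral_cong)
    fix s assume "s \<in> space (time T)"
    then have s: "0 < s" "s < T" by auto
    obtain n where "s < t n" using order_tendstoD(1)[OF lim s(2)] by (auto simp: eventually_sequentially)
    then have "f s \<le> (SUP n. f s * indicator {0<..<t n} s)" using s by (intro SUP_upper2[of n]) auto
    moreover have "(SUP n. f s * indicator {0<..<t n} s) \<le> f s"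
      by (intro SUP_least) (auto simp: indicator_def)
    ultimately show "f s = (SUP n. f s * indicator {0<..<t n} s)" by simp
  qed
  also have "\<dots> = (SUP n. \<integral>\<^sup>+s. f s * indicator {0<..<t n} s \<partial>time T)"
  proof (rule nn_integral_monotone_convergence_SUP[OF _ meas])
    show "incseq (\<lambda>n s. f s * indicator {0<..<t n} s)"
      using tm by (auto simp: incseq_def le_fun_def indicator_def dest: order.strict_trans2)
  qed
  also have "\<dots> \<le> C"
  proof (rule SUP_least)
    fix n show "(\<integral>\<^sup>+s. f s * indicator {0<..<t n} s \<partial>time T) \<le> C"
      using le[OF t, of n] nn_integral_time_mono[OF less_imp_le[OF t(2)], of n f] by simp
  qed
  finally show ?thesis .
qed

lemma continuous_on_halfopen:
  fixes f :: "real \<Rightarrow> 'b::topological_space"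
  assumes "\<And>t. 0 \<le> t \<Longrightarrow> t < T \<Longrightarrow> continuous_on {0..t} f"
  shows "continuous_on {0..<T} f"
  unfolding continuous_on_def
proof
  fix t assume t: "t \<in> {0..<T}"
  let ?u = "(t + T) / 2"
  have u: "0 \<le> ?u" "?u < T" "t < ?u" using t by auto
  have "(f \<longlongrightarrow> f t) (at t within {0..?u})"
    using assms[OF u(1,2)] t u by (auto simp: continuous_on_def)
  moreover have "at t within {0..<T} = at t within {0..?u}"
    by (rule at_within_nhd[of t "{..<?u}"]) (use t u in auto)
  ultimately show "(f \<longlongrightarrow> f t) (at t within {0..<T})" by simp
qed

text \<open>The zero set is closed and has full measure in the open interval, so it contains the
  interval together with both endpoints.\<close>

lemma continuous_AE_zero:
  fixes h :: "real \<Rightarrow> 'b::{t1_space, zero}"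
  assumes "continuous_on {0..T} h" "AE t in time T. h t = 0" "0 < T" "t \<in> {0..T}"
  shows "h t = 0"
proof -
  let ?C = "{0..T} \<inter> h -` {0}"
  have cl: "closed ?C" by (intro continuous_closed_preimage assms) auto
  have "AE x\<in>{0<..<T} in lebesgue. h x = 0"
    using assms(2) unfolding time_def by (subst (asm) AE_restrict_space_iff) auto
  then have "AE x\<in>{0<..<T} in lebesgue. x \<in> ?C" by (rule eventually_mono) auto
  then have "{0<..<T} \<subseteq> ?C"
    using mem_closed_if_AE_lebesgue_open[OF _ cl, of "{0<..<T}"] by auto
  then have "closure {0<..<T} \<subseteq> ?C" using cl by (rule closure_minimal)
  then show ?thesis using assms(3,4) by auto
qed

lemma time_measurable_mono:
  assumes "time_measurable T f" "t \<le> T" shows "time_measurable t f"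
proof -
  obtain g where g: "(\<lambda>(t, x). g t x) \<in> borel_measurable (time T \<Otimes>\<^sub>M torus)" "AE t in time T. AE x in torus. f t x = g t x"
    using assms(1) by (auto simp: time_measurable_def)
  have "(\<lambda>s. s) \<in> measurable (time t) (time T)"
    unfolding time_def by (rule measurable_restrict_space3) (use assms(2) in auto)
  then have "(\<lambda>p. (fst p, snd p)) \<in> measurable (time t \<Otimes>\<^sub>M torus) (time T \<Otimes>\<^sub>M torus)"
    by (intro measurable_Pair measurable_snd measurable_compose[OF measurable_fst])
  from measurable_compose[OF this g(1)] have "(\<lambda>(t, x). g t x) \<in> borel_measurable (time t \<Otimes>\<^sub>M torus)"
    by (simp add: case_prod_unfold)
  then show ?thesis using AE_time_mono[OF g(2) assms(2)] by (auto simp: time_measurable_def)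
qed

lemma time_measurable_diff:
  assumes "time_measurable T f" "time_measurable T f'"
  shows "time_measurable T (\<lambda>t x. f t x - f' t x)"
proof -
  obtain g g' where g: "(\<lambda>(t, x). g t x) \<in> borel_measurable (time T \<Otimes>\<^sub>M torus)" "AE t in time T. AE x in torus. f t x = g t x"
    "(\<lambda>(t, x). g' t x) \<in> borel_measurable (time T \<Otimes>\<^sub>M torus)" "AE t in time T. AE x in torus. f' t x = g' t x"
    using assms by (auto simp: time_measurable_def)
  have "(\<lambda>(t, x). g t x - g' t x) \<in> borel_measurable (time T \<Otimes>\<^sub>M torus)"
    using borel_measurable_diff[OF g(1,3)] by (simp add: case_prod_unfold)
  moreover have "AE t in time T. AE x in torus. f t x - f' t x = g t x - g' t x"
    using g(2,4) by eventually_elim (rule eventually_elim2, assumption+, simp)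
  ultimately show ?thesis by (auto simp: time_measurable_def)
qed

text \<open>The coefficients of a difference of time derivatives split only at almost every time,
  where both are integrable. Integrability and integrals in time are therefore transferred across a
  null set.\<close>

lemma energy_identity_diff:
  assumes C: "in_CH Ts 0 f" "in_CH Ts 0 f'" and d: "has_time_deriv Ts f g" "has_time_deriv Ts f' g'" and T: "T \<le> Ts"
    and G: "AE s in time T. L2 (\<lambda>x. g s x - g' s x) \<and> nrm torus (\<lambda>x. f s x - f' s x) * nrm torus (\<lambda>x. g s x - g' s x) \<le> B"
    and t: "0 \<le> t" "t < T"
  shows "nsq torus (\<lambda>x. f t x - f' t x) = nsq torus (\<lambda>x. f 0 x - f' 0 x)
      + 2 * (\<integral>s. ip torus (\<lambda>x. f s x - f' s x) (\<lambda>x. g s x - g' s x) \<partial>time t)"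
    and "integrable (time t) (\<lambda>s. ip torus (\<lambda>x. f s x - f' s x) (\<lambda>x. g s x - g' s x))"
proof -
  have L2: "L2 (f t)" "L2 (f' t)" if "0 \<le> t" "t < T" for t
    using in_CH_L2[OF C(1), of t] in_CH_L2[OF C(2), of t] that T by auto
  have q: "integrable (time Ts) (\<lambda>s. fc (g s) k)" "AE s in time Ts. integrable torus (g s)"
    "integrable (time Ts) (\<lambda>s. fc (g' s) k)" "AE s in time Ts. integrable torus (g' s)" for k
    using d by (auto simp: has_time_deriv_def intro: has_time_deriv_fc_integrable)
  have eq: "AE s in time T. fc (g s) k - fc (g' s) k = fc (\<lambda>x. g s x - g' s x) k" for k
    using AE_time_mono[OF q(2) T] AE_time_mono[OF q(4) T] by eventually_elim (simp add: fc_diff)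
  have qT: "integrable (time t) (\<lambda>s. fc (g s) k)" "integrable (time t) (\<lambda>s. fc (g' s) k)" if "t \<le> T" for k t
    using time_integrable_mono[OF q(1)] time_integrable_mono[OF q(3)] that T by auto
  have qd: "integrable (time T) (\<lambda>s. fc (g s) k - fc (g' s) k)" for k
    by (intro Bochner_Integration.integrable_diff qT order_refl)
  have qm: "(\<lambda>s. fc (\<lambda>x. g s x - g' s x) k) \<in> borel_measurable (time T)" for k
    by (rule borel_measurable_AE_complete[OF complete_time borel_measurable_integrable[OF qd] eq])
  have qi: "integrable (time T) (\<lambda>s. fc (\<lambda>x. g s x - g' s x) k)" for k
    using integrable_cong_AE[OF borel_measurable_integrable[OF qd] qm eq] qd by simp
  have mode: "fc (\<lambda>x. f t x - f' t x) k = fc (\<lambda>x. f 0 x - f' 0 x) k + (\<integral>s. fc (\<lambda>x. g s x - g' s x) k \<partial>time t)"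
    if t: "0 \<le> t" "t < T" for k t
  proof -
    have "(\<integral>s. fc (\<lambda>x. g s x - g' s x) k \<partial>time t) = (\<integral>s. fc (g s) k - fc (g' s) k \<partial>time t)"
    proof (rule integral_cong_AE)
      show "(\<lambda>s. fc (\<lambda>x. g s x - g' s x) k) \<in> borel_measurable (time t)"
        "(\<lambda>s. fc (g s) k - fc (g' s) k) \<in> borel_measurable (time t)"
        using time_integrable_mono[OF qi, of t k] time_integrable_mono[OF qd, of t k] t by auto
      show "AE s in time t. fc (\<lambda>x. g s x - g' s x) k = fc (g s) k - fc (g' s) k"
        using AE_time_mono[OF eq, of t k] t by (auto elim: eventually_mono)
    qed
    also have "\<dots> = (\<integral>s. fc (g s) k \<partial>time t) - (\<integral>s. fc (g' s) k \<partial>time t)"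
      by (rule Bochner_Integration.integral_diff[OF qT]) (use t in auto)
    finally show ?thesis
      using has_time_deriv_mode[OF C(1) d(1) t(1), of k] has_time_deriv_mode[OF C(2) d(2) t(1), of k] t T L2[of t] L2[of 0]
      by (simp add: fc_diff L2_integrable)
  qed
  show "nsq torus (\<lambda>x. f t x - f' t x) = nsq torus (\<lambda>x. f 0 x - f' 0 x)
      + 2 * (\<integral>s. ip torus (\<lambda>x. f s x - f' s x) (\<lambda>x. g s x - g' s x) \<partial>time t)"
    and "integrable (time t) (\<lambda>s. ip torus (\<lambda>x. f s x - f' s x) (\<lambda>x. g s x - g' s x))"
    by (rule energy_identity[where U="\<lambda>t x. f t x - f' t x" and G="\<lambda>t x. g t x - g' t x", OF _ qi mode G t]; (intro sqi_diff L2)?; assumption)+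
qed

text \<open>By continuity the mode of \<open>f\<close> vanishes at every time, so the integral of
  the mode of \<open>g\<close> from 0 to any time is zero. This carries the independence of
  \<open>sp\<close> from \<open>z\<close> over to \<open>spt\<close>.\<close>

lemma steady_modes:
  assumes C: "in_CH Ts 0 f" and d: "has_time_deriv Ts f g" and T: "0 < T" "T \<le> Ts"
    and z: "AE t in time T. fc (f t) k = 0"
  shows "AE t in time T. fc (g t) k = 0"
proof -
  have z': "fc (f t) k = 0" if "t \<in> {0..T}" for t
    by (rule continuous_AE_zero[OF continuous_on_subset[OF in_CH_fc_continuous[OF C]] z T(1) that]) (use T in auto)
  have q: "integrable (time T) (\<lambda>s. fc (g s) k)"
    by (rule time_integrable_mono[OF _ T(2)]) (use d in \<open>auto simp: has_time_deriv_def intro: has_time_deriv_fc_integrable\<close>)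
  have "AE s in time T. Re (c * fc (g s) k) = 0" for c
  proof (rule time_integral_zero_imp_AE[OF _ T(1)])
    show "integrable (time T) (\<lambda>s. Re (c * fc (g s) k))" by (intro integrable_Re integrable_mult_right q)
    fix t assume t: "0 \<le> t" "t < T"
    have qt: "integrable (time t) (\<lambda>s. fc (g s) k)" by (rule time_integrable_mono[OF q]) (use t in simp)
    have "(\<integral>s. fc (g s) k \<partial>time t) = 0"
      using has_time_deriv_mode[OF C d t(1), of k] z'[of t] z'[of 0] t T by simp
    moreover have "(\<integral>s. Re (c * fc (g s) k) \<partial>time t) = Re (c * (\<integral>s. fc (g s) k \<partial>time t))"
      by (subst integral_Re) (auto intro: qt)
    ultimately show "(\<integral>s. Re (c * fc (g s) k) \<partial>time t) = 0" by simp
  qed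
  from this[of 1] this[of "- \<i>"] show ?thesis
    by eventually_elim (auto simp: complex_eq_iff)
qed

section \<open>The error estimates\<close>

text \<open>\<open>Cc\<close> is the constant of the energy estimate, \<open>Bc\<close> bounds the squared \<open>L\<^sup>2\<close> norm in time of the Gronwall coefficient,
  \<open>Gc \<epsilon>\<^sup>2\<close> bounds the squared \<open>L\<^sup>2\<close> norm of \<open>S, V\<close>, and \<open>Hc \<epsilon>\<^sup>2\<close> the time integral of that of \<open>\<nabla>V\<close>.\<close>

definition Cc :: "real \<Rightarrow> real" where "Cc X = 60 * (400 * X) ^ 4"
definition Bc :: "real \<Rightarrow> real \<Rightarrow> real" where "Bc T X = 8 * (Cc X)\<^sup>2 * (T + (96 * X)\<^sup>2) + 1"
definition Gc :: "real \<Rightarrow> real \<Rightarrow> real \<Rightarrow> real" where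
  "Gc T X K = 2 * (K\<^sup>2 + 2 * Cc X * T) * exp (Bc T X * T)"
definition Hc :: "real \<Rightarrow> real \<Rightarrow> real \<Rightarrow> real" where
  "Hc T X K = K\<^sup>2 + 2 * Cc X * T + Gc T X K * (T + Bc T X)"

lemma constants_nonneg:
  assumes "0 \<le> T" "1 \<le> X" shows "0 < Cc X" "0 < Bc T X" "0 \<le> Gc T X K" "0 \<le> Hc T X K"
proof -
  show C: "0 < Cc X" using assms by (simp add: Cc_def)
  show B: "0 < Bc T X" unfolding Bc_def using assms by (intro add_nonneg_pos mult_nonneg_nonneg) auto
  show G: "0 \<le> Gc T X K" unfolding Gc_def using C assms by (intro mult_nonneg_nonneg add_nonneg_nonneg) auto
  show "0 \<le> Hc T X K" unfolding Hc_def using C B G assms by (intro mult_nonneg_nonneg add_nonneg_nonneg) auto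
qed

lemma measure_time: "0 \<le> T \<Longrightarrow> measure (time T) (space (time T)) = T"
  by (simp add: time_def measure_restrict_space)

text \<open>Raising the factor 2 to 4 turns the bound into a perfect square.\<close>

lemma exp_quadratic_le: "0 \<le> A \<Longrightarrow> (y::real)\<^sup>2 \<le> 2 * A\<^sup>2 * exp (2 * b * T) \<Longrightarrow> y \<le> 2 * A * exp (b * T)"
proof (rule power2_le_imp_le)
  assume A: "0 \<le> A" and y: "y\<^sup>2 \<le> 2 * A\<^sup>2 * exp (2 * b * T)"
  note y
  also have "2 * A\<^sup>2 * exp (2 * b * T) \<le> 4 * A\<^sup>2 * exp (2 * b * T)" by (intro mult_right_mono) auto
  also have "\<dots> = (2 * A * exp (b * T))\<^sup>2"
    by (simp add: power_mult_distrib exp_double[symmetric] algebra_simps)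
  finally show "y\<^sup>2 \<le> (2 * A * exp (b * T))\<^sup>2" .
qed auto

text \<open>The equations hold up to \<open>Ts\<close>, the bounds on both energies up to
  \<open>T\<close>. A single number \<open>X\<close> bounds all norms, so that only one constant has
  to be carried through the estimates.\<close>

locale solution_pair =
  fixes \<epsilon> X K T Ts :: real
    and s st stt w wt sp spt wp :: "real \<Rightarrow> real^3 \<Rightarrow> real" and v vt vp vpt :: "real \<Rightarrow> real^3 \<Rightarrow> real^2"
    and s0 w0 :: "real^3 \<Rightarrow> real" and v0 :: "real^3 \<Rightarrow> real^2"
  assumes eps: "0 < \<epsilon>" "\<epsilon> < 1" and X: "1 \<le> X" and K: "0 \<le> K" and T: "0 < T" "T \<le> Ts"
    and cf: "cf_solution \<epsilon> Ts s st v vt w wt s0 v0 w0"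
    and cp: "cpe_solution Ts sp spt vp vpt wp"
    and E: "AE t in time T. energy_E \<epsilon> (s t) (st t) (v t) (w t) \<le> ennreal X"
    and E1: "AE t in time T. energy_E1 \<epsilon> (st t) (stt t) (vt t) (wt t) \<le> ennreal X"
    and sp4: "AE t in time T. Hnorm 4 [sp t] \<le> ennreal X"
    and spt2: "AE t in time T. Hnorm 2 [spt t] \<le> ennreal X"
    and vp3: "AE t in time T. Hnorm 3 (comps (vp t)) \<le> ennreal X"
    and wp2: "AE t in time T. Hnorm 2 [wp t] \<le> ennreal X"
    and vp4: "L2_time T (\<lambda>t. Hnorm 4 (comps (vp t))) \<le> ennreal X"
    and init: "L2norm ((\<lambda>x. s0 x - sp 0 x) # comps (\<lambda>x. v0 x - vp 0 x)) \<le> ennreal (K * \<epsilon>)"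
begin

lemma X0: "0 \<le> X" using X by simp

text \<open>The fourth order norm of \<open>vp\<close> in its Fourier form, which is measurable in
  time; its root is the parameter \<open>A\<close> of \<open>time_slice\<close>.\<close>

definition "a2 t = (\<Sum>j\<in>UNIV. sobsq 4 (\<lambda>x. vp t x $ j))"
definition "a t = sqrt (enn2real (a2 t))"
definition "Y t = Y2 (s t) (v t) (sp t) (vp t)"
definition "D t = D2 (v t) (vp t)"
definition "Q t = ip torus (\<lambda>x. s t x - sp t x) (\<lambda>x. st t x - spt t x)
  + (\<Sum>j\<in>UNIV. ip torus (\<lambda>x. v t x $ j - vp t x $ j) (\<lambda>x. vt t x $ j - vpt t x $ j))"

abbreviation "slice_at t \<equiv> time_slice \<epsilon> X (a t) (s t) (st t) (stt t) (w t) (wt t) (sp t) (spt t) (wp t) (v t) (vt t) (vp t) (vpt t)"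

lemma CH: "in_CH Ts 0 s" "in_CH Ts 0 (\<lambda>t x. v t x $ j)" "in_CH Ts 0 sp" "in_CH Ts 0 (\<lambda>t x. vp t x $ j)"
  using cf cp by (auto simp: cf_solution_def cpe_solution_def)

lemma time_deriv: "has_time_deriv Ts s st" "has_time_deriv Ts (\<lambda>t x. v t x $ j) (\<lambda>t x. vt t x $ j)"
  "has_time_deriv Ts sp spt" "has_time_deriv Ts (\<lambda>t x. vp t x $ j) (\<lambda>t x. vpt t x $ j)"
  using cf cp by (auto simp: cf_solution_def cpe_solution_def has_time_deriv_vec_def)

lemma modes_measurable:
  assumes "in_CH Ts 0 f" shows "(\<lambda>t. fc (f t) k) \<in> borel_measurable (time T)"
  by (rule continuous_time_measurable, rule continuous_on_subset[OF in_CH_fc_continuous[OF assms]]) (use T in auto)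

lemma a2_measurable: "a2 \<in> borel_measurable (time T)"
  unfolding a2_def[abs_def] by (intro borel_measurable_sum sobsq_measurable modes_measurable CH)

lemma a_measurable: "a \<in> borel_measurable (time T)"
  using a2_measurable unfolding a_def[abs_def] by measurable

lemma a2_integral: "(\<integral>\<^sup>+t. a2 t \<partial>time T) \<le> ennreal ((96 * X)\<^sup>2)"
proof -
  have g: "(\<integral>\<^sup>+t. (Hnorm 4 (comps (vp t)))\<^sup>2 \<partial>time T) \<le> ennreal (X\<^sup>2)"
    using vp4 X0 unfolding L2_time_def by (rule ennreal_sqrt_le)
  have le: "a2 t \<le> ennreal (96\<^sup>2) * (Hnorm 4 (comps (vp t)))\<^sup>2" for t
  proof -
    have "a2 t \<le> ennreal (96\<^sup>2) * Hsq 4 (\<lambda>x. vp t x $ 1) + ennreal (96\<^sup>2) * Hsq 4 (\<lambda>x. vp t x $ 2)"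
      unfolding a2_def sum_UNIV_2 using sobsq_le[of 4 "\<lambda>x. vp t x $ 1"] sobsq_le[of 4 "\<lambda>x. vp t x $ 2"]
      by (intro add_mono) simp_all
    then show ?thesis by (simp add: Hnorm_sq comps_def distrib_left)
  qed
  have "(\<integral>\<^sup>+t. a2 t \<partial>time T) \<le> ennreal (96\<^sup>2) * ennreal (X\<^sup>2)"
    by (rule nn_integral_le_cmult[OF a2_measurable le g]) simp
  also have "\<dots> = ennreal ((96 * X)\<^sup>2)"
    unfolding power_mult_distrib by (rule ennreal_mult[symmetric]) auto
  finally show ?thesis .
qed

lemma a2_finite: "AE t in time T. a2 t < \<infinity>"
proof -
  have "(\<integral>\<^sup>+t. a2 t \<partial>time T) \<noteq> \<infinity>" using a2_integral by (auto simp: top_unique)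
  from nn_integral_PInf_AE[OF a2_measurable this] show ?thesis by eventually_elim (simp add: less_top)
qed

lemma a_sqi: "sqi (time T) a" "nsq (time T) a \<le> (96 * X)\<^sup>2"
proof -
  have "(\<integral>\<^sup>+t. ennreal ((a t)\<^sup>2) \<partial>time T) = (\<integral>\<^sup>+t. a2 t \<partial>time T)"
    by (rule nn_integral_cong_AE) (use a2_finite in eventually_elim, simp add: a_def)
  then have le: "(\<integral>\<^sup>+t. ennreal ((a t)\<^sup>2) \<partial>time T) \<le> ennreal ((96 * X)\<^sup>2)" using a2_integral by simp
  note n = sqi_nn_integral[OF a_measurable le_less_trans[OF le]]
  show "sqi (time T) a" by (rule n) simp
  have "ennreal (nsq (time T) a) \<le> ennreal ((96 * X)\<^sup>2)" using n(2) le by simp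
  then show "nsq (time T) a \<le> (96 * X)\<^sup>2" by (simp add: ennreal_le_iff)
qed

lemma slice: "AE t in time T. slice_at t"
proof -
  have vpt: "AE t in time T. \<forall>j. L2 (\<lambda>x. vpt t x $ j)"
    unfolding AE_all_countable
    using cp by (auto simp: cpe_solution_def intro!: AE_time_mono[OF in_L2H_AE_L2 T(2)])
  have eqs: "AE t in time T. AE x in torus.
      st t x + transport (v t) (w t) (s t) x + div_h (v t) x + wpd 3 (w t) x = 0 \<and>
      (\<forall>j. vt t x $ j + transport (v t) (w t) (\<lambda>y. v t y $ j) x + wpd (hidx j) (s t) x = laplacian (\<lambda>y. v t y $ j) x) \<and>
      \<epsilon>\<^sup>2 * (wt t x + transport (v t) (w t) (w t) x) + wpd 3 (s t) x = \<epsilon>\<^sup>2 * laplacian (w t) x"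
    "AE t in time T. AE x in torus.
      spt t x + transport (vp t) (wp t) (sp t) x + div_h (vp t) x + wpd 3 (wp t) x = 0 \<and>
      (\<forall>j. vpt t x $ j + transport (vp t) (wp t) (\<lambda>y. vp t y $ j) x + wpd (hidx j) (sp t) x = laplacian (\<lambda>y. vp t y $ j) x) \<and>
      wpd 3 (sp t) x = 0"
    by (rule AE_time_mono[OF _ T(2)], use cf cp in \<open>simp only: cf_solution_def cpe_solution_def\<close>)+
  \<comment> \<open>The vertical derivative of \<open>sp\<close> is zero, which kills these modes;
    \<open>steady_modes\<close> passes this on to \<open>spt\<close>, and countability of the
    frequencies gives a common null set.\<close>
  have z: "AE t in time T. fc (sp t) k = 0" if k: "k 3 \<noteq> 0" for k
    using sp4 eqs(2)
  proof eventually_elim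
    fix t assume t: "Hnorm 4 [sp t] \<le> ennreal X"
      "AE x in torus. spt t x + transport (vp t) (wp t) (sp t) x + div_h (vp t) x + wpd 3 (wp t) x = 0 \<and>
      (\<forall>j. vpt t x $ j + transport (vp t) (wp t) (\<lambda>y. vp t y $ j) x + wpd (hidx j) (sp t) x = laplacian (\<lambda>y. vp t y $ j) x) \<and>
      wpd 3 (sp t) x = 0"
    have f: "Hsq 4 (sp t) < \<infinity>" by (rule Hnorm_finite[of 4 "[sp t]", OF le_less_trans[OF t(1)]]) simp_all
    have "L2 (wpd 3 (sp t))" "fd 3 (sp t) (wpd 3 (sp t))" by (rule Hsq_wpd[OF f]; simp)+
    moreover from t(2) have "AE x in torus. wpd 3 (sp t) x = 0" by eventually_elim simp
    ultimately have "fc (wpd 3 (sp t)) k = fc (\<lambda>x. 0) k" by (intro fc_cong_AE) (auto simp: sqi_def)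
    then have "- mu k 3 * fc (sp t) k = 0" using \<open>fd 3 (sp t) (wpd 3 (sp t))\<close> by (simp add: fd_def fc_def)
    then show "fc (sp t) k = 0" using norm_mu_ge1[of k 3] k by auto
  qed
  have "AE t in time T. k 3 \<noteq> 0 \<longrightarrow> fc (spt t) k = 0" for k
    using steady_modes[OF CH(3) time_deriv(3) T z] by (cases "k 3 = 0") auto
  then have fspt: "AE t in time T. \<forall>k. k 3 \<noteq> 0 \<longrightarrow> fc (spt t) k = 0"
    unfolding AE_all_countable by blast
  have "AE t in time T. t \<in> {0<..<T}" using AE_space[of "time T"] by simp
  then show ?thesis
    using E E1 sp4 spt2 vp3 wp2 vpt fspt a2_finite eqs
  proof eventually_elim
    fix t assume t: "t \<in> {0<..<T}" and e: "energy_E \<epsilon> (s t) (st t) (v t) (w t) \<le> ennreal X"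
      "energy_E1 \<epsilon> (st t) (stt t) (vt t) (wt t) \<le> ennreal X" "Hnorm 4 [sp t] \<le> ennreal X" "Hnorm 2 [spt t] \<le> ennreal X"
      "Hnorm 3 (comps (vp t)) \<le> ennreal X" "Hnorm 2 [wp t] \<le> ennreal X"
      and l: "\<forall>j. L2 (\<lambda>x. vpt t x $ j)" "\<forall>k. k 3 \<noteq> 0 \<longrightarrow> fc (spt t) k = 0" and a2: "a2 t < \<infinity>"
      and q: "AE x in torus.
      st t x + transport (v t) (w t) (s t) x + div_h (v t) x + wpd 3 (w t) x = 0 \<and>
      (\<forall>j. vt t x $ j + transport (v t) (w t) (\<lambda>y. v t y $ j) x + wpd (hidx j) (s t) x = laplacian (\<lambda>y. v t y $ j) x) \<and>
      \<epsilon>\<^sup>2 * (wt t x + transport (v t) (w t) (w t) x) + wpd 3 (s t) x = \<epsilon>\<^sup>2 * laplacian (w t) x"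
    "AE x in torus.
      spt t x + transport (vp t) (wp t) (sp t) x + div_h (vp t) x + wpd 3 (wp t) x = 0 \<and>
      (\<forall>j. vpt t x $ j + transport (vp t) (wp t) (\<lambda>y. vp t y $ j) x + wpd (hidx j) (sp t) x = laplacian (\<lambda>y. vp t y $ j) x) \<and>
      wpd 3 (sp t) x = 0"
    have tS: "t \<in> {0..Ts}" using t T by auto
    have sob: "sob 4 (a t) (\<lambda>x. vp t x $ j)" for j
    proof (rule sobsq_sob)
      show "L2 (\<lambda>x. vp t x $ j)" by (rule in_CH_L2[OF CH(4) tS])
      have "sobsq 4 (\<lambda>x. vp t x $ j) \<le> a2 t"
        unfolding a2_def by (rule member_le_sum) auto
      also have "\<dots> = ennreal ((a t)\<^sup>2)" using a2 by (simp add: a_def)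
      finally show "sobsq 4 (\<lambda>x. vp t x $ j) \<le> ennreal ((a t)\<^sup>2)" .
    qed (simp add: a_def)
    have sym: "periodic_sym (s t) (v t) (w t)" "periodic_sym (sp t) (vp t) (wp t)"
      using cf cp tS by (auto simp: cf_solution_def cpe_solution_def)
    show "slice_at t"
      by (rule time_slice.intro) (use eps X e l sym sob q in \<open>simp_all add: a_def\<close>)
  qed
qed

lemma product_bounds: "AE t in time T. L2 (\<lambda>x. st t x - spt t x) \<and>
    nrm torus (\<lambda>x. s t x - sp t x) * nrm torus (\<lambda>x. st t x - spt t x) \<le> 2 * X * (X + 20 * (400 * X)\<^sup>2)"
  "AE t in time T. L2 (\<lambda>x. vt t x $ j - vpt t x $ j) \<and>
    nrm torus (\<lambda>x. v t x $ j - vp t x $ j) * nrm torus (\<lambda>x. vt t x $ j - vpt t x $ j) \<le> 2 * X * (X + 20 * (400 * X)\<^sup>2)"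
proof -
  show "AE t in time T. L2 (\<lambda>x. st t x - spt t x) \<and>
    nrm torus (\<lambda>x. s t x - sp t x) * nrm torus (\<lambda>x. st t x - spt t x) \<le> 2 * X * (X + 20 * (400 * X)\<^sup>2)"
    using slice
  proof eventually_elim
    fix t assume "slice_at t"
    from time_slice.L2_differences(1)[OF this] time_slice.nrm_products(1)[OF this, unfolded time_slice.c_def[OF this]]
    show "L2 (\<lambda>x. st t x - spt t x) \<and>
      nrm torus (\<lambda>x. s t x - sp t x) * nrm torus (\<lambda>x. st t x - spt t x) \<le> 2 * X * (X + 20 * (400 * X)\<^sup>2)" ..
  qed
  show "AE t in time T. L2 (\<lambda>x. vt t x $ j - vpt t x $ j) \<and>
    nrm torus (\<lambda>x. v t x $ j - vp t x $ j) * nrm torus (\<lambda>x. vt t x $ j - vpt t x $ j) \<le> 2 * X * (X + 20 * (400 * X)\<^sup>2)"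
    using slice
  proof eventually_elim
    fix t assume "slice_at t"
    from time_slice.L2_differences(2)[OF this] time_slice.nrm_products(2)[OF this, unfolded time_slice.c_def[OF this]]
    show "L2 (\<lambda>x. vt t x $ j - vpt t x $ j) \<and>
      nrm torus (\<lambda>x. v t x $ j - vp t x $ j) * nrm torus (\<lambda>x. vt t x $ j - vpt t x $ j) \<le> 2 * X * (X + 20 * (400 * X)\<^sup>2)" ..
  qed
qed

lemma energy_estimate: "AE t in time T. Q t \<le> - D t / 2 + Cc X * ((1 + a t) * Y t + \<epsilon>\<^sup>2)"
  using slice
proof eventually_elim
  fix t assume "slice_at t"
  from time_slice.energy_estimate[OF this, unfolded time_slice.c_def[OF this]]
  show "Q t \<le> - D t / 2 + Cc X * ((1 + a t) * Y t + \<epsilon>\<^sup>2)"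
    unfolding Q_def D_def Y_def Cc_def .
qed

lemma Y_identity:
  assumes t: "0 \<le> t" "t < T"
  shows "Y t = Y 0 + 2 * (\<integral>s. Q s \<partial>time t)" and "integrable (time t) Q"
proof -
  note S = energy_identity_diff[OF CH(1,3) time_deriv(1,3) T(2) product_bounds(1) t]
  note V = energy_identity_diff[OF CH(2,4) time_deriv(2,4) T(2) product_bounds(2) t]
  have Q: "Q = (\<lambda>t. ip torus (\<lambda>x. s t x - sp t x) (\<lambda>x. st t x - spt t x)
    + (\<Sum>j\<in>UNIV. ip torus (\<lambda>x. v t x $ j - vp t x $ j) (\<lambda>x. vt t x $ j - vpt t x $ j)))"
    by (simp add: Q_def fun_eq_iff)
  have Vi: "integrable (time t) (\<lambda>s. \<Sum>j\<in>UNIV. ip torus (\<lambda>x. v s x $ j - vp s x $ j) (\<lambda>x. vt s x $ j - vpt s x $ j))"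
    by (intro Bochner_Integration.integrable_sum V(2))
  show "integrable (time t) Q" unfolding Q by (rule Bochner_Integration.integrable_add[OF S(2) Vi])
  have "(\<integral>s. Q s \<partial>time t) = (\<integral>r. ip torus (\<lambda>x. s r x - sp r x) (\<lambda>x. st r x - spt r x) \<partial>time t)
    + (\<Sum>j\<in>UNIV. \<integral>r. ip torus (\<lambda>x. v r x $ j - vp r x $ j) (\<lambda>x. vt r x $ j - vpt r x $ j) \<partial>time t)"
    unfolding Q by (subst Bochner_Integration.integral_add[OF S(2) Vi], subst Bochner_Integration.integral_sum[OF V(2)], rule refl)
  from this[unfolded sum_UNIV_2] show "Y t = Y 0 + 2 * (\<integral>s. Q s \<partial>time t)"
    unfolding Y_def Y2_def sum_UNIV_2 using S(1) V(1)[of 1] V(1)[of 2] by linarith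
qed

lemma Y_nonneg: "0 \<le> Y t" and D_nonneg: "0 \<le> D t"
  by (auto simp: Y_def Y2_def D_def D2_def intro!: sum_nonneg add_nonneg_nonneg)

lemma Y_continuous: "continuous_on {0..<T} Y"
proof (rule continuous_on_halfopen)
  fix t assume t: "0 \<le> t" "t < T"
  have "continuous_on {0..t} (\<lambda>r. Y 0 + 2 * (\<integral>s. Q s \<partial>time r))"
    by (intro continuous_intros time_indefinite_continuous Y_identity t)
  then show "continuous_on {0..t} Y"
    by (rule continuous_on_eq) (rule Y_identity(1)[symmetric], use t in auto)
qed

lemma Y0: "Y 0 \<le> K\<^sup>2 * \<epsilon>\<^sup>2"
proof -
  let ?fs = "(\<lambda>x. s0 x - sp 0 x) # comps (\<lambda>x. v0 x - vp 0 x)"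
  have L: "L2 f" if "f \<in> set ?fs" for f
    by (rule Hnorm_L2[OF le_less_trans[OF init] that]) simp
  have l0: "L2 (\<lambda>x. s0 x - sp 0 x)" by (rule L) simp
  have lj: "L2 (\<lambda>x. v0 x $ j - vp 0 x $ j)" for j
    by (rule L) (use exhaust_2[of j] in \<open>auto simp: comps_def\<close>)
  have "(\<Sum>f\<leftarrow>?fs. nsq torus f) \<le> (K * \<epsilon>)\<^sup>2"
  proof (rule sqrt_le_D)
    show "sqrt (\<Sum>f\<leftarrow>?fs. nsq torus f) \<le> K * \<epsilon>"
    proof -
      have eq: "L2norm ?fs = ennreal (sqrt (\<Sum>f\<leftarrow>?fs. nsq torus f))" by (rule L2norm_eq[OF L])
      have "ennreal (sqrt (\<Sum>f\<leftarrow>?fs. nsq torus f)) \<le> ennreal (K * \<epsilon>)" using init unfolding eq .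
      then show ?thesis using K eps by (subst (asm) ennreal_le_iff) auto
    qed
  qed
  moreover have at0: "AE x in torus. s 0 x = s0 x \<and> v 0 x = v0 x \<and> w 0 x = w0 x"
    using cf by (simp add: cf_solution_def)
  have t0: "0 \<in> {0..Ts}" using T by auto
  have "nsq torus (\<lambda>x. s 0 x - sp 0 x) = nsq torus (\<lambda>x. s0 x - sp 0 x)"
    using at0 sqi_meas[OF l0] sqi_meas[OF in_CH_L2[OF CH(1) t0]] sqi_meas[OF in_CH_L2[OF CH(3) t0]]
    by (intro nsq_cong_AE) auto
  moreover have "nsq torus (\<lambda>x. v 0 x $ j - vp 0 x $ j) = nsq torus (\<lambda>x. v0 x $ j - vp 0 x $ j)" for j
    using at0 sqi_meas[OF lj[of j]] sqi_meas[OF in_CH_L2[OF CH(2)[of j] t0]] sqi_meas[OF in_CH_L2[OF CH(4)[of j] t0]]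
    by (intro nsq_cong_AE) auto
  ultimately show ?thesis
    by (simp add: Y_def Y2_def sum_UNIV_2 comps_def power_mult_distrib)
qed

section \<open>Gronwall's inequality for density and horizontal velocity\<close>

definition "b t = 2 * Cc X * (1 + a t)"

lemma Cc_pos: "0 < Cc X" and Bc_pos: "0 < Bc T X" and Gc_nonneg: "0 \<le> Gc T X K" and Hc_nonneg: "0 \<le> Hc T X K"
  using constants_nonneg[OF less_imp_le[OF T(1)] X] by auto

lemma b_sqi: "sqi (time T) b" "nsq (time T) b \<le> Bc T X"
proof -
  interpret finite_measure "time T" by (rule finite_measure_time)
  have one: "sqi (time T) (\<lambda>t. 1)" by (simp add: sqi_def)
  have b: "b = (\<lambda>t. 2 * Cc X * (1 + a t))" by (simp add: b_def fun_eq_iff)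
  show s: "sqi (time T) b" unfolding b by (intro sqi_cmult sqi_add one a_sqi)
  have "nsq (time T) b = (\<integral>t. (b t)\<^sup>2 \<partial>time T)" by (simp add: nsq_def)
  also have "\<dots> \<le> (\<integral>t. 8 * (Cc X)\<^sup>2 * (1 + (a t)\<^sup>2) \<partial>time T)"
  proof (rule integral_mono)
    show "integrable (time T) (\<lambda>t. (b t)\<^sup>2)" by (rule sqi_int[OF s])
    show "integrable (time T) (\<lambda>t. 8 * (Cc X)\<^sup>2 * (1 + (a t)\<^sup>2))"
      by (intro integrable_mult_right Bochner_Integration.integrable_add sqi_int[OF a_sqi(1)]) simp
    fix t
    have "(1 + a t)\<^sup>2 \<le> 2 * (1 + (a t)\<^sup>2)" using sum_squares_bound[of 1 "a t"] by (simp add: power2_sum)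
    then have "4 * (Cc X)\<^sup>2 * (1 + a t)\<^sup>2 \<le> 4 * (Cc X)\<^sup>2 * (2 * (1 + (a t)\<^sup>2))" by (rule mult_left_mono) simp
    moreover have "(b t)\<^sup>2 = 4 * (Cc X)\<^sup>2 * (1 + a t)\<^sup>2" by (simp add: b_def power_mult_distrib)
    ultimately show "(b t)\<^sup>2 \<le> 8 * (Cc X)\<^sup>2 * (1 + (a t)\<^sup>2)" by linarith
  qed
  also have "\<dots> = 8 * (Cc X)\<^sup>2 * (T + nsq (time T) a)"
    using T sqi_int[OF a_sqi(1)] measure_time[of T] by (simp add: nsq_def Bochner_Integration.integral_add)
  also have "\<dots> \<le> 8 * (Cc X)\<^sup>2 * (T + (96 * X)\<^sup>2)"
    using a_sqi(2) by (intro mult_left_mono) auto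
  finally show "nsq (time T) b \<le> Bc T X" by (simp add: Bc_def)
qed

lemma b_integrable: "integrable (time T) b"
  by (rule sqi_integrable[OF finite_measure_time b_sqi(1)])

lemma b_nonneg: "0 \<le> b t" using Cc_pos by (simp add: b_def a_def)

lemma bY_integrable: "0 \<le> t \<Longrightarrow> t < T \<Longrightarrow> integrable (time t) (\<lambda>s. b s * Y s)"
proof -
  assume t: "0 \<le> t" "t < T"
  have "integrable (time t) (\<lambda>s. Y s * b s)"
    by (rule time_integrable_mult_continuous[OF time_integrable_mono[OF b_integrable] continuous_on_subset[OF Y_continuous]])
      (use t in auto)
  then show ?thesis by (simp add: mult.commute)
qed

text \<open>Solved for \<open>D\<close>, the estimate serves twice: bounding \<open>D\<close> below
  by 0 gives the inequality for \<open>Y\<close> in \<open>Y_bound\<close>, and once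
  \<open>Y\<close> is bounded it gives the time integral of \<open>D\<close>.\<close>

lemma energy_balance: "AE t in time T. D t \<le> - 2 * Q t + (b t * Y t + 2 * Cc X * \<epsilon>\<^sup>2)"
  using energy_estimate by eventually_elim (simp add: b_def algebra_simps)

lemma balance_integral:
  assumes t: "0 \<le> t" "t < T"
  shows "integrable (time t) (\<lambda>s. - 2 * Q s + (b s * Y s + 2 * Cc X * \<epsilon>\<^sup>2))"
    "(\<integral>s. - 2 * Q s + (b s * Y s + 2 * Cc X * \<epsilon>\<^sup>2) \<partial>time t) = Y 0 - Y t + (\<integral>s. b s * Y s \<partial>time t) + 2 * Cc X * \<epsilon>\<^sup>2 * t"
proof -
  interpret finite_measure "time t" by (rule finite_measure_time)
  have q: "integrable (time t) (\<lambda>s. - 2 * Q s)" by (rule integrable_mult_right[OF Y_identity(2)[OF t]])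
  have c: "integrable (time t) (\<lambda>s. 2 * Cc X * \<epsilon>\<^sup>2)" by (rule integrable_const)
  note i = Bochner_Integration.integrable_add[OF bY_integrable[OF t] c]
  show "integrable (time t) (\<lambda>s. - 2 * Q s + (b s * Y s + 2 * Cc X * \<epsilon>\<^sup>2))"
    by (rule Bochner_Integration.integrable_add[OF q i])
  have "(\<integral>s. - 2 * Q s + (b s * Y s + 2 * Cc X * \<epsilon>\<^sup>2) \<partial>time t) = (\<integral>s. - 2 * Q s \<partial>time t) + ((\<integral>s. b s * Y s \<partial>time t) + 2 * Cc X * \<epsilon>\<^sup>2 * t)"
    unfolding Bochner_Integration.integral_add[OF q i] Bochner_Integration.integral_add[OF bY_integrable[OF t] c]
    using measure_time[OF t(1)] by simp
  then show "(\<integral>s. - 2 * Q s + (b s * Y s + 2 * Cc X * \<epsilon>\<^sup>2) \<partial>time t) = Y 0 - Y t + (\<integral>s. b s * Y s \<partial>time t) + 2 * Cc X * \<epsilon>\<^sup>2 * t"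
    using Y_identity(1)[OF t] by simp
qed

lemma balance_bound:
  assumes t: "0 \<le> t" "t < T"
  shows "Y 0 + 2 * Cc X * \<epsilon>\<^sup>2 * t \<le> (K\<^sup>2 + 2 * Cc X * T) * \<epsilon>\<^sup>2"
proof -
  have "2 * Cc X * \<epsilon>\<^sup>2 * t \<le> 2 * Cc X * \<epsilon>\<^sup>2 * T" using t Cc_pos by (intro mult_left_mono) auto
  then show ?thesis using Y0 by (simp add: algebra_simps)
qed

lemma Y_bound:
  assumes t: "0 \<le> t" "t < T"
  shows "Y t \<le> Gc T X K * \<epsilon>\<^sup>2"
proof -
  let ?A = "(K\<^sup>2 + 2 * Cc X * T) * \<epsilon>\<^sup>2"
  have le: "Y t \<le> ?A + (\<integral>s. b s * Y s \<partial>time t)" if t: "0 \<le> t" "t < T" for t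
  proof -
    have "0 \<le> (\<integral>s. - 2 * Q s + (b s * Y s + 2 * Cc X * \<epsilon>\<^sup>2) \<partial>time t)"
      by (rule integral_nonneg_AE, rule eventually_mono[OF AE_time_mono[OF energy_balance less_imp_le[OF t(2)]]], rule order_trans[OF D_nonneg])
    then show ?thesis using balance_integral(2)[OF t] balance_bound[OF t] by linarith
  qed
  have A0: "0 \<le> ?A" using Cc_pos T by (intro mult_nonneg_nonneg add_nonneg_nonneg) auto
  have "Y t \<le> 2 * ?A * exp (Bc T X * T)"
    by (rule exp_quadratic_le[OF A0 gronwall_L2[OF b_sqi Bc_pos Y_continuous Y_nonneg le t]])
  then show ?thesis by (simp add: Gc_def algebra_simps)
qed

text \<open>\<open>D\<close> contains derivatives chosen separately at each time. By Parseval's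
  identity it is, at almost every time, a limit of finite sums built from coefficients that are
  continuous in time.\<close>

lemma D_measurable: "D \<in> borel_measurable (time T)"
proof (rule borel_measurable_lim_AE[OF complete_time])
  let ?V = "\<lambda>j t k. fc (\<lambda>x. v t x $ j) k - fc (\<lambda>x. vp t x $ j) k"
  let ?f = "\<lambda>N t. \<Sum>j\<in>UNIV. \<Sum>i\<in>UNIV. (\<Sum>k\<in>KB N. (norm (- mu k i * ?V j t k))\<^sup>2) / 8"
  show "?f N \<in> borel_measurable (time T)" for N
    using modes_measurable[OF CH(2)] modes_measurable[OF CH(4)] by measurable
  show "AE t in time T. (\<lambda>N. ?f N t) \<longlonglongrightarrow> D t"
    using slice
  proof eventually_elim
    fix t assume ts: "slice_at t"
    interpret TS: time_slice \<epsilon> X "a t" "s t" "st t" "stt t" "w t" "wt t" "sp t" "spt t" "wp t" "v t" "vt t" "vp t" "vpt t" by (rule ts)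
    have "(\<lambda>N. (\<Sum>k\<in>KB N. (norm (- mu k i * ?V j t k))\<^sup>2) / 8)
        \<longlonglongrightarrow> nsq torus (\<lambda>x. wpd i (\<lambda>y. v t y $ j) x - wpd i (\<lambda>y. vp t y $ j) x)" for i j
    proof -
      have "fc (\<lambda>x. wpd i (\<lambda>y. v t y $ j) x - wpd i (\<lambda>y. vp t y $ j) x) k = - mu k i * ?V j t k" for k
        using TS.fd_differences(2)[of i j] by (simp add: fd_def fc_diff L2_integrable TS.L2s)
      then show ?thesis
        using tendsto_divide[OF Parseval[OF TS.L2_differences(7)[of i j]] tendsto_const, of 8] by simp
    qed
    then show "(\<lambda>N. ?f N t) \<longlonglongrightarrow> D t"
      unfolding D_def D2_def by (intro tendsto_sum)
  qed
qed

lemma D_integral: "(\<integral>\<^sup>+t. ennreal (D t) \<partial>time T) \<le> ennreal (Hc T X K * \<epsilon>\<^sup>2)"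
proof (rule nn_integral_time_le[OF measurable_compose[OF D_measurable measurable_ennreal] T(1)])
  fix t assume t: "0 \<le> t" "t < T"
  interpret finite_measure "time t" by (rule finite_measure_time)
  let ?R = "\<lambda>s. - 2 * Q s + (b s * Y s + 2 * Cc X * \<epsilon>\<^sup>2)"
  have bal: "AE s in time t. D s \<le> ?R s" by (rule AE_time_mono[OF energy_balance]) (use t in simp)
  have "(\<integral>\<^sup>+s. ennreal (D s) \<partial>time t) \<le> (\<integral>\<^sup>+s. ennreal (?R s) \<partial>time t)"
    by (rule nn_integral_mono_AE) (use bal in eventually_elim, rule ennreal_leI)
  also have "\<dots> = ennreal (\<integral>s. ?R s \<partial>time t)"
    by (rule nn_integral_eq_integral[OF balance_integral(1)[OF t]])
      (use bal in eventually_elim, use D_nonneg order_trans in blast)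
  also have "\<dots> \<le> ennreal (Hc T X K * \<epsilon>\<^sup>2)"
  proof (rule ennreal_leI)
    have bt: "integrable (time t) b" "sqi (time T) b" using time_integrable_mono[OF b_integrable] t b_sqi by auto
    have "(\<integral>s. b s * Y s \<partial>time t) \<le> (\<integral>s. b s * (Gc T X K * \<epsilon>\<^sup>2) \<partial>time t)"
      by (rule integral_mono[OF bY_integrable[OF t] integrable_mult_left[OF bt(1)]])
        (use t Y_bound b_nonneg in \<open>auto intro: mult_left_mono\<close>)
    also have "\<dots> = (\<integral>s. b s \<partial>time t) * (Gc T X K * \<epsilon>\<^sup>2)" by simp
    also have "\<dots> \<le> (T + Bc T X) * (Gc T X K * \<epsilon>\<^sup>2)"
    proof (rule mult_right_mono)
      have bsq: "integrable (time t) (\<lambda>s. (b s)\<^sup>2)" by (rule time_integrable_mono[OF sqi_int[OF bt(2)]]) (use t in simp)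
      \<comment> \<open>Since \<open>Bc\<close> controls the integral of the square of
        \<open>b\<close>, this elementary bound produces the factor \<open>T + Bc T X\<close> in
        \<open>Hc\<close>.\<close>
      have "(\<integral>s. b s \<partial>time t) \<le> (\<integral>s. 1 + (b s)\<^sup>2 \<partial>time t)"
      proof (rule integral_mono[OF bt(1)])
        show "integrable (time t) (\<lambda>s. 1 + (b s)\<^sup>2)" by (intro Bochner_Integration.integrable_add bsq) simp
        show "b s \<le> 1 + (b s)\<^sup>2" for s using sum_squares_bound[of 1 "b s"] b_nonneg[of s] by simp
      qed
      also have "\<dots> = t + (\<integral>s. (b s)\<^sup>2 \<partial>time t)"
        using measure_time[OF t(1)] by (subst Bochner_Integration.integral_add[OF _ bsq]) auto
      also have "(\<integral>s. (b s)\<^sup>2 \<partial>time t) \<le> nsq (time T) b"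
        unfolding nsq_def time_integral_indicator[OF less_imp_le[OF t(2)]]
      proof (rule integral_mono)
        show "integrable (time T) (\<lambda>s. (b s)\<^sup>2)" by (rule sqi_int[OF bt(2)])
        have "(\<lambda>s. indicator {0<..<t} s :: real) \<in> borel_measurable (time T)"
          unfolding time_def by (intro measurable_restrict_space1 measurable_completion) simp
        then show "integrable (time T) (\<lambda>s. indicator {0<..<t} s * (b s)\<^sup>2)"
          using sqi_int[OF bt(2)] sqi_meas[OF bt(2)]
          by (intro Bochner_Integration.integrable_bound[OF sqi_int[OF bt(2)]]) (auto simp: indicator_def)
      qed (auto simp: indicator_def)
      finally show "(\<integral>s. b s \<partial>time t) \<le> T + Bc T X" using b_sqi(2) t by linarith
      show "0 \<le> Gc T X K * \<epsilon>\<^sup>2" using Y_bound[of 0] Y_nonneg[of 0] T by linarith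
    qed
    finally have "(\<integral>s. b s * Y s \<partial>time t) \<le> (T + Bc T X) * (Gc T X K * \<epsilon>\<^sup>2)" .
    moreover have "Hc T X K * \<epsilon>\<^sup>2 = (K\<^sup>2 + 2 * Cc X * T) * \<epsilon>\<^sup>2 + (T + Bc T X) * (Gc T X K * \<epsilon>\<^sup>2)"
      by (simp add: Hc_def algebra_simps)
    ultimately show "(\<integral>s. ?R s \<partial>time t) \<le> Hc T X K * \<epsilon>\<^sup>2"
      unfolding balance_integral(2)[OF t] using balance_bound[OF t] Y_nonneg[of t] by linarith
  qed
  finally show "(\<integral>\<^sup>+s. ennreal (D s) \<partial>time t) \<le> ennreal (Hc T X K * \<epsilon>\<^sup>2)" .
qed

lemma difference_L2norm:
  assumes t: "t \<in> {0<..<T}"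
  shows "L2norm ((\<lambda>x. s t x - sp t x) # comps (\<lambda>x. v t x - vp t x)) = ennreal (sqrt (Y t))"
proof -
  have tS: "t \<in> {0..Ts}" using t T by auto
  have "L2 (\<lambda>x. s t x - sp t x)" "L2 (\<lambda>x. v t x $ j - vp t x $ j)" for j
    by (intro sqi_diff in_CH_L2[OF _ tS] CH)+
  then show ?thesis
    by (subst L2norm_eq) (auto simp: comps_def Y_def Y2_def sum_UNIV_2)
qed

lemma density_velocity_Linf:
  "Linf_time T (\<lambda>t. L2norm ((\<lambda>x. s t x - sp t x) # comps (\<lambda>x. v t x - vp t x))) \<le> ennreal (sqrt (Gc T X K) * \<epsilon>)"
  unfolding Linf_time_def
proof (rule esssup_I)
  \<comment> \<open>\<open>esssup_I\<close> asks for measurability of the norm in time. The norm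
    equals \<open>sqrt (Y t)\<close> at every time of the open interval, and \<open>Y\<close> is
    continuous there.\<close>
  have "(\<lambda>t. ennreal (sqrt (Y t))) \<in> borel_measurable (time T)"
    by (rule measurable_compose[OF continuous_time_measurable measurable_ennreal], rule continuous_on_real_sqrt,
        rule continuous_on_subset[OF Y_continuous]) auto
  then show "(\<lambda>t. L2norm ((\<lambda>x. s t x - sp t x) # comps (\<lambda>x. v t x - vp t x))) \<in> borel_measurable (time T)"
    by (subst measurable_cong[where g="\<lambda>t. ennreal (sqrt (Y t))"]) (use difference_L2norm in auto)
  show "AE t in time T. L2norm ((\<lambda>x. s t x - sp t x) # comps (\<lambda>x. v t x - vp t x)) \<le> ennreal (sqrt (Gc T X K) * \<epsilon>)"
    using AE_space
  proof eventually_elim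
    fix t assume t: "t \<in> space (time T)"
    then have "sqrt (Y t) \<le> sqrt (Gc T X K * \<epsilon>\<^sup>2)" using Y_bound[of t] by simp
    then show "L2norm ((\<lambda>x. s t x - sp t x) # comps (\<lambda>x. v t x - vp t x)) \<le> ennreal (sqrt (Gc T X K) * \<epsilon>)"
      using t eps by (subst difference_L2norm) (auto simp: real_sqrt_mult intro: ennreal_leI)
  qed
qed

lemma velocity_L2H1:
  "L2_time T (\<lambda>t. Hnorm 1 (comps (\<lambda>x. v t x - vp t x))) \<le> ennreal (sqrt (T * Gc T X K + Hc T X K) * \<epsilon>)"
  unfolding L2_time_def
proof (rule ennreal_sqrt_leI)
  have Ym: "(\<lambda>t. ennreal (Y t)) \<in> borel_measurable (time T)"
    by (rule measurable_compose[OF continuous_time_measurable measurable_ennreal],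
        rule continuous_on_subset[OF Y_continuous]) auto
  have "(\<integral>\<^sup>+t. (Hnorm 1 (comps (\<lambda>x. v t x - vp t x)))\<^sup>2 \<partial>time T) \<le> (\<integral>\<^sup>+t. ennreal (Y t) + ennreal (D t) \<partial>time T)"
  proof (rule nn_integral_mono_AE)
    show "AE t in time T. (Hnorm 1 (comps (\<lambda>x. v t x - vp t x)))\<^sup>2 \<le> ennreal (Y t) + ennreal (D t)"
      using slice
    proof eventually_elim
      fix t assume ts: "slice_at t"
      interpret TS: time_slice \<epsilon> X "a t" "s t" "st t" "stt t" "w t" "wt t" "sp t" "spt t" "wp t" "v t" "vt t" "vp t" "vpt t" by (rule ts)
      let ?h = "\<lambda>j. nsq torus (\<lambda>x. v t x $ j - vp t x $ j) + (\<Sum>i\<in>UNIV. nsq torus (\<lambda>x. wpd i (\<lambda>y. v t y $ j) x - wpd i (\<lambda>y. vp t y $ j) x))"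
      have "Hsq 1 (\<lambda>x. v t x $ j - vp t x $ j) = ennreal (?h j)" for j
        by (rule Hsq1_diff[OF TS.Hsq_finite_1])
      then have "(Hnorm 1 (comps (\<lambda>x. v t x - vp t x)))\<^sup>2 = ennreal (?h 1) + ennreal (?h 2)"
        by (simp add: Hnorm_sq comps_def)
      also have "\<dots> = ennreal (?h 1 + ?h 2)" by (rule ennreal_plus[symmetric]) (auto intro!: add_nonneg_nonneg sum_nonneg)
      also have "\<dots> \<le> ennreal (Y t + D t)"
        by (rule ennreal_leI) (simp add: Y_def Y2_def D_def D2_def sum_UNIV_2)
      also have "\<dots> = ennreal (Y t) + ennreal (D t)" by (rule ennreal_plus[OF Y_nonneg D_nonneg])
      finally show "(Hnorm 1 (comps (\<lambda>x. v t x - vp t x)))\<^sup>2 \<le> ennreal (Y t) + ennreal (D t)" .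
    qed
  qed
  also have "\<dots> = (\<integral>\<^sup>+t. ennreal (Y t) \<partial>time T) + (\<integral>\<^sup>+t. ennreal (D t) \<partial>time T)"
    by (rule nn_integral_add[OF Ym measurable_compose[OF D_measurable measurable_ennreal]])
  also have "\<dots> \<le> ennreal (T * Gc T X K * \<epsilon>\<^sup>2) + ennreal (Hc T X K * \<epsilon>\<^sup>2)"
  proof (rule add_mono[OF _ D_integral])
    interpret finite_measure "time T" by (rule finite_measure_time)
    have "(\<integral>\<^sup>+t. ennreal (Y t) \<partial>time T) \<le> (\<integral>\<^sup>+t. ennreal (Gc T X K * \<epsilon>\<^sup>2) \<partial>time T)"
      by (rule nn_integral_mono, rule ennreal_leI, rule Y_bound) auto
    also have "\<dots> = ennreal (Gc T X K * \<epsilon>\<^sup>2) * ennreal T"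
      using T measure_time[of T] by (simp add: emeasure_eq_measure)
    also have "\<dots> = ennreal (T * Gc T X K * \<epsilon>\<^sup>2)"
      using T Gc_nonneg by (simp add: ennreal_mult'[symmetric] mult_ac)
    finally show "(\<integral>\<^sup>+t. ennreal (Y t) \<partial>time T) \<le> ennreal (T * Gc T X K * \<epsilon>\<^sup>2)" .
  qed
  also have "\<dots> = ennreal (T * Gc T X K * \<epsilon>\<^sup>2 + Hc T X K * \<epsilon>\<^sup>2)"
    by (rule ennreal_plus[symmetric]) (use T Gc_nonneg Hc_nonneg in auto)
  also have "T * Gc T X K * \<epsilon>\<^sup>2 + Hc T X K * \<epsilon>\<^sup>2 = (sqrt (T * Gc T X K + Hc T X K) * \<epsilon>)\<^sup>2"
    using T Gc_nonneg Hc_nonneg by (simp add: power_mult_distrib algebra_simps)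
  finally show "(\<integral>\<^sup>+t. (Hnorm 1 (comps (\<lambda>x. v t x - vp t x)))\<^sup>2 \<partial>time T) \<le> ennreal ((sqrt (T * Gc T X K + Hc T X K) * \<epsilon>)\<^sup>2)" .
qed (use eps T Gc_nonneg Hc_nonneg in simp)

end

section \<open>Rates for the vertical velocity\<close>

definition Gx :: "real \<Rightarrow> real \<Rightarrow> real \<Rightarrow> real" where "Gx T X K = Gc T X K + (384 * X)\<^sup>2"
text \<open>The coefficients of \<open>W_bound\<close> after inserting
  \<open>4 * sqrt (Gx T X K)\<close> for each horizontal derivative of \<open>S\<close>; the last 4
  is the factor of \<open>sqrt (D t)\<close>.\<close>

definition Wc :: "real \<Rightarrow> real \<Rightarrow> real \<Rightarrow> real" where
  "Wc T X K = 2 * (400 * X) + 16 * (400 * X) * sqrt (Gx T X K) + 4 * (400 * X) * sqrt (Gc T X K) + 14 * (400 * X) ^ 3 + 4"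

lemma Gx_Wc_nonneg:
  assumes "0 \<le> T" "1 \<le> X" shows "0 \<le> Gx T X K" "4 \<le> Wc T X K"
  using constants_nonneg[OF assms] assms by (auto simp: Gx_def Wc_def)

context solution_pair
begin

lemma T0: "0 \<le> T" using T by simp

lemma powr_identities:
  "\<epsilon> powr (-1/2) * \<epsilon>\<^sup>2 = (\<epsilon> powr (3/4))\<^sup>2" "1 / (\<epsilon> powr (-1/2)) ^ 3 = (\<epsilon> powr (3/4))\<^sup>2"
  "\<epsilon> powr (-2/3) * \<epsilon>\<^sup>2 = (\<epsilon> powr (2/3))\<^sup>2" "1 / (\<epsilon> powr (-2/3)) ^ 2 = (\<epsilon> powr (2/3))\<^sup>2"
  "\<epsilon> \<le> \<epsilon> powr (3/4)" "\<epsilon> powr (3/4) \<le> \<epsilon> powr (2/3)"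
proof -
  have p: "(\<epsilon> powr r) ^ n = \<epsilon> powr (r * real n)" for r n using eps by (simp add: powr_realpow[symmetric] powr_powr)
  have e2: "\<epsilon>\<^sup>2 = \<epsilon> powr 2" using eps by simp
  show "\<epsilon> powr (-1/2) * \<epsilon>\<^sup>2 = (\<epsilon> powr (3/4))\<^sup>2" "\<epsilon> powr (-2/3) * \<epsilon>\<^sup>2 = (\<epsilon> powr (2/3))\<^sup>2"
    unfolding p unfolding e2 by (simp_all flip: powr_add)
  show "1 / (\<epsilon> powr (-1/2)) ^ 3 = (\<epsilon> powr (3/4))\<^sup>2" "1 / (\<epsilon> powr (-2/3)) ^ 2 = (\<epsilon> powr (2/3))\<^sup>2"
    unfolding p by (simp_all add: powr_minus_divide[symmetric])
  show "\<epsilon> \<le> \<epsilon> powr (3/4)" using powr_mono'[of "3/4" 1 \<epsilon>] eps by simp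
  show "\<epsilon> powr (3/4) \<le> \<epsilon> powr (2/3)" using powr_mono'[of "2/3" "3/4" \<epsilon>] eps by simp
qed

text \<open>For a balanced \<open>l\<close> both summands have the order \<open>m\<^sup>2\<close>.
  \<open>Gx\<close> adds the constant of \<open>Y\<close> to the larger of the two Sobolev bounds,
  so that it serves both interpolations.\<close>

lemma interpolated_sum:
  assumes t: "t \<in> {0<..<T}" and l: "0 < l" "l * \<epsilon>\<^sup>2 = m\<^sup>2" "1 / l ^ n = m\<^sup>2" and B: "0 \<le> B" "B \<le> 384 * X"
  shows "l * Y t + B\<^sup>2 / l ^ n \<le> Gx T X K * m\<^sup>2"
proof -
  have "l * Y t \<le> l * (Gc T X K * \<epsilon>\<^sup>2)" using Y_bound[of t] t l by (intro mult_left_mono) auto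
  also have "\<dots> = Gc T X K * m\<^sup>2" using l(2) by (simp add: mult_ac)
  finally have "l * Y t \<le> Gc T X K * m\<^sup>2" .
  moreover have "B\<^sup>2 / l ^ n = B\<^sup>2 * m\<^sup>2" using l(3) by (simp add: divide_inverse)
  moreover have "B\<^sup>2 * m\<^sup>2 \<le> (384 * X)\<^sup>2 * m\<^sup>2" using B by (intro mult_right_mono power_mono) auto
  ultimately show ?thesis unfolding Gx_def by (simp only: distrib_right)
qed

text \<open>The interpolation parameters \<open>\<epsilon> powr (-1/2)\<close> (for \<open>S\<close> in \<open>H\<^sup>4\<close>) and \<open>\<epsilon> powr (-2/3)\<close> (for \<open>V\<close> in \<open>H\<^sup>3\<close>) balance
  the two terms in \<open>time_slice.gradient_interpolation\<close> when \<open>Y t\<close> is of order \<open>\<epsilon>\<^sup>2\<close>.\<close>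

lemma vertical_velocity:
  "AE t in time T. L2 (\<lambda>x. w t x - wp t x) \<and> sqrt (D t) \<le> 10 * sqrt (Gx T X K) * \<epsilon> powr (2/3) \<and>
    nrm torus (\<lambda>x. w t x - wp t x) \<le> Wc T X K * (\<epsilon> powr (3/4) + sqrt (D t))"
proof -
  have "AE t in time T. t \<in> {0<..<T}" using AE_space[of "time T"] by simp
  then show ?thesis
    using slice
  proof eventually_elim
    fix t assume t: "t \<in> {0<..<T}"
      and ts: "slice_at t"
    interpret TS: time_slice \<epsilon> X "a t" "s t" "st t" "stt t" "w t" "wt t" "sp t" "spt t" "wp t" "v t" "vt t" "vp t" "vpt t" by (rule ts)
    let ?c = "400 * X" and ?G = "Gx T X K" and ?p = "\<epsilon> powr (3/4)" and ?q = "\<epsilon> powr (2/3)"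
    note G = Gx_Wc_nonneg[OF T0 X, of K]
    have c: "0 \<le> ?c" using X by simp
    have n: "nrm torus (\<lambda>x. wpd i (s t) x - wpd i (sp t) x) \<le> 4 * sqrt ?G * ?p" for i
    proof -
      have "nsq torus (\<lambda>x. wpd i (s t) x - wpd i (sp t) x) \<le> 16 * (\<epsilon> powr (-1/2) * Y t + (384 * X)\<^sup>2 / (\<epsilon> powr (-1/2)) ^ 3)"
        unfolding Y_def by (rule TS.gradient_interpolation) (use eps in simp)
      also have "\<dots> \<le> 16 * (?G * ?p\<^sup>2)"
        by (intro mult_left_mono interpolated_sum[OF t] powr_identities) (use eps X in auto)
      also have "\<dots> = (4 * sqrt ?G * ?p)\<^sup>2" using G by (simp add: power_mult_distrib)
      finally show ?thesis unfolding nrm_def using G by (intro real_le_lsqrt) auto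
    qed
    have "D t \<le> 96 * (\<epsilon> powr (-2/3) * Y t + (192 * X)\<^sup>2 / (\<epsilon> powr (-2/3)) ^ 2)"
      unfolding Y_def D_def by (rule TS.gradient_interpolation) (use eps in simp)
    also have "\<dots> \<le> 96 * (?G * ?q\<^sup>2)"
      by (intro mult_left_mono interpolated_sum[OF t] powr_identities) (use eps X in auto)
    \<comment> \<open>96 is raised to 100 so that the bound is the square of a term with factor
      10.\<close>
    also have "\<dots> \<le> 100 * (?G * ?q\<^sup>2)" using G by (intro mult_right_mono) auto
    also have "\<dots> = (10 * sqrt ?G * ?q)\<^sup>2" using G by (simp add: power_mult_distrib)
    finally have D: "sqrt (D t) \<le> 10 * sqrt ?G * ?q" using G by (intro real_le_lsqrt) auto
    have y: "sqrt (Y t) \<le> sqrt (Gc T X K) * ?p"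
    proof -
      have "sqrt (Y t) \<le> sqrt (Gc T X K * \<epsilon>\<^sup>2)" using Y_bound[of t] t by simp
      also have "\<dots> = sqrt (Gc T X K) * \<epsilon>" using eps by (simp add: real_sqrt_mult)
      also have "\<dots> \<le> sqrt (Gc T X K) * ?p" using powr_identities(5) Gc_nonneg by (intro mult_left_mono) auto
      finally show ?thesis .
    qed
    have "nrm torus (\<lambda>x. w t x - wp t x) \<le> 2 * (?c * \<epsilon> + (?c * nrm torus (\<lambda>x. wpd 1 (s t) x - wpd 1 (sp t) x)
      + ?c * nrm torus (\<lambda>x. wpd 2 (s t) x - wpd 2 (sp t) x) + 2 * ?c * sqrt (Y t) + 7 * ?c ^ 3 * \<epsilon> + 2 * sqrt (D t)))"
      using TS.vertical_velocity_estimate unfolding TS.c_def Y_def D_def .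
    also have "\<dots> \<le> 2 * (?c * ?p + (?c * (4 * sqrt ?G * ?p) + ?c * (4 * sqrt ?G * ?p) + 2 * ?c * (sqrt (Gc T X K) * ?p) + 7 * ?c ^ 3 * ?p + 2 * sqrt (D t)))"
      using c by (intro mult_left_mono add_mono n y powr_identities order_refl) auto
    also have "\<dots> = (Wc T X K - 4) * ?p + 4 * sqrt (D t)" by (simp add: Wc_def algebra_simps)
    also have "\<dots> \<le> Wc T X K * ?p + Wc T X K * sqrt (D t)"
      using G D_nonneg[of t] by (intro add_mono mult_right_mono) auto
    finally show "L2 (\<lambda>x. w t x - wp t x) \<and> sqrt (D t) \<le> 10 * sqrt ?G * ?q \<and>
        nrm torus (\<lambda>x. w t x - wp t x) \<le> Wc T X K * (?p + sqrt (D t))"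
      using TS.L2_differences(5) D by (simp add: distrib_left)
  qed
qed

lemma vertical_velocity_Linf:
  "Linf_time T (\<lambda>t. L2norm [\<lambda>x. w t x - wp t x]) \<le> ennreal (Wc T X K * (1 + 10 * sqrt (Gx T X K)) * \<epsilon> powr (2/3))"
  unfolding Linf_time_def
proof (rule esssup_I)
  have "time_measurable T (\<lambda>t x. w t x - wp t x)"
    by (rule time_measurable_mono[OF time_measurable_diff T(2)])
      (use cf cp in \<open>auto simp: cf_solution_def cpe_solution_def in_L2H_def\<close>)
  from time_measurable_Hsq0(1)[OF this]
  show "(\<lambda>t. L2norm [\<lambda>x. w t x - wp t x]) \<in> borel_measurable (time T)"
    unfolding Hnorm_def by simp
  show "AE t in time T. L2norm [\<lambda>x. w t x - wp t x] \<le> ennreal (Wc T X K * (1 + 10 * sqrt (Gx T X K)) * \<epsilon> powr (2/3))"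
    using vertical_velocity
  proof eventually_elim
    fix t assume t: "L2 (\<lambda>x. w t x - wp t x) \<and> sqrt (D t) \<le> 10 * sqrt (Gx T X K) * \<epsilon> powr (2/3) \<and>
      nrm torus (\<lambda>x. w t x - wp t x) \<le> Wc T X K * (\<epsilon> powr (3/4) + sqrt (D t))"
    note t[THEN conjunct2, THEN conjunct2]
    also have "Wc T X K * (\<epsilon> powr (3/4) + sqrt (D t)) \<le> Wc T X K * (\<epsilon> powr (2/3) + 10 * sqrt (Gx T X K) * \<epsilon> powr (2/3))"
      using t powr_identities(6) Gx_Wc_nonneg[OF T0 X, of K] by (intro mult_left_mono add_mono) auto
    finally have "nrm torus (\<lambda>x. w t x - wp t x) \<le> Wc T X K * (1 + 10 * sqrt (Gx T X K)) * \<epsilon> powr (2/3)"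
      by (simp add: algebra_simps)
    then show "L2norm [\<lambda>x. w t x - wp t x] \<le> ennreal (Wc T X K * (1 + 10 * sqrt (Gx T X K)) * \<epsilon> powr (2/3))"
      using t by (subst L2norm_eq) (auto simp: nrm_def intro: ennreal_leI)
  qed
qed

text \<open>Integrated over time, \<open>D\<close> is of order \<open>\<epsilon>\<^sup>2\<close>,
  which is better than its bound at single times. The exponent 3/4 comes from the gradient of
  \<open>S\<close>.\<close>

lemma vertical_velocity_L2:
  "L2_time T (\<lambda>t. L2norm [\<lambda>x. w t x - wp t x]) \<le> ennreal (sqrt (2 * (Wc T X K)\<^sup>2 * (T + Hc T X K)) * \<epsilon> powr (3/4))"
  unfolding L2_time_def
proof (rule ennreal_sqrt_leI)
  interpret finite_measure "time T" by (rule finite_measure_time)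
  let ?W = "2 * (Wc T X K)\<^sup>2" and ?p = "\<epsilon> powr (3/4)"
  have Dm: "(\<lambda>t. ennreal (D t)) \<in> borel_measurable (time T)"
    by (rule measurable_compose[OF D_measurable measurable_ennreal])
  have "(\<integral>\<^sup>+t. (L2norm [\<lambda>x. w t x - wp t x])\<^sup>2 \<partial>time T) \<le> (\<integral>\<^sup>+t. ennreal ?W * (ennreal (?p\<^sup>2) + ennreal (D t)) \<partial>time T)"
  proof (rule nn_integral_mono_AE)
    show "AE t in time T. (L2norm [\<lambda>x. w t x - wp t x])\<^sup>2 \<le> ennreal ?W * (ennreal (?p\<^sup>2) + ennreal (D t))"
      using vertical_velocity
    proof eventually_elim
      fix t assume t: "L2 (\<lambda>x. w t x - wp t x) \<and> sqrt (D t) \<le> 10 * sqrt (Gx T X K) * \<epsilon> powr (2/3) \<and>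
        nrm torus (\<lambda>x. w t x - wp t x) \<le> Wc T X K * (?p + sqrt (D t))"
      have "(nrm torus (\<lambda>x. w t x - wp t x))\<^sup>2 \<le> (Wc T X K * (?p + sqrt (D t)))\<^sup>2"
        using t by (intro power_mono) auto
      also have "\<dots> = (Wc T X K)\<^sup>2 * (?p + sqrt (D t))\<^sup>2" by (rule power_mult_distrib)
      also have "\<dots> \<le> (Wc T X K)\<^sup>2 * (2 * (?p\<^sup>2 + D t))"
        using sum_squares_bound[of ?p "sqrt (D t)"] D_nonneg[of t] by (intro mult_left_mono) (auto simp: power2_sum)
      finally have "nsq torus (\<lambda>x. w t x - wp t x) \<le> ?W * (?p\<^sup>2 + D t)" by (simp add: mult.assoc mult.left_commute[of 2])
      then have "ennreal (nsq torus (\<lambda>x. w t x - wp t x)) \<le> ennreal (?W * (?p\<^sup>2 + D t))" by (rule ennreal_leI)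
      also have "\<dots> = ennreal ?W * (ennreal (?p\<^sup>2) + ennreal (D t))"
        using D_nonneg[of t] by (simp add: ennreal_mult)
      finally show "(L2norm [\<lambda>x. w t x - wp t x])\<^sup>2 \<le> ennreal ?W * (ennreal (?p\<^sup>2) + ennreal (D t))"
        using t by (simp add: Hnorm_sq Hsq_0 L2_integrable nn_integral_nsq)
    qed
  qed
  also have "\<dots> = ennreal ?W * ((\<integral>\<^sup>+t. ennreal (?p\<^sup>2) \<partial>time T) + (\<integral>\<^sup>+t. ennreal (D t) \<partial>time T))"
    using Dm by (subst nn_integral_cmult) (auto simp: nn_integral_add)
  also have "\<dots> \<le> ennreal ?W * (ennreal (T * ?p\<^sup>2) + ennreal (Hc T X K * ?p\<^sup>2))"
  proof (intro mult_left_mono add_mono)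
    show "(\<integral>\<^sup>+t. ennreal (?p\<^sup>2) \<partial>time T) \<le> ennreal (T * ?p\<^sup>2)"
      using T measure_time[of T] by (simp add: emeasure_eq_measure ennreal_mult mult.commute)
    have "\<epsilon>\<^sup>2 \<le> ?p\<^sup>2" using powr_identities(5) eps by (intro power_mono) auto
    then have "Hc T X K * \<epsilon>\<^sup>2 \<le> Hc T X K * ?p\<^sup>2" using Hc_nonneg by (intro mult_left_mono)
    then show "(\<integral>\<^sup>+t. ennreal (D t) \<partial>time T) \<le> ennreal (Hc T X K * ?p\<^sup>2)"
      using D_integral by (rule order_trans[OF _ ennreal_leI, rotated])
  qed simp
  also have "\<dots> = ennreal (?W * (T * ?p\<^sup>2 + Hc T X K * ?p\<^sup>2))"
    using T0 Hc_nonneg by (simp add: ennreal_mult)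
  also have "?W * (T * ?p\<^sup>2 + Hc T X K * ?p\<^sup>2) = (sqrt (?W * (T + Hc T X K)) * ?p)\<^sup>2"
    using T0 Hc_nonneg by (simp add: power_mult_distrib algebra_simps)
  finally show "(\<integral>\<^sup>+t. (L2norm [\<lambda>x. w t x - wp t x])\<^sup>2 \<partial>time T) \<le> ennreal ((sqrt (?W * (T + Hc T X K)) * ?p)\<^sup>2)" .
qed (use T0 Hc_nonneg in simp)

end

section \<open>Assembly of the constants\<close>

definition C2c :: "real \<Rightarrow> real \<Rightarrow> real \<Rightarrow> real" where
  "C2c T X K = 1 + (sqrt (Gc T X K) + sqrt (T * Gc T X K + Hc T X K)) + Wc T X K * (1 + 10 * sqrt (Gx T X K))
    + sqrt (2 * (Wc T X K)\<^sup>2 * (T + Hc T X K))"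

lemma C2c_ge:
  assumes "0 \<le> T" "1 \<le> X"
  shows "0 < C2c T X K" "sqrt (Gc T X K) + sqrt (T * Gc T X K + Hc T X K) \<le> C2c T X K"
    "Wc T X K * (1 + 10 * sqrt (Gx T X K)) \<le> C2c T X K" "sqrt (2 * (Wc T X K)\<^sup>2 * (T + Hc T X K)) \<le> C2c T X K"
proof -
  have "0 \<le> sqrt (Gc T X K)" "0 \<le> sqrt (T * Gc T X K + Hc T X K)" "0 \<le> Wc T X K * (1 + 10 * sqrt (Gx T X K))"
    "0 \<le> sqrt (2 * (Wc T X K)\<^sup>2 * (T + Hc T X K))"
    using constants_nonneg[OF assms] Gx_Wc_nonneg[OF assms, of K] assms by auto
  then show "0 < C2c T X K" "sqrt (Gc T X K) + sqrt (T * Gc T X K + Hc T X K) \<le> C2c T X K"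
    "Wc T X K * (1 + 10 * sqrt (Gx T X K)) \<le> C2c T X K" "sqrt (2 * (Wc T X K)\<^sup>2 * (T + Hc T X K)) \<le> C2c T X K"
    unfolding C2c_def by linarith+
qed

lemma (in solution_pair) error_estimates:
  "Linf_time T (\<lambda>t. L2norm ((\<lambda>x. s t x - sp t x) # comps (\<lambda>x. v t x - vp t x)))
     + L2_time T (\<lambda>t. Hnorm 1 (comps (\<lambda>x. v t x - vp t x))) \<le> ennreal (C2c T X K * \<epsilon>)"
  "Linf_time T (\<lambda>t. L2norm [\<lambda>x. w t x - wp t x]) \<le> ennreal (C2c T X K * \<epsilon> powr (2/3))"
  "L2_time T (\<lambda>t. L2norm [\<lambda>x. w t x - wp t x]) \<le> ennreal (C2c T X K * \<epsilon> powr (3/4))"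
proof -
  note C = C2c_ge[OF T0 X, of K]
  have "Linf_time T (\<lambda>t. L2norm ((\<lambda>x. s t x - sp t x) # comps (\<lambda>x. v t x - vp t x)))
     + L2_time T (\<lambda>t. Hnorm 1 (comps (\<lambda>x. v t x - vp t x)))
     \<le> ennreal (sqrt (Gc T X K) * \<epsilon>) + ennreal (sqrt (T * Gc T X K + Hc T X K) * \<epsilon>)"
    by (rule add_mono[OF density_velocity_Linf velocity_L2H1])
  also have "\<dots> = ennreal ((sqrt (Gc T X K) + sqrt (T * Gc T X K + Hc T X K)) * \<epsilon>)"
    unfolding distrib_right by (rule ennreal_plus[symmetric]) (use eps T0 Gc_nonneg Hc_nonneg in auto)
  also have "\<dots> \<le> ennreal (C2c T X K * \<epsilon>)"
    by (rule ennreal_leI, rule mult_right_mono[OF C(2)]) (use eps in simp)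
  finally show "Linf_time T (\<lambda>t. L2norm ((\<lambda>x. s t x - sp t x) # comps (\<lambda>x. v t x - vp t x)))
     + L2_time T (\<lambda>t. Hnorm 1 (comps (\<lambda>x. v t x - vp t x))) \<le> ennreal (C2c T X K * \<epsilon>)" .
  show "Linf_time T (\<lambda>t. L2norm [\<lambda>x. w t x - wp t x]) \<le> ennreal (C2c T X K * \<epsilon> powr (2/3))"
    by (rule order_trans[OF vertical_velocity_Linf], rule ennreal_leI, rule mult_right_mono[OF C(3)]) simp
  show "L2_time T (\<lambda>t. L2norm [\<lambda>x. w t x - wp t x]) \<le> ennreal (C2c T X K * \<epsilon> powr (3/4))"
    by (rule order_trans[OF vertical_velocity_L2], rule ennreal_leI, rule mult_right_mono[OF C(4)]) simp
qed

text \<open>The energies are bounded through their squares, so \<open>C\<close> has to be compared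
  with the square of the new bound; adding 1 and taking absolute values makes that bound at least 1
  and this comparison valid.\<close>

lemma solution_pairI:
  assumes eps: "\<epsilon> \<in> {0<..<1}" and K: "0 \<le> K" and T: "0 < T" "T \<le> Ts"
    and cf: "cf_solution \<epsilon> Ts s st v vt w wt s0 v0 w0"
    and cp: "cpe_solution Ts sp spt vp vpt wp"
    and E: "Linf_time T (\<lambda>t. (energy_E \<epsilon> (s t) (st t) (v t) (w t))\<^sup>2 + (energy_E1 \<epsilon> (st t) (stt t) (vt t) (wt t))\<^sup>2) + I < ennreal C"
    and P: "Linf_time T (\<lambda>t. Hnorm 4 [sp t]) + Linf_time T (\<lambda>t. Hnorm 2 [spt t]) + Linf_time T (\<lambda>t. Hnorm 3 (comps (vp t)))
      + L2_time T (\<lambda>t. Hnorm 4 (comps (vp t))) + Linf_time T (\<lambda>t. Hnorm 2 [wp t]) < ennreal Cp"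
    and init: "L2norm ((\<lambda>x. s0 x - sp 0 x) # comps (\<lambda>x. v0 x - vp 0 x)) \<le> ennreal (K * \<epsilon>)"
  shows "solution_pair \<epsilon> (1 + \<bar>C\<bar> + \<bar>Cp\<bar>) K T Ts s st stt w wt sp spt wp v vt vp vpt s0 w0 v0"
proof -
  let ?X = "1 + \<bar>C\<bar> + \<bar>Cp\<bar>"
  have "C \<le> 1 * ?X" by simp
  also have "\<dots> \<le> ?X * ?X" by (rule mult_right_mono) auto
  finally have "C \<le> ?X\<^sup>2" by (simp only: power2_eq_square)
  then have CX: "ennreal C \<le> ennreal (?X\<^sup>2)" by (rule ennreal_leI)
  have "Linf_time T (\<lambda>t. (energy_E \<epsilon> (s t) (st t) (v t) (w t))\<^sup>2 + (energy_E1 \<epsilon> (st t) (stt t) (vt t) (wt t))\<^sup>2) \<le> ennreal (?X\<^sup>2)"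
    by (rule order_trans[OF _ CX], rule order_trans[OF _ less_imp_le[OF E]]) simp
  note E' = Linf_time_AE[OF this]
  have CpX: "ennreal Cp \<le> ennreal ?X" by (rule ennreal_leI) simp
  note P' = order_trans[OF less_imp_le[OF P] CpX]
  note P5 = order_trans[OF _ P', of "Linf_time T (\<lambda>t. Hnorm 2 [wp t])"]
  note P4 = ennreal_sum4_le[OF order_trans[OF add_increasing2[OF zero_le order_refl] P']]
  show ?thesis
  proof
    show "0 < \<epsilon>" "\<epsilon> < 1" using eps by auto
    show "AE t in time T. energy_E \<epsilon> (s t) (st t) (v t) (w t) \<le> ennreal ?X"
      using E' by eventually_elim (rule power2_le_imp_le_ennreal, rule order_trans[rotated], assumption, simp_all)
    show "AE t in time T. energy_E1 \<epsilon> (st t) (stt t) (vt t) (wt t) \<le> ennreal ?X"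
      using E' by eventually_elim (rule power2_le_imp_le_ennreal, rule order_trans[rotated], assumption, simp_all)
    show "AE t in time T. Hnorm 4 [sp t] \<le> ennreal ?X" by (rule Linf_time_AE, rule P4(1))
    show "AE t in time T. Hnorm 2 [spt t] \<le> ennreal ?X" by (rule Linf_time_AE, rule P4(2))
    show "AE t in time T. Hnorm 3 (comps (vp t)) \<le> ennreal ?X" by (rule Linf_time_AE, rule P4(3))
    show "AE t in time T. Hnorm 2 [wp t] \<le> ennreal ?X" by (rule Linf_time_AE, rule P5) simp
    show "L2_time T (\<lambda>t. Hnorm 4 (comps (vp t))) \<le> ennreal ?X" by (rule P4(4))
  qed (use K T cf cp init in auto)
qed

theorem theorem2:
  fixes Ts Tss C0 C1 :: "real \<Rightarrow> real \<Rightarrow> real"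
  shows "\<exists>C2 :: real \<Rightarrow> real \<Rightarrow> real \<Rightarrow> real \<Rightarrow> real.
    \<forall>M M1 Cp K. 0 \<le> M \<and> 0 \<le> M1 \<and> 0 < Cp \<and> 0 \<le> K \<and> 0 < Tss M M1 \<and> Tss M M1 \<le> Ts M M1 \<longrightarrow>
      0 < C2 M M1 Cp K \<and>
      (\<forall>(s0 :: real \<Rightarrow> real^3 \<Rightarrow> real) (v0 :: real \<Rightarrow> real^3 \<Rightarrow> real^2) (w0 :: real \<Rightarrow> real^3 \<Rightarrow> real)
        (s :: real \<Rightarrow> real \<Rightarrow> real^3 \<Rightarrow> real) (st :: real \<Rightarrow> real \<Rightarrow> real^3 \<Rightarrow> real)
        (stt :: real \<Rightarrow> real \<Rightarrow> real^3 \<Rightarrow> real)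
        (v :: real \<Rightarrow> real \<Rightarrow> real^3 \<Rightarrow> real^2) (vt :: real \<Rightarrow> real \<Rightarrow> real^3 \<Rightarrow> real^2)
        (vtt :: real \<Rightarrow> real \<Rightarrow> real^3 \<Rightarrow> real^2)
        (w :: real \<Rightarrow> real \<Rightarrow> real^3 \<Rightarrow> real) (wt :: real \<Rightarrow> real \<Rightarrow> real^3 \<Rightarrow> real)
        (wtt :: real \<Rightarrow> real \<Rightarrow> real^3 \<Rightarrow> real)
        (sp :: real \<Rightarrow> real^3 \<Rightarrow> real) (spt :: real \<Rightarrow> real^3 \<Rightarrow> real)
        (vp :: real \<Rightarrow> real^3 \<Rightarrow> real^2) (vpt :: real \<Rightarrow> real^3 \<Rightarrow> real^2)
        (wp :: real \<Rightarrow> real^3 \<Rightarrow> real) (e :: nat \<Rightarrow> real).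
        (\<forall>\<epsilon>\<in>{0<..<1}.
           init_E \<epsilon> (s0 \<epsilon>) (v0 \<epsilon>) (w0 \<epsilon>) \<le> ennreal M \<and>
           init_E1 \<epsilon> (s0 \<epsilon>) (v0 \<epsilon>) (w0 \<epsilon>) \<le> ennreal M1 \<and>
           cf_solution \<epsilon> (Ts M M1) (s \<epsilon>) (st \<epsilon>) (v \<epsilon>) (vt \<epsilon>) (w \<epsilon>) (wt \<epsilon>) (s0 \<epsilon>) (v0 \<epsilon>) (w0 \<epsilon>) \<and>
           has_time_deriv (Tss M M1) (st \<epsilon>) (stt \<epsilon>) \<and>
           has_time_deriv_vec (Tss M M1) (vt \<epsilon>) (vtt \<epsilon>) \<and>
           has_time_deriv (Tss M M1) (wt \<epsilon>) (wtt \<epsilon>) \<and>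
           Linf_time (Ts M M1) (\<lambda>t. (energy_E \<epsilon> (s \<epsilon> t) (st \<epsilon> t) (v \<epsilon> t) (w \<epsilon> t))\<^sup>2)
             + (\<integral>\<^sup>+t. (dissip_D \<epsilon> (s \<epsilon> t) (st \<epsilon> t) (v \<epsilon> t) (vt \<epsilon> t) (w \<epsilon> t) (wt \<epsilon> t))\<^sup>2 \<partial>time (Ts M M1))
             < ennreal (C0 M M1) \<and>
           Linf_time (Tss M M1) (\<lambda>t. (energy_E \<epsilon> (s \<epsilon> t) (st \<epsilon> t) (v \<epsilon> t) (w \<epsilon> t))\<^sup>2
                + (energy_E1 \<epsilon> (st \<epsilon> t) (stt \<epsilon> t) (vt \<epsilon> t) (wt \<epsilon> t))\<^sup>2)
             + (\<integral>\<^sup>+t. (dissip_D \<epsilon> (s \<epsilon> t) (st \<epsilon> t) (v \<epsilon> t) (vt \<epsilon> t) (w \<epsilon> t) (wt \<epsilon> t))\<^sup>2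
                + (dissip_D1 \<epsilon> (st \<epsilon> t) (stt \<epsilon> t) (vt \<epsilon> t) (vtt \<epsilon> t) (wt \<epsilon> t) (wtt \<epsilon> t))\<^sup>2 \<partial>time (Tss M M1))
             < ennreal (C1 M M1)) \<and>
        cpe_solution (Ts M M1) sp spt vp vpt wp \<and>
        limit_along (Ts M M1) e s st v vt w sp spt vp vpt wp \<and>
        Linf_time (Tss M M1) (\<lambda>t. Hnorm 4 [sp t])
          + Linf_time (Tss M M1) (\<lambda>t. Hnorm 2 [spt t])
          + Linf_time (Tss M M1) (\<lambda>t. Hnorm 3 (comps (vp t)))
          + L2_time (Tss M M1) (\<lambda>t. Hnorm 4 (comps (vp t)))
          + Linf_time (Tss M M1) (\<lambda>t. Hnorm 2 [wp t]) < ennreal Cp \<and>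
        (\<forall>\<epsilon>\<in>{0<..<1}.
           L2norm ((\<lambda>x. s0 \<epsilon> x - sp 0 x) # comps (\<lambda>x. v0 \<epsilon> x - vp 0 x)) \<le> ennreal (K * \<epsilon>))
        \<longrightarrow>
        (\<forall>\<epsilon>\<in>{0<..<1}.
           Linf_time (Tss M M1)
               (\<lambda>t. L2norm ((\<lambda>x. s \<epsilon> t x - sp t x) # comps (\<lambda>x. v \<epsilon> t x - vp t x)))
             + L2_time (Tss M M1) (\<lambda>t. Hnorm 1 (comps (\<lambda>x. v \<epsilon> t x - vp t x)))
             \<le> ennreal (C2 M M1 Cp K * \<epsilon>) \<and>
           Linf_time (Tss M M1) (\<lambda>t. L2norm [\<lambda>x. w \<epsilon> t x - wp t x])
             \<le> ennreal (C2 M M1 Cp K * \<epsilon> powr (2/3)) \<and>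
           L2_time (Tss M M1) (\<lambda>t. L2norm [\<lambda>x. w \<epsilon> t x - wp t x])
             \<le> ennreal (C2 M M1 Cp K * \<epsilon> powr (3/4))))"
proof (rule exI[of _ "\<lambda>M M1 Cp K. C2c (Tss M M1) (1 + \<bar>C1 M M1\<bar> + \<bar>Cp\<bar>) K"], intro allI impI, rule conjI, goal_cases)
  case (1 M M1 Cp K)
  then show ?case by (intro C2c_ge) auto
next
  case par: (2 M M1 Cp K)
  show ?case
  proof (intro allI impI ballI, goal_cases)
    case (1 s0 v0 w0 s st stt v vt vtt w wt wtt sp spt vp vpt wp e \<epsilon>)
    note cfs = 1(1)[THEN conjunct1, THEN bspec, OF 1(2)] and cpe = 1(1)[THEN conjunct2]
    \<comment> \<open>The bound is formed from \<open>C1 M M1\<close> and \<open>Cp\<close>, and the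
      time is \<open>Tss M M1\<close>. These are fixed before the data and \<open>\<epsilon>\<close>
      are introduced, which makes the constant uniform.\<close>
    interpret solution_pair \<epsilon> "1 + \<bar>C1 M M1\<bar> + \<bar>Cp\<bar>" K "Tss M M1" "Ts M M1" "s \<epsilon>" "st \<epsilon>" "stt \<epsilon>" "w \<epsilon>" "wt \<epsilon>" sp spt wp
      "v \<epsilon>" "vt \<epsilon>" vp vpt "s0 \<epsilon>" "w0 \<epsilon>" "v0 \<epsilon>"
    proof (rule solution_pairI[OF 1(2)])
      show "0 \<le> K" "0 < Tss M M1" "Tss M M1 \<le> Ts M M1" using par by auto
      show "cf_solution \<epsilon> (Ts M M1) (s \<epsilon>) (st \<epsilon>) (v \<epsilon>) (vt \<epsilon>) (w \<epsilon>) (wt \<epsilon>) (s0 \<epsilon>) (v0 \<epsilon>) (w0 \<epsilon>)"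
        using cfs by (elim conjE)
      show "cpe_solution (Ts M M1) sp spt vp vpt wp" using cpe by (elim conjE)
    qed (use cfs cpe[THEN conjunct2, THEN conjunct2] 1(2) in \<open>elim conjE, assumption | blast\<close>)+
    show ?case by (intro conjI error_estimates)
  qed
qed

end
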